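(* Let $R$ be an F-finite ring of prime characteristic $p$ and let $M$ be a finitely generated $R$-module. Then the limit $s(M)=\lim_{e\to\infty}a_e(M)/p^{e\gamma(R)}$ exists. Moreover, there exists a constant $C\in\mathbb R$ such that for each $e\in\mathbb N$, $a_e(M)\leq s(M)p^{e\gamma(R)}+Cp^{e(\gamma(R)-1)}$.
   Context: All rings are commutative Noetherian with identity. For an $R$-module $M$ over a ring of prime characteristic $p$, $F^e_*M$ is $M$ viewed as an $R$-module by restriction of scalars along the $e$-th iterate of Frobenius $r\mapsto r^{p^e}$. $R$ is F-finite if $F^e_*R$ is a finitely generated $R$-module for some (equivalently all) $e\geq 1$. $a_e(M)$ is the largest rank of a free $R$-module appearing as a direct summand of $F^e_*M$ (over all direct sum decompositions). For $P\in\operatorname{Spec}(R)$ let $\kappa(P)=R_P/PR_P$ and $\alpha(P)=\log_{p^e}[F^e_*\kappa(P):\kappa(P)]$ (independent of $e>0$). Let $\gamma(R)=\max\{\alpha(Q)\mid Q \text{ a minimal prime of } R\}$. *)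

theory Defs
  imports
    Complex_Main
    "HOL-Computational_Algebra.Primes"
    "HOL-Algebra.Ring_Divisibility"
    "HOL-Algebra.QuotRing"
    "Jordan_Normal_Form.Missing_VectorSpace"
begin

text \<open>
  The vocabulary for modules (\<open>module.span\<close>, \<open>module.lin_dep\<close>, \<open>module.submodule_sum\<close>,
  \<open>vectorspace.dim\<close>) is the one of the theory \<open>VectorSpace\<close>.  These constants are applied
  outside their locales, with ring and module as explicit arguments.  \<open>submodule R L M\<close> below is
  also the predicate of \<open>VectorSpace\<close>, which shadows the one of HOL-Algebra.
\<close>

subsection \<open>Modules\<close>

definition fin_gen :: "('a, 'm) ring_scheme \<Rightarrow> ('a, 'b, 'n) module_scheme \<Rightarrow> bool" where
  "fin_gen R M \<longleftrightarrow>
     (\<exists>A. finite A \<and> A \<subseteq> carrier M \<and> module.span R M A = carrier M)"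

definition free_of_rank ::
    "('a, 'm) ring_scheme \<Rightarrow> ('a, 'b, 'n) module_scheme \<Rightarrow> nat \<Rightarrow> bool" where
  "free_of_rank R M n \<longleftrightarrow>
     (\<exists>B. finite B \<and> card B = n \<and> B \<subseteq> carrier M \<and>
          \<not> module.lin_dep R M B \<and> module.span R M B = carrier M)"

text \<open>Direct sum decompositions \<open>M = L \<oplus> N\<close> are internal ones.\<close>

definition free_summand_of_rank ::
    "('a, 'm) ring_scheme \<Rightarrow> ('a, 'b, 'n) module_scheme \<Rightarrow> nat \<Rightarrow> bool" where
  "free_summand_of_rank R M n \<longleftrightarrow>
     (\<exists>L N. submodule R L M \<and> submodule R N M \<and>
            module.submodule_sum M L N = carrier M \<and> L \<inter> N = {\<zero>\<^bsub>M\<^esub>} \<and>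
            free_of_rank R (M\<lparr>carrier := L\<rparr>) n)"

definition self_module :: "('a, 'm) ring_scheme \<Rightarrow> ('a, 'a) module" where
  "self_module R =
     \<lparr>carrier = carrier R, mult = mult R, one = \<one>\<^bsub>R\<^esub>, zero = \<zero>\<^bsub>R\<^esub>, add = add R,
      smult = mult R\<rparr>"


subsection \<open>Frobenius\<close>

definition has_characteristic :: "('a, 'm) ring_scheme \<Rightarrow> nat \<Rightarrow> bool" where
  "has_characteristic R p \<longleftrightarrow> (\<forall>n::nat. [n] \<cdot>\<^bsub>R\<^esub> \<one>\<^bsub>R\<^esub> = \<zero>\<^bsub>R\<^esub> \<longleftrightarrow> p dvd n)"

text \<open>\<open>frob_push p e R M\<close> is \<open>F\<^sup>e\<^sub>* M\<close>, where \<open>p\<close> is the characteristic of \<open>R\<close>.\<close>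

definition frob_push ::
    "nat \<Rightarrow> nat \<Rightarrow> ('a, 'm) ring_scheme \<Rightarrow> ('a, 'b, 'n) module_scheme
       \<Rightarrow> ('a, 'b, 'n) module_scheme" where
  "frob_push p e R M = M\<lparr>smult := (\<lambda>r x. (r [^]\<^bsub>R\<^esub> (p ^ e)) \<odot>\<^bsub>M\<^esub> x)\<rparr>"

definition F_finite :: "nat \<Rightarrow> ('a, 'm) ring_scheme \<Rightarrow> bool" where
  "F_finite p R \<longleftrightarrow> (\<exists>e\<ge>1. fin_gen R (frob_push p e R (self_module R)))"

text \<open>
  \<open>a\<^sub>e(M)\<close>.  The set is nonempty (\<open>n = 0\<close>); it is finite when \<open>R\<close> is a nonzero F-finite ring
  and \<open>M\<close> is finitely generated.
\<close>

definition frob_free_rank ::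
    "nat \<Rightarrow> ('a, 'm) ring_scheme \<Rightarrow> ('a, 'b, 'n) module_scheme \<Rightarrow> nat \<Rightarrow> nat" where
  "frob_free_rank p R M e = Max {n. free_summand_of_rank R (frob_push p e R M) n}"


subsection \<open>Localization and residue fields\<close>

definition loc_rel :: "('a, 'm) ring_scheme \<Rightarrow> 'a set \<Rightarrow> (('a \<times> 'a) \<times> ('a \<times> 'a)) set" where
  "loc_rel R S =
     {((a, s), (b, t)). a \<in> carrier R \<and> s \<in> S \<and> b \<in> carrier R \<and> t \<in> S \<and>
        (\<exists>u\<in>S. u \<otimes>\<^bsub>R\<^esub> (a \<otimes>\<^bsub>R\<^esub> t \<ominus>\<^bsub>R\<^esub> b \<otimes>\<^bsub>R\<^esub> s) = \<zero>\<^bsub>R\<^esub>)}"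

definition loc_frac :: "('a, 'm) ring_scheme \<Rightarrow> 'a set \<Rightarrow> 'a \<Rightarrow> 'a \<Rightarrow> ('a \<times> 'a) set" where
  "loc_frac R S a s = loc_rel R S `` {(a, s)}"

text \<open>The operations are defined by unions over representatives, as in \<^const>\<open>rcoset_mult\<close>.\<close>

definition localization :: "('a, 'm) ring_scheme \<Rightarrow> 'a set \<Rightarrow> ('a \<times> 'a) set ring" where
  "localization R S =
     \<lparr>carrier = (carrier R \<times> S) // loc_rel R S,
      mult = (\<lambda>X Y. \<Union>(a, s)\<in>X. \<Union>(b, t)\<in>Y. loc_frac R S (a \<otimes>\<^bsub>R\<^esub> b) (s \<otimes>\<^bsub>R\<^esub> t)),
      one = loc_frac R S \<one>\<^bsub>R\<^esub> \<one>\<^bsub>R\<^esub>,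
      zero = loc_frac R S \<zero>\<^bsub>R\<^esub> \<one>\<^bsub>R\<^esub>,
      add = (\<lambda>X Y. \<Union>(a, s)\<in>X. \<Union>(b, t)\<in>Y.
               loc_frac R S (a \<otimes>\<^bsub>R\<^esub> t \<oplus>\<^bsub>R\<^esub> b \<otimes>\<^bsub>R\<^esub> s) (s \<otimes>\<^bsub>R\<^esub> t))\<rparr>"

text \<open>\<open>\<kappa>(P) = R\<^sub>P / P R\<^sub>P\<close>, where \<open>P R\<^sub>P\<close> is the extension of \<open>P\<close> along \<open>R \<rightarrow> R\<^sub>P\<close>.\<close>

definition residue_field ::
    "('a, 'm) ring_scheme \<Rightarrow> 'a set \<Rightarrow> ('a \<times> 'a) set set ring" where
  "residue_field R P =
     (let S = carrier R - P; RP = localization R S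
      in RP Quot (genideal RP ((\<lambda>a. loc_frac R S a \<one>\<^bsub>R\<^esub>) ` P)))"

text \<open>
  \<open>log\<^bsub>p^e\<^esub> [F\<^sup>e\<^sub>* \<kappa>(P) : \<kappa>(P)]\<close> does not depend on \<open>e > 0\<close>; the definition uses \<open>e = 1\<close>.
\<close>

definition frob_alpha :: "nat \<Rightarrow> ('a, 'm) ring_scheme \<Rightarrow> 'a set \<Rightarrow> real" where
  "frob_alpha p R P =
     (let K = residue_field R P
      in log (real p) (real (vectorspace.dim K (frob_push p 1 K (self_module K)))))"

definition minimal_primes :: "('a, 'm) ring_scheme \<Rightarrow> 'a set set" where
  "minimal_primes R =
     {Q. primeideal Q R \<and> (\<forall>Q'. primeideal Q' R \<and> Q' \<subseteq> Q \<longrightarrow> Q' = Q)}"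

definition frob_gamma :: "nat \<Rightarrow> ('a, 'm) ring_scheme \<Rightarrow> real" where
  "frob_gamma p R = Max (frob_alpha p R ` minimal_primes R)"

end

theory Submission
  imports Defs "HOL-Algebra.Finite_Extensions"
begin

text \<open>
  Write \<open>rk Q = p^\<alpha>(Q)\<close> and \<open>\<rho> = p^\<gamma>(R)\<close>.  Along a strict inclusion of primes \<open>rk\<close> drops by a
  factor of at least \<open>p\<close>, and if \<open>rk \<le> g\<close> on the primes containing an ideal \<open>I\<close>, then
  \<open>F\<^sup>e\<^sub>*(R/I)\<close> is generated by \<open>O(g^e)\<close> elements.

  A nonzero nilpotent forces \<open>a\<^sub>e(M) = 0\<close> for large \<open>e\<close>.  If \<open>R\<close> is reduced and \<open>rk Q < \<rho>\<close> for some
  minimal prime \<open>Q\<close>, then \<open>rk Q \<le> \<rho>/p\<close>, because both are powers of \<open>p\<close>, and counting generators over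
  \<open>R/Q\<close> gives \<open>a\<^sub>e(M) = O((\<rho>/p)^e)\<close>.  In both cases the limit is \<open>0\<close>.

  Otherwise \<open>F\<^sub>*M\<close> and \<open>M^\<rho>\<close> agree at the minimal primes, and there is a linear map \<open>F\<^sub>*M \<rightarrow> M^\<rho>\<close> whose
  cokernel is killed by an ideal \<open>I\<close> contained in no minimal prime.  Composing \<open>F\<^sup>e\<^sub>*\<close> of it with a
  projection \<open>F\<^sup>e\<^sub>*M \<rightarrow> R^n\<close>, where \<open>n = a\<^sub>e(M)\<close>, gives a map from \<open>F\<^sup>e\<^sup>+\<^sup>1\<^sub>*M\<close> to \<open>R\<close> to the power
  \<open>\<rho> n\<close> whose cokernel has \<open>O((\<rho>/p)^e)\<close> generators.  A stable range theorem turns such a map into a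
  surjection onto a free module of rank \<open>\<rho> n - O((\<rho>/p)^e)\<close>, so that
  \<open>a\<^bsub>e+1\<^esub>(M) \<ge> \<rho> a\<^sub>e(M) - C (\<rho>/p)^e\<close>.  Hence \<open>a\<^sub>e(M) / \<rho>^e\<close> minus a constant multiple of \<open>p^-e\<close> is
  increasing and bounded, which gives the limit and the upper bound.
\<close>

text \<open>The rank estimates do without localization: a statement at a prime Q is phrased in R
  with a multiplier outside Q, and finitely many multipliers are merged into their product.
  Localization only enters when \<open>rk\<close> is identified with the degree that defines
  \<alpha>.

  Rank drop and growth bound depend on each other. For P strictly inside Q, the first p^e layers of
  R/P in the filtration by powers of Q contribute (rk Q)^e independent elements each, so that
  \<open>F\<^sup>e\<^sub>*(R/P)\<close> needs at least (p rk Q)^e generators. An upper bound of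
  nearly the right order turns this into p rk Q \<le> rk P, and the rank drop then sharpens the
  upper bound. One Noetherian induction therefore proves both.

  The generic comparison of \<open>F\<^sub>*M\<close> with \<open>M^\<rho>\<close> only has a small
  cokernel, while a_e counts global free summands. Removing t generators of a cokernel at the price
  of t coordinates is where the stable range theorem is needed. Controlling the cokernel suffices
  because the recursion is only wanted from below: a bounded, almost increasing sequence
  converges.\<close>

section \<open>Additivity of Frobenius in characteristic p\<close>

lemma (in cring) binomial_theorem:
  assumes x: "x \<in> carrier R" and y: "y \<in> carrier R"
  shows "(x \<oplus> y) [^] n = (\<Oplus>k\<in>{..n}. [(n choose k)] \<cdot> (x [^] k \<otimes> y [^] (n - k)))"
proof (induction n)
  case 0
  show ?case using x y by simp
next
  case (Suc n)
  let ?t = "\<lambda>k. x [^] k \<otimes> y [^] (Suc n - k)"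
  have c: "[(m::nat)] \<cdot> z \<in> carrier R" if "z \<in> carrier R" for m z using that by simp
  have tc: "x [^] (i::nat) \<otimes> y [^] (j::nat) \<in> carrier R" for i j using x y by simp
  \<comment> \<open>Both sides come from the sum over \<open>{..Suc n}\<close>: on the left the term
    for k = 0 is split off, on the right the top term, whose coefficient
    \<open>n choose Suc n\<close> vanishes.\<close>
  have sh: "(\<Oplus>k\<in>{..n}. [(n choose Suc k)] \<cdot> ?t (Suc k)) \<oplus> ?t 0
      = (\<Oplus>k\<in>{..n}. [(n choose k)] \<cdot> ?t k)"
  proof -
    have "(\<Oplus>k\<in>{..Suc n}. [(n choose k)] \<cdot> ?t k)
        = (\<Oplus>k\<in>{..n}. [(n choose Suc k)] \<cdot> ?t (Suc k)) \<oplus> [(n choose 0)] \<cdot> ?t 0"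
      by (rule add.finprod_Suc2) (auto intro: c tc)
    moreover have "(\<Oplus>k\<in>{..Suc n}. [(n choose k)] \<cdot> ?t k)
        = [(n choose Suc n)] \<cdot> ?t (Suc n) \<oplus> (\<Oplus>k\<in>{..n}. [(n choose k)] \<cdot> ?t k)"
      by (rule add.finprod_Suc) (auto intro: c tc)
    moreover have "(\<Oplus>k\<in>{..n}. [(n choose k)] \<cdot> ?t k) \<in> carrier R"
      by (rule add.finprod_closed) (auto intro: c tc)
    ultimately show ?thesis using x y by (simp add: binomial_eq_0)
  qed
  have "(\<Oplus>k\<in>{..Suc n}. [(Suc n choose k)] \<cdot> ?t k)
      = (\<Oplus>k\<in>{..n}. [(Suc n choose Suc k)] \<cdot> ?t (Suc k)) \<oplus> [(Suc n choose 0)] \<cdot> ?t 0"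
    by (rule add.finprod_Suc2) (auto intro: c tc)
  also have "(\<Oplus>k\<in>{..n}. [(Suc n choose Suc k)] \<cdot> ?t (Suc k))
      = (\<Oplus>k\<in>{..n}. [(n choose k)] \<cdot> ?t (Suc k) \<oplus> [(n choose Suc k)] \<cdot> ?t (Suc k))"
    by (rule add.finprod_cong') (use x y in \<open>auto simp: add.nat_pow_mult\<close>)
  also have "\<dots> = (\<Oplus>k\<in>{..n}. [(n choose k)] \<cdot> ?t (Suc k))
      \<oplus> (\<Oplus>k\<in>{..n}. [(n choose Suc k)] \<cdot> ?t (Suc k))"
    by (rule add.finprod_multf) (use x y in auto)
  also have "(\<Oplus>k\<in>{..n}. [(n choose k)] \<cdot> ?t (Suc k))
      \<oplus> (\<Oplus>k\<in>{..n}. [(n choose Suc k)] \<cdot> ?t (Suc k)) \<oplus> [(Suc n choose 0)] \<cdot> ?t 0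
     = (\<Oplus>k\<in>{..n}. [(n choose k)] \<cdot> ?t (Suc k))
      \<oplus> ((\<Oplus>k\<in>{..n}. [(n choose Suc k)] \<cdot> ?t (Suc k)) \<oplus> ?t 0)"
    by (subst a_assoc) (auto intro!: c tc add.finprod_closed simp: x y)
  also have "\<dots> = (\<Oplus>k\<in>{..n}. [(n choose k)] \<cdot> ?t (Suc k)) \<oplus> (\<Oplus>k\<in>{..n}. [(n choose k)] \<cdot> ?t k)"
    by (simp only: sh)
  also have "(\<Oplus>k\<in>{..n}. [(n choose k)] \<cdot> ?t (Suc k))
      = (\<Oplus>k\<in>{..n}. ([(n choose k)] \<cdot> (x [^] k \<otimes> y [^] (n - k))) \<otimes> x)"
    by (rule add.finprod_cong') (use x y in \<open>auto simp: add_pow_rdistr m_ac\<close>)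
  also have "\<dots> = (\<Oplus>k\<in>{..n}. [(n choose k)] \<cdot> (x [^] k \<otimes> y [^] (n - k))) \<otimes> x"
    by (subst finsum_ldistr) (auto intro: c tc x)
  also have "(\<Oplus>k\<in>{..n}. [(n choose k)] \<cdot> ?t k)
      = (\<Oplus>k\<in>{..n}. ([(n choose k)] \<cdot> (x [^] k \<otimes> y [^] (n - k))) \<otimes> y)"
    by (rule add.finprod_cong') (use x y in \<open>auto simp: add_pow_rdistr m_ac Suc_diff_le\<close>)
  also have "\<dots> = (\<Oplus>k\<in>{..n}. [(n choose k)] \<cdot> (x [^] k \<otimes> y [^] (n - k))) \<otimes> y"
    by (subst finsum_ldistr) (auto intro: c tc y)
  finally show ?case using Suc.IH x y by (simp add: r_distr)
qed

lemma (in cring) prime_char_add_pow: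
  assumes p: "Factorial_Ring.prime (p::nat)" and ch: "[p] \<cdot> \<one> = \<zero>"
    and x: "x \<in> carrier R" and y: "y \<in> carrier R"
  shows "(x \<oplus> y) [^] p = x [^] p \<oplus> y [^] p"
proof -
  \<comment> \<open>Two successors, so that the terms for k = p and k = 0 can both be split off;
    every remaining coefficient is divisible by p.\<close>
  obtain n where n: "p = Suc (Suc n)"
    using prime_ge_2_nat[OF p] by (metis One_nat_def Suc_1 add_2_eq_Suc le_Suc_ex)
  have z: "[m] \<cdot> z = \<zero>" if d: "p dvd m" and "z \<in> carrier R" for m :: nat and z
  proof -
    obtain l where l: "m = p * l" using d by auto
    have "[m] \<cdot> z = [m] \<cdot> (\<one> \<otimes> z)" using that by simp
    also have "\<dots> = ([m] \<cdot> \<one>) \<otimes> z" using that by (simp add: add_pow_ldistr)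
    also have "[m] \<cdot> \<one> = [l] \<cdot> ([p] \<cdot> \<one>)" unfolding l by (simp add: add.nat_pow_pow)
    finally show ?thesis using that ch by simp
  qed
  let ?f = "\<lambda>k. [(p choose k)] \<cdot> (x [^] k \<otimes> y [^] (p - k))"
  have fc: "?f k \<in> carrier R" for k using x y by simp
  have "(x \<oplus> y) [^] p = (\<Oplus>k\<in>{..Suc (Suc n)}. ?f k)"
    unfolding n[symmetric] by (rule binomial_theorem[OF x y])
  also have "\<dots> = ?f (Suc (Suc n)) \<oplus> (\<Oplus>k\<in>{..Suc n}. ?f k)"
    by (rule add.finprod_Suc) (use fc in auto)
  also have "(\<Oplus>k\<in>{..Suc n}. ?f k) = (\<Oplus>k\<in>{..n}. ?f (Suc k)) \<oplus> ?f 0"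
    by (rule add.finprod_Suc2) (use fc in auto)
  also have "(\<Oplus>k\<in>{..n}. ?f (Suc k)) = (\<Oplus>k\<in>{..n}. \<zero>)"
  proof (rule add.finprod_cong')
    fix k assume "k \<in> {..n}"
    then have "p dvd (p choose Suc k)" using n p by (intro dvd_choose_prime) auto
    then show "?f (Suc k) = \<zero>" using x y by (intro z) auto
  qed auto
  finally show ?thesis using x y n by simp
qed

locale frob_ring = cring R + noetherian_ring R for R :: "('a, 'm) ring_scheme" (structure) +
  fixes p :: nat
  assumes p_prime: "Factorial_Ring.prime p" and has_char: "has_characteristic R p"

section \<open>Ideals, multipliers outside a prime, and Noetherian induction\<close>

context cring
begin

lemma idealI_cring:
  assumes "I \<subseteq> carrier R" "\<zero> \<in> I"
    and add: "\<And>x y. x \<in> I \<Longrightarrow> y \<in> I \<Longrightarrow> x \<oplus> y \<in> I"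
    and smult: "\<And>r x. r \<in> carrier R \<Longrightarrow> x \<in> I \<Longrightarrow> r \<otimes> x \<in> I"
  shows "ideal I R"
proof (rule idealI)
  show "subgroup I (add_monoid R)"
  proof (rule add.subgroupI)
    fix x assume x: "x \<in> I"
    have "(\<ominus> \<one>) \<otimes> x \<in> I" using x by (intro smult) auto
    then show "\<ominus> x \<in> I" using x assms(1) by (simp add: l_minus subset_iff)
  qed (use assms in auto)
  show "ring R" by (rule ring_axioms)
  show "x \<otimes> a \<in> I" if "a \<in> I" "x \<in> carrier R" for a x using smult that by auto
  then show "a \<otimes> x \<in> I" if "a \<in> I" "x \<in> carrier R" for a x
    using that assms(1) by (subst m_comm) auto
qed

lemma prime_notin_mult:
  assumes "primeideal Q R" "s \<in> carrier R - Q" "t \<in> carrier R - Q"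
  shows "s \<otimes> t \<in> carrier R - Q"
  using assms primeideal.I_prime[OF assms(1), of s t] by auto

lemma one_notin_prime: "primeideal Q R \<Longrightarrow> \<one> \<notin> Q"
  using ideal.one_imp_carrier[of Q R] primeideal.I_notcarr[of Q R] primeideal.axioms(1)[of Q R] by auto

lemma prime_pow:
  assumes "primeideal Q R" "x \<in> carrier R" "x [^] (n::nat) \<in> Q"
  shows "x \<in> Q"
  using assms(3)
proof (induction n)
  case 0
  then show ?case using one_notin_prime[OF assms(1)] by simp
next
  case (Suc n)
  then show ?case using primeideal.I_prime[OF assms(1), of "x [^] n" x] assms(2) by auto
qed

text \<open>The substitute for localizing at Q: conditions stable under multiples that each hold for
  some multiplier outside Q hold together for the product of the multipliers, which stays outside Q.
  With membership in ideals as the condition, the same lemma gives prime avoidance.\<close>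

lemma prime_finite_common_multiple:
  assumes Q: "primeideal Q R" and "finite G"
    and ex: "\<And>g. g \<in> G \<Longrightarrow> \<exists>s\<in>carrier R - Q. \<phi> s g"
    and mult: "\<And>s t g. s \<in> carrier R \<Longrightarrow> t \<in> carrier R \<Longrightarrow> g \<in> G \<Longrightarrow> \<phi> s g \<Longrightarrow> \<phi> (t \<otimes> s) g"
  shows "\<exists>s\<in>carrier R - Q. \<forall>g\<in>G. \<phi> s g"
  using assms(2) ex mult
proof (induction G rule: finite_induct)
  case empty
  then show ?case using one_notin_prime[OF Q] by auto
next
  case (insert g G)
  have "\<exists>s\<in>carrier R - Q. \<forall>g\<in>G. \<phi> s g"
    by (rule insert.IH) (use insert.prems in auto)
  then obtain s where s: "s \<in> carrier R - Q" "\<forall>g\<in>G. \<phi> s g" by blast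
  obtain t where t: "t \<in> carrier R - Q" "\<phi> t g" using insert.prems(1) by blast
  have "t \<otimes> s \<in> carrier R - Q" by (rule prime_notin_mult[OF Q t(1) s(1)])
  moreover have "\<forall>g'\<in>G. \<phi> (t \<otimes> s) g'" using s t insert.prems(2) by auto
  moreover have "\<phi> (t \<otimes> s) g"
    using s t insert.prems(2)[of t s g] by (simp add: m_comm)
  ultimately show ?case by blast
qed

definition adjoin :: "'a set \<Rightarrow> 'a \<Rightarrow> 'a set" where
  "adjoin I a = {i \<oplus> r \<otimes> a | i r. i \<in> I \<and> r \<in> carrier R}"

lemma adjoinI: "i \<in> I \<Longrightarrow> r \<in> carrier R \<Longrightarrow> i \<oplus> r \<otimes> a \<in> adjoin I a"
  unfolding adjoin_def by blast

lemma adjoinE: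
  assumes "x \<in> adjoin I a"
  obtains i r where "x = i \<oplus> r \<otimes> a" "i \<in> I" "r \<in> carrier R"
  using assms unfolding adjoin_def by blast

lemma adjoin_ideal:
  assumes I: "ideal I R" and a: "a \<in> carrier R"
  shows "ideal (adjoin I a) R" "I \<subseteq> adjoin I a" "a \<in> adjoin I a"
proof -
  interpret ideal I R by (rule I)
  have zero: "\<zero> \<in> I" by simp
  show "ideal (adjoin I a) R"
  proof (rule idealI_cring)
    show "adjoin I a \<subseteq> carrier R" using a by (auto elim!: adjoinE)
    show "\<zero> \<in> adjoin I a" using adjoinI[OF zero, of \<zero> a] a by simp
    fix x y assume "x \<in> adjoin I a" "y \<in> adjoin I a"
    then obtain i r j t where *: "x = i \<oplus> r \<otimes> a" "y = j \<oplus> t \<otimes> a" "i \<in> I" "j \<in> I"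
      "r \<in> carrier R" "t \<in> carrier R" by (elim adjoinE) blast
    then have "x \<oplus> y = (i \<oplus> j) \<oplus> (r \<oplus> t) \<otimes> a" using a by (simp add: l_distr a_ac)
    then show "x \<oplus> y \<in> adjoin I a" using * adjoinI[of "i \<oplus> j" I "r \<oplus> t" a] by simp
  next
    fix r x assume r: "r \<in> carrier R" and "x \<in> adjoin I a"
    then obtain i t where *: "x = i \<oplus> t \<otimes> a" "i \<in> I" "t \<in> carrier R" by (elim adjoinE) blast
    then have "r \<otimes> x = r \<otimes> i \<oplus> (r \<otimes> t) \<otimes> a" using a r by (simp add: r_distr m_assoc)
    then show "r \<otimes> x \<in> adjoin I a"
      using * r I_l_closed adjoinI[of "r \<otimes> i" I "r \<otimes> t" a] by simp
  qed
  show "I \<subseteq> adjoin I a"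
  proof
    fix x assume "x \<in> I"
    then show "x \<in> adjoin I a" using adjoinI[of x I \<zero> a] a by simp
  qed
  show "a \<in> adjoin I a" using adjoinI[OF zero, of \<one> a] a by simp
qed

lemma adjoin_mult:
  assumes I: "ideal I R" and a: "a \<in> carrier R" "b \<in> carrier R" "a \<otimes> b \<in> I"
    and x: "x \<in> adjoin I a" "y \<in> adjoin I b"
  shows "x \<otimes> y \<in> I"
proof -
  interpret ideal I R by (rule I)
  obtain i r j t where *: "x = i \<oplus> r \<otimes> a" "y = j \<oplus> t \<otimes> b" "i \<in> I" "j \<in> I"
      "r \<in> carrier R" "t \<in> carrier R" using x by (elim adjoinE) blast
  have "x \<otimes> y = i \<otimes> (j \<oplus> t \<otimes> b) \<oplus> ((r \<otimes> a) \<otimes> j \<oplus> (r \<otimes> t) \<otimes> (a \<otimes> b))"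
    using * a by (simp add: l_distr r_distr m_ac a_ac)
  then show ?thesis using * a I_l_closed I_r_closed by simp
qed

lemma not_prime_ideal:
  assumes I: "ideal I R" and "\<not> primeideal I R" "I \<noteq> carrier R"
  obtains a b where "a \<in> carrier R" "b \<in> carrier R" "a \<notin> I" "b \<notin> I" "a \<otimes> b \<in> I"
proof -
  have "\<not> primeideal_axioms I R" using primeideal.intro[OF I cring_axioms] assms(2) by blast
  then have "\<exists>a b. a \<in> carrier R \<and> b \<in> carrier R \<and> a \<notin> I \<and> b \<notin> I \<and> a \<otimes> b \<in> I"
    using assms(3) unfolding primeideal_axioms_def by blast
  then show ?thesis using that by blast
qed

end

text \<open>If the property failed somewhere, every failing ideal would lie strictly below another
  failing one, and iterating a choice of such ideals would produce an infinite strictly ascending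
  chain.\<close>

lemma (in noetherian_ring) noetherian_ideal_induct [consumes 1, case_names ideal]:
  assumes "ideal I R"
    and step: "\<And>I. ideal I R \<Longrightarrow> (\<And>J. ideal J R \<Longrightarrow> I \<subset> J \<Longrightarrow> \<phi> J) \<Longrightarrow> \<phi> I"
  shows "\<phi> I"
proof (rule ccontr)
  assume "\<not> \<phi> I"
  define S where "S = {I. ideal I R \<and> \<not> \<phi> I}"
  have "\<forall>I\<in>S. \<exists>J. J \<in> S \<and> I \<subset> J" unfolding S_def using step by blast
  from bchoice[OF this] obtain f where "\<forall>I\<in>S. f I \<in> S \<and> I \<subset> f I" by blast
  then have f: "\<And>I. I \<in> S \<Longrightarrow> f I \<in> S \<and> I \<subset> f I" by blast
  define g where "g n = (f ^^ n) I" for n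
  have g_Suc: "g (Suc n) = f (g n)" for n by (simp add: g_def)
  have I: "I \<in> S" using assms(1) \<open>\<not> \<phi> I\<close> by (simp add: S_def)
  have g: "g n \<in> S" for n
  proof (induction n)
    case 0
    then show ?case using I by (simp add: g_def)
  next
    case (Suc n)
    then show ?case using f unfolding g_Suc by blast
  qed
  have gs: "g n \<subset> g (Suc n)" for n using f[OF g[of n]] unfolding g_Suc by blast
  have mono: "g m \<subseteq> g n" if "m \<le> n" for m n
    by (rule lift_Suc_mono_le[of g, OF psubset_imp_subset[OF gs] that])
  have "subset.chain {I. ideal I R} (range g)"
    unfolding subset_chain_def
  proof (intro conjI ballI)
    fix Xa Y assume "Xa \<in> range g" "Y \<in> range g"
    then obtain m n where mn: "Xa = g m" "Y = g n" by blast
    show "Xa \<subseteq> Y \<or> Y \<subseteq> Xa" unfolding mn using mono[of m n] mono[of n m] nat_le_linear[of m n] by blast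
  next
    show "range g \<subseteq> {I. ideal I R}" using g unfolding S_def by blast
  qed
  then have "\<Union> (range g) \<in> range g" by (intro ideal_chain_is_trivial) blast+
  then obtain n where "\<Union> (range g) = g n" by blast
  moreover have "g (Suc n) \<subseteq> \<Union> (range g)" by blast
  ultimately have "g (Suc n) \<subseteq> g n" by (simp only:)
  then show False using gs[of n] by auto
qed

text \<open>The radical of I is cut out by finitely many primes. For I proper and not prime, take a
  b in I with neither factor in I: the primes found for I + (a) and for I + (b) together work,
  because powers of x in these two ideals multiply into I.\<close>

lemma (in noetherian_ring) exists_finite_primes:
  assumes "cring R" "ideal I R"
  shows "\<exists>PP. finite PP \<and> (\<forall>P\<in>PP. primeideal P R \<and> I \<subseteq> P) \<and>
           (\<forall>x\<in>carrier R. (\<forall>P\<in>PP. x \<in> P) \<longrightarrow> (\<exists>n::nat. x [^] n \<in> I))"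
  using assms(2)
proof (induction rule: noetherian_ideal_induct)
  case (ideal I)
  interpret cring R by (rule assms(1))
  consider "I = carrier R" | "primeideal I R" | "I \<noteq> carrier R" "\<not> primeideal I R" by auto
  then show ?case
  proof cases
    case 1
    have "\<exists>n::nat. x [^] n \<in> I" if "x \<in> carrier R" for x
      using 1 that by (intro exI[of _ "0::nat"]) simp
    then show ?thesis by (intro exI[of _ "{}"]) simp
  next
    case 2
    have "\<exists>n::nat. x [^] n \<in> I" if "x \<in> I" "x \<in> carrier R" for x
      using that by (intro exI[of _ "1::nat"]) auto
    then show ?thesis using 2 by (intro exI[of _ "{I}"]) auto
  next
    case 3
    obtain a b where ab: "a \<in> carrier R" "b \<in> carrier R" "a \<notin> I" "b \<notin> I" "a \<otimes> b \<in> I"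
      using not_prime_ideal[OF ideal.hyps 3(2,1)] by blast
    note A = adjoin_ideal[OF ideal.hyps ab(1)] and B = adjoin_ideal[OF ideal.hyps ab(2)]
    have "I \<subset> adjoin I a" "I \<subset> adjoin I b" using A B ab by auto
    then obtain PA PB where
      PA: "finite PA" "\<forall>P\<in>PA. primeideal P R \<and> adjoin I a \<subseteq> P"
        "\<forall>x\<in>carrier R. (\<forall>P\<in>PA. x \<in> P) \<longrightarrow> (\<exists>n::nat. x [^] n \<in> adjoin I a)" and
      PB: "finite PB" "\<forall>P\<in>PB. primeideal P R \<and> adjoin I b \<subseteq> P"
        "\<forall>x\<in>carrier R. (\<forall>P\<in>PB. x \<in> P) \<longrightarrow> (\<exists>n::nat. x [^] n \<in> adjoin I b)"
      using ideal.IH[OF A(1) \<open>I \<subset> adjoin I a\<close>] ideal.IH[OF B(1) \<open>I \<subset> adjoin I b\<close>]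
      by blast
    have "\<exists>n::nat. x [^] n \<in> I" if x: "x \<in> carrier R" "\<forall>P\<in>PA \<union> PB. x \<in> P" for x
    proof -
      obtain n m :: nat where "x [^] n \<in> adjoin I a" "x [^] m \<in> adjoin I b"
        using PA(3) PB(3) x by blast
      then have "x [^] n \<otimes> x [^] m \<in> I" by (rule adjoin_mult[OF ideal.hyps ab(1,2,5)])
      then show ?thesis using x by (auto simp: nat_pow_mult)
    qed
    moreover have "\<forall>P\<in>PA \<union> PB. primeideal P R \<and> I \<subseteq> P"
      using PA(2) PB(2) A(2) B(2) by (meson UnE order_trans)
    ultimately show ?thesis using PA(1) PB(1) by (intro exI[of _ "PA \<union> PB"]) simp
  qed
qed

context cring
begin

lemma ideal_finsum:
  assumes "ideal I R" "finite A" "\<And>a. a \<in> A \<Longrightarrow> f a \<in> I"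
  shows "(\<Oplus>a\<in>A. f a) \<in> I"
proof -
  interpret ideal I R by (rule assms(1))
  show ?thesis using assms(2,3)
  proof (induction A rule: finite_induct)
    case (insert x F)
    have "finsum R f (insert x F) = f x \<oplus> finsum R f F"
      using insert by (intro finsum_insert) auto
    then show ?case using insert by simp
  qed simp
qed

lemma ideal_add_cancel:
  assumes "ideal I R" "x \<in> carrier R" "y \<in> I" "x \<oplus> y \<in> I"
  shows "x \<in> I"
proof -
  interpret ideal I R by (rule assms(1))
  have "(x \<oplus> y) \<ominus> y \<in> I" using assms by (simp add: a_minus_def)
  moreover have "(x \<oplus> y) \<ominus> y = x" using assms a_subset by (simp add: a_minus_def a_assoc subset_iff r_neg)
  ultimately show ?thesis by simp
qed

subsection \<open>Linear dependence and generation modulo an ideal\<close>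

text \<open>Gaussian elimination over the domain \<open>R/Q\<close>, with denominators cleared.\<close>

lemma dependence_mod_prime:
  fixes c :: "'j \<Rightarrow> 'l \<Rightarrow> 'a"
  assumes Q: "primeideal Q R" and "finite J" "finite L" "card L < card J"
    and c: "\<And>j l. j \<in> J \<Longrightarrow> l \<in> L \<Longrightarrow> c j l \<in> carrier R"
  shows "\<exists>a. a \<in> J \<rightarrow> carrier R \<and> (\<exists>j\<in>J. a j \<notin> Q) \<and> (\<forall>l\<in>L. (\<Oplus>j\<in>J. a j \<otimes> c j l) \<in> Q)"
  using assms(3,2,4,5)
proof (induction L arbitrary: J c rule: finite_induct)
  case empty
  then have "J \<noteq> {}" by auto
  then show ?case using one_notin_prime[OF Q] by (intro exI[of _ "\<lambda>_. \<one>"]) auto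
next
  case (insert t L)
  interpret Q: primeideal Q R by (rule Q)
  have J: "finite J" and cJ: "card (insert t L) < card J"
    and cc: "\<And>j l. j \<in> J \<Longrightarrow> l \<in> insert t L \<Longrightarrow> c j l \<in> carrier R"
    using insert.prems by auto
  show ?case
  proof (cases "\<forall>j\<in>J. c j t \<in> Q")
    case True
    obtain a where a: "a \<in> J \<rightarrow> carrier R" "\<exists>j\<in>J. a j \<notin> Q"
      "\<forall>l\<in>L. (\<Oplus>j\<in>J. a j \<otimes> c j l) \<in> Q"
      using insert.IH[of J c, OF J] cJ cc insert.hyps by auto
    moreover have "(\<Oplus>j\<in>J. a j \<otimes> c j t) \<in> Q"
      using True a(1) by (intro ideal_finsum[OF Q.ideal_axioms J]) (auto intro: Q.I_l_closed)
    ultimately show ?thesis by (intro exI[of _ a]) auto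
  next
    case False
    then obtain j0 where j0: "j0 \<in> J" "c j0 t \<notin> Q" by blast
    define J' where "J' = J - {j0}"
    have J': "finite J'" "J = insert j0 J'" "j0 \<notin> J'" using J j0 by (auto simp: J'_def)
    \<comment> \<open>Column \<open>t\<close> is eliminated with the pivot \<open>c j0 t\<close> by
      cross-multiplication.\<close>
    define d where "d j l = c j0 t \<otimes> c j l \<ominus> c j t \<otimes> c j0 l" for j l
    have cL: "card L < card J'" using cJ J J' insert.hyps by auto
    have dc: "d j l \<in> carrier R" if "j \<in> J'" "l \<in> L" for j l
      using that cc J'(2) by (auto simp: d_def)
    obtain a where a: "a \<in> J' \<rightarrow> carrier R" "\<exists>j\<in>J'. a j \<notin> Q"
      "\<forall>l\<in>L. (\<Oplus>j\<in>J'. a j \<otimes> d j l) \<in> Q"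
      using insert.IH[of J' d, OF J'(1) cL dc] by blast
    have ac: "a j \<in> carrier R" if "j \<in> J'" for j using a that by auto
    have ct: "c j l \<in> carrier R" if "j \<in> J'" "l \<in> insert t L" for j l using that cc J'(2) by auto
    have c0: "c j0 l \<in> carrier R" if "l \<in> insert t L" for l using that cc j0 by auto
    define S where "S = (\<Oplus>j\<in>J'. a j \<otimes> c j t)"
    have S: "S \<in> carrier R" unfolding S_def using ac ct by (intro finsum_closed) auto
    \<comment> \<open>The pivot row receives the coefficient that cancels column \<open>t\<close>.
      Scaling the other rows by the pivot keeps one coefficient outside Q, since neither factor lies
      in the prime Q.\<close>
    define b where "b j = (if j = j0 then \<ominus> S else a j \<otimes> c j0 t)" for j
    have bc: "b \<in> J \<rightarrow> carrier R" using S ac c0 J'(2) by (auto simp: b_def)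
    have key: "(\<Oplus>j\<in>J. b j \<otimes> c j l) = (\<Oplus>j\<in>J'. a j \<otimes> d j l)" if l: "l \<in> insert t L" for l
    proof -
      have "(\<Oplus>j\<in>J. b j \<otimes> c j l) = b j0 \<otimes> c j0 l \<oplus> (\<Oplus>j\<in>J'. b j \<otimes> c j l)"
        unfolding J'(2) using J' bc cc l by (intro finsum_insert) auto
      also have "b j0 \<otimes> c j0 l = (\<Oplus>j\<in>J'. a j \<otimes> c j t) \<otimes> (\<ominus> c j0 l)"
        using S c0[OF l] by (simp add: b_def S_def[symmetric] l_minus r_minus)
      also have "\<dots> = (\<Oplus>j\<in>J'. (a j \<otimes> c j t) \<otimes> (\<ominus> c j0 l))"
        using J' ac ct c0[OF l] by (intro finsum_ldistr) auto
      also have "(\<Oplus>j\<in>J'. (a j \<otimes> c j t) \<otimes> (\<ominus> c j0 l)) \<oplus> (\<Oplus>j\<in>J'. b j \<otimes> c j l)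
          = (\<Oplus>j\<in>J'. (a j \<otimes> c j t) \<otimes> (\<ominus> c j0 l) \<oplus> b j \<otimes> c j l)"
        using J' ac ct c0 l bc by (intro finsum_addf[symmetric]) auto
      also have "\<dots> = (\<Oplus>j\<in>J'. a j \<otimes> d j l)"
      proof (intro add.finprod_cong')
        fix j assume j: "j \<in> J'"
        then have "j \<noteq> j0" using J' by auto
        then show "(a j \<otimes> c j t) \<otimes> (\<ominus> c j0 l) \<oplus> b j \<otimes> c j l = a j \<otimes> d j l"
          using ac[OF j] ct[OF j] c0 l
          by (simp add: b_def d_def a_minus_def r_distr r_minus m_ac a_ac)
      qed (use ac ct c0 l in \<open>auto simp: d_def\<close>)
      finally show ?thesis .
    qed
    have "(\<Oplus>j\<in>J. b j \<otimes> c j t) \<in> Q"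
    proof -
      have "(\<Oplus>j\<in>J'. a j \<otimes> d j t) = (\<Oplus>j\<in>J'. \<zero>)"
        using ac ct c0 by (intro add.finprod_cong') (auto simp: d_def a_minus_def m_comm r_neg)
      then show ?thesis unfolding key[OF insertI1] by simp
    qed
    moreover have "\<forall>l\<in>L. (\<Oplus>j\<in>J. b j \<otimes> c j l) \<in> Q" using key a(3) by simp
    moreover have "\<exists>j\<in>J. b j \<notin> Q"
    proof -
      obtain j where j: "j \<in> J'" "a j \<notin> Q" using a(2) by blast
      then have "j \<noteq> j0" "j \<in> J" using J' by auto
      moreover have "a j \<otimes> c j0 t \<notin> Q" using j j0 ac[OF j(1)] c0 Q.I_prime by blast
      ultimately show ?thesis by (intro bexI[of _ j]) (auto simp: b_def)
    qed
    ultimately show ?thesis using bc by (intro exI[of _ b]) auto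
  qed
qed

text \<open>Additive spans with coefficients restricted to \<open>D\<close>.  Taking for \<open>D\<close> the \<open>p^e\<close>-th powers
  gives generation of \<open>F\<^sup>e\<^sub>*(R/I)\<close>; taking an ideal gives the products in Nakayama's lemma.\<close>

inductive_set gspan :: "'a set \<Rightarrow> 'a set \<Rightarrow> 'a set \<Rightarrow> 'a set" for D I U where
  base: "i \<in> I \<Longrightarrow> i \<in> gspan D I U"
| step: "x \<in> gspan D I U \<Longrightarrow> d \<in> D \<Longrightarrow> u \<in> U \<Longrightarrow> x \<oplus> d \<otimes> u \<in> gspan D I U"

lemma gspan_carrier:
  assumes "D \<subseteq> carrier R" "I \<subseteq> carrier R" "U \<subseteq> carrier R"
  shows "gspan D I U \<subseteq> carrier R"
proof
  fix x assume "x \<in> gspan D I U"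
  then show "x \<in> carrier R" by induction (use assms in \<open>auto simp: subset_iff\<close>)
qed

lemma gspan_add:
  assumes D: "D \<subseteq> carrier R" and I: "ideal I R" and U: "U \<subseteq> carrier R"
    and x: "x \<in> gspan D I U" and y: "y \<in> gspan D I U"
  shows "x \<oplus> y \<in> gspan D I U"
proof -
  interpret ideal I R by (rule I)
  have sub: "gspan D I U \<subseteq> carrier R" using gspan_carrier[OF D _ U] a_subset by blast
  have add_base: "z \<oplus> i \<in> gspan D I U" if "z \<in> gspan D I U" "i \<in> I" for z i
    using that
  proof (induction)
    case (base j)
    then show ?case by (intro gspan.base) simp
  next
    case (step z d u)
    have "z \<oplus> d \<otimes> u \<oplus> i = z \<oplus> i \<oplus> d \<otimes> u"
      using step sub D U by (simp add: a_ac subset_iff)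
    then show ?case using gspan.step[OF step.IH step.hyps(2,3)] step.prems by simp
  qed
  show ?thesis using y
  proof induction
    case (base i)
    then show ?case using x by (intro add_base)
  next
    case (step z d u)
    have "x \<oplus> (z \<oplus> d \<otimes> u) = x \<oplus> z \<oplus> d \<otimes> u"
      using step sub x D U by (simp add: a_assoc subset_iff)
    then show ?case using gspan.step[OF step.IH step.hyps(2,3)] by simp
  qed
qed

lemma gspan_smult:
  assumes D: "D \<subseteq> carrier R" and I: "ideal I R" and U: "U \<subseteq> carrier R"
    and r: "r \<in> carrier R" "\<And>d. d \<in> D \<Longrightarrow> r \<otimes> d \<in> D" and x: "x \<in> gspan D I U"
  shows "r \<otimes> x \<in> gspan D I U"
proof -
  interpret ideal I R by (rule I)
  have sub: "gspan D I U \<subseteq> carrier R" using gspan_carrier[OF D _ U] a_subset by blast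
  show ?thesis using x
  proof induction
    case (base i)
    then show ?case using r by (intro gspan.base I_l_closed)
  next
    case (step z d u)
    have "r \<otimes> (z \<oplus> d \<otimes> u) = r \<otimes> z \<oplus> (r \<otimes> d) \<otimes> u"
      using step sub r D U by (simp add: r_distr m_assoc subset_iff)
    then show ?case using gspan.step[OF step.IH r(2)[OF step.hyps(2)] step.hyps(3)] by simp
  qed
qed

lemma gspan_mono:
  assumes "D \<subseteq> D'" "I \<subseteq> I'" "U \<subseteq> U'"
  shows "gspan D I U \<subseteq> gspan D' I' U'"
proof
  fix x assume "x \<in> gspan D I U"
  then show "x \<in> gspan D' I' U'"
    by induction (use assms in \<open>auto intro: gspan.intros\<close>)
qed

lemma gspan_single:
  assumes D: "D \<subseteq> carrier R" and I: "ideal I R" and U: "U \<subseteq> carrier R"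
    and "d \<in> D" "u \<in> U"
  shows "d \<otimes> u \<in> gspan D I U"
proof -
  interpret ideal I R by (rule I)
  have "\<zero> \<oplus> d \<otimes> u \<in> gspan D I U" by (rule gspan.step[OF gspan.base]) (use assms in auto)
  then show ?thesis using assms by (simp add: subset_iff)
qed

lemma gspan_finsum:
  assumes D: "D \<subseteq> carrier R" and I: "ideal I R" and U: "U \<subseteq> carrier R"
    and "finite A" "\<And>a. a \<in> A \<Longrightarrow> f a \<in> gspan D I U"
  shows "(\<Oplus>a\<in>A. f a) \<in> gspan D I U"
proof -
  interpret ideal I R by (rule I)
  have sub: "gspan D I U \<subseteq> carrier R" using gspan_carrier[OF D _ U] a_subset by blast
  show ?thesis using assms(4,5)
  proof (induction A rule: finite_induct)
    case empty
    then show ?case by (auto intro: gspan.base)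
  next
    case (insert x F)
    have "finsum R f (insert x F) = f x \<oplus> finsum R f F"
      using insert sub by (intro finsum_insert) auto
    moreover have "f x \<oplus> finsum R f F \<in> gspan D I U"
      by (rule gspan_add[OF D I U]) (use insert in auto)
    ultimately show ?case by simp
  qed
qed

text \<open>The multiples of \<open>u\<close> merge into one coefficient because \<open>D\<close> is
  closed under addition. This isolates the generator that \<open>nakayama_prime\<close> eliminates
  next.\<close>

lemma gspan_insert_cases:
  assumes D: "ideal D R" and I: "ideal I R" and U: "insert u U \<subseteq> carrier R"
    and x: "x \<in> gspan D I (insert u U)"
  shows "\<exists>d\<in>D. \<exists>y\<in>gspan D I U. x = y \<oplus> d \<otimes> u"
proof -
  interpret D: ideal D R by (rule D)
  interpret I: ideal I R by (rule I)
  have Dc: "D \<subseteq> carrier R" by (rule D.a_subset)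
  have sub: "gspan D I U \<subseteq> carrier R" using gspan_carrier[OF Dc I.a_subset] U by auto
  show ?thesis using x
  proof induction
    case (base i)
    then show ?case
      using U gspan.base[OF base] by (intro bexI[of _ \<zero>] bexI[of _ i]) auto
  next
    case (step z d v)
    then obtain d' y where *: "d' \<in> D" "y \<in> gspan D I U" "z = y \<oplus> d' \<otimes> u" by blast
    have c: "d \<in> carrier R" "d' \<in> carrier R" "y \<in> carrier R" "u \<in> carrier R" "v \<in> carrier R"
      using * step Dc sub U by auto
    show ?case
    proof (cases "v = u")
      case True
      have "z \<oplus> d \<otimes> v = y \<oplus> (d' \<oplus> d) \<otimes> u" using * c True by (simp add: l_distr a_assoc)
      then show ?thesis using * step by blast
    next
      case False
      have "z \<oplus> d \<otimes> v = (y \<oplus> d \<otimes> v) \<oplus> d' \<otimes> u" using * c by (simp add: a_ac)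
      moreover have "y \<oplus> d \<otimes> v \<in> gspan D I U" using False step * by (intro gspan.step) auto
      ultimately show ?thesis using * by blast
    qed
  qed
qed

text \<open>Nakayama's lemma at Q with denominators cleared: if A is contained in Q A + P up to a
  multiplier outside Q, then A is contained in P up to such a multiplier. One generator is
  eliminated at a time, by solving its own equation for it.\<close>

lemma nakayama_prime:
  assumes Q: "primeideal Q R" and P: "ideal P R" and "finite A" "A \<subseteq> carrier R"
    and s: "s \<in> carrier R - Q" "\<And>a. a \<in> A \<Longrightarrow> s \<otimes> a \<in> gspan Q P A"
  shows "\<exists>s\<in>carrier R - Q. \<forall>a\<in>A. s \<otimes> a \<in> P"
  using assms(3,4) s
proof (induction A arbitrary: s rule: finite_induct)
  case empty
  then show ?case by auto
next
  case (insert a A)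
  interpret Q: primeideal Q R by (rule Q)
  interpret P: ideal P R by (rule P)
  note QI = Q.ideal_axioms
  have Qc: "Q \<subseteq> carrier R" by (rule Q.a_subset)
  have Ac: "A \<subseteq> carrier R" and ac: "a \<in> carrier R" using insert by auto
  note sub = gspan_carrier[OF Qc P.a_subset Ac]
  obtain q y where q: "q \<in> Q" "y \<in> gspan Q P A" "s \<otimes> a = y \<oplus> q \<otimes> a"
    using gspan_insert_cases[OF QI P insert.prems(1) insert.prems(3)[OF insertI1]] by blast
  define t where "t = s \<ominus> q"
  have qc: "q \<in> carrier R" "y \<in> carrier R" "s \<in> carrier R" using q Qc sub insert by auto
  have st: "s = t \<oplus> q" unfolding t_def using qc by (simp add: a_minus_def a_assoc l_neg)
  have tc: "t \<in> carrier R" using qc by (simp add: t_def)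
  have "t \<notin> Q"
  proof
    assume "t \<in> Q"
    then have "t \<oplus> q \<in> Q" using q(1) by simp
    then show False using insert.prems(2) st by simp
  qed
  then have t: "t \<in> carrier R - Q" using tc by simp
  have ta: "t \<otimes> a = y"
    unfolding t_def using q(3) qc ac by (simp add: a_minus_def l_distr l_minus a_assoc r_neg)
  have "(t \<otimes> s) \<otimes> b \<in> gspan Q P A" if b: "b \<in> A" for b
  proof -
    obtain q' z where z: "q' \<in> Q" "z \<in> gspan Q P A" "s \<otimes> b = z \<oplus> q' \<otimes> a"
      using gspan_insert_cases[OF QI P insert.prems(1) insert.prems(3)[of b]] b by blast
    have c: "q' \<in> carrier R" "z \<in> carrier R" "b \<in> carrier R" using z Qc sub Ac b by auto
    have "(t \<otimes> s) \<otimes> b = t \<otimes> z \<oplus> q' \<otimes> y"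
      using z(3) c qc tc ac by (simp add: m_assoc r_distr ta[symmetric] m_lcomm)
    moreover have "t \<otimes> z \<in> gspan Q P A"
      by (rule gspan_smult[OF Qc P Ac tc _ z(2)]) (simp add: Q.I_l_closed tc)
    moreover have "q' \<otimes> y \<in> gspan Q P A"
      by (rule gspan_smult[OF Qc P Ac c(1) _ q(2)]) (simp add: Q.I_l_closed c)
    ultimately show ?thesis using gspan_add[OF Qc P Ac] by simp
  qed
  then obtain s' where s': "s' \<in> carrier R - Q" "\<forall>b\<in>A. s' \<otimes> b \<in> P"
    using insert.IH[OF Ac prime_notin_mult[OF Q t insert.prems(2)]] by blast
  have "gspan Q P A \<subseteq> {x \<in> carrier R. s' \<otimes> x \<in> P}"
  proof
    fix x assume "x \<in> gspan Q P A"
    then show "x \<in> {x \<in> carrier R. s' \<otimes> x \<in> P}"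
    proof induction
      case (base i)
      then show ?case using s' P.I_l_closed P.a_subset by auto
    next
      case (step x d u)
      then have c: "d \<in> carrier R" "u \<in> carrier R" "s' \<in> carrier R" using Qc Ac s' by auto
      have "s' \<otimes> (x \<oplus> d \<otimes> u) = s' \<otimes> x \<oplus> d \<otimes> (s' \<otimes> u)"
        using step c by (simp add: r_distr m_lcomm)
      moreover have "d \<otimes> (s' \<otimes> u) \<in> P" using s'(2) step.hyps(3) c(1) by (intro P.I_l_closed[of "s' \<otimes> u" d]) auto
      ultimately show ?case using step c by auto
    qed
  qed
  then have "s' \<otimes> y \<in> P" using q by auto
  then have "(s' \<otimes> t) \<otimes> a \<in> P" using ta s' tc ac by (simp add: m_assoc)
  moreover have "(s' \<otimes> t) \<otimes> b \<in> P" if "b \<in> A" for b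
  proof -
    have "t \<otimes> (s' \<otimes> b) \<in> P" using s'(2) that tc by (intro P.I_l_closed[of "s' \<otimes> b" t]) auto
    moreover have "(s' \<otimes> t) \<otimes> b = t \<otimes> (s' \<otimes> b)" using s' that tc Ac by (simp add: m_ac subset_iff)
    ultimately show ?thesis by simp
  qed
  ultimately show ?case using prime_notin_mult[OF Q s'(1) t] by blast
qed

end

lemma (in abelian_monoid) finsum_cartesian_product:
  assumes "finite A" "finite B" "\<And>i j. i \<in> A \<Longrightarrow> j \<in> B \<Longrightarrow> f (i, j) \<in> carrier G"
  shows "(\<Oplus>k\<in>A \<times> B. f k) = (\<Oplus>i\<in>A. \<Oplus>j\<in>B. f (i, j))"
  using assms(1,3)
proof (induction A rule: finite_induct)
  case (insert x A)
  have "(\<Oplus>k\<in>insert x A \<times> B. f k) = (\<Oplus>k\<in>(Pair x ` B) \<union> (A \<times> B). f k)"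
    by (rule arg_cong[of _ _ "finsum G f"]) auto
  also have "\<dots> = (\<Oplus>k\<in>Pair x ` B. f k) \<oplus> (\<Oplus>k\<in>A \<times> B. f k)"
    using insert assms(2) by (intro finsum_Un_disjoint) auto
  also have "(\<Oplus>k\<in>Pair x ` B. f k) = (\<Oplus>j\<in>B. f (x, j))"
    using insert.prems by (intro finsum_reindex) (auto simp: inj_on_def)
  also have "(\<Oplus>k\<in>A \<times> B. f k) = (\<Oplus>i\<in>A. \<Oplus>j\<in>B. f (i, j))"
    using insert by auto
  also have "(\<Oplus>j\<in>B. f (x, j)) \<oplus> (\<Oplus>i\<in>A. \<Oplus>j\<in>B. f (i, j)) = (\<Oplus>i\<in>insert x A. \<Oplus>j\<in>B. f (i, j))"
    using insert by (intro finsum_insert[symmetric]) (auto intro!: finsum_closed)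
  finally show ?case .
qed auto

lemma (in abelian_monoid) finsum_swap:
  assumes "finite A" "finite B" "\<And>i j. i \<in> A \<Longrightarrow> j \<in> B \<Longrightarrow> f i j \<in> carrier G"
  shows "(\<Oplus>i\<in>A. \<Oplus>j\<in>B. f i j) = (\<Oplus>j\<in>B. \<Oplus>i\<in>A. f i j)"
proof -
  have "(\<Oplus>i\<in>A. \<Oplus>j\<in>B. f i j) = (\<Oplus>k\<in>A \<times> B. case k of (i, j) \<Rightarrow> f i j)"
    using finsum_cartesian_product[of A B "\<lambda>(i, j). f i j"] assms by simp
  also have "A \<times> B = prod.swap ` (B \<times> A)" by auto
  also have "(\<Oplus>k\<in>prod.swap ` (B \<times> A). case k of (i, j) \<Rightarrow> f i j)
      = (\<Oplus>k\<in>B \<times> A. case prod.swap k of (i, j) \<Rightarrow> f i j)"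
    using assms by (intro finsum_reindex) auto
  also have "\<dots> = (\<Oplus>j\<in>B. \<Oplus>i\<in>A. f i j)"
    using finsum_cartesian_product[of B A "\<lambda>k. case prod.swap k of (i, j) \<Rightarrow> f i j"] assms by simp
  finally show ?thesis .
qed

section \<open>Generation and independence with coefficients raised to the power p^e\<close>

context frob_ring
begin

lemma char_zero: "[p] \<cdot> \<one> = \<zero>"
  using has_char unfolding has_characteristic_def by simp

lemma p_ge_2: "p \<ge> 2" by (rule prime_ge_2_nat[OF p_prime])

lemma one_not_zero: "\<one> \<noteq> \<zero>"
proof
  assume "\<one> = \<zero>"
  then have "[(1::nat)] \<cdot> \<one> = \<zero>" by simp
  then have "p dvd 1" using has_char unfolding has_characteristic_def by blast
  then show False using p_ge_2 by simp
qed

lemma q_pos [simp]: "p ^ e > 0" using p_ge_2 by simp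

lemma frob_add:
  assumes "x \<in> carrier R" "y \<in> carrier R"
  shows "(x \<oplus> y) [^] (p ^ e) = x [^] (p ^ e) \<oplus> y [^] (p ^ e)"
proof (induction e)
  case (Suc e)
  have *: "z [^] (p ^ Suc e) = (z [^] (p ^ e)) [^] p" if "z \<in> carrier R" for z
    using that by (simp add: nat_pow_pow mult.commute)
  show ?case
    using prime_char_add_pow[OF p_prime char_zero, of "x [^] (p ^ e)" "y [^] (p ^ e)"] Suc assms *
    by simp
qed (use assms in auto)

lemma frob_zero: "\<zero> [^] (p ^ e) = \<zero>"
  by (rule nat_pow_zero) (use p_ge_2 in simp)

lemma frob_mult:
  assumes "x \<in> carrier R" "y \<in> carrier R"
  shows "(x \<otimes> y) [^] (p ^ e) = x [^] (p ^ e) \<otimes> y [^] (p ^ e)"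
  using assms by (simp add: nat_pow_distrib)

lemma frob_finsum:
  assumes "finite A" "f \<in> A \<rightarrow> carrier R"
  shows "(\<Oplus>a\<in>A. f a) [^] (p ^ e) = (\<Oplus>a\<in>A. f a [^] (p ^ e))"
  using assms
proof (induction A rule: finite_induct)
  case empty
  then show ?case by (simp add: frob_zero)
next
  case (insert x A)
  have "(\<Oplus>a\<in>insert x A. f a) = f x \<oplus> (\<Oplus>a\<in>A. f a)"
    using insert by (intro finsum_insert) auto
  moreover have "(\<Oplus>a\<in>insert x A. f a [^] (p ^ e)) = f x [^] (p ^ e) \<oplus> (\<Oplus>a\<in>A. f a [^] (p ^ e))"
    using insert by (intro finsum_insert) auto
  ultimately show ?case using insert by (simp add: frob_add Pi_iff)
qed

lemma frob_pow_add: "x \<in> carrier R \<Longrightarrow> (x [^] (p ^ d)) [^] (p ^ e) = x [^] (p ^ (d + e))"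
  by (simp add: nat_pow_pow power_add)

definition Fr :: "nat \<Rightarrow> 'a set" where "Fr e = (\<lambda>r. r [^] (p ^ e)) ` carrier R"

lemma Fr_carrier: "Fr e \<subseteq> carrier R" by (auto simp: Fr_def)

lemma FrI: "r \<in> carrier R \<Longrightarrow> r [^] (p ^ e) \<in> Fr e" by (auto simp: Fr_def)

lemma Fr_mult: "r \<in> carrier R \<Longrightarrow> d \<in> Fr e \<Longrightarrow> r [^] (p ^ e) \<otimes> d \<in> Fr e"
  unfolding Fr_def by (auto simp: frob_mult[symmetric])

text \<open>The module \<open>F\<^sup>e\<^sub>*(R/I)\<close> is generated by at most t elements.
  Upper bounds are enough for all later estimates, so no least number of generators is
  introduced.\<close>

definition mu_le :: "nat \<Rightarrow> 'a set \<Rightarrow> nat \<Rightarrow> bool" where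
  "mu_le e I t \<longleftrightarrow>
     (\<exists>U. finite U \<and> card U \<le> t \<and> U \<subseteq> carrier R \<and> carrier R \<subseteq> gspan (Fr e) I U)"

lemma gspan_Fr_smult:
  assumes I: "ideal I R" and U: "U \<subseteq> carrier R" and "r \<in> carrier R" "x \<in> gspan (Fr e) I U"
  shows "r [^] (p ^ e) \<otimes> x \<in> gspan (Fr e) I U"
  using assms by (intro gspan_smult[OF Fr_carrier I U]) (auto intro: Fr_mult)

lemma gspan_Fr_coeffs:
  assumes I: "ideal I R" and U: "finite U" "U \<subseteq> carrier R" and x: "x \<in> gspan (Fr e) I U"
  shows "\<exists>c\<in>U \<rightarrow> carrier R. \<exists>i\<in>I. x = i \<oplus> (\<Oplus>u\<in>U. c u [^] (p ^ e) \<otimes> u)"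
  using x
proof induction
  case (base i)
  interpret ideal I R by (rule I)
  have "(\<Oplus>u\<in>U. \<zero> [^] (p ^ e) \<otimes> u) = (\<Oplus>u\<in>U. \<zero>)"
    using U by (intro add.finprod_cong') (auto simp: frob_zero)
  then show ?case using base by (intro bexI[of _ "\<lambda>_. \<zero>"] bexI[of _ i]) auto
next
  case (step x d v)
  interpret ideal I R by (rule I)
  obtain c i where c: "c \<in> U \<rightarrow> carrier R" "i \<in> I" "x = i \<oplus> (\<Oplus>u\<in>U. c u [^] (p ^ e) \<otimes> u)"
    using step.IH by blast
  obtain r where r: "r \<in> carrier R" "d = r [^] (p ^ e)" using step.hyps unfolding Fr_def by blast
  define V where "V = U - {v}"
  have V: "finite V" "U = insert v V" "v \<notin> V" using U step.hyps by (auto simp: V_def)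
  define c' where "c' = c(v := c v \<oplus> r)"
  have cc: "c u \<in> carrier R" "u \<in> carrier R" if "u \<in> U" for u using c U that by auto
  have c'c: "c' \<in> U \<rightarrow> carrier R" using cc r by (auto simp: c'_def)
  have c'u: "c' u \<in> carrier R" if "u \<in> U" for u using c'c that by auto
  have vU: "v \<in> U" by (rule step.hyps)
  let ?S = "\<Oplus>u\<in>V. c u [^] (p ^ e) \<otimes> u"
  have SV: "(\<Oplus>u\<in>V. c' u [^] (p ^ e) \<otimes> u) = ?S"
    using V cc by (intro add.finprod_cong') (auto simp: c'_def)
  have Sc: "?S \<in> carrier R" using V cc by (intro finsum_closed) auto
  have "(\<Oplus>u\<in>U. c' u [^] (p ^ e) \<otimes> u) = c' v [^] (p ^ e) \<otimes> v \<oplus> ?S"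
    unfolding V(2) SV[symmetric] using V c'u cc by (intro finsum_insert) auto
  also have "\<dots> = (c v [^] (p ^ e) \<otimes> v \<oplus> ?S) \<oplus> d \<otimes> v"
    using cc[OF vU] r Sc by (simp add: c'_def frob_add l_distr a_ac)
  also have "c v [^] (p ^ e) \<otimes> v \<oplus> ?S = (\<Oplus>u\<in>U. c u [^] (p ^ e) \<otimes> u)"
    unfolding V(2) using V cc by (intro finsum_insert[symmetric]) auto
  finally have "x \<oplus> d \<otimes> v = i \<oplus> (\<Oplus>u\<in>U. c' u [^] (p ^ e) \<otimes> u)"
    unfolding c(3) using c(2) a_subset r cc vU U
    by (subst a_assoc) (auto intro!: finsum_closed)
  then show ?case using c'c c(2) by blast
qed

text \<open>With N = Q this is linear independence over R/Q in
  \<open>F\<^sup>e\<^sub>*(R/Q)\<close>. The second ideal N allows relations to be tested modulo a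
  smaller ideal, such as \<open>P + Q^(p^e)\<close> in \<open>mu_lower_bound\<close>.\<close>

definition pindep :: "nat \<Rightarrow> 'a set \<Rightarrow> 'a set \<Rightarrow> 'j set \<Rightarrow> ('j \<Rightarrow> 'a) \<Rightarrow> bool" where
  "pindep e N Q J b \<longleftrightarrow> finite J \<and> b \<in> J \<rightarrow> carrier R \<and>
     (\<forall>a\<in>J \<rightarrow> carrier R. (\<Oplus>j\<in>J. a j [^] (p ^ e) \<otimes> b j) \<in> N \<longrightarrow> (\<forall>j\<in>J. a j \<in> Q))"

text \<open>Independent elements cannot outnumber generators. Expanding the \<open>b j\<close> in
  terms of U, more than \<open>card U\<close> coefficient vectors are dependent modulo Q; the p^e-th
  power of such a dependence has coefficients in N by \<open>QN\<close>, so it is a relation modulo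
  N whose coefficients are not all in Q.\<close>

lemma pindep_card_le:
  assumes Q: "primeideal Q R" and N: "ideal N R" and P: "ideal P R" "P \<subseteq> N"
    and QN: "\<And>x. x \<in> Q \<Longrightarrow> x [^] (p ^ e) \<in> N"
    and U: "finite U" "U \<subseteq> carrier R" "carrier R \<subseteq> gspan (Fr e) P U"
    and b: "pindep e N Q J b"
  shows "card J \<le> card U"
proof (rule ccontr)
  assume "\<not> card J \<le> card U"
  then have less: "card U < card J" by simp
  interpret Q: primeideal Q R by (rule Q)
  interpret N: ideal N R by (rule N)
  interpret P: ideal P R by (rule P)
  have J: "finite J" and bc: "b \<in> J \<rightarrow> carrier R" using b by (auto simp: pindep_def)
  let ?ok = "\<lambda>j z. fst z \<in> U \<rightarrow> carrier R \<and> snd z \<in> P \<and>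
      b j = snd z \<oplus> (\<Oplus>u\<in>U. fst z u [^] (p ^ e) \<otimes> u)"
  have "\<exists>z. ?ok j z" if "j \<in> J" for j
  proof -
    have "b j \<in> gspan (Fr e) P U" using that U(3) bc by blast
    from gspan_Fr_coeffs[OF P(1) U(1,2) this]
    obtain c i where "c \<in> U \<rightarrow> carrier R" "i \<in> P"
      "b j = i \<oplus> (\<Oplus>u\<in>U. c u [^] (p ^ e) \<otimes> u)"
      by (elim bexE) (rule that)
    then show ?thesis by (intro exI[of _ "(c, i)"]) simp
  qed
  then have "\<forall>j\<in>J. \<exists>z. ?ok j z" by (intro ballI)
  from bchoice[OF this] obtain z where "\<forall>j\<in>J. ?ok j (z j)" ..
  then have z: "?ok j (z j)" if "j \<in> J" for j using that by (rule bspec)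
  define c where "c j = fst (z j)" for j
  define i where "i j = snd (z j)" for j
  have c: "c j \<in> U \<rightarrow> carrier R" if "j \<in> J" for j using z[OF that] by (simp add: c_def)
  have i: "i j \<in> P" if "j \<in> J" for j using z[OF that] by (simp add: i_def)
  have b_eq: "b j = i j \<oplus> (\<Oplus>u\<in>U. c j u [^] (p ^ e) \<otimes> u)" if "j \<in> J" for j
    using z[OF that] by (simp add: c_def i_def)
  have cc: "c j u \<in> carrier R" if "j \<in> J" "u \<in> U" for j u using c that by auto
  have ic: "i j \<in> carrier R" if "j \<in> J" for j using i that P.a_subset by auto
  have uc: "u \<in> carrier R" if "u \<in> U" for u using U that by auto
  have "\<exists>a. a \<in> J \<rightarrow> carrier R \<and> (\<exists>j\<in>J. a j \<notin> Q) \<and> (\<forall>u\<in>U. (\<Oplus>j\<in>J. a j \<otimes> c j u) \<in> Q)"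
    by (intro dependence_mod_prime[OF Q J U(1) less] cc)
  then obtain a where a: "a \<in> J \<rightarrow> carrier R" "\<exists>j\<in>J. a j \<notin> Q"
    "\<forall>u\<in>U. (\<Oplus>j\<in>J. a j \<otimes> c j u) \<in> Q" by (elim exE conjE) (rule that)
  have ac: "a j \<in> carrier R" if "j \<in> J" for j using a that by auto
  have "(\<Oplus>j\<in>J. a j [^] (p ^ e) \<otimes> b j)
      = (\<Oplus>j\<in>J. a j [^] (p ^ e) \<otimes> i j \<oplus> (\<Oplus>u\<in>U. (a j \<otimes> c j u) [^] (p ^ e) \<otimes> u))"
  proof (intro add.finprod_cong')
    fix j assume j: "j \<in> J"
    have "a j [^] (p ^ e) \<otimes> b j
        = a j [^] (p ^ e) \<otimes> i j \<oplus> a j [^] (p ^ e) \<otimes> (\<Oplus>u\<in>U. c j u [^] (p ^ e) \<otimes> u)"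
      unfolding b_eq[OF j] 
      by (intro r_distr m_closed nat_pow_closed finsum_closed Pi_I uc ac[OF j] cc[OF j] ic[OF j])
    also have "a j [^] (p ^ e) \<otimes> (\<Oplus>u\<in>U. c j u [^] (p ^ e) \<otimes> u)
        = (\<Oplus>u\<in>U. a j [^] (p ^ e) \<otimes> (c j u [^] (p ^ e) \<otimes> u))"
      using j ac cc uc U by (intro finsum_rdistr) auto
    also have "\<dots> = (\<Oplus>u\<in>U. (a j \<otimes> c j u) [^] (p ^ e) \<otimes> u)"
      using j ac cc uc by (intro add.finprod_cong') (auto simp: frob_mult m_assoc)
    finally show "a j [^] (p ^ e) \<otimes> b j
        = a j [^] (p ^ e) \<otimes> i j \<oplus> (\<Oplus>u\<in>U. (a j \<otimes> c j u) [^] (p ^ e) \<otimes> u)" .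
  next
    show "(\<lambda>j. a j [^] (p ^ e) \<otimes> i j \<oplus> (\<Oplus>u\<in>U. (a j \<otimes> c j u) [^] (p ^ e) \<otimes> u)) \<in> J \<rightarrow> carrier R"
      by (intro Pi_I a_closed m_closed nat_pow_closed finsum_closed uc ac cc ic)
  qed simp
  also have "\<dots> = (\<Oplus>j\<in>J. a j [^] (p ^ e) \<otimes> i j)
      \<oplus> (\<Oplus>j\<in>J. \<Oplus>u\<in>U. (a j \<otimes> c j u) [^] (p ^ e) \<otimes> u)"
    by (intro finsum_addf Pi_I m_closed nat_pow_closed finsum_closed uc ac cc ic)
  also have "(\<Oplus>j\<in>J. \<Oplus>u\<in>U. (a j \<otimes> c j u) [^] (p ^ e) \<otimes> u)
      = (\<Oplus>u\<in>U. \<Oplus>j\<in>J. (a j \<otimes> c j u) [^] (p ^ e) \<otimes> u)"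
    using ac cc uc J U by (intro finsum_swap) auto
  also have "\<dots> = (\<Oplus>u\<in>U. (\<Oplus>j\<in>J. a j \<otimes> c j u) [^] (p ^ e) \<otimes> u)"
  proof (intro add.finprod_cong')
    fix u assume u: "u \<in> U"
    have "(\<Oplus>j\<in>J. a j \<otimes> c j u) [^] (p ^ e) = (\<Oplus>j\<in>J. (a j \<otimes> c j u) [^] (p ^ e))"
      using ac cc u J by (intro frob_finsum) auto
    moreover have "(\<Oplus>j\<in>J. (a j \<otimes> c j u) [^] (p ^ e)) \<otimes> u
        = (\<Oplus>j\<in>J. (a j \<otimes> c j u) [^] (p ^ e) \<otimes> u)"
      using ac cc u by (intro finsum_ldistr J uc) auto
    ultimately show "(\<Oplus>j\<in>J. (a j \<otimes> c j u) [^] (p ^ e) \<otimes> u)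
        = (\<Oplus>j\<in>J. a j \<otimes> c j u) [^] (p ^ e) \<otimes> u" by simp
  next
    show "(\<lambda>u. (\<Oplus>j\<in>J. a j \<otimes> c j u) [^] (p ^ e) \<otimes> u) \<in> U \<rightarrow> carrier R"
      by (intro Pi_I m_closed nat_pow_closed finsum_closed uc ac cc)
  qed simp
  also have "(\<Oplus>j\<in>J. a j [^] (p ^ e) \<otimes> i j)
      \<oplus> (\<Oplus>u\<in>U. (\<Oplus>j\<in>J. a j \<otimes> c j u) [^] (p ^ e) \<otimes> u) \<in> N"
  proof (rule N.a_closed)
    show "(\<Oplus>j\<in>J. a j [^] (p ^ e) \<otimes> i j) \<in> N"
      by (intro ideal_finsum[OF N J] N.I_l_closed subsetD[OF P(2)] i nat_pow_closed ac)
    show "(\<Oplus>u\<in>U. (\<Oplus>j\<in>J. a j \<otimes> c j u) [^] (p ^ e) \<otimes> u) \<in> N"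
      by (intro ideal_finsum[OF N U(1)] N.I_r_closed QN uc bspec[OF a(3)])
  qed
  finally have "(\<Oplus>j\<in>J. a j [^] (p ^ e) \<otimes> b j) \<in> N" .
  then have "\<forall>j\<in>J. a j \<in> Q"
    using b a(1) unfolding pindep_def by (elim conjE) (drule (1) bspec, simp)
  then show False using a(2) by blast
qed

text \<open>Transfers a family to an initial segment of the naturals, the only index sets over which
  \<open>rk\<close> takes its maximum.\<close>

lemma pindep_nat:
  assumes "pindep e N Q J b"
  shows "\<exists>b'. pindep e N Q {..<card J} (b' :: nat \<Rightarrow> 'a)"
proof -
  have J: "finite J" and bc: "b \<in> J \<rightarrow> carrier R" using assms by (auto simp: pindep_def)
  obtain h where h: "bij_betw h {..<card J} J"
    using ex_bij_betw_nat_finite[OF J] by (auto simp: lessThan_atLeast0)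
  define k where "k = the_inv_into {..<card J} h"
  have k: "bij_betw k J {..<card J}" unfolding k_def by (rule bij_betw_the_inv_into[OF h])
  have hk: "h (k j) = j" if "j \<in> J" for j
    using that h unfolding k_def bij_betw_def by (auto intro: f_the_inv_into_f)
  have "pindep e N Q {..<card J} (\<lambda>n. b (h n))"
    unfolding pindep_def
  proof (intro conjI ballI impI)
    show "(\<lambda>n. b (h n)) \<in> {..<card J} \<rightarrow> carrier R" using bc bij_betwE[OF h] by auto
    fix a n assume a: "a \<in> {..<card J} \<rightarrow> carrier R"
      and N: "(\<Oplus>j\<in>{..<card J}. a j [^] (p ^ e) \<otimes> b (h j)) \<in> N" and n: "n \<in> {..<card J}"
    have kc: "k j \<in> {..<card J}" if "j \<in> J" for j using bij_betwE[OF k] that by auto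
    have ak: "a (k j) \<in> carrier R" if "j \<in> J" for j using a kc[OF that] by blast
    have "(\<Oplus>j\<in>{..<card J}. a j [^] (p ^ e) \<otimes> b (h j)) = (\<Oplus>j\<in>k ` J. a j [^] (p ^ e) \<otimes> b (h j))"
      using k by (simp add: bij_betw_def)
    also have "\<dots> = (\<Oplus>j\<in>J. a (k j) [^] (p ^ e) \<otimes> b (h (k j)))"
    proof (intro finsum_reindex)
      show "(\<lambda>j. a j [^] (p ^ e) \<otimes> b (h j)) \<in> k ` J \<rightarrow> carrier R"
      proof
        fix x assume "x \<in> k ` J"
        then obtain j where "j \<in> J" "x = k j" by blast
        then show "a x [^] (p ^ e) \<otimes> b (h x) \<in> carrier R" using ak hk bc by auto
      qed
      show "inj_on k J" using k by (simp add: bij_betw_def)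
    qed
    also have "\<dots> = (\<Oplus>j\<in>J. a (k j) [^] (p ^ e) \<otimes> b j)"
      using bc ak hk by (intro add.finprod_cong') auto
    finally have "(\<Oplus>j\<in>J. a (k j) [^] (p ^ e) \<otimes> b j) \<in> N" using N by simp
    moreover have "(\<lambda>j. a (k j)) \<in> J \<rightarrow> carrier R" using ak by auto
    ultimately have "\<forall>j\<in>J. a (k j) \<in> Q" using assms by (auto simp: pindep_def)
    moreover obtain j where "j \<in> J" "n = k j" using n k by (auto simp: bij_betw_def)
    ultimately show "a n \<in> Q" by auto
  qed simp
  then show ?thesis by blast
qed

lemma pindep_one:
  assumes Q: "primeideal Q R"
  shows "pindep e Q Q {..<1::nat} (\<lambda>_. \<one>)"
proof -
  have *: "a j \<in> Q" if a: "a \<in> {..<1::nat} \<rightarrow> carrier R"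
    and Qa: "(\<Oplus>j\<in>{..<1::nat}. a j [^] (p ^ e) \<otimes> \<one>) \<in> Q" and j: "j \<in> {..<1}" for a j
  proof -
    have j0: "j = 0" and a0: "a 0 \<in> carrier R" using a j by auto
    have "(\<Oplus>j\<in>{..<1::nat}. a j [^] (p ^ e) \<otimes> \<one>) = (\<Oplus>j\<in>insert 0 {}. a j [^] (p ^ e) \<otimes> \<one>)"
      by (rule arg_cong[of _ _ "finsum R _"]) auto
    also have "\<dots> = a 0 [^] (p ^ e)" using a0 by simp
    finally show ?thesis using prime_pow[OF Q a0] j0 Qa by simp
  qed
  show ?thesis unfolding pindep_def
  proof (intro conjI ballI impI)
    show "(\<lambda>_. \<one>) \<in> {..<1::nat} \<rightarrow> carrier R" by simp
  qed (simp, rule *)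
qed

text \<open>The tower law for independence. A combination of the products
  \<open>b j \<otimes> c k [^] p\<close> with coefficients raised to \<open>p ^ Suc e\<close> is a
  combination of the \<open>b j\<close> whose coefficients are p-th powers of combinations of the
  \<open>c k\<close>; independence is then used first for b, afterwards for c.\<close>

lemma pindep_compose:
  assumes b: "pindep 1 Q Q J b" and c: "pindep e Q Q K c"
  shows "pindep (Suc e) Q Q (J \<times> K) (\<lambda>(j, k). b j \<otimes> c k [^] p)"
  unfolding pindep_def
proof (intro conjI ballI impI)
  have J: "finite J" "finite K" and bc: "b \<in> J \<rightarrow> carrier R" "c \<in> K \<rightarrow> carrier R"
    using assms by (auto simp: pindep_def)
  then show "finite (J \<times> K)" by simp
  have bj: "b j \<in> carrier R" if "j \<in> J" for j using bc that by auto
  have ck: "c j \<in> carrier R" if "j \<in> K" for j using bc that by auto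
  show "(\<lambda>(j, k). b j \<otimes> c k [^] p) \<in> J \<times> K \<rightarrow> carrier R" using bj ck by auto
  fix a x assume a: "a \<in> J \<times> K \<rightarrow> carrier R" and x: "x \<in> J \<times> K"
    and Q: "(\<Oplus>x\<in>J \<times> K. a x [^] (p ^ Suc e) \<otimes> (case x of (j, k) \<Rightarrow> b j \<otimes> c k [^] p)) \<in> Q"
  have ac: "a (j, k) \<in> carrier R" if "j \<in> J" "k \<in> K" for j k using a that by auto
  define w where "w j = (\<Oplus>k\<in>K. a (j, k) [^] (p ^ e) \<otimes> c k)" for j
  have wc: "w j \<in> carrier R" if "j \<in> J" for j
    unfolding w_def using ac ck that by (intro finsum_closed) auto
  have "(\<Oplus>x\<in>J \<times> K. a x [^] (p ^ Suc e) \<otimes> (case x of (j, k) \<Rightarrow> b j \<otimes> c k [^] p))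
      = (\<Oplus>j\<in>J. \<Oplus>k\<in>K. a (j, k) [^] (p ^ Suc e) \<otimes> (b j \<otimes> c k [^] p))"
    using J ac bj ck by (subst finsum_cartesian_product) auto
  also have "\<dots> = (\<Oplus>j\<in>J. w j [^] (p ^ 1) \<otimes> b j)"
  proof (intro add.finprod_cong')
    fix j assume j: "j \<in> J"
    have "w j [^] (p ^ 1) = (\<Oplus>k\<in>K. (a (j, k) [^] (p ^ e) \<otimes> c k) [^] (p ^ 1))"
      unfolding w_def using J ac ck j by (intro frob_finsum) auto
    also have "\<dots> \<otimes> b j = (\<Oplus>k\<in>K. (a (j, k) [^] (p ^ e) \<otimes> c k) [^] (p ^ 1) \<otimes> b j)"
      using J ac ck j bj by (intro finsum_ldistr) auto
    also have "\<dots> = (\<Oplus>k\<in>K. a (j, k) [^] (p ^ Suc e) \<otimes> (b j \<otimes> c k [^] p))"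
    proof (intro add.finprod_cong')
      fix k assume k: "k \<in> K"
      have "(a (j, k) [^] (p ^ e) \<otimes> c k) [^] (p ^ 1) = a (j, k) [^] (p ^ Suc e) \<otimes> c k [^] p"
        using ac ck j k frob_pow_add[of "a (j, k)" e 1]
        by (simp add: nat_pow_distrib)
      then show "(a (j, k) [^] (p ^ e) \<otimes> c k) [^] (p ^ 1) \<otimes> b j
          = a (j, k) [^] (p ^ Suc e) \<otimes> (b j \<otimes> c k [^] p)"
        using ac ck bj j k by (simp only:) (simp add: m_ac)
    qed (use ac ck bj j in auto)
    finally show "(\<Oplus>k\<in>K. a (j, k) [^] (p ^ Suc e) \<otimes> (b j \<otimes> c k [^] p)) = w j [^] (p ^ 1) \<otimes> b j"
      by simp
  qed (use wc bj in auto)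
  finally have "(\<Oplus>j\<in>J. w j [^] (p ^ 1) \<otimes> b j) \<in> Q" using Q by simp
  moreover have "w \<in> J \<rightarrow> carrier R" using wc by auto
  ultimately have w: "\<forall>j\<in>J. w j \<in> Q" using b by (auto simp: pindep_def)
  obtain j k where x': "x = (j, k)" "j \<in> J" "k \<in> K" using x by auto
  have "(\<lambda>k. a (j, k)) \<in> K \<rightarrow> carrier R" using ac x' by auto
  moreover have "(\<Oplus>k\<in>K. a (j, k) [^] (p ^ e) \<otimes> c k) \<in> Q" using w x' by (simp add: w_def)
  ultimately have "\<forall>k\<in>K. a (j, k) \<in> Q" using c unfolding pindep_def by (elim conjE) (drule (1) bspec, simp)
  then show "a x \<in> Q" using x' by simp
qed

lemma pindep_power:
  assumes Q: "primeideal Q R" and b: "pindep 1 Q Q {..<n::nat} b"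
  shows "\<exists>c. pindep e Q Q {..<n ^ e} (c :: nat \<Rightarrow> 'a)"
proof (induction e)
  case 0
  show ?case using pindep_one[OF Q] by auto
next
  case (Suc e)
  then obtain c where c: "pindep e Q Q {..<n ^ e} (c :: nat \<Rightarrow> 'a)" by blast
  show ?case using pindep_nat[OF pindep_compose[OF b c]] by simp
qed

end

lemma (in abelian_monoid) finsum_in_closed_set:
  assumes "S \<subseteq> carrier G" "\<zero> \<in> S" "\<And>x y. x \<in> S \<Longrightarrow> y \<in> S \<Longrightarrow> x \<oplus> y \<in> S"
    and "finite A" "\<And>a. a \<in> A \<Longrightarrow> f a \<in> S"
  shows "(\<Oplus>a\<in>A. f a) \<in> S"
  using assms(4,5)
proof (induction A rule: finite_induct)
  case (insert x F)
  have "finsum G f (insert x F) = f x \<oplus> finsum G f F"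
    using insert assms(1) by (intro finsum_insert) auto
  then show ?case using insert assms(3) by simp
qed (use assms in auto)

lemma (in cring) gspan_subset:
  assumes "I \<subseteq> T" "\<And>d u. d \<in> D \<Longrightarrow> u \<in> U \<Longrightarrow> d \<otimes> u \<in> T"
    and "\<And>x y. x \<in> T \<Longrightarrow> y \<in> T \<Longrightarrow> x \<oplus> y \<in> T"
  shows "gspan D I U \<subseteq> T"
proof
  fix x assume "x \<in> gspan D I U"
  then show "x \<in> T"
  proof induction
    case (base i)
    then show ?case using assms(1) by blast
  next
    case (step x d u)
    show ?case by (rule assms(3)[OF step.IH assms(2)[OF step.hyps(2,3)]])
  qed
qed

lemma (in cring) ideal_pow:
  assumes "ideal I R" "x \<in> I" "n > (0::nat)"
  shows "x [^] n \<in> I"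
proof -
  interpret ideal I R by (rule assms(1))
  have x: "x \<in> carrier R" using assms(2) by (rule Icarr)
  obtain m where m: "n = Suc m" using assms(3) gr0_conv_Suc by blast
  show ?thesis unfolding m nat_pow_Suc by (rule I_l_closed[OF assms(2) nat_pow_closed[OF x]])
qed

lemma frob_push_simps [simp]:
  "carrier (frob_push p e R M) = carrier M" "add (frob_push p e R M) = add M"
  "zero (frob_push p e R M) = zero M"
  "smult (frob_push p e R M) r x = (r [^]\<^bsub>R\<^esub> (p ^ e)) \<odot>\<^bsub>M\<^esub> x"
  by (simp_all add: frob_push_def)

lemma self_module_simps [simp]:
  "carrier (self_module R) = carrier R" "add (self_module R) = add R"
  "zero (self_module R) = zero R" "smult (self_module R) = mult R"
  by (simp_all add: self_module_def)

lemma (in cring) self_module_is_module: "module R (self_module R)"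
proof (intro module.intro module_axioms.intro cring_axioms abelian_groupI)
  show "\<exists>y\<in>carrier (self_module R). y \<oplus>\<^bsub>self_module R\<^esub> x = \<zero>\<^bsub>self_module R\<^esub>"
    if "x \<in> carrier (self_module R)" for x
    using that by (intro bexI[of _ "\<ominus> x"]) (simp_all add: l_neg)
qed (simp_all add: a_ac l_distr r_distr m_assoc)

context frob_ring
begin

lemma frob_push_is_module:
  assumes "module R M"
  shows "module R (frob_push p e R M)"
proof -
  interpret M: module R M by (rule assms)
  have "abelian_group (frob_push p e R M)"
    using M.abelian_group_axioms
    unfolding abelian_group_def abelian_monoid_def abelian_group_axioms_def by simp
  then show ?thesis
    by (intro module.intro module_axioms.intro cring_axioms)
      (simp_all add: M.smult_l_distr M.smult_r_distr M.smult_assoc1 frob_add frob_mult)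
qed

end

subsection \<open>Ranks at primes and growth of generators\<close>

locale F_finite_ring = frob_ring R p for R :: "('a, 'm) ring_scheme" (structure) and p +
  assumes F_finite: "F_finite p R"
begin

text \<open>F-finiteness is given for some e \<ge> 1 and is brought down to e = 1: a p^e-th power is
  in particular a p-th power, so the same generators serve.\<close>

lemma frobenius_generators:
  obtains G where "finite G" "G \<subseteq> carrier R" "carrier R \<subseteq> gspan (Fr 1) {\<zero>} G"
proof -
  obtain e where e: "e \<ge> 1" "fin_gen R (frob_push p e R (self_module R))"
    using F_finite unfolding F_finite_def by blast
  define N where "N = frob_push p e R (self_module R)"
  interpret N: module R N
    unfolding N_def by (rule frob_push_is_module[OF self_module_is_module])
  obtain G where G: "finite G" "G \<subseteq> carrier N" "N.span G = carrier N"
    using e(2) unfolding fin_gen_def N_def by blast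
  have Gc: "G \<subseteq> carrier R" using G by (simp add: N_def)
  have zi: "ideal {\<zero>} R" by (rule zeroideal)
  have "carrier R \<subseteq> gspan (Fr 1) {\<zero>} G"
  proof
    fix x assume "x \<in> carrier R"
    then have "x \<in> N.span G" using G by (simp add: N_def)
    then obtain a where a: "a \<in> G \<rightarrow> carrier R" "N.lincomb a G = x"
      using N.finite_in_span[OF G(1,2)] by blast
    have "(\<Oplus>\<^bsub>N\<^esub>v\<in>G. a v \<odot>\<^bsub>N\<^esub> v) \<in> gspan (Fr 1) {\<zero>} G"
    proof (rule N.finsum_in_closed_set)
      show "gspan (Fr 1) {\<zero>} G \<subseteq> carrier N"
        using gspan_carrier[OF Fr_carrier _ Gc] by (simp add: N_def)
      show "\<zero>\<^bsub>N\<^esub> \<in> gspan (Fr 1) {\<zero>} G" by (simp add: N_def gspan.base)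
      show "x \<oplus>\<^bsub>N\<^esub> y \<in> gspan (Fr 1) {\<zero>} G"
        if "x \<in> gspan (Fr 1) {\<zero>} G" "y \<in> gspan (Fr 1) {\<zero>} G" for x y
        using gspan_add[OF Fr_carrier zi Gc that] by (simp add: N_def)
      fix v assume v: "v \<in> G"
      then have av: "a v \<in> carrier R" using a by auto
      obtain d where d: "e = d + 1" using e(1) by (metis add.commute le_Suc_ex)
      have "a v [^] (p ^ e) = (a v [^] (p ^ d)) [^] (p ^ 1)"
        unfolding d by (rule frob_pow_add[OF av, symmetric])
      then have "a v [^] (p ^ e) \<in> Fr 1" using FrI[of "a v [^] (p ^ d)" 1] av by simp
      then have "a v [^] (p ^ e) \<otimes> v \<in> gspan (Fr 1) {\<zero>} G"
        by (rule gspan_single[OF Fr_carrier zi Gc _ v])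
      then show "a v \<odot>\<^bsub>N\<^esub> v \<in> gspan (Fr 1) {\<zero>} G" by (simp add: N_def)
    qed (rule G)
    then show "x \<in> gspan (Fr 1) {\<zero>} G" using a(2) by (simp add: N.lincomb_def)
  qed
  then show ?thesis using that G(1) Gc by blast
qed

text \<open>This is \<open>[F\<^sub>*\<kappa>(Q) : \<kappa>(Q)] = p^\<alpha>(Q)\<close>, with denominators cleared.\<close>

definition rk :: "'a set \<Rightarrow> nat" where
  "rk Q = Max {n. \<exists>b :: nat \<Rightarrow> 'a. pindep 1 Q Q {..<n} b}"

text \<open>Makes the maximum in \<open>rk\<close> meaningful: the size of an independent family is
  bounded by the number of generators of \<open>F\<^sub>*R\<close>.\<close>

lemma rk_finite:
  assumes Q: "primeideal Q R"
  shows "finite {n. \<exists>b :: nat \<Rightarrow> 'a. pindep 1 Q Q {..<n} b}"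
proof -
  interpret Q: primeideal Q R by (rule Q)
  obtain G where G: "finite G" "G \<subseteq> carrier R" "carrier R \<subseteq> gspan (Fr 1) {\<zero>} G"
    by (rule frobenius_generators)
  have "n \<le> card G" if "pindep 1 Q Q {..<n} b" for n and b :: "nat \<Rightarrow> 'a"
  proof -
    have QN: "x [^] (p ^ 1) \<in> Q" if "x \<in> Q" for x
      by (rule ideal_pow[OF Q.ideal_axioms that q_pos])
    have "card {..<n} \<le> card G"
      by (rule pindep_card_le[OF Q Q.ideal_axioms zeroideal _ _ G]) (simp, erule QN, rule that)
    then show ?thesis by simp
  qed
  note le = this
  show ?thesis
  proof (rule finite_subset[OF subsetI])
    fix n assume "n \<in> {n. \<exists>b :: nat \<Rightarrow> 'a. pindep 1 Q Q {..<n} b}"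
    then obtain b :: "nat \<Rightarrow> 'a" where "pindep 1 Q Q {..<n} b" by (elim CollectE exE)
    from le[OF this] show "n \<in> {..card G}" by simp
  qed simp
qed

lemma rk_basis:
  assumes Q: "primeideal Q R"
  shows "\<exists>b :: nat \<Rightarrow> 'a. pindep 1 Q Q {..<rk Q} b"
proof -
  have "{n. \<exists>b :: nat \<Rightarrow> 'a. pindep 1 Q Q {..<n} b} \<noteq> {}" using pindep_one[OF Q] by blast
  then show ?thesis using Max_in[OF rk_finite[OF Q]] unfolding rk_def by blast
qed

lemma card_le_rk:
  assumes Q: "primeideal Q R" and "pindep 1 Q Q J b"
  shows "card J \<le> rk Q"
  unfolding rk_def using pindep_nat[OF assms(2)] by (intro Max_ge rk_finite[OF Q]) blast

lemma rk_pos: "primeideal Q R \<Longrightarrow> rk Q \<ge> 1"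
  using card_le_rk[OF _ pindep_one[of Q 1]] by simp

text \<open>A maximal independent family spans generically: appending u creates a relation, and the
  coefficient of u in it is outside Q, so it can act as the multiplier.\<close>

lemma rk_span:
  assumes Q: "primeideal Q R" and b: "pindep 1 Q Q {..<rk Q} b" and u: "u \<in> carrier R"
  shows "\<exists>s\<in>carrier R - Q. s [^] p \<otimes> u \<in> gspan (Fr 1) Q (b ` {..<rk Q})"
proof -
  interpret Q: primeideal Q R by (rule Q)
  let ?n = "rk Q"
  define b' where "b' = b(?n := u)"
  have bc: "b j \<in> carrier R" if "j < ?n" for j using b that by (auto simp: pindep_def)
  have b'c: "b' \<in> {..<Suc ?n} \<rightarrow> carrier R" using bc u by (auto simp: b'_def less_Suc_eq)
  have "\<not> pindep 1 Q Q {..<Suc ?n} b'"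
  proof
    assume "pindep 1 Q Q {..<Suc ?n} b'"
    from card_le_rk[OF Q this] show False by simp
  qed
  then have "\<not> (\<forall>a\<in>{..<Suc ?n} \<rightarrow> carrier R.
      (\<Oplus>j\<in>{..<Suc ?n}. a j [^] (p ^ 1) \<otimes> b' j) \<in> Q \<longrightarrow> (\<forall>j\<in>{..<Suc ?n}. a j \<in> Q))"
    using b'c unfolding pindep_def by simp
  then obtain a where a: "a \<in> {..<Suc ?n} \<rightarrow> carrier R"
    and s: "(\<Oplus>j\<in>{..<Suc ?n}. a j [^] (p ^ 1) \<otimes> b' j) \<in> Q" and nj: "\<not> (\<forall>j\<in>{..<Suc ?n}. a j \<in> Q)"
    unfolding Ball_def[of "{..<Suc ?n} \<rightarrow> carrier R"] not_all not_imp by (elim exE conjE) (rule that)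
  from nj obtain j where j: "j < Suc ?n" "a j \<notin> Q" by auto
  have ac: "a j \<in> carrier R" if "j < Suc ?n" for j using a that by auto
  let ?T = "\<Oplus>j\<in>{..<?n}. a j [^] (p ^ 1) \<otimes> b j"
  have Tc: "?T \<in> carrier R" using ac bc by (intro finsum_closed) auto
  have "(\<Oplus>j\<in>{..<Suc ?n}. a j [^] (p ^ 1) \<otimes> b' j)
      = a ?n [^] (p ^ 1) \<otimes> u \<oplus> (\<Oplus>j\<in>{..<?n}. a j [^] (p ^ 1) \<otimes> b' j)"
    unfolding lessThan_Suc using ac bc u by (subst finsum_insert) (auto simp: b'_def)
  also have "(\<Oplus>j\<in>{..<?n}. a j [^] (p ^ 1) \<otimes> b' j) = ?T"
    using ac bc by (intro add.finprod_cong') (auto simp: b'_def)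
  finally have sum: "a ?n [^] (p ^ 1) \<otimes> u \<oplus> ?T \<in> Q" using s by simp
  have anc: "a ?n \<in> carrier R" using ac by simp
  \<comment> \<open>If the coefficient of u were in Q, its term could be dropped modulo Q, and the
    remaining relation among the b would put every coefficient into Q.\<close>
  have an: "a ?n \<notin> Q"
  proof
    assume anQ: "a ?n \<in> Q"
    have "a ?n [^] (p ^ 1) \<otimes> u \<in> Q"
      by (rule Q.I_r_closed[OF ideal_pow[OF Q.ideal_axioms anQ q_pos] u])
    then have "?T \<in> Q"
    proof (rule ideal_add_cancel[OF Q.ideal_axioms Tc])
      have "a ?n [^] (p ^ 1) \<otimes> u \<in> carrier R" using anc u by simp
      then show "?T \<oplus> a ?n [^] (p ^ 1) \<otimes> u \<in> Q"
        using sum a_comm[OF _ Tc] by (simp only:)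
    qed
    moreover have "a \<in> {..<?n} \<rightarrow> carrier R" using ac by auto
    ultimately have "\<forall>j\<in>{..<?n}. a j \<in> Q"
      using b unfolding pindep_def by (elim conjE) (drule (1) bspec, simp)
    then show False using j anQ by (auto simp: less_Suc_eq)
  qed
  have bI: "b ` {..<?n} \<subseteq> carrier R" using bc by auto
  note QI = Q.ideal_axioms
  \<comment> \<open>The negative of \<open>?T\<close>, written with the sign inside the p-th power:
    in this form membership in the span is immediate, and p = 2 is no special case.\<close>
  define N where "N = (\<Oplus>j\<in>{..<?n}. (\<ominus> a j) [^] (p ^ 1) \<otimes> b j)"
  have N: "N \<in> gspan (Fr 1) Q (b ` {..<?n})"
    unfolding N_def
    using ac by (intro gspan_finsum[OF Fr_carrier QI bI] gspan_single[OF Fr_carrier QI bI] FrI) auto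
  have Nc: "N \<in> carrier R" unfolding N_def using ac bc by (intro finsum_closed) auto
  have "N \<oplus> ?T = (\<Oplus>j\<in>{..<?n}. (\<ominus> a j) [^] (p ^ 1) \<otimes> b j \<oplus> a j [^] (p ^ 1) \<otimes> b j)"
    unfolding N_def using ac bc by (intro finsum_addf[symmetric]) auto
  also have "\<dots> = (\<Oplus>j\<in>{..<?n}. \<zero>)"
  proof (intro add.finprod_cong')
    fix j assume "j \<in> {..<?n}"
    then have c: "a j \<in> carrier R" "b j \<in> carrier R" using ac bc by auto
    have "(\<ominus> a j) [^] (p ^ 1) \<oplus> a j [^] (p ^ 1) = (\<ominus> a j \<oplus> a j) [^] (p ^ 1)"
      by (rule frob_add[symmetric]) (use c in auto)
    also have "\<dots> = \<zero>" using c frob_zero[of 1] by (simp add: l_neg)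
    finally show "(\<ominus> a j) [^] (p ^ 1) \<otimes> b j \<oplus> a j [^] (p ^ 1) \<otimes> b j = \<zero>"
      using c l_distr[of "(\<ominus> a j) [^] (p ^ 1)" "a j [^] (p ^ 1)" "b j"] by simp
  qed simp_all
  finally have NT: "N \<oplus> ?T = \<zero>" by simp
  have "a ?n [^] (p ^ 1) \<otimes> u \<oplus> ?T \<oplus> N = a ?n [^] (p ^ 1) \<otimes> u \<oplus> (N \<oplus> ?T)"
    using Tc Nc anc u by (simp only: a_ac m_closed nat_pow_closed)
  also have "\<dots> = a ?n [^] p \<otimes> u" unfolding NT using anc u by simp
  finally have "a ?n [^] p \<otimes> u \<in> gspan (Fr 1) Q (b ` {..<?n})"
    using gspan_add[OF Fr_carrier QI bI gspan.base[OF sum] N] by simp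
  then show ?thesis using an anc by (intro bexI[of _ "a ?n"]) simp_all
qed

text \<open>One multiplier serves all x: it is found for the finitely many generators of
  \<open>F\<^sub>*R\<close>, and combinations with p-th power coefficients inherit it.\<close>

lemma rk_span_uniform:
  assumes P: "primeideal P R" and b: "pindep 1 P P {..<rk P} b"
  shows "\<exists>s\<in>carrier R - P. \<forall>x\<in>carrier R. s [^] p \<otimes> x \<in> gspan (Fr 1) P (b ` {..<rk P})"
proof -
  interpret P: primeideal P R by (rule P)
  note PI = P.ideal_axioms
  obtain G where G: "finite G" "G \<subseteq> carrier R" "carrier R \<subseteq> gspan (Fr 1) {\<zero>} G"
    by (rule frobenius_generators)
  define B where "B = b ` {..<rk P}"
  have B: "B \<subseteq> carrier R" using b by (auto simp: B_def pindep_def)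
  have "\<exists>s\<in>carrier R - P. \<forall>g\<in>G. s [^] p \<otimes> g \<in> gspan (Fr 1) P B"
  proof (rule prime_finite_common_multiple[OF P G(1)])
    show "\<exists>s\<in>carrier R - P. s [^] p \<otimes> g \<in> gspan (Fr 1) P B" if "g \<in> G" for g
      unfolding B_def using that G by (intro rk_span[OF P b]) auto
    fix s t g assume *: "s \<in> carrier R" "t \<in> carrier R" "g \<in> G" "s [^] p \<otimes> g \<in> gspan (Fr 1) P B"
    have "t [^] (p ^ 1) \<otimes> (s [^] p \<otimes> g) \<in> gspan (Fr 1) P B"
      by (rule gspan_Fr_smult[OF PI B *(2,4)])
    moreover have "g \<in> carrier R" using * G by auto
    ultimately show "(t \<otimes> s) [^] p \<otimes> g \<in> gspan (Fr 1) P B"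
      using * by (simp add: nat_pow_distrib m_assoc)
  qed
  then obtain s where s: "s \<in> carrier R - P" "\<And>g. g \<in> G \<Longrightarrow> s [^] p \<otimes> g \<in> gspan (Fr 1) P B"
    by blast
  have sB: "s [^] p \<otimes> x \<in> gspan (Fr 1) P B" if "x \<in> gspan (Fr 1) {\<zero>} G" for x
    using that
  proof induction
    case (base i)
    then show ?case using s by (auto intro: gspan.base)
  next
    case (step x d u)
    obtain r where r: "r \<in> carrier R" "d = r [^] (p ^ 1)" using step.hyps by (auto simp: Fr_def)
    have c: "u \<in> carrier R" "s \<in> carrier R" "x \<in> carrier R"
      using step.hyps G s gspan_carrier[OF Fr_carrier _ G(2), of "{\<zero>}" 1] by auto
    have "r [^] (p ^ 1) \<otimes> (s [^] p \<otimes> u) \<in> gspan (Fr 1) P B"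
      by (rule gspan_Fr_smult[OF PI B r(1) s(2)[OF step.hyps(3)]])
    then have "s [^] p \<otimes> x \<oplus> r [^] (p ^ 1) \<otimes> (s [^] p \<otimes> u) \<in> gspan (Fr 1) P B"
      by (rule gspan_add[OF Fr_carrier PI B step.IH])
    moreover have "s [^] p \<otimes> (x \<oplus> d \<otimes> u) = s [^] p \<otimes> x \<oplus> r [^] (p ^ 1) \<otimes> (s [^] p \<otimes> u)"
      unfolding r(2) using c r(1) by (simp add: r_distr m_lcomm)
    ultimately show ?case by simp
  qed
  have "\<forall>x\<in>carrier R. s [^] p \<otimes> x \<in> gspan (Fr 1) P B" using G(3) sB by (intro ballI sB) (rule subsetD)
  then show ?thesis unfolding B_def by (rule bexI[where x = s, OF _ s(1)])
qed

text \<open>Up to P, the module \<open>F\<^sub>*R\<close> contains the span of \<open>rk P\<close>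
  elements, and the quotient by that span has a finite set of generators and is killed by s.
  Applying \<open>F\<^sup>e\<^sub>*\<close>, the span costs \<open>rk P\<close> times the generators
  for R/P and the quotient costs n times those for R/(P + (s)). It is essential that s and n do not
  depend on e.\<close>

lemma mu_le_prime_step:
  assumes P: "primeideal P R"
  shows "\<exists>s\<in>carrier R - P. \<exists>n. \<forall>e t t'. mu_le e P t \<longrightarrow> mu_le e (adjoin P s) t' \<longrightarrow>
           mu_le (Suc e) P (rk P * t + n * t')"
proof -
  interpret P: primeideal P R by (rule P)
  note PI = P.ideal_axioms
  obtain G where G: "finite G" "G \<subseteq> carrier R" "carrier R \<subseteq> gspan (Fr 1) {\<zero>} G"
    by (rule frobenius_generators)
  obtain b :: "nat \<Rightarrow> 'a" where b: "pindep 1 P P {..<rk P} b" using rk_basis[OF P] by blast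
  define B where "B = b ` {..<rk P}"
  have B: "finite B" "card B \<le> rk P" "B \<subseteq> carrier R"
    using b card_image_le[of "{..<rk P}" b] by (auto simp: B_def pindep_def)
  obtain s where s: "s \<in> carrier R - P" "\<forall>x\<in>carrier R. s [^] p \<otimes> x \<in> gspan (Fr 1) P (b ` {..<rk P})"
    using rk_span_uniform[OF P b] by (elim bexE)
  have sB: "s [^] p \<otimes> x \<in> gspan (Fr 1) P B" if "x \<in> carrier R" for x
    unfolding B_def by (rule bspec[OF s(2) that])
  have "mu_le (Suc e) P (rk P * t + card G * t')"
    if UP: "mu_le e P t" and VP: "mu_le e (adjoin P s) t'" for e t t'
  proof -
    obtain U where U: "finite U" "card U \<le> t" "U \<subseteq> carrier R" "carrier R \<subseteq> gspan (Fr e) P U"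
      using UP unfolding mu_le_def by blast
    obtain V where V: "finite V" "card V \<le> t'" "V \<subseteq> carrier R"
      "carrier R \<subseteq> gspan (Fr e) (adjoin P s) V"
      using VP unfolding mu_le_def by blast
    \<comment> \<open>\<open>W1\<close> generates the part coming from the free span B,
      \<open>W2\<close> the part coming from the quotient killed by s.\<close>
    define W1 where "W1 = (\<lambda>(b, u). u [^] p \<otimes> b) ` (B \<times> U)"
    define W2 where "W2 = (\<lambda>(g, v). v [^] p \<otimes> g) ` (G \<times> V)"
    let ?W = "W1 \<union> W2"
    have "W1 \<subseteq> carrier R" "W2 \<subseteq> carrier R"
      unfolding W1_def W2_def using U(3) V(3) B(3) G(2) by (force intro!: m_closed nat_pow_closed)+
    then have W: "finite ?W" "?W \<subseteq> carrier R"
      using U(1) V(1) B(1) G(1) by (simp_all add: W1_def W2_def)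
    have "card W1 \<le> card (B \<times> U)" unfolding W1_def using B U by (intro card_image_le) simp
    also have "\<dots> \<le> rk P * t" using B U by (simp add: card_cartesian_product mult_le_mono)
    finally have W1: "card W1 \<le> rk P * t" .
    have "card W2 \<le> card (G \<times> V)" unfolding W2_def using G V by (intro card_image_le) simp
    also have "\<dots> \<le> card G * t'" using G V by (simp add: card_cartesian_product)
    finally have W2: "card W2 \<le> card G * t'" .
    have card: "card ?W \<le> rk P * t + card G * t'" using W1 W2 card_Un_le[of W1 W2] by linarith
    let ?T = "gspan (Fr (Suc e)) P ?W"
    note Tadd = gspan_add[OF Fr_carrier PI W(2)]
    have frob_step: "x [^] p \<otimes> c \<oplus> r [^] (p ^ Suc e) \<otimes> (u [^] p \<otimes> c) = (x \<oplus> r [^] (p ^ e) \<otimes> u) [^] p \<otimes> c"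
      if "x \<in> carrier R" "r \<in> carrier R" "u \<in> carrier R" "c \<in> carrier R" for x r u c
    proof -
      have "(x \<oplus> r [^] (p ^ e) \<otimes> u) [^] (p ^ 1) = x [^] (p ^ 1) \<oplus> (r [^] (p ^ e)) [^] (p ^ 1) \<otimes> u [^] (p ^ 1)"
        using that by (simp only: frob_add frob_mult m_closed nat_pow_closed)
      also have "(r [^] (p ^ e)) [^] (p ^ 1) = r [^] (p ^ Suc e)"
        using frob_pow_add[OF that(2), of e 1] by simp
      finally show ?thesis using that by (simp add: l_distr m_assoc)
    qed
    have yb: "y [^] p \<otimes> c \<in> ?T" if "y \<in> gspan (Fr e) P U" and c: "c \<in> B" for y c
      using that(1)
    proof induction
      case (base i)
      have "i [^] p \<otimes> c \<in> P"
        by (rule P.I_r_closed[OF ideal_pow[OF PI base prime_gt_0_nat[OF p_prime]] subsetD[OF B(3) c]])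
      then show ?case by (rule gspan.base)
    next
      case (step x d u)
      obtain r where r: "r \<in> carrier R" "d = r [^] (p ^ e)" using step.hyps by (auto simp: Fr_def)
      have cc: "u \<in> carrier R" "x \<in> carrier R" "c \<in> carrier R"
        using step.hyps U B c gspan_carrier[OF Fr_carrier P.a_subset U(3), of e] by auto
      have "x [^] p \<otimes> c \<oplus> r [^] (p ^ Suc e) \<otimes> (u [^] p \<otimes> c) \<in> ?T"
        using step.hyps c by (intro gspan.step[OF step.IH] FrI r(1)) (auto simp: W1_def)
      then show ?case unfolding r(2) by (simp only: frob_step[OF cc(2) r(1) cc(1,3)])
    qed
    have BT: "gspan (Fr 1) P B \<subseteq> ?T"
    proof (rule gspan_subset)
      show "P \<subseteq> ?T" by (intro subsetI gspan.base)
      fix d u assume "d \<in> Fr 1" "u \<in> B"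
      then obtain r where r: "r \<in> carrier R" "d = r [^] p" by (auto simp: Fr_def)
      show "d \<otimes> u \<in> ?T" unfolding r(2) by (rule yb[OF subsetD[OF U(4) r(1)] \<open>u \<in> B\<close>])
    qed (rule Tadd)
    have yg: "y [^] p \<otimes> g \<in> ?T" if "y \<in> gspan (Fr e) (adjoin P s) V" and g: "g \<in> G" for y g
      using that(1)
    proof induction
      case (base y)
      then obtain i r where ir: "y = i \<oplus> r \<otimes> s" "i \<in> P" "r \<in> carrier R" by (rule adjoinE)
      have c: "i \<in> carrier R" "g \<in> carrier R" "s \<in> carrier R" using ir P.a_subset g G s by auto
      have "i [^] p \<otimes> g \<in> P"
        by (rule P.I_r_closed[OF ideal_pow[OF PI ir(2) prime_gt_0_nat[OF p_prime]] c(2)])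
      then have 1: "i [^] p \<otimes> g \<in> ?T" by (rule gspan.base)
      \<comment> \<open>A multiple of s occurring as coefficient of g contributes s^p (r^p g), and
        s^p moves every element into the span of B.\<close>
      have "s [^] p \<otimes> (r [^] p \<otimes> g) \<in> ?T"
        using c ir by (intro subsetD[OF BT] sB) simp
      moreover have "y [^] p \<otimes> g = i [^] p \<otimes> g \<oplus> s [^] p \<otimes> (r [^] p \<otimes> g)"
        unfolding ir(1) using c ir(3) frob_add[of i "r \<otimes> s" 1]
        by (simp add: nat_pow_distrib l_distr r_distr m_ac)
      ultimately show ?case using Tadd[OF 1] by simp
    next
      case (step x d u)
      obtain r where r: "r \<in> carrier R" "d = r [^] (p ^ e)" using step.hyps by (auto simp: Fr_def)
      have "ideal (adjoin P s) R" using s(1) by (intro adjoin_ideal(1)[OF PI]) simp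
      then have "adjoin P s \<subseteq> carrier R" by (rule additive_subgroup.a_subset[OF ideal.axioms(1)])
      then have "x \<in> carrier R"
        using step.hyps(1) by (intro subsetD[OF gspan_carrier[OF Fr_carrier _ V(3)]])
      then have cc: "u \<in> carrier R" "x \<in> carrier R" "g \<in> carrier R"
        using subsetD[OF V(3) step.hyps(3)] subsetD[OF G(2) g] by simp_all
      have "x [^] p \<otimes> g \<oplus> r [^] (p ^ Suc e) \<otimes> (u [^] p \<otimes> g) \<in> ?T"
        using step.hyps g by (intro gspan.step[OF step.IH] FrI r(1)) (auto simp: W2_def)
      then show ?case unfolding r(2) by (simp only: frob_step[OF cc(2) r(1) cc(1,3)])
    qed
    have "gspan (Fr 1) {\<zero>} G \<subseteq> ?T"
    proof (rule gspan_subset)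
      show "{\<zero>} \<subseteq> ?T" using gspan.base[OF P.zero_closed] by simp
      fix d u assume "d \<in> Fr 1" "u \<in> G"
      then obtain r where r: "r \<in> carrier R" "d = r [^] p" by (auto simp: Fr_def)
      show "d \<otimes> u \<in> ?T" unfolding r(2) by (rule yg[OF subsetD[OF V(4) r(1)] \<open>u \<in> G\<close>])
    qed (rule Tadd)
    with G(3) have "carrier R \<subseteq> ?T" by (rule subset_trans)
    with W card show ?thesis unfolding mu_le_def by (intro exI[of _ ?W] conjI)
  qed
  note * = this
  show ?thesis
  proof (rule bexI[where x = s], rule exI[where x = "card G"], intro allI impI)
    show "s \<in> carrier R - P" by (rule s)
    fix e t t' assume "mu_le e P t" "mu_le e (adjoin P s) t'"
    then show "mu_le (Suc e) P (rk P * t + card G * t')" by (rule *)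
  qed
qed

text \<open>Multiplication by a maps R/(I + (b)) onto the kernel of R/I \<rightarrow> R/(I + (a)) up
  to I, because a b lies in I. Hence generators of the two quotients, the former multiplied by a,
  generate the middle term.\<close>

lemma mu_le_product:
  assumes I: "ideal I R" and ab: "a \<in> carrier R" "b \<in> carrier R" "a \<otimes> b \<in> I"
    and A: "mu_le e (adjoin I a) t" and B: "mu_le e (adjoin I b) t'"
  shows "mu_le e I (t + t')"
proof -
  interpret I: ideal I R by (rule I)
  obtain U where U: "finite U" "card U \<le> t" "U \<subseteq> carrier R" "carrier R \<subseteq> gspan (Fr e) (adjoin I a) U"
    using A unfolding mu_le_def by blast
  obtain V where V: "finite V" "card V \<le> t'" "V \<subseteq> carrier R" "carrier R \<subseteq> gspan (Fr e) (adjoin I b) V"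
    using B unfolding mu_le_def by blast
  let ?W = "U \<union> (\<lambda>v. v \<otimes> a) ` V"
  have W: "finite ?W" "?W \<subseteq> carrier R" using U V ab by auto
  have "card ((\<lambda>v. v \<otimes> a) ` V) \<le> t'" using V card_image_le le_trans by blast
  then have card: "card ?W \<le> t + t'" using U card_Un_le[of U "(\<lambda>v. v \<otimes> a) ` V"] by linarith
  let ?T = "gspan (Fr e) I ?W"
  note Tadd = gspan_add[OF Fr_carrier I W(2)]
  have ya: "y \<otimes> a \<in> ?T" if "y \<in> gspan (Fr e) (adjoin I b) V" for y
    using that
  proof induction
    case (base y)
    then obtain i r where ir: "y = i \<oplus> r \<otimes> b" "i \<in> I" "r \<in> carrier R" by (rule adjoinE)
    have "y \<otimes> a = i \<otimes> a \<oplus> r \<otimes> (a \<otimes> b)"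
      unfolding ir(1) using ir ab I.a_subset by (simp add: l_distr r_distr m_ac subset_iff)
    then have "y \<otimes> a \<in> I" using ir ab by (simp add: I.I_l_closed I.I_r_closed)
    then show ?case by (rule gspan.base)
  next
    case (step x d v)
    have sub: "gspan (Fr e) (adjoin I b) V \<subseteq> carrier R"
      by (intro gspan_carrier[OF Fr_carrier _ V(3)] additive_subgroup.a_subset ideal.axioms(1)
            adjoin_ideal(1)[OF I ab(2)])
    have c: "x \<in> carrier R" "d \<in> carrier R" "v \<in> carrier R"
      using step.hyps sub V Fr_carrier by auto
    have "x \<otimes> a \<oplus> d \<otimes> (v \<otimes> a) \<in> ?T" using step.hyps by (intro gspan.step[OF step.IH]) auto
    then show ?case using c ab by (simp add: l_distr m_assoc)
  qed
  have "x \<in> ?T" if "x \<in> gspan (Fr e) (adjoin I a) U" for x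
    using that
  proof induction
    case (base y)
    then obtain i r where ir: "y = i \<oplus> r \<otimes> a" "i \<in> I" "r \<in> carrier R" by (rule adjoinE)
    have "r \<otimes> a \<in> ?T" using ir V by (intro ya) auto
    then show ?case unfolding ir(1) by (rule Tadd[OF gspan.base[OF ir(2)]])
  next
    case (step x d u)
    show ?case by (rule gspan.step[OF step.IH step.hyps(2)]) (use step.hyps(3) in simp)
  qed
  then have "carrier R \<subseteq> ?T" using U by blast
  then show ?thesis unfolding mu_le_def using W card by blast
qed

lemma mu_le_trivial: "mu_le e (carrier R) 0"
  unfolding mu_le_def by (intro exI[of _ "{}"]) (auto intro: gspan.base)

lemma mu_le_zero: "ideal I R \<Longrightarrow> mu_le 0 I 1"
proof -
  assume I: "ideal I R"
  have "x \<in> gspan (Fr 0) I {\<one>}" if "x \<in> carrier R" for x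
    using gspan_single[OF Fr_carrier I, of "{\<one>}" x 0 \<one>] FrI[OF that, of 0] that by simp
  then show ?thesis unfolding mu_le_def by (intro exI[of _ "{\<one>}"]) auto
qed

end

section \<open>The filtration by \<open>P + Q^j\<close> and the lower bound for generators\<close>

context cring
begin

text \<open>The j-th member is the ideal \<open>P + Q^j\<close>. The recursion expresses each member
  as a \<open>gspan\<close> with coefficients in Q, which is the form that
  \<open>nakayama_prime\<close> consumes.\<close>

primrec power_chain :: "'a set \<Rightarrow> 'a set \<Rightarrow> nat \<Rightarrow> 'a set" where
  "power_chain Q P 0 = carrier R"
| "power_chain Q P (Suc j) = gspan Q P (power_chain Q P j)"

lemma ideal_gspan:
  assumes D: "ideal D R" and I: "ideal I R" and U: "U \<subseteq> carrier R"
  shows "ideal (gspan D I U) R"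
proof -
  interpret D: ideal D R by (rule D)
  interpret I: ideal I R by (rule I)
  show ?thesis
  proof (rule idealI_cring)
    show "gspan D I U \<subseteq> carrier R" by (rule gspan_carrier[OF D.a_subset I.a_subset U])
    show "\<zero> \<in> gspan D I U" by (rule gspan.base[OF I.zero_closed])
    show "x \<oplus> y \<in> gspan D I U" if "x \<in> gspan D I U" "y \<in> gspan D I U" for x y
      by (rule gspan_add[OF D.a_subset I U that])
    show "r \<otimes> x \<in> gspan D I U" if "r \<in> carrier R" "x \<in> gspan D I U" for r x
      by (rule gspan_smult[OF D.a_subset I U that(1) D.I_l_closed[OF _ that(1)] that(2)])
  qed
qed

lemma power_chain_ideal:
  assumes "ideal Q R" "ideal P R"
  shows "ideal (power_chain Q P j) R"
proof (induction j)
  case 0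
  show ?case using oneideal by simp
next
  case (Suc j)
  have "power_chain Q P j \<subseteq> carrier R"
    by (rule additive_subgroup.a_subset[OF ideal.axioms(1)[OF Suc]])
  then show ?case unfolding power_chain.simps by (rule ideal_gspan[OF assms])
qed

lemma power_chain_carrier:
  assumes "ideal Q R" "ideal P R"
  shows "power_chain Q P j \<subseteq> carrier R"
  by (rule additive_subgroup.a_subset[OF ideal.axioms(1)[OF power_chain_ideal[OF assms]]])

lemma power_chain_antimono:
  assumes Q: "ideal Q R" and P: "ideal P R" and "i \<le> j"
  shows "power_chain Q P j \<subseteq> power_chain Q P i"
proof -
  have step: "power_chain Q P (Suc j) \<subseteq> power_chain Q P j" for j
  proof (induction j)
    case 0
    show ?case using power_chain_carrier[OF Q P, of "Suc 0"] by simp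
  next
    case (Suc j)
    show ?case
      unfolding power_chain.simps(2)[of Q P "Suc j"] power_chain.simps(2)[of Q P j]
      by (rule gspan_mono[OF subset_refl subset_refl])
        (use Suc in \<open>simp only: power_chain.simps\<close>)
  qed
  show ?thesis by (rule lift_Suc_antimono_le[of "power_chain Q P", OF step assms(3)])
qed

lemma power_chain_base: "ideal P R \<Longrightarrow> P \<subseteq> power_chain Q P j"
proof (cases j)
  case 0
  assume "ideal P R"
  then show ?thesis using 0 additive_subgroup.a_subset[OF ideal.axioms(1)] by simp
next
  case (Suc n)
  then show ?thesis by (auto intro: gspan.base)
qed

lemma power_chain_mult:
  assumes Q: "ideal Q R" and P: "ideal P R" and "x \<in> Q" "z \<in> power_chain Q P j"
  shows "x \<otimes> z \<in> power_chain Q P (Suc j)"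
  unfolding power_chain.simps
  by (rule gspan_single[OF additive_subgroup.a_subset[OF ideal.axioms(1)[OF Q]] P
        power_chain_carrier[OF Q P] assms(3,4)])

lemma power_chain_pow:
  assumes Q: "ideal Q R" and P: "ideal P R" and x: "x \<in> Q"
  shows "x [^] j \<in> power_chain Q P j"
proof (induction j)
  case (Suc j)
  have xc: "x \<in> carrier R" by (rule ideal.Icarr[OF Q x])
  have "x [^] Suc j = x \<otimes> x [^] j" using xc by (simp add: m_comm)
  then show ?case using power_chain_mult[OF Q P x Suc] by (simp only:)
qed (use ideal.Icarr[OF Q x] in simp)

lemma ideal_colon:
  assumes P: "ideal P R" and s: "s \<in> carrier R"
  shows "ideal {x \<in> carrier R. s \<otimes> x \<in> P} R"
proof -
  interpret ideal P R by (rule P)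
  show ?thesis
  proof (rule idealI_cring)
    show "\<zero> \<in> {x \<in> carrier R. s \<otimes> x \<in> P}" using s by simp
    fix x y assume "x \<in> {x \<in> carrier R. s \<otimes> x \<in> P}" "y \<in> {x \<in> carrier R. s \<otimes> x \<in> P}"
    then show "x \<oplus> y \<in> {x \<in> carrier R. s \<otimes> x \<in> P}" using s by (simp add: r_distr)
  next
    fix r x assume "r \<in> carrier R" "x \<in> {x \<in> carrier R. s \<otimes> x \<in> P}"
    then show "r \<otimes> x \<in> {x \<in> carrier R. s \<otimes> x \<in> P}"
      using s I_l_closed[of "s \<otimes> x" r] by (simp add: m_lcomm)
  qed blast
qed

end

context frob_ring
begin

text \<open>No layer of the filtration vanishes at Q. Otherwise finite generation gives one
  multiplier for the whole layer, Nakayama's lemma then moves \<open>P + Q^j\<close> into P by a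
  multiplier outside Q, and primality of P puts \<open>Q^j\<close>, hence Q, inside P.\<close>

lemma power_chain_strict:
  assumes Q: "primeideal Q R" and P: "primeideal P R" and PQ: "P \<subset> Q"
  shows "\<exists>z\<in>power_chain Q P j. \<forall>s\<in>carrier R - Q. s \<otimes> z \<notin> power_chain Q P (Suc j)"
proof (rule ccontr)
  interpret Q: primeideal Q R by (rule Q)
  interpret P: primeideal P R by (rule P)
  note QI = Q.ideal_axioms and PI = P.ideal_axioms
  let ?N = "power_chain Q P j"
  assume "\<not> ?thesis"
  then have ex: "\<exists>s\<in>carrier R - Q. s \<otimes> z \<in> power_chain Q P (Suc j)" if "z \<in> ?N" for z
    using that by blast
  have NI: "ideal ?N R" by (rule power_chain_ideal[OF QI PI])
  have SI: "ideal (power_chain Q P (Suc j)) R" by (rule power_chain_ideal[OF QI PI])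
  obtain A where A: "A \<subseteq> carrier R" "finite A" "?N = Idl A" using finetely_gen[OF NI] by blast
  have AN: "A \<subseteq> ?N" unfolding A(3) by (rule genideal_self[OF A(1)])
  have "\<exists>s\<in>carrier R - Q. \<forall>a\<in>A. s \<otimes> a \<in> power_chain Q P (Suc j)"
  proof (rule prime_finite_common_multiple[OF Q A(2)])
    show "\<exists>s\<in>carrier R - Q. s \<otimes> g \<in> power_chain Q P (Suc j)" if "g \<in> A" for g
      by (rule ex[OF subsetD[OF AN that]])
    fix s t g assume *: "s \<in> carrier R" "t \<in> carrier R" "g \<in> A" "s \<otimes> g \<in> power_chain Q P (Suc j)"
    have "t \<otimes> (s \<otimes> g) \<in> power_chain Q P (Suc j)"
      by (rule ideal.I_l_closed[OF SI *(4,2)])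
    then show "(t \<otimes> s) \<otimes> g \<in> power_chain Q P (Suc j)"
      using m_assoc[OF *(2,1) subsetD[OF A(1) *(3)]] by (simp only:)
  qed
  then obtain s where s: "s \<in> carrier R - Q" "\<forall>a\<in>A. s \<otimes> a \<in> power_chain Q P (Suc j)" by blast
  have "ideal (gspan Q P A) R" by (rule ideal_gspan[OF QI PI A(1)])
  then interpret T: ideal "gspan Q P A" R .
  have sub: "power_chain Q P (Suc j) \<subseteq> gspan Q P A"
    unfolding power_chain.simps
  proof (rule gspan_subset)
    show "P \<subseteq> gspan Q P A" by (intro subsetI gspan.base)
    fix d u assume d: "d \<in> Q" and u: "u \<in> ?N"
    have "A \<subseteq> {x \<in> carrier R. d \<otimes> x \<in> gspan Q P A}"
    proof
      fix a assume a: "a \<in> A"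
      then show "a \<in> {x \<in> carrier R. d \<otimes> x \<in> gspan Q P A}"
        using subsetD[OF A(1) a] gspan_single[OF Q.a_subset PI A(1) d a] by simp
    qed
    then have "Idl A \<subseteq> {x \<in> carrier R. d \<otimes> x \<in> gspan Q P A}"
      by (rule genideal_minimal[OF ideal_colon[OF T.ideal_axioms Q.Icarr[OF d]]])
    then show "d \<otimes> u \<in> gspan Q P A" using u A(3) by auto
  qed (rule T.a_closed)
  have "\<exists>s\<in>carrier R - Q. \<forall>a\<in>A. s \<otimes> a \<in> P"
  proof (rule nakayama_prime[OF Q PI A(2,1) s(1)])
    show "s \<otimes> a \<in> gspan Q P A" if "a \<in> A" for a
      by (rule subsetD[OF sub bspec[OF s(2) that]])
  qed
  then obtain s' where s': "s' \<in> carrier R - Q" "\<forall>a\<in>A. s' \<otimes> a \<in> P" by blast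
  have s'c: "s' \<in> carrier R" and s'P: "s' \<notin> P" using s'(1) PQ by auto
  have "A \<subseteq> {x \<in> carrier R. s' \<otimes> x \<in> P}" using s'(2) A(1) by blast
  then have "Idl A \<subseteq> {x \<in> carrier R. s' \<otimes> x \<in> P}"
    by (rule genideal_minimal[OF ideal_colon[OF PI s'c]])
  then have NP: "x \<in> P" if "x \<in> ?N" for x
    using that A(3) P.I_prime[OF s'c, of x] s'P by auto
  obtain x where x: "x \<in> Q" "x \<notin> P" using PQ by blast
  have "x [^] j \<in> P" by (rule NP[OF power_chain_pow[OF QI PI x(1)]])
  then show False using prime_pow[OF P Q.Icarr[OF x(1)]] x(2) by blast
qed

end

context F_finite_ring
begin

text \<open>Choose z_j surviving at Q in each of the layers j < p^e, and (rk Q)^e elements c_i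
  independent in \<open>F\<^sup>e\<^sub>*(R/Q)\<close>. The products z_j c_i are independent modulo
  \<open>P + Q^(p^e)\<close>, and this ideal contains the p^e-th powers of elements of Q. Counting
  them gives p^e (rk Q)^e.\<close>

lemma mu_lower_bound:
  assumes Q: "primeideal Q R" and P: "primeideal P R" and PQ: "P \<subset> Q" and mu: "mu_le e P t"
  shows "(p * rk Q) ^ e \<le> t"
proof -
  interpret Q: primeideal Q R by (rule Q)
  interpret P: primeideal P R by (rule P)
  note QI = Q.ideal_axioms and PI = P.ideal_axioms
  define n where "n = p ^ e"
  define r where "r = rk Q ^ e"
  let ?N = "power_chain Q P"
  note NI = power_chain_ideal[OF QI PI]
  obtain U where U: "finite U" "card U \<le> t" "U \<subseteq> carrier R" "carrier R \<subseteq> gspan (Fr e) P U"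
    using mu unfolding mu_le_def by (elim exE conjE)
  obtain b :: "nat \<Rightarrow> 'a" where b: "pindep 1 Q Q {..<rk Q} b" using rk_basis[OF Q] by (elim exE)
  obtain c :: "nat \<Rightarrow> 'a" where c: "pindep e Q Q {..<r} c"
    using pindep_power[OF Q b, of e] unfolding r_def by (elim exE)
  have cc: "c i \<in> carrier R" if "i \<in> {..<r}" for i using c that unfolding pindep_def by blast
  have "\<forall>j. \<exists>z. z \<in> ?N j \<and> (\<forall>s\<in>carrier R - Q. s \<otimes> z \<notin> ?N (Suc j))"
    using power_chain_strict[OF Q P PQ] by (simp only: Bex_def) simp
  from choice[OF this] obtain z where "\<forall>j. z j \<in> ?N j \<and> (\<forall>s\<in>carrier R - Q. s \<otimes> z j \<notin> ?N (Suc j))"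
    by (elim exE)
  then have z: "z j \<in> ?N j" and zs: "s \<in> carrier R - Q \<Longrightarrow> s \<otimes> z j \<notin> ?N (Suc j)" for j s by simp_all
  have zc: "z j \<in> carrier R" for j by (rule subsetD[OF power_chain_carrier[OF QI PI] z])
  have Qn: "x [^] (p ^ e) \<in> ?N n" if "x \<in> Q" for x
    unfolding n_def by (rule power_chain_pow[OF QI PI that])
  have "pindep e (?N n) Q ({..<n} \<times> {..<r}) (\<lambda>(j, i). z j \<otimes> c i)"
    unfolding pindep_def
  proof (intro conjI ballI impI)
    show "(\<lambda>(j, i). z j \<otimes> c i) \<in> {..<n} \<times> {..<r} \<rightarrow> carrier R"
      using zc cc by (intro Pi_I) (simp add: split_beta mem_Times_iff)
    fix a x assume a: "a \<in> {..<n} \<times> {..<r} \<rightarrow> carrier R" and x: "x \<in> {..<n} \<times> {..<r}"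
      and sum: "(\<Oplus>x\<in>{..<n} \<times> {..<r}. a x [^] (p ^ e) \<otimes> (case x of (j, i) \<Rightarrow> z j \<otimes> c i)) \<in> ?N n"
    have ac: "a (j, i) \<in> carrier R" if "j \<in> {..<n}" "i \<in> {..<r}" for j i
      by (rule funcset_mem[OF a]) (use that in simp)
    define w where "w j = (\<Oplus>i\<in>{..<r}. a (j, i) [^] (p ^ e) \<otimes> c i)" for j
    have wc: "w j \<in> carrier R" if "j \<in> {..<n}" for j
      unfolding w_def by (intro finsum_closed Pi_I m_closed nat_pow_closed ac cc that)
    have "(\<Oplus>x\<in>{..<n} \<times> {..<r}. a x [^] (p ^ e) \<otimes> (case x of (j, i) \<Rightarrow> z j \<otimes> c i))
        = (\<Oplus>j\<in>{..<n}. \<Oplus>i\<in>{..<r}. a (j, i) [^] (p ^ e) \<otimes> (case (j, i) of (j, i) \<Rightarrow> z j \<otimes> c i))"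
      by (rule finsum_cartesian_product) (simp_all add: ac zc cc)
    also have "\<dots> = (\<Oplus>j\<in>{..<n}. z j \<otimes> w j)"
    proof (rule add.finprod_cong'[OF refl])
      fix j assume j: "j \<in> {..<n}"
      have "z j \<otimes> w j = (\<Oplus>i\<in>{..<r}. z j \<otimes> (a (j, i) [^] (p ^ e) \<otimes> c i))"
        unfolding w_def
        by (rule finsum_rdistr) (intro finite_lessThan zc Pi_I m_closed nat_pow_closed ac cc j)+
      also have "\<dots> = (\<Oplus>i\<in>{..<r}. a (j, i) [^] (p ^ e) \<otimes> (case (j, i) of (j, i) \<Rightarrow> z j \<otimes> c i))"
      proof (rule add.finprod_cong'[OF refl])
        fix i assume "i \<in> {..<r}"
        then show "z j \<otimes> (a (j, i) [^] (p ^ e) \<otimes> c i)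
            = a (j, i) [^] (p ^ e) \<otimes> (case (j, i) of (j, i) \<Rightarrow> z j \<otimes> c i)"
          using zc[of j] ac[OF j] cc by (simp add: m_lcomm)
      qed (use zc ac[OF j] cc in simp)
      finally show "(\<Oplus>i\<in>{..<r}. a (j, i) [^] (p ^ e) \<otimes> (case (j, i) of (j, i) \<Rightarrow> z j \<otimes> c i)) = z j \<otimes> w j"
        by (rule sym)
    qed (use zc wc in simp)
    finally have S: "(\<Oplus>j\<in>{..<n}. z j \<otimes> w j) \<in> ?N n" using sum by (simp only:)
    \<comment> \<open>A triangular argument along the layers. Modulo layer j + 1 the terms before j
      vanish, as their coefficients are p^e-th powers of elements of Q and so lie at depth p^e, and
      the terms after j lie too deep already. What remains is z_j w_j, and the choice of z_j forces
      w_j into Q.\<close>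
    have claim: "\<forall>i\<in>{..<r}. a (j, i) \<in> Q" if "j \<in> {..<n}" for j
      using that
    proof (induction j rule: less_induct)
      case (less j)
      have jn: "Suc j \<le> n" using less.prems by simp
      note down = power_chain_antimono[OF QI PI]
      have "(\<Oplus>k\<in>{..<n} - {j}. z k \<otimes> w k) \<in> ?N (Suc j)"
      proof (rule ideal_finsum[OF NI])
        fix k assume k: "k \<in> {..<n} - {j}"
        have wk: "w k \<in> carrier R" using k by (intro wc) simp
        show "z k \<otimes> w k \<in> ?N (Suc j)"
        proof (cases "k < j")
          case True
          then have "\<forall>i\<in>{..<r}. a (k, i) \<in> Q" using less.IH[of k] less.prems by simp
          then have "w k \<in> ?N n"
            unfolding w_def by (intro ideal_finsum[OF NI finite_lessThan] ideal.I_r_closed[OF NI] Qn cc) simp_all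
          then have "w k \<in> ?N (Suc j)" by (rule subsetD[OF down[OF jn]])
          then show ?thesis by (rule ideal.I_l_closed[OF NI _ zc])
        next
          case False
          then have "Suc j \<le> k" using k by simp
          then have "z k \<in> ?N (Suc j)" by (rule subsetD[OF down z])
          then show ?thesis by (rule ideal.I_r_closed[OF NI _ wk])
        qed
      qed simp
      moreover have "(\<Oplus>k\<in>insert j ({..<n} - {j}). z k \<otimes> w k)
          = z j \<otimes> w j \<oplus> (\<Oplus>k\<in>{..<n} - {j}. z k \<otimes> w k)"
        using zc wc less.prems by (intro finsum_insert) simp_all
      moreover have "insert j ({..<n} - {j}) = {..<n}" using less.prems by blast
      moreover have "(\<Oplus>j\<in>{..<n}. z j \<otimes> w j) \<in> ?N (Suc j)" by (rule subsetD[OF down[OF jn] S])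
      ultimately have "z j \<otimes> w j \<in> ?N (Suc j)"
        by (intro ideal_add_cancel[OF NI m_closed[OF zc wc[OF less.prems]]]) (assumption, simp only:)
      then have wz: "w j \<otimes> z j \<in> ?N (Suc j)" using m_comm[OF zc wc[OF less.prems]] by (simp only:)
      have "w j \<in> Q"
      proof (rule ccontr)
        assume "w j \<notin> Q"
        then have "w j \<in> carrier R - Q" using wc[OF less.prems] by simp
        from zs[OF this] show False using wz by blast
      qed
      moreover have "(\<lambda>i. a (j, i)) \<in> {..<r} \<rightarrow> carrier R" by (intro Pi_I ac less.prems)
      ultimately show ?case
        using c unfolding pindep_def w_def by (elim conjE) (drule (1) bspec, simp)
    qed
    obtain j i where ji: "x = (j, i)" "j \<in> {..<n}" "i \<in> {..<r}" using x by (elim SigmaE) (rule that)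
    show "a x \<in> Q" unfolding ji(1) by (rule bspec[OF claim[OF ji(2)] ji(3)])
  qed simp
  then have "card ({..<n} \<times> {..<r}) \<le> card U"
    by (rule pindep_card_le[OF Q NI PI power_chain_base[OF PI] Qn U(1,3,4), rotated 1])
  then show ?thesis using U(2) by (simp add: n_def r_def power_mult_distrib)
qed

end

section \<open>From generator counts to the rank drop\<close>

text \<open>A linear factor does not change an exponential rate: if y < x, division by x^e would let
  the right-hand side tend to 0. This lets \<open>prime_growth\<close> begin with a crude upper
  bound.\<close>

lemma power_le_linear_times_power:
  fixes x y :: nat and C :: real
  assumes "\<And>e. real (x ^ e) \<le> C * real (Suc e) * real (y ^ e)"
  shows "x \<le> y"
proof (rule ccontr)
  assume "\<not> x \<le> y"
  then have xy: "y < x" by simp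
  define r where "r = real y / real x"
  have r: "0 \<le> r" "r < 1" using xy by (auto simp: r_def)
  have le: "1 \<le> C * (real e * r ^ e + r ^ e)" for e
  proof -
    have "real x ^ e > 0" using xy by simp
    then have "1 = real x ^ e / real x ^ e" by simp
    also have "\<dots> \<le> C * real (Suc e) * real y ^ e / real x ^ e"
      using assms[of e] \<open>real x ^ e > 0\<close> by (intro divide_right_mono) simp_all
    also have "\<dots> = C * (real e * r ^ e + r ^ e)"
      by (simp add: r_def power_divide distrib_left distrib_right add_divide_distrib)
    finally show ?thesis .
  qed
  have "(\<lambda>e. C * (real e * r ^ e + r ^ e)) \<longlonglongrightarrow> C * (0 + 0)"
    using r by (intro tendsto_intros powser_times_n_limit_0 LIMSEQ_realpow_zero) auto
  then have "1 \<le> C * (0 + 0)"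
    by (rule LIMSEQ_le_const) (use le in blast)
  then show False by simp
qed

context F_finite_ring
begin

text \<open>J stands for P + (s), and g1 for the largest rank strictly above P. The recursion first
  yields a bound of order (e+1) h^e with h the maximum of g1 and \<open>rk P\<close>. Against
  \<open>mu_lower_bound\<close> this gives p g1 \<le> h, which excludes h = g1 > 0 and so proves the
  rank drop. Run again with g1 \<le> rk P / 2, the recursion loses only a geometric series, and the
  factor e + 1 disappears.\<close>

lemma prime_growth:
  fixes C1 :: real and g1 n :: nat
  assumes P: "primeideal P R" and C1: "C1 \<ge> 0"
    and step: "\<And>e t t'. mu_le e P t \<Longrightarrow> mu_le e J t' \<Longrightarrow> mu_le (Suc e) P (rk P * t + n * t')"
    and J: "\<And>e. \<exists>t. mu_le e J t \<and> real t \<le> C1 * real g1 ^ e"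
    and g1: "\<And>Q. primeideal Q R \<Longrightarrow> P \<subset> Q \<Longrightarrow> rk Q \<le> g1"
    and att: "g1 > 0 \<Longrightarrow> \<exists>Q. primeideal Q R \<and> P \<subset> Q \<and> rk Q = g1"
  shows "p * g1 \<le> rk P" "\<exists>C\<ge>0. \<forall>e. \<exists>t. mu_le e P t \<and> real t \<le> C * real (rk P) ^ e"
proof -
  note PI = primeideal.axioms(1)[OF P]
  let ?r = "rk P"
  have r1: "?r \<ge> 1" by (rule rk_pos[OF P])
  define h where "h = max g1 ?r"
  have h1: "h \<ge> 1" using r1 by (simp add: h_def)
  \<comment> \<open>At least 1 for the start of the induction, at least n C1 so that each step adds
    at most one further \<open>C2 * h ^ Suc e\<close>.\<close>
  define C2 where "C2 = max 1 (real n * C1)"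
  have C2: "1 \<le> C2" "real n * C1 \<le> C2" by (simp_all add: C2_def)
  have up: "\<exists>t. mu_le e P t \<and> real t \<le> C2 * real (Suc e) * real (h ^ e)" for e
  proof (induction e)
    case 0
    show ?case using mu_le_zero[OF PI] C2 by (intro exI[of _ 1]) simp
  next
    case (Suc e)
    obtain t where t: "mu_le e P t" "real t \<le> C2 * real (Suc e) * real (h ^ e)"
      using Suc by (elim exE conjE)
    obtain t' where t': "mu_le e J t'" "real t' \<le> C1 * real g1 ^ e" using J[of e] by (elim exE conjE)
    have "real ?r * real t \<le> real h * (C2 * real (Suc e) * real (h ^ e))"
      using t(2) by (intro mult_mono) (simp_all add: h_def)
    moreover have "real n * real t' \<le> real n * (C1 * real h ^ e)"
    proof (rule mult_left_mono)
      have "C1 * real g1 ^ e \<le> C1 * real h ^ e"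
        by (intro mult_left_mono power_mono C1) (simp_all add: h_def)
      then show "real t' \<le> C1 * real h ^ e" using t'(2) by simp
    qed simp
    moreover have "real n * (C1 * real h ^ e) \<le> C2 * real h ^ Suc e"
    proof -
      have "real n * C1 * real h ^ e \<le> C2 * real h ^ Suc e"
        using C2 C1 h1 by (intro mult_mono) simp_all
      then show ?thesis by simp
    qed
    ultimately have "real (?r * t + n * t') \<le> real h * (C2 * real (Suc e) * real (h ^ e)) + C2 * real h ^ Suc e"
      by simp
    also have "\<dots> = C2 * real (Suc (Suc e)) * real (h ^ Suc e)" by (simp add: algebra_simps)
    finally show ?case using step[OF t(1) t'(1)] by (intro exI[of _ "?r * t + n * t'"] conjI)
  qed
  have K: "p * rk Q \<le> h" if Q: "primeideal Q R" "P \<subset> Q" for Q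
  proof (rule power_le_linear_times_power)
    fix e
    obtain t where t: "mu_le e P t" "real t \<le> C2 * real (Suc e) * real (h ^ e)"
      using up[of e] by (elim exE conjE)
    have "(p * rk Q) ^ e \<le> t" by (rule mu_lower_bound[OF Q(1) P Q(2) t(1)])
    then show "real ((p * rk Q) ^ e) \<le> C2 * real (Suc e) * real (h ^ e)" using t(2) by linarith
  qed
  show pg: "p * g1 \<le> ?r"
  proof (cases "g1 > 0")
    case True
    then obtain Q where Q: "primeideal Q R" "P \<subset> Q" "rk Q = g1" using att[OF True] by (elim exE conjE) (rule that)
    have "p * g1 \<le> h" using K[OF Q(1,2)] Q(3) by simp
    moreover have "g1 < p * g1" using p_ge_2 True by simp
    ultimately show ?thesis by (simp add: h_def max_def split: if_splits)
  qed simp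
  \<comment> \<open>The doubled constant accounts for writing (r/2)^e as 2 (1/2)^(e+1) r^e. The
    increments are then \<open>C3 * (1/2) ^ Suc e\<close>, whose partial sums with the initial 1
    give the factor \<open>2 - (1/2) ^ e\<close> below.\<close>
  define C3 where "C3 = max 1 (2 * real n * C1)"
  have C3: "1 \<le> C3" "2 * real n * C1 \<le> C3" by (simp_all add: C3_def)
  have g1h: "real g1 \<le> real ?r / 2"
  proof -
    have "2 * g1 \<le> ?r" using pg mult_le_mono1[OF p_ge_2, of g1] by linarith
    then show ?thesis by simp
  qed
  have up2: "\<exists>t. mu_le e P t \<and> real t \<le> C3 * (2 - (1/2) ^ e) * real ?r ^ e" for e
  proof (induction e)
    case 0
    show ?case using mu_le_zero[OF PI] C3 by (intro exI[of _ 1]) simp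
  next
    case (Suc e)
    obtain t where t: "mu_le e P t" "real t \<le> C3 * (2 - (1/2) ^ e) * real ?r ^ e"
      using Suc by (elim exE conjE)
    obtain t' where t': "mu_le e J t'" "real t' \<le> C1 * real g1 ^ e" using J[of e] by (elim exE conjE)
    have "real ?r * real t \<le> real ?r * (C3 * (2 - (1/2) ^ e) * real ?r ^ e)"
      using t(2) by (intro mult_left_mono) simp_all
    moreover have "real n * real t' \<le> real n * (C1 * (real ?r / 2) ^ e)"
    proof (rule mult_left_mono)
      have "C1 * real g1 ^ e \<le> C1 * (real ?r / 2) ^ e"
        by (intro mult_left_mono power_mono C1 g1h) simp
      then show "real t' \<le> C1 * (real ?r / 2) ^ e" using t'(2) by simp
    qed simp
    moreover have "real n * (C1 * (real ?r / 2) ^ e) \<le> C3 * (1/2) ^ Suc e * real ?r ^ Suc e"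
    proof -
      have "real n * (C1 * (real ?r / 2) ^ e) = (2 * real n * C1) * ((1/2) ^ Suc e * real ?r ^ e)"
        by (simp add: power_divide field_simps)
      also have "\<dots> \<le> C3 * ((1/2) ^ Suc e * real ?r ^ Suc e)"
        using C3 C1 r1 by (intro mult_mono) simp_all
      finally show ?thesis by simp
    qed
    ultimately have "real (?r * t + n * t')
        \<le> real ?r * (C3 * (2 - (1/2) ^ e) * real ?r ^ e) + C3 * (1/2) ^ Suc e * real ?r ^ Suc e"
      by simp
    also have "\<dots> = C3 * (2 - (1/2) ^ Suc e) * real ?r ^ Suc e" by (simp add: algebra_simps)
    finally show ?case using step[OF t(1) t'(1)] by (intro exI[of _ "?r * t + n * t'"] conjI)
  qed
  have "\<exists>t. mu_le e P t \<and> real t \<le> (2 * C3) * real ?r ^ e" for e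
  proof -
    obtain t where t: "mu_le e P t" "real t \<le> C3 * (2 - (1/2) ^ e) * real ?r ^ e"
      using up2[of e] by (elim exE conjE)
    have "C3 * (2 - (1/2) ^ e) * real ?r ^ e \<le> (2 * C3) * real ?r ^ e"
      using C3(1) by (intro mult_right_mono) simp_all
    then show ?thesis using t by (intro exI[of _ t]) simp
  qed
  then show "\<exists>C\<ge>0. \<forall>e. \<exists>t. mu_le e P t \<and> real t \<le> C * real ?r ^ e"
    using C3 by (intro exI[of _ "2 * C3"]) simp
qed

text \<open>Both parts have to be carried through one Noetherian induction: at a prime I the growth
  bound for the larger ideal I + (s) yields the rank drop at I, and the rank drop yields the growth
  bound for I. If I is neither prime nor R, a product a b in I reduces both parts to I + (a) and I +
  (b), because a prime over I contains a or b.\<close>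

theorem rank_drop_and_growth:
  assumes "ideal I R"
  shows "(\<forall>P Q. primeideal P R \<longrightarrow> I \<subseteq> P \<longrightarrow> primeideal Q R \<longrightarrow> P \<subset> Q \<longrightarrow> p * rk Q \<le> rk P) \<and>
    (\<forall>g::nat. (\<forall>P. primeideal P R \<longrightarrow> I \<subseteq> P \<longrightarrow> rk P \<le> g) \<longrightarrow>
      (\<exists>C::real\<ge>0. \<forall>e. \<exists>t. mu_le e I t \<and> real t \<le> C * real g ^ e))"
    (is "?K I \<and> ?B I")
  using assms
proof (induction rule: noetherian_ideal_induct)
  case (ideal I)
  consider "I = carrier R" | "primeideal I R" | "I \<noteq> carrier R" "\<not> primeideal I R" by blast
  then show ?case
  proof cases
    case 1
    have no: "\<not> I \<subseteq> P" if "primeideal P R" for P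
      using one_notin_prime[OF that] 1 one_closed by blast
    have "\<exists>C::real\<ge>0. \<forall>e. \<exists>t. mu_le e I t \<and> real t \<le> C * real g ^ e" for g :: nat
    proof (rule exI[of _ 0], intro conjI allI)
      fix e
      have "mu_le e I 0 \<and> real 0 \<le> 0 * real g ^ e" unfolding 1 using mu_le_trivial by simp
      then show "\<exists>t. mu_le e I t \<and> real t \<le> 0 * real g ^ e" by (rule exI)
    qed simp
    then show ?thesis using no by simp
  next
    case 2
    let ?above = "{Q. primeideal Q R \<and> I \<subset> Q}"
    obtain s n where s: "s \<in> carrier R - I"
      and n: "\<forall>e t t'. mu_le e I t \<longrightarrow> mu_le e (adjoin I s) t' \<longrightarrow> mu_le (Suc e) I (rk I * t + n * t')"
      using mu_le_prime_step[OF 2] by (elim bexE exE)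
    have sc: "s \<in> carrier R" using s by simp
    note A = adjoin_ideal[OF ideal.hyps sc]
    have IA: "I \<subset> adjoin I s" using A(2,3) s by blast
    \<comment> \<open>All ranks are bounded by the number of generators of
      \<open>F\<^sub>*R\<close>, so the maximum of ranks strictly above I exists although there may
      be infinitely many such primes.\<close>
    obtain m where m: "\<And>Q. primeideal Q R \<Longrightarrow> rk Q \<le> m"
    proof -
      obtain G where G: "finite G" "G \<subseteq> carrier R" "carrier R \<subseteq> gspan (Fr 1) {\<zero>} G"
        by (rule frobenius_generators)
      have "rk Q \<le> card G" if Q: "primeideal Q R" for Q
      proof -
        obtain b :: "nat \<Rightarrow> 'a" where b: "pindep 1 Q Q {..<rk Q} b" using rk_basis[OF Q] by (elim exE)
        have QI: "ideal Q R" by (rule primeideal.axioms(1)[OF Q])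
        have z: "{\<zero>} \<subseteq> Q" using additive_subgroup.zero_closed[OF ideal.axioms(1)[OF QI]] by simp
        have "card {..<rk Q} \<le> card G"
          by (rule pindep_card_le[OF Q QI zeroideal z _ G b]) (rule ideal_pow[OF QI _ q_pos])
        then show ?thesis by simp
      qed
      then show ?thesis by (rule that)
    qed
    \<comment> \<open>With no prime strictly above I the value is 0; the induction hypothesis for I
      + (s) then applies with g = 0, its condition on primes being vacuous.\<close>
    define g1 where "g1 = (if ?above = {} then 0 else Max (rk ` ?above))"
    have fin: "finite (rk ` ?above)" by (rule finite_subset[of _ "{..m}"]) (use m in \<open>simp_all add: image_subset_iff\<close>)
    have g1: "rk Q \<le> g1" if "primeideal Q R" "I \<subset> Q" for Q
    proof -
      have ne: "?above \<noteq> {}" using that by blast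
      have "rk Q \<le> Max (rk ` ?above)" by (rule Max_ge[OF fin]) (use that in simp)
      then show ?thesis unfolding g1_def if_not_P[OF ne] .
    qed
    have att: "\<exists>Q. primeideal Q R \<and> I \<subset> Q \<and> rk Q = g1" if "g1 > 0"
    proof -
      have ne: "?above \<noteq> {}" using that by (simp add: g1_def split: if_splits)
      then have "Max (rk ` ?above) \<in> rk ` ?above" by (intro Max_in[OF fin]) simp
      then obtain Q where "Q \<in> ?above" "Max (rk ` ?above) = rk Q" by (elim imageE)
      then show ?thesis unfolding g1_def if_not_P[OF ne] by (intro exI[of _ Q]) simp
    qed
    have IHA: "?K (adjoin I s) \<and> ?B (adjoin I s)" by (rule ideal.IH[OF A(1) IA])
    have "\<forall>P. primeideal P R \<longrightarrow> adjoin I s \<subseteq> P \<longrightarrow> rk P \<le> g1" using g1 IA by blast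
    then have "\<exists>C::real\<ge>0. \<forall>e. \<exists>t. mu_le e (adjoin I s) t \<and> real t \<le> C * real g1 ^ e"
      using IHA by simp
    then obtain C1 :: real where C1: "C1 \<ge> 0"
      "\<forall>e. \<exists>t. mu_le e (adjoin I s) t \<and> real t \<le> C1 * real g1 ^ e" by (elim exE conjE)
    have pg: "p * g1 \<le> rk I" and gr: "\<exists>C\<ge>0. \<forall>e. \<exists>t. mu_le e I t \<and> real t \<le> C * real (rk I) ^ e"
      using prime_growth[OF 2 C1(1), of "adjoin I s" n g1] n C1(2) g1 att by simp_all
    have "p * rk Q \<le> rk P" if "primeideal P R" "I \<subseteq> P" "primeideal Q R" "P \<subset> Q" for P Q
    proof (cases "P = I")
      case True
      have "p * rk Q \<le> p * g1" using g1[OF that(3)] that(4) True by simp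
      then have "p * rk Q \<le> rk I" using pg by (rule le_trans)
      then show ?thesis unfolding True .
    next
      case False
      then have "I \<subset> P" using that(2) by blast
      from ideal.IH[OF primeideal.axioms(1)[OF that(1)] this]
      show ?thesis using that(1,3,4) by blast
    qed
    moreover have "\<exists>C::real\<ge>0. \<forall>e. \<exists>t. mu_le e I t \<and> real t \<le> C * real g ^ e"
      if "\<forall>P. primeideal P R \<longrightarrow> I \<subseteq> P \<longrightarrow> rk P \<le> g" for g :: nat
    proof -
      have rg: "rk I \<le> g" using that 2 by simp
      obtain C where C: "C \<ge> 0" "\<forall>e. \<exists>t. mu_le e I t \<and> real t \<le> C * real (rk I) ^ e"
        using gr by (elim exE conjE)
      have "\<exists>t. mu_le e I t \<and> real t \<le> C * real g ^ e" for e
      proof -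
        obtain t where t: "mu_le e I t" "real t \<le> C * real (rk I) ^ e" using C(2) by (elim allE exE conjE)
        have "C * real (rk I) ^ e \<le> C * real g ^ e"
          using rg C(1) by (intro mult_left_mono power_mono) simp_all
        then show ?thesis using t by (intro exI[of _ t]) simp
      qed
      then show ?thesis using C(1) by (intro exI[of _ C]) simp
    qed
    ultimately show ?thesis by simp
  next
    case 3
    obtain a b where ab: "a \<in> carrier R" "b \<in> carrier R" "a \<notin> I" "b \<notin> I" "a \<otimes> b \<in> I"
      by (rule not_prime_ideal[OF ideal.hyps 3(2,1)])
    note A = adjoin_ideal[OF ideal.hyps ab(1)] and B = adjoin_ideal[OF ideal.hyps ab(2)]
    have sA: "I \<subset> adjoin I a" and sB: "I \<subset> adjoin I b" using A(2,3) B(2,3) ab(3,4) by blast+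
    have IHA: "?K (adjoin I a) \<and> ?B (adjoin I a)" by (rule ideal.IH[OF A(1) sA])
    have IHB: "?K (adjoin I b) \<and> ?B (adjoin I b)" by (rule ideal.IH[OF B(1) sB])
    have KI: "?K I"
    proof (intro allI impI)
      fix P Q assume P: "primeideal P R" "I \<subseteq> P" and Q: "primeideal Q R" "P \<subset> Q"
      have disj: "a \<in> P \<or> b \<in> P" using primeideal.I_prime[OF P(1) ab(1,2)] ab(5) P(2) by blast
      have sub: "adjoin I c \<subseteq> P" if "c \<in> P" "c \<in> carrier R" for c
      proof
        fix x assume "x \<in> adjoin I c"
        then obtain i r where *: "x = i \<oplus> r \<otimes> c" "i \<in> I" "r \<in> carrier R" by (rule adjoinE)
        interpret P: primeideal P R by (rule P(1))
        show "x \<in> P" unfolding *(1)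
          by (rule P.a_closed[OF subsetD[OF P(2) *(2)] P.I_l_closed[OF that(1) *(3)]])
      qed
      from disj show "p * rk Q \<le> rk P"
      proof (elim disjE)
        assume "a \<in> P"
        show ?thesis
          by (rule conjunct1[OF IHA, rule_format, OF P(1) sub[OF \<open>a \<in> P\<close> ab(1)] Q])
      next
        assume "b \<in> P"
        show ?thesis
          by (rule conjunct1[OF IHB, rule_format, OF P(1) sub[OF \<open>b \<in> P\<close> ab(2)] Q])
      qed
    qed
    have BI: "?B I"
    proof (intro allI impI)
      fix g :: nat assume g: "\<forall>P. primeideal P R \<longrightarrow> I \<subseteq> P \<longrightarrow> rk P \<le> g"
      have "\<forall>P. primeideal P R \<longrightarrow> adjoin I a \<subseteq> P \<longrightarrow> rk P \<le> g"
        "\<forall>P. primeideal P R \<longrightarrow> adjoin I b \<subseteq> P \<longrightarrow> rk P \<le> g" using g A(2) B(2) by blast+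
      then have "\<exists>C::real\<ge>0. \<forall>e. \<exists>t. mu_le e (adjoin I a) t \<and> real t \<le> C * real g ^ e"
        "\<exists>C::real\<ge>0. \<forall>e. \<exists>t. mu_le e (adjoin I b) t \<and> real t \<le> C * real g ^ e"
        using IHA IHB by simp_all
      then obtain CA CB :: real where CA: "CA \<ge> 0"
        "\<forall>e. \<exists>t. mu_le e (adjoin I a) t \<and> real t \<le> CA * real g ^ e" and CB: "CB \<ge> 0"
        "\<forall>e. \<exists>t. mu_le e (adjoin I b) t \<and> real t \<le> CB * real g ^ e" by (elim exE conjE)
      have "\<exists>t. mu_le e I t \<and> real t \<le> (CA + CB) * real g ^ e" for e
      proof -
        obtain t where t: "mu_le e (adjoin I a) t" "real t \<le> CA * real g ^ e"
          using CA(2) by (elim allE exE conjE)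
        obtain t' where t': "mu_le e (adjoin I b) t'" "real t' \<le> CB * real g ^ e"
          using CB(2) by (elim allE exE conjE)
        have "mu_le e I (t + t')" by (rule mu_le_product[OF ideal.hyps ab(1,2,5) t(1) t'(1)])
        moreover have "real (t + t') \<le> (CA + CB) * real g ^ e" using t(2) t'(2) by (simp add: distrib_right)
        ultimately show ?thesis by (intro exI[of _ "t + t'"] conjI)
      qed
      then show "\<exists>C::real\<ge>0. \<forall>e. \<exists>t. mu_le e I t \<and> real t \<le> C * real g ^ e"
        using CA(1) CB(1) by (intro exI[of _ "CA + CB"]) simp
    qed
    show ?thesis using KI BI by (rule conjI)
  qed
qed

lemma rank_drop:
  assumes "primeideal P R" "primeideal Q R" "P \<subset> Q"
  shows "p * rk Q \<le> rk P"
proof -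
  have I: "ideal P R" by (rule primeideal.axioms(1)[OF assms(1)])
  show ?thesis by (rule conjunct1[OF rank_drop_and_growth[OF I], rule_format, OF assms(1) subset_refl assms(2,3)])
qed

lemma mu_growth:
  fixes g :: nat
  assumes "ideal I R" "\<And>P. primeideal P R \<Longrightarrow> I \<subseteq> P \<Longrightarrow> rk P \<le> g"
  shows "\<exists>C::real\<ge>0. \<forall>e. \<exists>t. mu_le e I t \<and> real t \<le> C * real g ^ e"
  using conjunct2[OF rank_drop_and_growth[OF assms(1)]] assms(2) by simp

end

lemma (in cring) ideal_common:
  assumes "\<And>P. P \<in> F \<Longrightarrow> ideal P R"
  shows "ideal {y \<in> carrier R. \<forall>P\<in>F. y \<in> P} R"
proof (rule idealI_cring)
  show "\<zero> \<in> {y \<in> carrier R. \<forall>P\<in>F. y \<in> P}"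
    using additive_subgroup.zero_closed[OF ideal.axioms(1)[OF assms]] by simp
next
  fix x y assume "x \<in> {y \<in> carrier R. \<forall>P\<in>F. y \<in> P}" "y \<in> {y \<in> carrier R. \<forall>P\<in>F. y \<in> P}"
  then show "x \<oplus> y \<in> {y \<in> carrier R. \<forall>P\<in>F. y \<in> P}"
    using additive_subgroup.a_closed[OF ideal.axioms(1)[OF assms]] by simp
next
  fix r x assume "r \<in> carrier R" "x \<in> {y \<in> carrier R. \<forall>P\<in>F. y \<in> P}"
  then show "r \<otimes> x \<in> {y \<in> carrier R. \<forall>P\<in>F. y \<in> P}"
    using ideal.I_l_closed[OF assms] by simp
qed simp

lemma (in cring) set_add_ideal_superset:
  assumes I: "ideal I R" and J: "ideal J R"
  shows "I \<subseteq> I <+>\<^bsub>R\<^esub> J" "J \<subseteq> I <+>\<^bsub>R\<^esub> J"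
proof -
  interpret I: ideal I R by (rule I)
  interpret J: ideal J R by (rule J)
  have mem: "i \<oplus> j \<in> I <+>\<^bsub>R\<^esub> J" if "i \<in> I" "j \<in> J" for i j
    using that unfolding set_add_def set_mult_def by auto
  show "I \<subseteq> I <+>\<^bsub>R\<^esub> J"
  proof
    fix i assume "i \<in> I"
    then show "i \<in> I <+>\<^bsub>R\<^esub> J" using mem[of i \<zero>] I.Icarr[of i] by simp
  qed
  show "J \<subseteq> I <+>\<^bsub>R\<^esub> J"
  proof
    fix j assume "j \<in> J"
    then show "j \<in> I <+>\<^bsub>R\<^esub> J" using mem[of \<zero> j] J.Icarr[of j] by simp
  qed
qed

context F_finite_ring
begin

subsection \<open>Stable range\<close>

text \<open>Coquand's argument for Bass's stable range theorem; the rank bound \<open>p ^ n\<close> plays the role of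
  the Krull dimension, since passing to the boundary ideal \<open>J\<close> drops the rank by a factor \<open>p\<close>.\<close>

definition unimodular_mod :: "'a set \<Rightarrow> 'a set \<Rightarrow> bool" where
  "unimodular_mod I A \<longleftrightarrow> (\<forall>P. primeideal P R \<longrightarrow> I \<subseteq> P \<longrightarrow> \<not> A \<subseteq> P)"

lemma stable_range:
  assumes "ideal I R" and "\<And>P. primeideal P R \<Longrightarrow> I \<subseteq> P \<Longrightarrow> rk P < p ^ n"
    and "a \<in> carrier R" "b \<in> {..<n} \<rightarrow> carrier R"
    and "unimodular_mod I (insert a (b ` {..<n}))"
  shows "\<exists>x\<in>{..<n} \<rightarrow> carrier R. unimodular_mod I ((\<lambda>i. b i \<oplus> a \<otimes> x i) ` {..<n})"
  using assms
proof (induction n arbitrary: I)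
  case 0
  \<comment> \<open>Ranks are at least 1, so the bound \<open>p ^ 0\<close> leaves no prime over I,
    and even the empty family is unimodular modulo I.\<close>
  have "\<not> (primeideal P R \<and> I \<subseteq> P)" for P using rk_pos[of P] "0.prems"(2)[of P] by auto
  then show ?case unfolding unimodular_mod_def by auto
next
  case (Suc n)
  interpret I: ideal I R by (rule Suc.prems(1))
  have ac: "a \<in> carrier R" by (rule Suc.prems(3))
  have bc: "b i \<in> carrier R" if "i < Suc n" for i using Suc.prems(4) that by auto
  obtain PP where PP: "finite PP" "\<forall>P\<in>PP. primeideal P R \<and> I \<subseteq> P"
    "\<forall>x\<in>carrier R. (\<forall>P\<in>PP. x \<in> P) \<longrightarrow> (\<exists>n::nat. x [^] n \<in> I)"
    using exists_finite_primes[OF cring_axioms Suc.prems(1)] by (elim exE conjE)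
  \<comment> \<open>Y consists of the elements whose product with \<open>b n\<close> is nilpotent
    modulo I, described through the finitely many primes \<open>PP\<close> that cut out the radical
    of I.\<close>
  define Y where "Y = {y \<in> carrier R. \<forall>P\<in>{P \<in> PP. b n \<notin> P}. y \<in> P}"
  have bn: "b n \<in> carrier R" by (rule bc) simp
  have YI: "ideal Y R"
    unfolding Y_def
  proof (rule ideal_common)
    fix P assume "P \<in> {P \<in> PP. b n \<notin> P}"
    then have "primeideal P R" using PP(2) by simp
    then show "ideal P R" by (rule primeideal.axioms(1))
  qed
  interpret Y: ideal Y R by (rule YI)
  have bY: "b n \<otimes> y \<in> P" if "y \<in> Y" "primeideal P R" "I \<subseteq> P" for y P
  proof -
    interpret P: primeideal P R by (rule that)
    have yc: "y \<in> carrier R" using that(1) by simp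
    have "\<forall>P'\<in>PP. b n \<otimes> y \<in> P'"
    proof
      fix P' assume P': "P' \<in> PP"
      interpret P': primeideal P' R using PP(2) P' by blast
      show "b n \<otimes> y \<in> P'"
      proof (cases "b n \<in> P'")
        case True
        then show ?thesis using yc by (rule P'.I_r_closed)
      next
        case False
        then have "y \<in> P'" using that(1) P' unfolding Y_def by blast
        then show ?thesis using bn by (rule P'.I_l_closed)
      qed
    qed
    then have "\<exists>k::nat. (b n \<otimes> y) [^] k \<in> I" using bspec[OF PP(3) m_closed[OF bn yc]] by simp
    then obtain k :: nat where "(b n \<otimes> y) [^] k \<in> I" by (elim exE)
    then have "(b n \<otimes> y) [^] k \<in> P" using that(3) by blast
    then show ?thesis by (rule prime_pow[OF that(2) m_closed[OF bn yc]])
  qed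
  \<comment> \<open>The boundary ideal of \<open>b n\<close> over I: \<open>b n\<close> together
    with everything that it makes nilpotent modulo I.\<close>
  define J where "J = adjoin (I <+>\<^bsub>R\<^esub> Y) (b n)"
  have IY: "ideal (I <+>\<^bsub>R\<^esub> Y) R" by (rule add_ideals[OF Suc.prems(1) YI])
  note IYsub = set_add_ideal_superset[OF Suc.prems(1) YI]
  note J = adjoin_ideal[OF IY bn, folded J_def]
  have rkJ: "rk P < p ^ n" if P: "primeideal P R" "J \<subseteq> P" for P
  proof -
    interpret P: primeideal P R by (rule P)
    have IP: "I \<subseteq> P" and YP: "Y \<subseteq> P" and bP: "b n \<in> P" using that(2) J(2,3) IYsub by auto
    \<comment> \<open>P contains Y, the intersection of the finitely many members of
      \<open>PP\<close> avoiding \<open>b n\<close>, so it contains one of them by prime avoidance.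
      The inclusion is strict because \<open>b n\<close> is in P, and the rank drops by the factor
      p.\<close>
    have "\<exists>P0\<in>PP. b n \<notin> P0 \<and> P0 \<subseteq> P"
    proof (rule ccontr)
      assume no: "\<not> ?thesis"
      have "\<exists>s\<in>carrier R - P. \<forall>P'\<in>PP. b n \<notin> P' \<longrightarrow> s \<in> P'"
      proof (rule prime_finite_common_multiple[OF P(1) PP(1)])
        fix P' assume P': "P' \<in> PP"
        have P'c: "P' \<subseteq> carrier R"
          using bspec[OF PP(2) P'] by (intro additive_subgroup.a_subset ideal.axioms(1) primeideal.axioms(1)) simp
        show "\<exists>s\<in>carrier R - P. b n \<notin> P' \<longrightarrow> s \<in> P'"
        proof (cases "b n \<in> P'")
          case True
          then show ?thesis using one_notin_prime[OF P(1)] by blast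
        next
          case False
          then have "\<not> P' \<subseteq> P" using no P' by blast
          then show ?thesis using P'c by blast
        qed
        show "b n \<notin> P' \<longrightarrow> t \<otimes> s \<in> P'"
          if "s \<in> carrier R" "t \<in> carrier R" "b n \<notin> P' \<longrightarrow> s \<in> P'" for s t
        proof
          assume "b n \<notin> P'"
          then have "s \<in> P'" using that(3) by simp
          moreover have "primeideal P' R" using PP(2) P' by simp
          then have "ideal P' R" by (rule primeideal.axioms(1))
          ultimately show "t \<otimes> s \<in> P'" using that(2) by (intro ideal.I_l_closed)
        qed
      qed
      then obtain s where "s \<in> carrier R - P" "\<forall>P'\<in>PP. b n \<notin> P' \<longrightarrow> s \<in> P'" by blast
      then have "s \<in> Y" "s \<notin> P" unfolding Y_def by auto
      then show False using YP by blast
    qed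
    then obtain P0 where P0: "P0 \<in> PP" "b n \<notin> P0" "P0 \<subseteq> P" by blast
    have P0p: "primeideal P0 R" "I \<subseteq> P0" using PP(2) P0(1) by auto
    have "P0 \<subset> P" using P0 bP by blast
    then have "p * rk P \<le> rk P0" by (rule rank_drop[OF P0p(1) P(1)])
    also have "rk P0 < p ^ Suc n" by (rule Suc.prems(2)[OF P0p])
    finally show ?thesis using p_ge_2 by simp
  qed
  have "unimodular_mod J (insert a (b ` {..<n}))"
    unfolding unimodular_mod_def
  proof (intro allI impI notI)
    fix P assume P: "primeideal P R" "J \<subseteq> P" "insert a (b ` {..<n}) \<subseteq> P"
    have "insert a (b ` {..<Suc n}) \<subseteq> P" using P J(3) by (auto simp: lessThan_Suc)
    moreover have "I \<subseteq> P" using P(2) J(2) IYsub by blast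
    ultimately show False using Suc.prems(5) P(1) unfolding unimodular_mod_def by blast
  qed
  moreover have "b \<in> {..<n} \<rightarrow> carrier R" using bc by auto
  ultimately obtain x where x: "x \<in> {..<n} \<rightarrow> carrier R"
    "unimodular_mod J ((\<lambda>i. b i \<oplus> a \<otimes> x i) ` {..<n})"
    using Suc.IH[OF J(1) rkJ ac] by blast
  let ?c = "\<lambda>i. b i \<oplus> a \<otimes> x i"
  have xc: "x i \<in> carrier R" if "i < n" for i using x(1) that by auto
  have cc: "?c i \<in> carrier R" if "i < n" for i using xc[OF that] bc[of i] ac that by simp
  define C where "C = Idl (I \<union> (?c ` {..<n}))"
  have Cs: "I \<union> (?c ` {..<n}) \<subseteq> carrier R" using I.a_subset cc by auto
  have C: "ideal C R" "I \<union> (?c ` {..<n}) \<subseteq> C"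
    unfolding C_def by (rule genideal_ideal[OF Cs], rule genideal_self[OF Cs])
  \<comment> \<open>The induction hypothesis says that no prime contains J and the first n modified
    entries, so these generate the unit ideal. The Y-part of such an expression of 1 will be the
    last multiplier.\<close>
  have "\<exists>y\<in>Y. \<exists>r\<in>carrier R. \<exists>k\<in>C. \<one> = k \<oplus> y \<oplus> r \<otimes> b n"
  proof -
    define D where "D = adjoin (C <+>\<^bsub>R\<^esub> Y) (b n)"
    have CY: "ideal (C <+>\<^bsub>R\<^esub> Y) R" by (rule add_ideals[OF C(1) YI])
    interpret C: ideal C R by (rule C(1))
    note CYsub = set_add_ideal_superset[OF C(1) YI]
    note D = adjoin_ideal[OF CY bn, folded D_def]
    obtain QQ where QQ: "finite QQ" "\<forall>P\<in>QQ. primeideal P R \<and> D \<subseteq> P"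
      "\<forall>x\<in>carrier R. (\<forall>P\<in>QQ. x \<in> P) \<longrightarrow> (\<exists>n::nat. x [^] n \<in> D)"
      using exists_finite_primes[OF cring_axioms D(1)] by (elim exE conjE)
    have "\<forall>P\<in>QQ. \<one> \<in> P"
    proof (intro ballI, rule ccontr)
      fix P assume "P \<in> QQ"
      then have P: "primeideal P R" "D \<subseteq> P" using QQ(2) by auto
      interpret P: primeideal P R by (rule P(1))
      have "J \<subseteq> P"
      proof
        fix z assume "z \<in> J"
        then obtain i r where z: "z = i \<oplus> r \<otimes> b n" "i \<in> I <+>\<^bsub>R\<^esub> Y" "r \<in> carrier R"
          unfolding J_def by (rule adjoinE)
        obtain i' y where i: "i' \<in> I" "y \<in> Y" "i = i' \<oplus> y"
          using z(2) unfolding set_add_def set_mult_def by auto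
        have "i' \<in> P" "y \<in> P" "b n \<in> P" using i(1,2) P(2) D(2,3) CYsub C(2) by blast+
        then show "z \<in> P" unfolding z(1) i(3) using z(3) by (simp add: P.I_l_closed)
      qed
      moreover have "?c ` {..<n} \<subseteq> P" using P(2) D(2) CYsub(1) C(2) by blast
      ultimately show False using x(2) P(1) unfolding unimodular_mod_def by blast
    qed
    then have "\<exists>k::nat. \<one> [^] k \<in> D" using bspec[OF QQ(3) one_closed] by simp
    then have "\<one> \<in> D" by simp
    then obtain i r where z: "\<one> = i \<oplus> r \<otimes> b n" "i \<in> C <+>\<^bsub>R\<^esub> Y" "r \<in> carrier R"
      unfolding D_def by (rule adjoinE)
    obtain i' y where i: "i' \<in> C" "y \<in> Y" "i = i' \<oplus> y"
      using z(2) unfolding set_add_def set_mult_def by auto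
    show ?thesis using z i by (intro bexI[of _ y] bexI[of _ r] bexI[of _ i']) simp_all
  qed
  then obtain y r k where y: "y \<in> Y" "r \<in> carrier R" "k \<in> C" "\<one> = k \<oplus> y \<oplus> r \<otimes> b n" by (elim bexE)
  have yc: "y \<in> carrier R" using y(1) by simp
  define x' where "x' = x(n := y)"
  have x'c: "x' \<in> {..<Suc n} \<rightarrow> carrier R" using xc yc by (auto simp: x'_def less_Suc_eq)
  have "unimodular_mod I ((\<lambda>i. b i \<oplus> a \<otimes> x' i) ` {..<Suc n})"
    unfolding unimodular_mod_def
  proof (intro allI impI notI)
    fix P assume P: "primeideal P R" "I \<subseteq> P" and sub: "(\<lambda>i. b i \<oplus> a \<otimes> x' i) ` {..<Suc n} \<subseteq> P"
    interpret P: primeideal P R by (rule P(1))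
    have cP: "?c i \<in> P" if "i < n" for i
    proof -
      have "b i \<oplus> a \<otimes> x' i \<in> P" using sub that by auto
      then show ?thesis using that by (simp add: x'_def)
    qed
    have last: "b n \<oplus> a \<otimes> y \<in> P"
    proof -
      have "b n \<oplus> a \<otimes> x' n \<in> P" using sub by auto
      then show ?thesis by (simp add: x'_def)
    qed
    have "I \<union> (?c ` {..<n}) \<subseteq> P" using P(2) cP by auto
    then have "C \<subseteq> P" unfolding C_def by (rule genideal_minimal[OF P.ideal_axioms])
    then have kP: "k \<in> P" using y(3) by blast
    have byP: "b n \<otimes> y \<in> P" by (rule bY[OF y(1) P])
    \<comment> \<open>The product and the sum of \<open>b n\<close> and \<open>a \<otimes> y\<close>
      both lie in P up to a factor a, so each of \<open>b n\<close> and \<open>a \<otimes> y\<close>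
      lies in P. Then a in P contradicts the hypothesis on the original entries, and y in P makes
      the expression of 1 lie in P.\<close>
    have bP: "b n \<in> P"
    proof (rule ccontr)
      assume nb: "b n \<notin> P"
      then have yP: "y \<in> P" using P.I_prime[OF bn yc byP] by blast
      have "a \<otimes> y \<in> P" by (rule P.I_l_closed[OF yP ac])
      then show False using ideal_add_cancel[OF P.ideal_axioms bn _ last] nb by blast
    qed
    have "a \<otimes> y \<in> P"
      using ideal_add_cancel[OF P.ideal_axioms m_closed[OF ac yc] bP] last
        a_comm[OF bn m_closed[OF ac yc]] by simp
    then consider "a \<in> P" | "y \<in> P" using P.I_prime[OF ac yc] by blast
    then show False
    proof cases
      case 1
      have "b i \<in> P" if "i < n" for i
      proof (rule ideal_add_cancel[OF P.ideal_axioms bc _ cP[OF that]])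
        show "a \<otimes> x i \<in> P" using 1 xc[OF that] by (rule P.I_r_closed)
      qed (use that in simp)
      then have "insert a (b ` {..<Suc n}) \<subseteq> P" using 1 bP by (auto simp: less_Suc_eq)
      then show False using Suc.prems(5) P unfolding unimodular_mod_def by blast
    next
      case 2
      have "k \<oplus> y \<oplus> r \<otimes> b n \<in> P" using kP 2 P.I_l_closed[OF bP y(2)] by simp
      then have "\<one> \<in> P" using y(4) by (simp only:)
      then show False using one_notin_prime[OF P(1)] by blast
    qed
  qed
  then show ?case using x'c by (rule bexI)
qed

end

section \<open>Submodules of \<open>R^m\<close> and generators of the quotient\<close>

context cring
begin

definition vec :: "nat \<Rightarrow> (nat \<Rightarrow> 'a) set" where
  "vec m = {v. \<forall>i<m. v i \<in> carrier R}"

lemma vecD: "v \<in> vec m \<Longrightarrow> i < m \<Longrightarrow> v i \<in> carrier R"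
  by (simp add: vec_def)

text \<open>A vector of \<open>R^m\<close> is a function of which only the first \<open>m\<close> values matter.\<close>

definition vsub :: "nat \<Rightarrow> (nat \<Rightarrow> 'a) set \<Rightarrow> bool" where
  "vsub m W \<longleftrightarrow> W \<subseteq> vec m \<and> (\<lambda>_. \<zero>) \<in> W \<and>
     (\<forall>u\<in>W. \<forall>v\<in>W. (\<lambda>i. u i \<oplus> v i) \<in> W) \<and>
     (\<forall>r\<in>carrier R. \<forall>u\<in>W. (\<lambda>i. r \<otimes> u i) \<in> W) \<and>
     (\<forall>u\<in>W. \<forall>v. (\<forall>i<m. u i = v i) \<longrightarrow> v \<in> W)"

lemma vsubD:
  assumes "vsub m W"
  shows "u \<in> W \<Longrightarrow> u \<in> vec m" "(\<lambda>_. \<zero>) \<in> W"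
    "u \<in> W \<Longrightarrow> v \<in> W \<Longrightarrow> (\<lambda>i. u i \<oplus> v i) \<in> W"
    "r \<in> carrier R \<Longrightarrow> u \<in> W \<Longrightarrow> (\<lambda>i. r \<otimes> u i) \<in> W"
    "u \<in> W \<Longrightarrow> (\<And>i. i < m \<Longrightarrow> v i = u i) \<Longrightarrow> v \<in> W"
  using assms unfolding vsub_def by (simp_all add: subset_iff)

definition vext :: "nat \<Rightarrow> (nat \<Rightarrow> 'a) set \<Rightarrow> (nat \<Rightarrow> 'a) \<Rightarrow> (nat \<Rightarrow> 'a) set" where
  "vext m W w = {v. \<exists>u\<in>W. \<exists>a\<in>carrier R. \<forall>i<m. v i = u i \<oplus> a \<otimes> w i}"

lemma vextI: "u \<in> W \<Longrightarrow> a \<in> carrier R \<Longrightarrow> (\<And>i. i < m \<Longrightarrow> v i = u i \<oplus> a \<otimes> w i) \<Longrightarrow> v \<in> vext m W w"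
  unfolding vext_def by (intro CollectI bexI[of _ u] bexI[of _ a]) simp_all

lemma vextE:
  assumes "v \<in> vext m W w"
  obtains u a where "u \<in> W" "a \<in> carrier R" "\<And>i. i < m \<Longrightarrow> v i = u i \<oplus> a \<otimes> w i"
  using assms unfolding vext_def by (elim CollectE bexE) (rule that, simp_all)

lemma vsub_vext:
  assumes W: "vsub m W" and w: "w \<in> vec m"
  shows "vsub m (vext m W w)"
  unfolding vsub_def
proof (intro conjI ballI allI impI)
  note wc = vecD[OF w]
  have uc: "u i \<in> carrier R" if "u \<in> W" "i < m" for u i using vecD[OF vsubD(1)[OF W that(1)] that(2)] .
  show "vext m W w \<subseteq> vec m"
  proof
    fix v assume "v \<in> vext m W w"
    then obtain u a where "u \<in> W" "a \<in> carrier R" "\<And>i. i < m \<Longrightarrow> v i = u i \<oplus> a \<otimes> w i" by (rule vextE) (rule that, simp_all) 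
    then show "v \<in> vec m" using uc wc by (simp add: vec_def)
  qed
  show "(\<lambda>_. \<zero>) \<in> vext m W w"
    by (rule vextI[OF vsubD(2)[OF W] zero_closed]) (simp add: wc)
  fix v assume "v \<in> vext m W w"
  then obtain u a where u: "u \<in> W" "a \<in> carrier R" "\<And>i. i < m \<Longrightarrow> v i = u i \<oplus> a \<otimes> w i" by (rule vextE) (rule that, simp_all)
  {
    fix v' assume "v' \<in> vext m W w"
    then obtain u' a' where u': "u' \<in> W" "a' \<in> carrier R" "\<And>i. i < m \<Longrightarrow> v' i = u' i \<oplus> a' \<otimes> w i"
      by (rule vextE) (rule that, simp_all)
    show "(\<lambda>i. v i \<oplus> v' i) \<in> vext m W w"
      by (rule vextI[OF vsubD(3)[OF W u(1) u'(1)] a_closed[OF u(2) u'(2)]])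
        (use u(2) u'(2) in \<open>simp add: u(3) u'(3) uc[OF u(1)] uc[OF u'(1)] wc l_distr a_ac\<close>)
  next
    fix r assume r: "r \<in> carrier R"
    show "(\<lambda>i. r \<otimes> v i) \<in> vext m W w"
      by (rule vextI[OF vsubD(4)[OF W r u(1)] m_closed[OF r u(2)]])
        (use u(2) r in \<open>simp add: u(3) uc[OF u(1)] wc r_distr m_assoc\<close>)
  next
    fix v' assume "\<forall>i<m. v i = v' i"
    then show "v' \<in> vext m W w" by (intro vextI[OF u(1,2)]) (simp add: u(3)[symmetric])
  }
qed

lemma vext_base:
  assumes "vsub m W" "w \<in> vec m"
  shows "W \<subseteq> vext m W w"
proof
  fix u assume u: "u \<in> W"
  show "u \<in> vext m W w"
    by (rule vextI[OF u zero_closed]) (simp add: vecD[OF vsubD(1)[OF assms(1) u]] vecD[OF assms(2)])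
qed

lemma vext_self:
  assumes "vsub m W" "w \<in> vec m"
  shows "w \<in> vext m W w"
  by (rule vextI[OF vsubD(2)[OF assms(1)] one_closed]) (simp add: vecD[OF assms(2)])

text \<open>The quotient of \<open>R^m\<close> by W is generated by t elements. Adding the
  generators to W one by one fits the induction that removes them again in
  \<open>clear_generator\<close>.\<close>

primrec vgen :: "nat \<Rightarrow> (nat \<Rightarrow> 'a) set \<Rightarrow> nat \<Rightarrow> bool" where
  "vgen m W 0 \<longleftrightarrow> vec m \<subseteq> W"
| "vgen m W (Suc t) \<longleftrightarrow> (\<exists>w\<in>vec m. vgen m (vext m W w) t)"

lemma vext_mono: "W \<subseteq> W' \<Longrightarrow> vext m W w \<subseteq> vext m W' w"
  unfolding vext_def by blast

lemma vgen_mono: "vgen m W t \<Longrightarrow> W \<subseteq> W' \<Longrightarrow> vgen m W' t"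
proof (induction t arbitrary: W W')
  case 0
  then show ?case by simp
next
  case (Suc t)
  then obtain w where w: "w \<in> vec m" "vgen m (vext m W w) t" by (auto simp only: vgen.simps)
  have "vgen m (vext m W' w) t" by (rule Suc.IH[OF w(2) vext_mono[OF Suc.prems(2)]])
  then show ?case using w(1) by (simp only: vgen.simps) (rule bexI)
qed

text \<open>The generation hypothesis quantifies over the submodules containing W and S, so the span
  of W and S never has to be written out.\<close>

lemma vgen_finite:
  assumes "finite S" "S \<subseteq> vec m" "vsub m W"
    and "\<And>W'. vsub m W' \<Longrightarrow> W \<subseteq> W' \<Longrightarrow> S \<subseteq> W' \<Longrightarrow> vec m \<subseteq> W'"
  shows "vgen m W (card S)"
  using assms
proof (induction S arbitrary: W rule: finite_induct)
  case empty
  then show ?case by simp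
next
  case (insert w S)
  have w: "w \<in> vec m" using insert.prems(1) by simp
  have "vgen m (vext m W w) (card S)"
  proof (rule insert.IH)
    show "S \<subseteq> vec m" using insert.prems(1) by simp
    show "vsub m (vext m W w)" by (rule vsub_vext[OF insert.prems(2) w])
    fix W' assume W': "vsub m W'" "vext m W w \<subseteq> W'" "S \<subseteq> W'"
    have "w \<in> W'" using vext_self[OF insert.prems(2) w] W'(2) by (rule rev_subsetD)
    then show "vec m \<subseteq> W'"
      using insert.prems(3)[OF W'(1) subset_trans[OF vext_base[OF insert.prems(2) w] W'(2)]] W'(3) by simp
  qed
  then have "vgen m W (Suc (card S))" using w by (simp only: vgen.simps) (rule bexI)
  then show ?case using insert.hyps by simp
qed

definition vlin :: "nat \<Rightarrow> nat \<Rightarrow> ((nat \<Rightarrow> 'a) \<Rightarrow> nat \<Rightarrow> 'a) \<Rightarrow> bool" where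
  "vlin m n \<pi> \<longleftrightarrow> (\<forall>u\<in>vec m. \<pi> u \<in> vec n) \<and>
     (\<forall>u\<in>vec m. \<forall>v\<in>vec m. \<forall>j<n. \<pi> (\<lambda>i. u i \<oplus> v i) j = \<pi> u j \<oplus> \<pi> v j) \<and>
     (\<forall>r\<in>carrier R. \<forall>u\<in>vec m. \<forall>j<n. \<pi> (\<lambda>i. r \<otimes> u i) j = r \<otimes> \<pi> u j) \<and>
     (\<forall>u\<in>vec m. \<forall>v. (\<forall>i<m. v i = u i) \<longrightarrow> (\<forall>j<n. \<pi> v j = \<pi> u j))"

lemma vlinD:
  assumes "vlin m n \<pi>"
  shows "u \<in> vec m \<Longrightarrow> \<pi> u \<in> vec n"
    "u \<in> vec m \<Longrightarrow> v \<in> vec m \<Longrightarrow> j < n \<Longrightarrow> \<pi> (\<lambda>i. u i \<oplus> v i) j = \<pi> u j \<oplus> \<pi> v j"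
    "r \<in> carrier R \<Longrightarrow> u \<in> vec m \<Longrightarrow> j < n \<Longrightarrow> \<pi> (\<lambda>i. r \<otimes> u i) j = r \<otimes> \<pi> u j"
    "u \<in> vec m \<Longrightarrow> (\<And>i. i < m \<Longrightarrow> v i = u i) \<Longrightarrow> j < n \<Longrightarrow> \<pi> v j = \<pi> u j"
proof -
  note d = assms[unfolded vlin_def]
  show "u \<in> vec m \<Longrightarrow> \<pi> u \<in> vec n" by (rule conjunct1[OF d, rule_format])
  show "u \<in> vec m \<Longrightarrow> v \<in> vec m \<Longrightarrow> j < n \<Longrightarrow> \<pi> (\<lambda>i. u i \<oplus> v i) j = \<pi> u j \<oplus> \<pi> v j"
    by (rule conjunct1[OF conjunct2[OF d], rule_format])
  show "r \<in> carrier R \<Longrightarrow> u \<in> vec m \<Longrightarrow> j < n \<Longrightarrow> \<pi> (\<lambda>i. r \<otimes> u i) j = r \<otimes> \<pi> u j"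
    by (rule conjunct1[OF conjunct2[OF conjunct2[OF d]], rule_format])
  show "u \<in> vec m \<Longrightarrow> (\<And>i. i < m \<Longrightarrow> v i = u i) \<Longrightarrow> j < n \<Longrightarrow> \<pi> v j = \<pi> u j"
    by (rule conjunct2[OF conjunct2[OF conjunct2[OF d]], rule_format])
qed

lemma vec_add: "u \<in> vec m \<Longrightarrow> v \<in> vec m \<Longrightarrow> (\<lambda>i. u i \<oplus> v i) \<in> vec m"
  and vec_smult: "r \<in> carrier R \<Longrightarrow> u \<in> vec m \<Longrightarrow> (\<lambda>i. r \<otimes> u i) \<in> vec m"
  by (simp_all add: vec_def)

definition vimg :: "nat \<Rightarrow> ((nat \<Rightarrow> 'a) \<Rightarrow> nat \<Rightarrow> 'a) \<Rightarrow> (nat \<Rightarrow> 'a) set \<Rightarrow> (nat \<Rightarrow> 'a) set" where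
  "vimg n \<pi> W = {v. \<exists>u\<in>W. \<forall>j<n. v j = \<pi> u j}"

lemma vimgI: "u \<in> W \<Longrightarrow> (\<And>j. j < n \<Longrightarrow> v j = \<pi> u j) \<Longrightarrow> v \<in> vimg n \<pi> W"
  unfolding vimg_def by (intro CollectI bexI[of _ u]) simp_all

lemma vimgE:
  assumes "v \<in> vimg n \<pi> W" obtains u where "u \<in> W" "\<And>j. j < n \<Longrightarrow> v j = \<pi> u j"
  using assms unfolding vimg_def by (elim CollectE bexE) (rule that, simp_all)

lemma vsub_vimg:
  assumes W: "vsub m W" and \<pi>: "vlin m n \<pi>"
  shows "vsub n (vimg n \<pi> W)"
  unfolding vsub_def
proof (intro conjI ballI allI impI)
  note Wv = vsubD(1)[OF W]
  show "vimg n \<pi> W \<subseteq> vec n"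
  proof
    fix v assume "v \<in> vimg n \<pi> W"
    then obtain u where u: "u \<in> W" "\<And>j. j < n \<Longrightarrow> v j = \<pi> u j" by (rule vimgE) (rule that, simp_all)
    show "v \<in> vec n" using vecD[OF vlinD(1)[OF \<pi> Wv[OF u(1)]]] by (simp add: vec_def u(2))
  qed
  show "(\<lambda>_. \<zero>) \<in> vimg n \<pi> W"
  proof (rule vimgI[OF vsubD(2)[OF W]])
    fix j assume j: "j < n"
    have z: "(\<lambda>_. \<zero>) \<in> vec m" by (simp add: vec_def)
    have "\<pi> (\<lambda>i. \<zero> \<otimes> \<zero>) j = \<zero> \<otimes> \<pi> (\<lambda>_. \<zero>) j" by (rule vlinD(3)[OF \<pi> zero_closed z j])
    then show "\<zero> = \<pi> (\<lambda>_. \<zero>) j" using vecD[OF vlinD(1)[OF \<pi> z] j] by simp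
  qed
  fix v assume "v \<in> vimg n \<pi> W"
  then obtain u where u: "u \<in> W" "\<And>j. j < n \<Longrightarrow> v j = \<pi> u j" by (rule vimgE) (rule that, simp_all)
  {
    fix v' assume "v' \<in> vimg n \<pi> W"
    then obtain u' where u': "u' \<in> W" "\<And>j. j < n \<Longrightarrow> v' j = \<pi> u' j" by (rule vimgE) (rule that, simp_all)
    show "(\<lambda>i. v i \<oplus> v' i) \<in> vimg n \<pi> W"
      by (rule vimgI[OF vsubD(3)[OF W u(1) u'(1)]])
        (simp add: u(2) u'(2) vlinD(2)[OF \<pi> Wv[OF u(1)] Wv[OF u'(1)]])
  next
    fix r assume r: "r \<in> carrier R"
    show "(\<lambda>i. r \<otimes> v i) \<in> vimg n \<pi> W"
      by (rule vimgI[OF vsubD(4)[OF W r u(1)]]) (simp add: u(2) vlinD(3)[OF \<pi> r Wv[OF u(1)]])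
  next
    fix v' assume "\<forall>i<n. v i = v' i"
    then show "v' \<in> vimg n \<pi> W" by (intro vimgI[OF u(1)]) (simp add: u(2)[symmetric])
  }
qed

lemma vimg_vext:
  assumes W: "vsub m W" and w: "w \<in> vec m" and \<pi>: "vlin m n \<pi>"
  shows "vimg n \<pi> (vext m W w) \<subseteq> vext n (vimg n \<pi> W) (\<pi> w)"
proof
  fix v assume "v \<in> vimg n \<pi> (vext m W w)"
  then obtain x where x: "x \<in> vext m W w" "\<And>j. j < n \<Longrightarrow> v j = \<pi> x j" by (rule vimgE) (rule that, simp_all)
  obtain u a where u: "u \<in> W" "a \<in> carrier R" "\<And>i. i < m \<Longrightarrow> x i = u i \<oplus> a \<otimes> w i"
    using x(1) by (rule vextE) (rule that, simp_all)
  have uv: "u \<in> vec m" by (rule vsubD(1)[OF W u(1)])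
  have aw: "(\<lambda>i. a \<otimes> w i) \<in> vec m" by (rule vec_smult[OF u(2) w])
  show "v \<in> vext n (vimg n \<pi> W) (\<pi> w)"
  proof (rule vextI[OF _ u(2)])
    show "\<pi> u \<in> vimg n \<pi> W" by (rule vimgI[OF u(1)]) (rule refl)
    fix j assume j: "j < n"
    have "\<pi> x j = \<pi> (\<lambda>i. u i \<oplus> a \<otimes> w i) j"
      by (rule vlinD(4)[OF \<pi> vec_add[OF uv aw] _ j]) (rule u(3))
    also have "\<dots> = \<pi> u j \<oplus> a \<otimes> \<pi> w j"
      using vlinD(2)[OF \<pi> uv aw j] vlinD(3)[OF \<pi> u(2) w j] by (simp only:)
    finally show "v j = \<pi> u j \<oplus> a \<otimes> \<pi> w j" using x(2)[OF j] by (simp only:)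
  qed
qed

definition vrel :: "nat \<Rightarrow> (nat \<Rightarrow> 'a) set \<Rightarrow> (nat \<Rightarrow> 'a) \<Rightarrow> (nat \<Rightarrow> 'a) \<Rightarrow> 'a \<Rightarrow> bool" where
  "vrel m W w v a \<longleftrightarrow> a \<in> carrier R \<and> (\<exists>u\<in>W. \<forall>i<m. v i = u i \<oplus> a \<otimes> w i)"

lemma vrelI: "a \<in> carrier R \<Longrightarrow> u \<in> W \<Longrightarrow> (\<And>i. i < m \<Longrightarrow> v i = u i \<oplus> a \<otimes> w i) \<Longrightarrow> vrel m W w v a"
  unfolding vrel_def by (intro conjI bexI[of _ u]) simp_all

lemma vrelE:
  assumes "vrel m W w v a"
  obtains u where "a \<in> carrier R" "u \<in> W" "\<And>i. i < m \<Longrightarrow> v i = u i \<oplus> a \<otimes> w i"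
  using assms unfolding vrel_def by (elim conjE bexE) (rule that, simp_all)

lemma vrel_linear:
  assumes W: "vsub m W" and w: "w \<in> vec m"
    and c: "c \<in> carrier R" and v: "vrel m W w v a" and v': "vrel m W w v' a'"
    and eq: "\<And>i. i < m \<Longrightarrow> x i = c \<otimes> v i \<oplus> v' i"
  shows "vrel m W w x (c \<otimes> a \<oplus> a')"
proof -
  obtain u where u: "a \<in> carrier R" "u \<in> W" "\<And>i. i < m \<Longrightarrow> v i = u i \<oplus> a \<otimes> w i" using v by (rule vrelE) (rule that, simp_all)
  obtain u' where u': "a' \<in> carrier R" "u' \<in> W" "\<And>i. i < m \<Longrightarrow> v' i = u' i \<oplus> a' \<otimes> w i" using v' by (rule vrelE) (rule that, simp_all)
  note uc = vecD[OF vsubD(1)[OF W u(2)]] and u'c = vecD[OF vsubD(1)[OF W u'(2)]] and wc = vecD[OF w]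
  show ?thesis
  proof (rule vrelI)
    show "(\<lambda>i. c \<otimes> u i \<oplus> u' i) \<in> W"
      by (rule vsubD(3)[OF W vsubD(4)[OF W c u(2)] u'(2)])
    show "x i = c \<otimes> u i \<oplus> u' i \<oplus> (c \<otimes> a \<oplus> a') \<otimes> w i" if i: "i < m" for i
      using c u(1) u'(1) uc[OF i] u'c[OF i] wc[OF i]
      by (simp add: eq[OF i] u(3)[OF i] u'(3)[OF i] r_distr l_distr a_ac m_ac)
  qed (use c u(1) u'(1) in simp)
qed

lemma vrel_zero:
  assumes W: "vsub m W" and w: "w \<in> vec m"
  shows "vrel m W w (\<lambda>_. \<zero>) \<zero>"
  by (rule vrelI[OF zero_closed vsubD(2)[OF W]]) (simp add: vecD[OF w])

lemma vrel_finsum: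
  assumes W: "vsub m W" and w: "w \<in> vec m"
    and A: "finite A" "\<And>k. k \<in> A \<Longrightarrow> c k \<in> carrier R" "\<And>k. k \<in> A \<Longrightarrow> vrel m W w (v k) (a k)"
    "\<And>k. k \<in> A \<Longrightarrow> v k \<in> vec m"
  shows "vrel m W w (\<lambda>i. \<Oplus>k\<in>A. c k \<otimes> v k i) (\<Oplus>k\<in>A. c k \<otimes> a k)"
  using A
proof (induction A rule: finite_induct)
  case empty
  show ?case using vrel_zero[OF W w] by simp
next
  case (insert k A)
  have ac: "a l \<in> carrier R" if "l \<in> insert k A" for l using insert.prems(2)[OF that] by (rule vrelE)
  have IH: "vrel m W w (\<lambda>i. \<Oplus>k\<in>A. c k \<otimes> v k i) (\<Oplus>k\<in>A. c k \<otimes> a k)"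
    by (rule insert.IH) (use insert.prems in simp_all)
  have "(\<Oplus>k\<in>insert k A. c k \<otimes> a k) = c k \<otimes> a k \<oplus> (\<Oplus>k\<in>A. c k \<otimes> a k)"
    using insert ac by (intro finsum_insert) simp_all
  moreover have "vrel m W w (\<lambda>i. \<Oplus>k\<in>insert k A. c k \<otimes> v k i) (c k \<otimes> a k \<oplus> (\<Oplus>k\<in>A. c k \<otimes> a k))"
  proof (rule vrel_linear[OF W w _ _ IH])
    show "c k \<in> carrier R" "vrel m W w (v k) (a k)" using insert.prems by simp_all
    fix i assume i: "i < m"
    show "(\<Oplus>k\<in>insert k A. c k \<otimes> v k i) = c k \<otimes> v k i \<oplus> (\<Oplus>k\<in>A. c k \<otimes> v k i)"
      using insert vecD[OF insert.prems(3) i] by (intro finsum_insert) simp_all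
  qed
  ultimately show ?case by simp
qed

lemma finsum_unit_vectors:
  assumes v: "v \<in> vec m" and i: "i < m"
  shows "(\<Oplus>k\<in>{..<m}. v k \<otimes> (if i = k then \<one> else \<zero>)) = v i"
proof -
  have "(\<Oplus>k\<in>{..<m}. v k \<otimes> (if i = k then \<one> else \<zero>)) = (\<Oplus>k\<in>{..<m}. if i = k then v k else \<zero>)"
    by (rule add.finprod_cong') (use vecD[OF v] in simp_all)
  also have "\<dots> = v i" by (rule add.finprod_singleton) (use vecD[OF v] i in simp_all)
  finally show ?thesis .
qed

lemma ideal_linear_combinations:
  assumes I: "ideal I R" and c: "\<And>j. j < n \<Longrightarrow> c j \<in> carrier R"
  shows "ideal {i \<oplus> (\<Oplus>j\<in>{..<n::nat}. y j \<otimes> c j) | i y. i \<in> I \<and> y \<in> vec n} R" (is "ideal ?K R")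
proof -
  interpret ideal I R by (rule I)
  have sc: "(\<Oplus>j\<in>{..<n}. y j \<otimes> c j) \<in> carrier R" if "y \<in> vec n" for y
    using vecD[OF that] c by (intro finsum_closed) simp
  show ?thesis
  proof (rule idealI_cring)
    show "?K \<subseteq> carrier R" using sc by (intro subsetI) (elim CollectE exE conjE, simp)
    have z: "(\<lambda>_. \<zero>) \<in> vec n" by (simp add: vec_def)
    have "(\<Oplus>j\<in>{..<n}. \<zero> \<otimes> c j) = (\<Oplus>j\<in>{..<n}. \<zero>)"
      by (rule add.finprod_cong') (use c in simp_all)
    then have "\<zero> = \<zero> \<oplus> (\<Oplus>j\<in>{..<n}. \<zero> \<otimes> c j)" by simp
    then show "\<zero> \<in> ?K" using z zero_closed by (intro CollectI exI conjI)
  next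
    fix s t assume "s \<in> ?K" "t \<in> ?K"
    then obtain i y j x where s: "s = i \<oplus> (\<Oplus>j\<in>{..<n}. y j \<otimes> c j)" "i \<in> I" "y \<in> vec n"
      and t: "t = j \<oplus> (\<Oplus>j\<in>{..<n}. x j \<otimes> c j)" "j \<in> I" "x \<in> vec n" by (elim CollectE exE conjE)
    have "(\<Oplus>j\<in>{..<n}. (y j \<oplus> x j) \<otimes> c j) = (\<Oplus>j\<in>{..<n}. y j \<otimes> c j \<oplus> x j \<otimes> c j)"
      by (rule add.finprod_cong') (use vecD[OF s(3)] vecD[OF t(3)] c in \<open>simp_all add: l_distr\<close>)
    also have "\<dots> = (\<Oplus>j\<in>{..<n}. y j \<otimes> c j) \<oplus> (\<Oplus>j\<in>{..<n}. x j \<otimes> c j)"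
      by (rule finsum_addf) (use vecD[OF s(3)] vecD[OF t(3)] c in simp_all)
    finally have "s \<oplus> t = (i \<oplus> j) \<oplus> (\<Oplus>j\<in>{..<n}. (y j \<oplus> x j) \<otimes> c j)"
      unfolding s(1) t(1) using s(2) t(2) sc[OF s(3)] sc[OF t(3)] by (simp add: a_ac)
    then show "s \<oplus> t \<in> ?K"
      using a_closed[OF s(2) t(2)] vec_add[OF s(3) t(3)] by (intro CollectI exI conjI)
  next
    fix r s assume r: "r \<in> carrier R" and "s \<in> ?K"
    then obtain i y where s: "s = i \<oplus> (\<Oplus>j\<in>{..<n}. y j \<otimes> c j)" "i \<in> I" "y \<in> vec n"
      by (elim CollectE exE conjE)
    have "r \<otimes> (\<Oplus>j\<in>{..<n}. y j \<otimes> c j) = (\<Oplus>j\<in>{..<n}. r \<otimes> (y j \<otimes> c j))"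
      by (rule finsum_rdistr) (use vecD[OF s(3)] c r in simp_all)
    also have "\<dots> = (\<Oplus>j\<in>{..<n}. (r \<otimes> y j) \<otimes> c j)"
      by (rule add.finprod_cong') (use vecD[OF s(3)] c r in \<open>simp_all add: m_assoc\<close>)
    finally have "r \<otimes> s = r \<otimes> i \<oplus> (\<Oplus>j\<in>{..<n}. (r \<otimes> y j) \<otimes> c j)"
      unfolding s(1) using r s(2) sc[OF s(3)] by (simp add: r_distr)
    then show "r \<otimes> s \<in> ?K"
      using I_l_closed[OF s(2) r] vec_smult[OF r s(3)] by (intro CollectI exI conjI)
  qed
qed

end

text \<open>Converts the condition on primes into an equation. The combinations form an ideal
  contained in no prime, so the finite family of primes cutting out its radical must be empty and a
  power of 1 lies in the ideal.\<close>

lemma (in F_finite_ring) unimodular_mod_coeffs: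
  assumes I: "ideal I R" and c: "\<And>j. j < n \<Longrightarrow> c j \<in> carrier R"
    and um: "unimodular_mod I (c ` {..<n})"
  shows "\<exists>i\<in>I. \<exists>y\<in>vec n. \<one> = i \<oplus> (\<Oplus>j\<in>{..<n}. y j \<otimes> c j)"
proof -
  interpret ideal I R by (rule I)
  let ?K = "{i \<oplus> (\<Oplus>j\<in>{..<n}. y j \<otimes> c j) | i y. i \<in> I \<and> y \<in> vec n}"
  have K: "ideal ?K R" by (rule ideal_linear_combinations[OF I c])
  have IK: "x \<in> ?K" if "x \<in> I" for x
  proof -
    have "(\<Oplus>j\<in>{..<n}. \<zero> \<otimes> c j) = (\<Oplus>j\<in>{..<n}. \<zero>)"
      by (rule add.finprod_cong') (use c in simp_all)
    then have "x = x \<oplus> (\<Oplus>j\<in>{..<n}. \<zero> \<otimes> c j)" using that by simp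
    moreover have "(\<lambda>_. \<zero>) \<in> vec n" by (simp add: vec_def)
    ultimately show ?thesis using that by (intro CollectI exI conjI)
  qed
  have cK: "c j \<in> ?K" if "j < n" for j
  proof -
    have "(\<Oplus>k\<in>{..<n}. (if j = k then \<one> else \<zero>) \<otimes> c k)
        = (\<Oplus>k\<in>{..<n}. c k \<otimes> (if j = k then \<one> else \<zero>))"
      by (rule add.finprod_cong') (use c in simp_all)
    also have "\<dots> = c j" by (rule finsum_unit_vectors[OF _ that]) (use c in \<open>simp add: vec_def\<close>)
    finally have "c j = \<zero> \<oplus> (\<Oplus>k\<in>{..<n}. (if j = k then \<one> else \<zero>) \<otimes> c k)" using c[OF that] by simp
    moreover have "(\<lambda>k. if j = k then \<one> else \<zero>) \<in> vec n" by (simp add: vec_def)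
    ultimately show ?thesis using zero_closed by (intro CollectI exI conjI)
  qed
  obtain QQ where QQ: "\<forall>P\<in>QQ. primeideal P R \<and> ?K \<subseteq> P"
    "\<forall>x\<in>carrier R. (\<forall>P\<in>QQ. x \<in> P) \<longrightarrow> (\<exists>n::nat. x [^] n \<in> ?K)"
    using exists_finite_primes[OF cring_axioms K] by (elim exE conjE)
  have "\<forall>P\<in>QQ. \<one> \<in> P"
  proof (intro ballI, rule ccontr)
    fix P assume P: "P \<in> QQ"
    have sub: "?K \<subseteq> P" using QQ(1) P by simp
    have "I \<subseteq> P" by (rule subsetI, rule subsetD[OF sub IK])
    moreover have "c ` {..<n} \<subseteq> P" by (rule image_subsetI, rule subsetD[OF sub cK]) simp
    ultimately show False using um QQ(1) P unfolding unimodular_mod_def by simp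
  qed
  then have "\<exists>n::nat. \<one> [^] n \<in> ?K" using bspec[OF QQ(2) one_closed] by simp
  then have "\<one> \<in> ?K" by simp
  then show ?thesis by (elim CollectE exE conjE) (intro bexI)
qed

section \<open>Clearing generators of a cokernel\<close>

context F_finite_ring
begin

text \<open>Write \<open>e\<^sub>i \<equiv> a\<^sub>i w\<close> modulo \<open>W\<close>.  After an elementary change of basis some vector
  \<open>\<epsilon> = e\<^sub>n + \<Sum> z\<^sub>i (e\<^sub>i + x\<^sub>i e\<^sub>n)\<close> is congruent to \<open>w\<close>, and \<open>\<pi>\<close> is the projection along \<open>\<epsilon>\<close>.\<close>

lemma clear_one_generator:
  assumes W: "vsub (Suc n) W" and w: "w \<in> vec (Suc n)" and gen: "vec (Suc n) \<subseteq> vext (Suc n) W w"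
    and rk: "\<And>P. primeideal P R \<Longrightarrow> rk P < p ^ n"
  shows "\<exists>\<pi>. vlin (Suc n) n \<pi> \<and> vec n \<subseteq> vimg n \<pi> W"
proof -
  let ?m = "Suc n"
  note wc = vecD[OF w]
  have rel: "\<exists>a. vrel ?m W w v a" if "v \<in> vec ?m" for v
  proof -
    have "v \<in> vext ?m W w" by (rule subsetD[OF gen that])
    then obtain u a where "u \<in> W" "a \<in> carrier R" "\<And>i. i < ?m \<Longrightarrow> v i = u i \<oplus> a \<otimes> w i"
      by (rule vextE) (rule that, simp_all)
    then have "vrel ?m W w v a" by (intro vrelI)
    then show ?thesis by (rule exI)
  qed
  let ?e = "\<lambda>k i. if i = k then \<one> else \<zero>"
  have ev: "?e k \<in> vec ?m" for k by (simp add: vec_def)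
  have "\<forall>k::nat. \<exists>a. vrel ?m W w (?e k) a" using rel[OF ev] by (intro allI)
  from choice[OF this] obtain a where "\<forall>k. vrel ?m W w (?e k) (a k)" by (elim exE)
  then have a: "vrel ?m W w (?e k) (a k)" for k by (rule spec)
  have ac: "a k \<in> carrier R" for k using a[of k] unfolding vrel_def by (rule conjunct1)
  have rel_vec: "vrel ?m W w v (\<Oplus>k\<in>{..<?m}. v k \<otimes> a k)" if v: "v \<in> vec ?m" for v
  proof -
    have "vrel ?m W w (\<lambda>i. \<Oplus>k\<in>{..<?m}. v k \<otimes> ?e k i) (\<Oplus>k\<in>{..<?m}. v k \<otimes> a k)"
      by (rule vrel_finsum[OF W w finite_lessThan _ a ev]) (simp add: vecD[OF v])
    then obtain u where u: "(\<Oplus>k\<in>{..<?m}. v k \<otimes> a k) \<in> carrier R" "u \<in> W"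
      "\<And>i. i < ?m \<Longrightarrow> (\<Oplus>k\<in>{..<?m}. v k \<otimes> ?e k i) = u i \<oplus> (\<Oplus>k\<in>{..<?m}. v k \<otimes> a k) \<otimes> w i"
      by (rule vrelE) (rule that, simp_all only:)
    show ?thesis
      by (rule vrelI[OF u(1,2)]) (simp only: u(3)[symmetric] finsum_unit_vectors[OF v])
  qed
  \<comment> \<open>The annihilator of w modulo W. The quotient by W is cyclic with generator w, so
    the coefficients of w are well defined exactly modulo I.\<close>
  define I where "I = {c \<in> carrier R. (\<lambda>i. c \<otimes> w i) \<in> W}"
  have I: "ideal I R"
  proof (rule idealI_cring)
    show "\<zero> \<in> I" unfolding I_def
      using vsubD(5)[OF W vsubD(2)[OF W], of "\<lambda>i. \<zero> \<otimes> w i"] wc by simp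
    show "x \<oplus> y \<in> I" if "x \<in> I" "y \<in> I" for x y
    proof -
      have c: "x \<in> carrier R" "y \<in> carrier R" "(\<lambda>i. x \<otimes> w i) \<in> W" "(\<lambda>i. y \<otimes> w i) \<in> W"
        using that by (simp_all add: I_def)
      have "(\<lambda>i. (x \<oplus> y) \<otimes> w i) \<in> W"
        by (rule vsubD(5)[OF W vsubD(3)[OF W c(3,4)]]) (simp add: c wc l_distr)
      then show ?thesis using c by (simp add: I_def)
    qed
    show "r \<otimes> x \<in> I" if "r \<in> carrier R" "x \<in> I" for r x
    proof -
      have c: "x \<in> carrier R" "(\<lambda>i. x \<otimes> w i) \<in> W" using that by (simp_all add: I_def)
      have "(\<lambda>i. (r \<otimes> x) \<otimes> w i) \<in> W"
        by (rule vsubD(5)[OF W vsubD(4)[OF W that(1) c(2)]]) (simp add: c that wc m_assoc)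
      then show ?thesis using c that by (simp add: I_def)
    qed
  qed (auto simp: I_def)
  interpret I: ideal I R by (rule I)
  have rel_unique: "c \<ominus> d \<in> I" if c: "vrel ?m W w v c" and d: "vrel ?m W w v d" for v c d
  proof -
    have "vrel ?m W w (\<lambda>i. \<ominus> \<one> \<otimes> v i \<oplus> v i) (\<ominus> \<one> \<otimes> c \<oplus> d)"
      by (rule vrel_linear[OF W w _ c d]) simp_all
    then obtain u where u: "u \<in> W" "\<And>i. i < ?m \<Longrightarrow> \<ominus> \<one> \<otimes> v i \<oplus> v i = u i \<oplus> (\<ominus> \<one> \<otimes> c \<oplus> d) \<otimes> w i"
      by (rule vrelE) (rule that, simp_all only:)
    have cc: "c \<in> carrier R" "d \<in> carrier R" using c d by (simp_all add: vrel_def)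
    obtain u1 where u1: "u1 \<in> W" "\<And>i. i < ?m \<Longrightarrow> v i = u1 i \<oplus> c \<otimes> w i"
      using c by (rule vrelE) (rule that, simp_all)
    have "(\<lambda>i. (c \<ominus> d) \<otimes> w i) \<in> W"
    proof (rule vsubD(5)[OF W u(1)])
      fix i assume i: "i < ?m"
      have uc: "u i \<in> carrier R" "u1 i \<in> carrier R" "w i \<in> carrier R"
        using vecD[OF vsubD(1)[OF W u(1)] i] vecD[OF vsubD(1)[OF W u1(1)] i] wc[OF i] by simp_all
      have vc: "v i \<in> carrier R" using u1(2)[OF i] uc cc by simp
      have "u i \<oplus> (\<ominus> \<one> \<otimes> c \<oplus> d) \<otimes> w i = \<zero>"
        using u(2)[OF i] vc by (simp add: l_minus l_neg)
      then have "u i = \<ominus> ((\<ominus> \<one> \<otimes> c \<oplus> d) \<otimes> w i)"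
        using uc cc by (intro sum_zero_eq_neg) simp_all
      moreover have "c \<ominus> d = \<ominus> (\<ominus> \<one> \<otimes> c \<oplus> d)"
        using cc by (simp add: a_minus_def l_minus minus_add)
      then have "(c \<ominus> d) \<otimes> w i = \<ominus> ((\<ominus> \<one> \<otimes> c \<oplus> d) \<otimes> w i)"
        using cc uc l_minus[of "\<ominus> \<one> \<otimes> c \<oplus> d" "w i"] by (simp only: a_closed m_closed a_inv_closed one_closed)
      ultimately show "(c \<ominus> d) \<otimes> w i = u i" by (simp only:)
    qed
    then show ?thesis unfolding I_def using cc by (intro CollectI conjI minus_closed)
  qed
  have one_rel: "vrel ?m W w w \<one>"
    by (rule vrelI[OF one_closed vsubD(2)[OF W]]) (simp add: wc)
  \<comment> \<open>Expanding w in unit vectors expresses it as \<Sum> w_k a_k times w modulo W, so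
    1 - \<Sum> w_k a_k annihilates w.\<close>
  have um: "unimodular_mod I (insert (a n) (a ` {..<n}))"
    unfolding unimodular_mod_def
  proof (intro allI impI notI)
    fix P assume P: "primeideal P R" "I \<subseteq> P" and sub: "insert (a n) (a ` {..<n}) \<subseteq> P"
    interpret P: primeideal P R by (rule P(1))
    have aP: "a k \<in> P" if "k < ?m" for k using sub that by (auto simp: less_Suc_eq)
    have "(\<Oplus>k\<in>{..<?m}. w k \<otimes> a k) \<in> P"
      by (rule ideal_finsum[OF P.ideal_axioms]) (use aP wc P.I_l_closed in simp_all)
    moreover have "\<one> \<ominus> (\<Oplus>k\<in>{..<?m}. w k \<otimes> a k) \<in> P"
      by (rule subsetD[OF P(2) rel_unique[OF one_rel rel_vec[OF w]]])
    ultimately have "(\<one> \<ominus> (\<Oplus>k\<in>{..<?m}. w k \<otimes> a k)) \<oplus> (\<Oplus>k\<in>{..<?m}. w k \<otimes> a k) \<in> P"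
      by (intro P.a_closed)
    moreover have "(\<Oplus>k\<in>{..<?m}. w k \<otimes> a k) \<in> carrier R" using wc ac by (intro finsum_closed) simp
    ultimately have "\<one> \<in> P" by (simp add: a_minus_def a_assoc l_neg)
    then show False using one_notin_prime[OF P(1)] by simp
  qed
  \<comment> \<open>Replacing e_i by e_i + x_i e_n for i < n changes its coefficient to a_i + a_n
    x_i; the stable range theorem makes the first n coefficients unimodular on their own.\<close>
  have "\<exists>x\<in>{..<n} \<rightarrow> carrier R. unimodular_mod I ((\<lambda>i. a i \<oplus> a n \<otimes> x i) ` {..<n})"
  proof (rule stable_range[OF I _ ac[of n] _ um])
    show "rk P < p ^ n" if "primeideal P R" for P by (rule rk[OF that])
    show "a \<in> {..<n} \<rightarrow> carrier R" using ac by simp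
  qed
  then obtain x where x: "x \<in> {..<n} \<rightarrow> carrier R"
    "unimodular_mod I ((\<lambda>i. a i \<oplus> a n \<otimes> x i) ` {..<n})"
    by (elim bexE)
  have xc: "x i \<in> carrier R" if "i < n" for i by (rule funcset_mem[OF x(1)]) (use that in simp)
  have "\<exists>i\<in>I. \<exists>y\<in>vec n. \<one> = i \<oplus> (\<Oplus>j\<in>{..<n}. y j \<otimes> (a j \<oplus> a n \<otimes> x j))"
    by (rule unimodular_mod_coeffs[OF I _ x(2)]) (simp add: ac xc)
  then obtain \<iota> y where y: "\<iota> \<in> I" "y \<in> vec n" "\<one> = \<iota> \<oplus> (\<Oplus>j\<in>{..<n}. y j \<otimes> (a j \<oplus> a n \<otimes> x j))"
    by (elim bexE)
  have yc: "y j \<in> carrier R" if "j < n" for j by (rule vecD[OF y(2) that])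
  \<comment> \<open>The y_j combine the new coefficients to 1 modulo I, so scaling them by 1 - a_n
    gives \<epsilon> the coefficient a_n + (1 - a_n) = 1 modulo I.\<close>
  define z where "z j = y j \<otimes> (\<one> \<ominus> a n)" for j
  have zc: "z j \<in> carrier R" if "j < n" for j using yc[OF that] ac by (simp add: z_def)
  define s where "s v = (\<Oplus>i\<in>{..<n}. x i \<otimes> v i)" for v
  have sc: "s v \<in> carrier R" if "v \<in> vec ?m" for v
    unfolding s_def using xc vecD[OF that] by (intro finsum_closed) simp
  have s_add: "s (\<lambda>i. u i \<oplus> v i) = s u \<oplus> s v" if "u \<in> vec ?m" "v \<in> vec ?m" for u v
  proof -
    have "s (\<lambda>i. u i \<oplus> v i) = (\<Oplus>i\<in>{..<n}. x i \<otimes> u i \<oplus> x i \<otimes> v i)"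
      unfolding s_def by (rule add.finprod_cong') (use xc vecD[OF that(1)] vecD[OF that(2)] in \<open>simp_all add: r_distr\<close>)
    also have "\<dots> = s u \<oplus> s v"
      unfolding s_def by (rule finsum_addf) (use xc vecD[OF that(1)] vecD[OF that(2)] in simp_all)
    finally show ?thesis .
  qed
  have s_smult: "s (\<lambda>i. r \<otimes> v i) = r \<otimes> s v" if "r \<in> carrier R" "v \<in> vec ?m" for r v
  proof -
    have "r \<otimes> s v = (\<Oplus>i\<in>{..<n}. r \<otimes> (x i \<otimes> v i))"
      unfolding s_def by (rule finsum_rdistr) (use xc that(1) vecD[OF that(2)] in simp_all)
    also have "\<dots> = s (\<lambda>i. r \<otimes> v i)"
      unfolding s_def by (rule add.finprod_cong') (use xc that(1) vecD[OF that(2)] in \<open>simp_all add: m_lcomm\<close>)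
    finally show ?thesis by (rule sym)
  qed
  have s_cong: "s v = s u" if "u \<in> vec ?m" "\<And>i. i < ?m \<Longrightarrow> v i = u i" for u v
    unfolding s_def by (rule add.finprod_cong') (use xc vecD[OF that(1)] that(2) in simp_all)
  \<comment> \<open>In the basis of the vectors e_i + x_i e_n and e_n, the coordinates of v are v_i
    and v_n - s(v). Subtracting (v_n - s(v)) \<epsilon> removes the last one, and the first n
    coordinates of the result are \<pi>(v).\<close>
  define \<pi> where "\<pi> v j = v j \<oplus> z j \<otimes> (s v \<ominus> v n)" for v j
  have lin: "vlin ?m n \<pi>"
    unfolding vlin_def
  proof (intro conjI ballI allI impI)
    fix u assume u: "u \<in> vec ?m"
    have un: "u n \<in> carrier R" using vecD[OF u] by simp
    have uj: "u j \<in> carrier R" if "j < n" for j using vecD[OF u] that by simp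
    show "\<pi> u \<in> vec n" using sc[OF u] un uj zc by (simp add: vec_def \<pi>_def)
    {
      fix v j assume v: "v \<in> vec ?m" and j: "j < n"
      have vn: "v n \<in> carrier R" "v j \<in> carrier R" using vecD[OF v] j by simp_all
      show "\<pi> (\<lambda>i. u i \<oplus> v i) j = \<pi> u j \<oplus> \<pi> v j"
        unfolding \<pi>_def s_add[OF u v]
        using sc[OF u] sc[OF v] un uj[OF j] vn zc[OF j]
        by (simp add: a_minus_def minus_add r_distr a_ac)
    next
      fix r j assume r: "r \<in> carrier R" and j: "j < n"
      show "\<pi> (\<lambda>i. r \<otimes> u i) j = r \<otimes> \<pi> u j"
        unfolding \<pi>_def s_smult[OF r u]
        using sc[OF u] un uj[OF j] zc[OF j] r
        by (simp add: a_minus_def r_distr r_minus m_ac)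
    next
      fix v j assume eq: "\<forall>i<?m. v i = u i" and j: "j < n"
      have "s v = s u" by (rule s_cong[OF u]) (use eq in simp)
      then show "\<pi> v j = \<pi> u j" unfolding \<pi>_def using eq j by simp
    }
  qed
  define \<epsilon> where "\<epsilon> i = (if i < n then z i else \<one> \<oplus> (\<Oplus>j\<in>{..<n}. x j \<otimes> z j))" for i
  have xz: "(\<Oplus>j\<in>{..<n}. x j \<otimes> z j) \<in> carrier R" using xc zc by (intro finsum_closed) simp
  have \<epsilon>v: "\<epsilon> \<in> vec ?m" using zc xz by (simp add: vec_def \<epsilon>_def)
  have s\<epsilon>: "s \<epsilon> = (\<Oplus>j\<in>{..<n}. x j \<otimes> z j)"
    unfolding s_def by (rule add.finprod_cong') (use xc zc in \<open>simp_all add: \<epsilon>_def\<close>)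
  have \<pi>\<epsilon>: "\<pi> \<epsilon> j = \<zero>" if "j < n" for j
  proof -
    have "s \<epsilon> \<ominus> \<epsilon> n = \<ominus> \<one>"
      unfolding s\<epsilon> using xz by (simp add: \<epsilon>_def a_minus_def minus_add r_neg r_neg2 a_lcomm)
    then show ?thesis unfolding \<pi>_def using zc[OF that] that by (simp add: \<epsilon>_def r_minus r_neg)
  qed
  have "(\<Oplus>k\<in>{..<?m}. \<epsilon> k \<otimes> a k) \<ominus> \<one> \<in> I"
  proof -
    let ?A = "\<Oplus>k\<in>{..<n}. z k \<otimes> a k" and ?Xa = "\<Oplus>j\<in>{..<n}. x j \<otimes> z j"
      and ?Y = "\<Oplus>j\<in>{..<n}. y j \<otimes> (a j \<oplus> a n \<otimes> x j)"
    have Ac: "?A \<in> carrier R" using zc ac by (intro finsum_closed) simp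
    have Yc: "?Y \<in> carrier R" using yc ac xc by (intro finsum_closed) simp
    have "(\<Oplus>k\<in>{..<?m}. \<epsilon> k \<otimes> a k) = \<epsilon> n \<otimes> a n \<oplus> (\<Oplus>k\<in>{..<n}. \<epsilon> k \<otimes> a k)"
      unfolding lessThan_Suc using vecD[OF \<epsilon>v] ac by (intro finsum_insert) simp_all
    also have "(\<Oplus>k\<in>{..<n}. \<epsilon> k \<otimes> a k) = ?A"
      by (rule add.finprod_cong') (use zc ac in \<open>simp_all add: \<epsilon>_def\<close>)
    also have "\<epsilon> n = \<one> \<oplus> ?Xa" by (simp add: \<epsilon>_def)
    finally have 1: "(\<Oplus>k\<in>{..<?m}. \<epsilon> k \<otimes> a k) = a n \<oplus> (?A \<oplus> a n \<otimes> ?Xa)"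
      using Ac xz ac[of n] by (simp add: l_distr r_distr a_ac m_comm)
    have "a n \<otimes> ?Xa = (\<Oplus>j\<in>{..<n}. a n \<otimes> (x j \<otimes> z j))"
      by (rule finsum_rdistr) (use xc zc ac in simp_all)
    then have "?A \<oplus> a n \<otimes> ?Xa = (\<Oplus>j\<in>{..<n}. z j \<otimes> a j) \<oplus> (\<Oplus>j\<in>{..<n}. a n \<otimes> (x j \<otimes> z j))"
      by (simp only:)
    also have "\<dots> = (\<Oplus>j\<in>{..<n}. z j \<otimes> a j \<oplus> a n \<otimes> (x j \<otimes> z j))"
      by (rule finsum_addf[symmetric]) (use xc zc ac in simp_all)
    also have "\<dots> = (\<Oplus>j\<in>{..<n}. (y j \<otimes> (a j \<oplus> a n \<otimes> x j)) \<otimes> (\<one> \<ominus> a n))"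
      by (rule add.finprod_cong') (use xc yc ac in \<open>simp_all add: z_def r_distr l_distr m_ac\<close>)
    also have "\<dots> = ?Y \<otimes> (\<one> \<ominus> a n)"
      by (rule finsum_ldistr[symmetric]) (use xc yc ac in simp_all)
    finally have 2: "?A \<oplus> a n \<otimes> ?Xa = ?Y \<otimes> (\<one> \<ominus> a n)" .
    have "?Y = \<one> \<ominus> \<iota>"
    proof -
      have "\<iota> \<oplus> ?Y \<ominus> \<iota> = ?Y" using Yc I.Icarr[OF y(1)] by (simp add: a_minus_def a_ac r_neg2)
      then show ?thesis unfolding y(3)[symmetric] by (rule sym)
    qed
    then have "(\<Oplus>k\<in>{..<?m}. \<epsilon> k \<otimes> a k) \<ominus> \<one> = a n \<oplus> (\<one> \<ominus> \<iota>) \<otimes> (\<one> \<ominus> a n) \<ominus> \<one>"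
      unfolding 1 2 by (simp only:)
    also have "\<dots> = \<iota> \<otimes> (a n \<ominus> \<one>)"
    proof -
      have "(\<one> \<ominus> \<iota>) \<otimes> (\<one> \<ominus> a n) = (\<one> \<ominus> a n) \<oplus> \<iota> \<otimes> (a n \<ominus> \<one>)"
        using ac[of n] I.Icarr[OF y(1)]
        by (simp add: a_minus_def l_distr r_distr l_minus r_minus minus_add a_ac)
      moreover have "a n \<oplus> ((\<one> \<ominus> a n) \<oplus> \<iota> \<otimes> (a n \<ominus> \<one>)) \<ominus> \<one> = \<iota> \<otimes> (a n \<ominus> \<one>)"
      proof -
        define q where "q = \<iota> \<otimes> (a n \<ominus> \<one>)"
        have qc: "q \<in> carrier R" using ac[of n] I.Icarr[OF y(1)] by (simp add: q_def)
        have "a n \<oplus> ((\<one> \<ominus> a n) \<oplus> q) \<ominus> \<one> = (a n \<ominus> a n) \<oplus> ((\<one> \<ominus> \<one>) \<oplus> q)"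
          using ac[of n] qc by (simp only: a_minus_def a_ac a_closed a_inv_closed one_closed)
        also have "\<dots> = q" using ac[of n] qc by (simp add: a_minus_def r_neg)
        finally show ?thesis unfolding q_def .
      qed
      ultimately show ?thesis by (simp only:)
    qed
    also have "\<dots> \<in> I" using ac[of n] by (intro I.I_r_closed[OF y(1)]) simp
    finally show ?thesis .
  qed
  then have cI: "(\<Oplus>k\<in>{..<?m}. \<epsilon> k \<otimes> a k) \<ominus> \<one> \<in> I" .
  have "\<exists>u\<in>W. \<forall>i<?m. w i = u i \<oplus> \<epsilon> i"
  proof -
    define c where "c = (\<Oplus>k\<in>{..<?m}. \<epsilon> k \<otimes> a k)"
    obtain u where u: "c \<in> carrier R" "u \<in> W" "\<And>i. i < ?m \<Longrightarrow> \<epsilon> i = u i \<oplus> c \<otimes> w i"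
      using rel_vec[OF \<epsilon>v, folded c_def] by (rule vrelE) (rule that, simp_all)
    have d: "(\<lambda>i. (c \<ominus> \<one>) \<otimes> w i) \<in> W"
      using cI unfolding I_def c_def[symmetric] by (elim CollectE conjE)
    have "(\<lambda>i. \<ominus> \<one> \<otimes> (u i \<oplus> (c \<ominus> \<one>) \<otimes> w i)) \<in> W"
      by (rule vsubD(4)[OF W _ vsubD(3)[OF W u(2) d]]) simp
    moreover have "\<forall>i<?m. w i = \<ominus> \<one> \<otimes> (u i \<oplus> (c \<ominus> \<one>) \<otimes> w i) \<oplus> \<epsilon> i"
    proof (intro allI impI)
      fix i assume i: "i < ?m"
      have c: "u i \<in> carrier R" "w i \<in> carrier R" using vecD[OF vsubD(1)[OF W u(2)] i] wc[OF i] by simp_all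
      define q where "q = c \<otimes> w i"
      have qc: "q \<in> carrier R" using u(1) c by (simp add: q_def)
      have "(c \<ominus> \<one>) \<otimes> w i = q \<ominus> w i" using c u(1) by (simp add: q_def a_minus_def l_distr l_minus)
      then have "\<ominus> \<one> \<otimes> (u i \<oplus> (c \<ominus> \<one>) \<otimes> w i) \<oplus> \<epsilon> i = \<ominus> (u i \<oplus> (q \<ominus> w i)) \<oplus> (u i \<oplus> q)"
        unfolding u(3)[OF i] q_def[symmetric] using c qc by (simp add: l_minus)
      also have "\<dots> = (u i \<ominus> u i) \<oplus> ((q \<ominus> q) \<oplus> w i)"
        using c qc by (simp add: a_minus_def minus_add a_ac)
      also have "\<dots> = w i" using c qc by (simp add: a_minus_def r_neg)
      finally show "w i = \<ominus> \<one> \<otimes> (u i \<oplus> (c \<ominus> \<one>) \<otimes> w i) \<oplus> \<epsilon> i" by (rule sym)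
    qed
    ultimately show ?thesis
      by (rule bexI[where x = "\<lambda>i. \<ominus> \<one> \<otimes> (u i \<oplus> (c \<ominus> \<one>) \<otimes> w i)", rotated])
  qed
  then obtain u0 where u0: "u0 \<in> W" "\<forall>i<?m. w i = u0 i \<oplus> \<epsilon> i" by (elim bexE)
  have u0v: "u0 \<in> vec ?m" by (rule vsubD(1)[OF W u0(1)])
  have \<pi>w: "\<pi> w j = \<pi> u0 j" if j: "j < n" for j
  proof -
    have "\<pi> w j = \<pi> (\<lambda>i. u0 i \<oplus> \<epsilon> i) j"
      by (rule vlinD(4)[OF lin vec_add[OF u0v \<epsilon>v] _ j]) (use u0(2) in simp)
    also have "\<dots> = \<pi> u0 j \<oplus> \<pi> \<epsilon> j" by (rule vlinD(2)[OF lin u0v \<epsilon>v j])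
    finally show ?thesis using \<pi>\<epsilon>[OF j] vecD[OF vlinD(1)[OF lin u0v] j] by simp
  qed
  have "vec n \<subseteq> vimg n \<pi> W"
  proof
    fix t assume t: "t \<in> vec n"
    have tx: "(\<Oplus>j\<in>{..<n}. x j \<otimes> t j) \<in> carrier R" using xc vecD[OF t] by (intro finsum_closed) simp
    \<comment> \<open>The lift of t with vanishing e_n-coordinate, on which \<pi> simply returns
      t.\<close>
    define v where "v i = (if i < n then t i else (\<Oplus>j\<in>{..<n}. x j \<otimes> t j))" for i
    have vv: "v \<in> vec ?m" using vecD[OF t] tx by (simp add: vec_def v_def)
    have sv: "s v = v n"
    proof -
      have "s v = (\<Oplus>j\<in>{..<n}. x j \<otimes> t j)"
        unfolding s_def by (rule add.finprod_cong') (use xc vecD[OF t] in \<open>simp_all add: v_def\<close>)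
      then show ?thesis by (simp add: v_def)
    qed
    have \<pi>v: "\<pi> v j = t j" if "j < n" for j
      unfolding \<pi>_def sv using zc[OF that] vecD[OF t that] tx that by (simp add: v_def a_minus_def r_neg)
    have "v \<in> vext ?m W w" by (rule subsetD[OF gen vv])
    then obtain u c where u: "u \<in> W" "c \<in> carrier R" "\<And>i. i < ?m \<Longrightarrow> v i = u i \<oplus> c \<otimes> w i"
      by (rule vextE) (rule that, simp_all)
    have uv: "u \<in> vec ?m" by (rule vsubD(1)[OF W u(1)])
    show "t \<in> vimg n \<pi> W"
    proof (rule vimgI[OF vsubD(3)[OF W u(1) vsubD(4)[OF W u(2) u0(1)]]])
      fix j assume j: "j < n"
      have "\<pi> v j = \<pi> (\<lambda>i. u i \<oplus> c \<otimes> w i) j"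
        by (rule vlinD(4)[OF lin vec_add[OF uv vec_smult[OF u(2) w]] _ j]) (rule u(3))
      also have "\<dots> = \<pi> u j \<oplus> c \<otimes> \<pi> u0 j"
        using vlinD(2)[OF lin uv vec_smult[OF u(2) w] j] vlinD(3)[OF lin u(2) w j] \<pi>w[OF j] by (simp only:)
      also have "\<dots> = \<pi> (\<lambda>i. u i \<oplus> c \<otimes> u0 i) j"
        using vlinD(2)[OF lin uv vec_smult[OF u(2) u0v] j] vlinD(3)[OF lin u(2) u0v j] by (simp only:)
      finally show "t j = \<pi> (\<lambda>i. u i \<oplus> c \<otimes> u0 i) j" using \<pi>v[OF j] by (simp only:)
    qed
  qed
  then show ?thesis using lin by (intro exI[of _ \<pi>] conjI)
qed

text \<open>All generators but the last are first absorbed into W; the last is then cleared by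
  \<open>clear_one_generator\<close>. The images under \<pi> of the absorbed ones generate the new
  quotient, so one generator and one coordinate disappear together.\<close>

lemma clear_generator:
  assumes "vsub (Suc n) W" and "vgen (Suc n) W (Suc t)"
    and rk: "\<And>P. primeideal P R \<Longrightarrow> rk P < p ^ n"
  shows "\<exists>\<pi>. vlin (Suc n) n \<pi> \<and> vgen n (vimg n \<pi> W) t"
  using assms(1,2)
proof (induction t arbitrary: W)
  case 0
  obtain w where w: "w \<in> vec (Suc n)" "vec (Suc n) \<subseteq> vext (Suc n) W w"
    using 0(2) by (simp only: vgen.simps) (elim bexE)
  show ?case using clear_one_generator[OF 0(1) w rk] by (simp only: vgen.simps)
next
  case (Suc t)
  obtain w where w: "w \<in> vec (Suc n)" "vgen (Suc n) (vext (Suc n) W w) (Suc t)"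
    using Suc.prems(2) unfolding vgen.simps(2)[of _ _ "Suc t"] by (elim bexE)
  obtain \<pi> where \<pi>: "vlin (Suc n) n \<pi>" "vgen n (vimg n \<pi> (vext (Suc n) W w)) t"
    using Suc.IH[OF vsub_vext[OF Suc.prems(1) w(1)] w(2)] by (elim exE conjE)
  have "vgen n (vext n (vimg n \<pi> W) (\<pi> w)) t"
    by (rule vgen_mono[OF \<pi>(2) vimg_vext[OF Suc.prems(1) w(1) \<pi>(1)]])
  then have "vgen n (vimg n \<pi> W) (Suc t)"
    unfolding vgen.simps by (rule bexI[OF _ vlinD(1)[OF \<pi>(1) w(1)]])
  then show ?case using \<pi>(1) by (intro exI[of _ \<pi>] conjI)
qed

text \<open>Each removal lowers the number of coordinates by one. The condition
  \<open>k + t \<le> m\<close> keeps at least k coordinates after every removal, so that the rank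
  bound \<open>p ^ k\<close> is available throughout.\<close>

lemma clear_generators:
  assumes "vsub m W" and "vgen m W t" and "k + t \<le> m"
    and rk: "\<And>P. primeideal P R \<Longrightarrow> rk P < p ^ k"
  shows "\<exists>\<pi>. vlin m (m - t) \<pi> \<and> vec (m - t) \<subseteq> vimg (m - t) \<pi> W"
  using assms(1-3)
proof (induction t arbitrary: m W)
  case 0
  have "vlin m m (\<lambda>u. u)" by (simp add: vlin_def)
  moreover have "vec m \<subseteq> vimg m (\<lambda>u. u) W"
    using 0(2) by (intro subsetI vimgI) auto
  ultimately show ?case by (intro exI[of _ "\<lambda>u. u"]) simp
next
  case (Suc t)
  obtain n where m: "m = Suc n" using Suc.prems(3) by (cases m) simp_all
  have kn: "k \<le> n" "k + t \<le> n" using Suc.prems(3) m by simp_all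
  have rkn: "rk P < p ^ n" if "primeideal P R" for P
    using rk[OF that] power_increasing[OF kn(1), of p] p_ge_2 by linarith
  have "\<exists>\<pi>. vlin (Suc n) n \<pi> \<and> vgen n (vimg n \<pi> W) t"
    by (rule clear_generator[OF Suc.prems(1)[unfolded m] Suc.prems(2)[unfolded m] rkn])
  then obtain \<pi> where \<pi>: "vlin m n \<pi>" "vgen n (vimg n \<pi> W) t"
    unfolding m by (elim exE conjE)
  have sub: "vsub n (vimg n \<pi> W)" by (rule vsub_vimg[OF Suc.prems(1) \<pi>(1)])
  obtain \<sigma> where \<sigma>: "vlin n (n - t) \<sigma>" "vec (n - t) \<subseteq> vimg (n - t) \<sigma> (vimg n \<pi> W)"
    using Suc.IH[OF sub \<pi>(2) kn(2)] by (elim exE conjE)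
  have "vlin m (n - t) (\<lambda>u. \<sigma> (\<pi> u))"
    unfolding vlin_def
  proof (intro conjI ballI allI impI)
    fix u assume u: "u \<in> vec m"
    note pu = vlinD(1)[OF \<pi>(1) u]
    show "\<sigma> (\<pi> u) \<in> vec (n - t)" by (rule vlinD(1)[OF \<sigma>(1) pu])
    {
      fix v j assume v: "v \<in> vec m" and j: "j < n - t"
      note pv = vlinD(1)[OF \<pi>(1) v]
      have "\<sigma> (\<pi> (\<lambda>i. u i \<oplus> v i)) j = \<sigma> (\<lambda>i. \<pi> u i \<oplus> \<pi> v i) j"
        by (rule vlinD(4)[OF \<sigma>(1) vec_add[OF pu pv] vlinD(2)[OF \<pi>(1) u v] j])
      then show "\<sigma> (\<pi> (\<lambda>i. u i \<oplus> v i)) j = \<sigma> (\<pi> u) j \<oplus> \<sigma> (\<pi> v) j"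
        using vlinD(2)[OF \<sigma>(1) pu pv j] by (simp only:)
    next
      fix r j assume r: "r \<in> carrier R" and j: "j < n - t"
      have "\<sigma> (\<pi> (\<lambda>i. r \<otimes> u i)) j = \<sigma> (\<lambda>i. r \<otimes> \<pi> u i) j"
        by (rule vlinD(4)[OF \<sigma>(1) vec_smult[OF r pu] vlinD(3)[OF \<pi>(1) r u] j])
      then show "\<sigma> (\<pi> (\<lambda>i. r \<otimes> u i)) j = r \<otimes> \<sigma> (\<pi> u) j"
        using vlinD(3)[OF \<sigma>(1) r pu j] by (simp only:)
    next
      fix v j assume eq: "\<forall>i<m. v i = u i" and j: "j < n - t"
      show "\<sigma> (\<pi> v) j = \<sigma> (\<pi> u) j"
        by (rule vlinD(4)[OF \<sigma>(1) pu vlinD(4)[OF \<pi>(1) u] j]) (use eq in simp_all)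
    }
  qed
  moreover have "vec (n - t) \<subseteq> vimg (n - t) (\<lambda>u. \<sigma> (\<pi> u)) W"
  proof
    fix v assume "v \<in> vec (n - t)"
    then have "v \<in> vimg (n - t) \<sigma> (vimg n \<pi> W)" by (rule subsetD[OF \<sigma>(2)])
    then obtain y where y: "y \<in> vimg n \<pi> W" "\<And>j. j < n - t \<Longrightarrow> v j = \<sigma> y j"
      by (rule vimgE) (rule that, simp_all)
    obtain u where u: "u \<in> W" "\<And>j. j < n \<Longrightarrow> y j = \<pi> u j"
      using y(1) by (rule vimgE) (rule that, simp_all)
    have pu: "\<pi> u \<in> vec n" by (rule vlinD(1)[OF \<pi>(1) vsubD(1)[OF Suc.prems(1) u(1)]])
    show "v \<in> vimg (n - t) (\<lambda>u. \<sigma> (\<pi> u)) W"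
    proof (rule vimgI[OF u(1)])
      fix j assume j: "j < n - t"
      have "\<sigma> y j = \<sigma> (\<pi> u) j" by (rule vlinD(4)[OF \<sigma>(1) pu u(2) j])
      then show "v j = \<sigma> (\<pi> u) j" using y(2)[OF j] by (simp only:)
    qed
  qed
  moreover have "m - Suc t = n - t" by (simp add: m)
  ultimately show ?case by (intro exI[of _ "\<lambda>u. \<sigma> (\<pi> u)"] conjI) (simp_all only:)
qed

end

context frob_ring
begin

subsection \<open>Free summands and dual families\<close>

definition linear_form :: "('a, 'b, 'n) module_scheme \<Rightarrow> ('b \<Rightarrow> 'a) \<Rightarrow> bool" where
  "linear_form N \<phi> \<longleftrightarrow> (\<forall>x\<in>carrier N. \<phi> x \<in> carrier R) \<and>
     (\<forall>x\<in>carrier N. \<forall>y\<in>carrier N. \<phi> (x \<oplus>\<^bsub>N\<^esub> y) = \<phi> x \<oplus> \<phi> y) \<and>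
     (\<forall>r\<in>carrier R. \<forall>x\<in>carrier N. \<phi> (r \<odot>\<^bsub>N\<^esub> x) = r \<otimes> \<phi> x)"

lemma linear_formD:
  assumes "linear_form N \<phi>"
  shows "x \<in> carrier N \<Longrightarrow> \<phi> x \<in> carrier R"
    "x \<in> carrier N \<Longrightarrow> y \<in> carrier N \<Longrightarrow> \<phi> (x \<oplus>\<^bsub>N\<^esub> y) = \<phi> x \<oplus> \<phi> y"
    "r \<in> carrier R \<Longrightarrow> x \<in> carrier N \<Longrightarrow> \<phi> (r \<odot>\<^bsub>N\<^esub> x) = r \<otimes> \<phi> x"
  using assms unfolding linear_form_def by simp_all

lemma linear_form_zero:
  assumes "module R N" "linear_form N \<phi>"
  shows "\<phi> \<zero>\<^bsub>N\<^esub> = \<zero>"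
proof -
  interpret N: module R N by (rule assms(1))
  have "\<phi> (\<zero> \<odot>\<^bsub>N\<^esub> \<zero>\<^bsub>N\<^esub>) = \<zero> \<otimes> \<phi> \<zero>\<^bsub>N\<^esub>"
    by (rule linear_formD(3)[OF assms(2) zero_closed N.M.zero_closed])
  then show ?thesis using linear_formD(1)[OF assms(2) N.M.zero_closed] by simp
qed

lemma linear_form_finsum:
  assumes N: "module R N" and \<phi>: "linear_form N \<phi>" and A: "finite A" "\<And>k. k \<in> A \<Longrightarrow> f k \<in> carrier N"
  shows "\<phi> (\<Oplus>\<^bsub>N\<^esub>k\<in>A. f k) = (\<Oplus>k\<in>A. \<phi> (f k))"
  using A
proof (induction A rule: finite_induct)
  case empty
  interpret N: module R N by (rule N)
  show ?case using linear_form_zero[OF N \<phi>] by simp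
next
  case (insert k A)
  interpret N: module R N by (rule N)
  have fc: "f l \<in> carrier N" if "l \<in> insert k A" for l by (rule insert.prems[OF that])
  have "(\<Oplus>\<^bsub>N\<^esub>k\<in>insert k A. f k) = f k \<oplus>\<^bsub>N\<^esub> (\<Oplus>\<^bsub>N\<^esub>k\<in>A. f k)"
    using insert.hyps fc by (intro N.finsum_insert) simp_all
  moreover have "(\<Oplus>\<^bsub>N\<^esub>k\<in>A. f k) \<in> carrier N" using fc by (intro N.finsum_closed) simp
  moreover have "(\<Oplus>k\<in>insert k A. \<phi> (f k)) = \<phi> (f k) \<oplus> (\<Oplus>k\<in>A. \<phi> (f k))"
    using insert.hyps linear_formD(1)[OF \<phi> fc] by (intro finsum_insert) simp_all
  moreover have "\<phi> (\<Oplus>\<^bsub>N\<^esub>k\<in>A. f k) = (\<Oplus>k\<in>A. \<phi> (f k))"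
    by (rule insert.IH) (rule fc, simp)
  ultimately show ?case using linear_formD(2)[OF \<phi> fc[OF insertI1]] by simp
qed

text \<open>A split surjection of N onto \<open>R^n\<close>, which amounts to a free summand of rank
  n. In this form a summand can be produced from linear maps alone, without following complements
  through them.\<close>

definition dual_family :: "('a, 'b, 'n) module_scheme \<Rightarrow> nat \<Rightarrow> (nat \<Rightarrow> 'b \<Rightarrow> 'a) \<Rightarrow> (nat \<Rightarrow> 'b) \<Rightarrow> bool" where
  "dual_family N n \<phi> x \<longleftrightarrow> (\<forall>i<n. linear_form N (\<phi> i) \<and> x i \<in> carrier N) \<and>
     (\<forall>i<n. \<forall>j<n. \<phi> i (x j) = (if i = j then \<one> else \<zero>))"

lemma dual_familyD:
  assumes "dual_family N n \<phi> x"
  shows "i < n \<Longrightarrow> linear_form N (\<phi> i)" "i < n \<Longrightarrow> x i \<in> carrier N"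
    "i < n \<Longrightarrow> j < n \<Longrightarrow> \<phi> i (x j) = (if i = j then \<one> else \<zero>)"
  using assms unfolding dual_family_def by simp_all

lemma dual_family_free_summand:
  assumes N: "module R N" and d: "dual_family N n \<phi> x"
  shows "free_summand_of_rank R N n"
proof -
  interpret N: module R N by (rule N)
  note \<phi> = dual_familyD(1)[OF d] and xc = dual_familyD(2)[OF d] and \<phi>x = dual_familyD(3)[OF d]
  define B where "B = x ` {..<n}"
  have B: "finite B" "B \<subseteq> carrier N" using xc by (auto simp: B_def)
  have inj: "inj_on x {..<n}"
  proof (rule inj_onI, rule ccontr)
    fix i j assume ij: "i \<in> {..<n}" "j \<in> {..<n}" "x i = x j" "i \<noteq> j"
    have "\<phi> i (x i) = \<one>" "\<phi> i (x j) = \<zero>" using \<phi>x ij(1,2,4) by simp_all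
    then show False unfolding ij(3) using one_not_zero by simp
  qed
  have card: "card B = n" unfolding B_def using card_image[OF inj] by simp
  have comb: "\<phi> i (N.lincomb a B) = a (x i)" if a: "a \<in> B \<rightarrow> carrier R" and i: "i < n" for a i
  proof -
    have ac: "a (x j) \<in> carrier R" if "j < n" for j by (rule funcset_mem[OF a]) (use that in \<open>simp add: B_def\<close>)
    have "N.lincomb a B = (\<Oplus>\<^bsub>N\<^esub>j\<in>{..<n}. a (x j) \<odot>\<^bsub>N\<^esub> x j)"
      unfolding N.lincomb_def B_def by (rule N.finsum_reindex[OF _ inj]) (use ac xc in auto)
    then have "\<phi> i (N.lincomb a B) = (\<Oplus>j\<in>{..<n}. \<phi> i (a (x j) \<odot>\<^bsub>N\<^esub> x j))"
      using linear_form_finsum[OF N \<phi>[OF i] finite_lessThan[of n], of "\<lambda>j. a (x j) \<odot>\<^bsub>N\<^esub> x j"] ac xc by simp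
    also have "\<dots> = (\<Oplus>j\<in>{..<n}. a (x j) \<otimes> (if i = j then \<one> else \<zero>))"
      by (rule add.finprod_cong') (use linear_formD(3)[OF \<phi>[OF i] ac xc] \<phi>x[OF i] ac in simp_all)
    also have "\<dots> = a (x i)"
      by (rule finsum_unit_vectors[where v = "\<lambda>j. a (x j)", OF _ i]) (use ac in \<open>simp add: vec_def\<close>)
    finally show ?thesis .
  qed
  \<comment> \<open>The summand is spanned by the x_i and its complement is the common kernel of the
    forms; v minus \<Sum> \<phi>_i(v) x_i lies in the latter.\<close>
  let ?L = "N.span B" and ?K = "{v \<in> carrier N. \<forall>i<n. \<phi> i v = \<zero>}"
  have L: "submodule R ?L N" by (rule N.span_is_submodule[OF B(2)])
  have K: "submodule R ?K N"
  proof (rule submodule.intro[OF N])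
    show "\<zero>\<^bsub>N\<^esub> \<in> ?K" using linear_form_zero[OF N \<phi>] by simp
    show "v \<oplus>\<^bsub>N\<^esub> w \<in> ?K" if "v \<in> ?K" "w \<in> ?K" for v w
      using that linear_formD(2)[OF \<phi>, of _ v w] by simp
    show "c \<odot>\<^bsub>N\<^esub> v \<in> ?K" if "c \<in> carrier R" "v \<in> ?K" for c v
      using that linear_formD(3)[OF \<phi>, of _ c v] by simp
  qed simp
  have in_span: "N.lincomb a B \<in> ?L" if "a \<in> B \<rightarrow> carrier R" for a
    unfolding N.finite_span[OF B] using that by (intro CollectI exI conjI) simp_all
  have LK: "?L \<inter> ?K = {\<zero>\<^bsub>N\<^esub>}"
  proof
    show "{\<zero>\<^bsub>N\<^esub>} \<subseteq> ?L \<inter> ?K" using submodule.zero_closed[OF L] submodule.zero_closed[OF K] by simp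
    show "?L \<inter> ?K \<subseteq> {\<zero>\<^bsub>N\<^esub>}"
    proof
      fix v assume v: "v \<in> ?L \<inter> ?K"
      then have vL: "v \<in> ?L" by simp
      obtain a where a: "a \<in> B \<rightarrow> carrier R" "N.lincomb a B = v"
        using N.finite_in_span[OF B vL] by (elim exE conjE)
      have "a b = \<zero>" if "b \<in> B" for b
      proof -
        obtain i where i: "i < n" "b = x i" using \<open>b \<in> B\<close> unfolding B_def by auto
        show ?thesis using comb[OF a(1) i(1)] v a(2) i by simp
      qed
      then have "N.lincomb a B = (\<Oplus>\<^bsub>N\<^esub>b\<in>B. \<zero>\<^bsub>N\<^esub>)"
        unfolding N.lincomb_def using B by (intro N.M.add.finprod_cong') (auto simp: subset_iff)
      then show "v \<in> {\<zero>\<^bsub>N\<^esub>}" using a(2) by simp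
    qed
  qed
  have sum: "N.submodule_sum ?L ?K = carrier N"
  proof
    show "N.submodule_sum ?L ?K \<subseteq> carrier N"
      using submodule.subset[OF L] unfolding N.submodule_sum_def by auto
    show "carrier N \<subseteq> N.submodule_sum ?L ?K"
    proof
      fix v assume v: "v \<in> carrier N"
      \<comment> \<open>\<open>lincomb\<close> indexes coefficients by the vectors themselves, hence
        the passage through the inverse of x.\<close>
      define a where "a b = \<phi> (inv_into {..<n} x b) v" for b
      have ax: "a (x i) = \<phi> i v" if "i < n" for i
        unfolding a_def using inv_into_f_f[OF inj, of i] that by simp
      have ac: "a \<in> B \<rightarrow> carrier R"
      proof
        fix b assume "b \<in> B"
        then obtain i where "i < n" "b = x i" unfolding B_def by auto
        then show "a b \<in> carrier R" using ax linear_formD(1)[OF \<phi> v] by simp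
      qed
      define l where "l = N.lincomb a B"
      have l: "l \<in> ?L" unfolding l_def by (rule in_span[OF ac])
      have lc: "l \<in> carrier N" using l submodule.subset[OF L] by (rule rev_subsetD)
      define k where "k = (\<ominus> \<one>) \<odot>\<^bsub>N\<^esub> l \<oplus>\<^bsub>N\<^esub> v"
      have lc': "(\<ominus> \<one>) \<odot>\<^bsub>N\<^esub> l \<in> carrier N" using lc by simp
      have "\<phi> i k = \<zero>" if i: "i < n" for i
      proof -
        have "\<phi> i k = (\<ominus> \<one>) \<otimes> \<phi> i l \<oplus> \<phi> i v"
          unfolding k_def using linear_formD(2)[OF \<phi>[OF i] lc' v] linear_formD(3)[OF \<phi>[OF i] _ lc, of "\<ominus> \<one>"]
          by simp
        also have "\<phi> i l = \<phi> i v" unfolding l_def using comb[OF ac i] ax[OF i] by simp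
        finally show ?thesis using linear_formD(1)[OF \<phi>[OF i] v] by (simp add: l_minus l_neg)
      qed
      then have "k \<in> ?K" using lc' v by (simp add: k_def)
      moreover have "v = l \<oplus>\<^bsub>N\<^esub> k"
        unfolding k_def using lc v N.smult_minus_1[OF lc] by (simp add: N.M.r_neg2)
      ultimately show "v \<in> N.submodule_sum ?L ?K"
        unfolding N.submodule_sum_def using l by (intro image_eqI[of _ _ "(l, k)"]) simp_all
    qed
  qed
  have indep: "\<not> N.lin_dep B"
  proof (rule N.finite_lin_indpt2[OF B])
    fix a assume a: "a \<in> B \<rightarrow> carrier R" "N.lincomb a B = \<zero>\<^bsub>N\<^esub>"
    show "\<forall>v\<in>B. a v = \<zero>"
    proof
      fix b assume "b \<in> B"
      then obtain i where i: "i < n" "b = x i" unfolding B_def by auto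
      show "a b = \<zero>" using comb[OF a(1) i(1)] a(2) i(2) linear_form_zero[OF N \<phi>[OF i(1)]] by simp
    qed
  qed
  have BL: "B \<subseteq> ?L" by (rule N.in_own_span[OF B(2)])
  have "free_of_rank R (N\<lparr>carrier := ?L\<rparr>) n"
    unfolding free_of_rank_def
    using B(1) card BL indep N.span_li_not_depend[OF BL L] by (intro exI[of _ B]) simp
  then show ?thesis
    unfolding free_summand_of_rank_def using L K LK sum by (intro exI[of _ ?L] exI[of _ ?K] conjI)
qed

text \<open>The forms are the coordinates, with respect to a basis of L, of the L-component of a
  vector. Coordinates are chosen vector by vector; uniqueness of the representation makes the choice
  linear.\<close>

lemma free_summand_dual_family:
  assumes N: "module R N" and f: "free_summand_of_rank R N n"
  shows "\<exists>\<phi> x. dual_family N n \<phi> x"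
proof -
  interpret N: module R N by (rule N)
  obtain L K where L: "submodule R L N" and K: "submodule R K N"
    and sum: "N.submodule_sum L K = carrier N" and LK: "L \<inter> K = {\<zero>\<^bsub>N\<^esub>}"
    and fr: "free_of_rank R (N\<lparr>carrier := L\<rparr>) n"
    using f unfolding free_summand_of_rank_def by (elim exE conjE)
  obtain B where B: "finite B" "card B = n" "B \<subseteq> L" "\<not> module.lin_dep R (N\<lparr>carrier := L\<rparr>) B"
    "module.span R (N\<lparr>carrier := L\<rparr>) B = L"
    using fr unfolding free_of_rank_def by (elim exE conjE) simp
  have indep: "\<not> N.lin_dep B" and span: "N.span B = L"
    using B(4,5) N.span_li_not_depend[OF B(3) L] by simp_all
  have Lc: "L \<subseteq> carrier N" by (rule submodule.subset[OF L])
  have Kc: "K \<subseteq> carrier N" by (rule submodule.subset[OF K])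
  have Bc: "B \<subseteq> carrier N" using B(3) Lc by (rule subset_trans)
  define rep where "rep v a \<longleftrightarrow> a \<in> B \<rightarrow> carrier R \<and> (\<exists>k\<in>K. v = N.lincomb a B \<oplus>\<^bsub>N\<^esub> k)" for v a
  have rep_ex: "\<exists>a. rep v a" if "v \<in> carrier N" for v
  proof -
    have "v \<in> N.submodule_sum L K" using sum that by simp
    then obtain l k where lk: "l \<in> L" "k \<in> K" "v = l \<oplus>\<^bsub>N\<^esub> k" unfolding N.submodule_sum_def by auto
    have lB: "l \<in> N.span B" using lk span by simp
    obtain a where "a \<in> B \<rightarrow> carrier R" "N.lincomb a B = l"
      using N.finite_in_span[OF B(1) Bc lB] by (elim exE conjE)
    then show ?thesis unfolding rep_def using lk by (intro exI[of _ a] conjI bexI[of _ k]) simp_all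
  qed
  have lcc: "N.lincomb a B \<in> carrier N" if "a \<in> B \<rightarrow> carrier R" for a
    by (rule N.lincomb_closed[OF Bc that])
  have lin_L: "N.lincomb a B \<in> L" if "a \<in> B \<rightarrow> carrier R" for a
    unfolding span[symmetric] N.finite_span[OF B(1) Bc] using that by (intro CollectI exI conjI) simp_all
  have rep_lin: "rep (r \<odot>\<^bsub>N\<^esub> v \<oplus>\<^bsub>N\<^esub> v') (\<lambda>b. r \<otimes> a b \<oplus> a' b)"
    if r: "r \<in> carrier R" and a: "rep v a" and a': "rep v' a'" for r v v' a a'
  proof -
    obtain k where k: "k \<in> K" "v = N.lincomb a B \<oplus>\<^bsub>N\<^esub> k" and ac: "a \<in> B \<rightarrow> carrier R"
      using a unfolding rep_def by (elim conjE bexE)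
    obtain k' where k': "k' \<in> K" "v' = N.lincomb a' B \<oplus>\<^bsub>N\<^esub> k'" and a'c: "a' \<in> B \<rightarrow> carrier R"
      using a' unfolding rep_def by (elim conjE bexE)
    have rac: "(\<lambda>b. r \<otimes> a b) \<in> B \<rightarrow> carrier R" using ac r by auto
    have kc: "k \<in> carrier N" "k' \<in> carrier N" using k(1) k'(1) Kc by auto
    have "N.lincomb (\<lambda>b. r \<otimes> a b \<oplus> a' b) B = r \<odot>\<^bsub>N\<^esub> N.lincomb a B \<oplus>\<^bsub>N\<^esub> N.lincomb a' B"
      using N.lincomb_sum[OF B(1) Bc rac a'c] N.lincomb_smult[OF Bc ac r] by simp
    then have "r \<odot>\<^bsub>N\<^esub> v \<oplus>\<^bsub>N\<^esub> v' = N.lincomb (\<lambda>b. r \<otimes> a b \<oplus> a' b) B \<oplus>\<^bsub>N\<^esub> (r \<odot>\<^bsub>N\<^esub> k \<oplus>\<^bsub>N\<^esub> k')"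
      unfolding k(2) k'(2) using r kc lcc[OF ac] lcc[OF a'c] by (simp add: N.smult_r_distr N.M.a_ac)
    moreover have "r \<odot>\<^bsub>N\<^esub> k \<oplus>\<^bsub>N\<^esub> k' \<in> K" using K k(1) k'(1) r by (simp add: submodule.m_closed submodule.smult_closed)
    moreover have "(\<lambda>b. r \<otimes> a b \<oplus> a' b) \<in> B \<rightarrow> carrier R" using ac a'c r by auto
    ultimately show ?thesis unfolding rep_def by (intro conjI bexI)
  qed
  have rep_zero: "a b = \<zero>" if r0: "rep \<zero>\<^bsub>N\<^esub> a" and bB: "b \<in> B" for a b
  proof -
    obtain k where k: "k \<in> K" "\<zero>\<^bsub>N\<^esub> = N.lincomb a B \<oplus>\<^bsub>N\<^esub> k" and ac: "a \<in> B \<rightarrow> carrier R"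
      using r0 unfolding rep_def by (elim conjE bexE)
    have kc: "k \<in> carrier N" using k(1) Kc by auto
    have "N.lincomb a B = \<ominus>\<^bsub>N\<^esub> k"
      by (rule N.M.minus_equality[symmetric, OF k(2)[symmetric] kc lcc[OF ac]])
    also have "\<dots> = (\<ominus> \<one>) \<odot>\<^bsub>N\<^esub> k" using N.smult_minus_1[OF kc] by simp
    also have "\<dots> \<in> K" using K k(1) by (simp add: submodule.smult_closed)
    finally have "N.lincomb a B \<in> L \<inter> K" using lin_L[OF ac] by simp
    then have z: "N.lincomb a B = \<zero>\<^bsub>N\<^esub>" using LK by simp
    show ?thesis
    proof (rule ccontr)
      assume "a b \<noteq> \<zero>"
      then have "N.lin_dep B" by (rule N.lin_dep_crit[OF B(1) subset_refl ac bB _ z])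
      then show False using indep by simp
    qed
  qed
  have rep_unique: "a b = a' b" if a: "rep v a" and a': "rep v a'" and b: "b \<in> B" and v: "v \<in> carrier N" for v a a' b
  proof -
    have "rep ((\<ominus> \<one>) \<odot>\<^bsub>N\<^esub> v \<oplus>\<^bsub>N\<^esub> v) (\<lambda>b. (\<ominus> \<one>) \<otimes> a b \<oplus> a' b)"
      by (rule rep_lin[OF _ a a']) simp
    moreover have "(\<ominus> \<one>) \<odot>\<^bsub>N\<^esub> v \<oplus>\<^bsub>N\<^esub> v = \<zero>\<^bsub>N\<^esub>" using N.smult_minus_1[OF v] v by (simp add: N.M.l_neg)
    ultimately have z: "(\<ominus> \<one>) \<otimes> a b \<oplus> a' b = \<zero>" using rep_zero[OF _ b] by simp
    have c: "a b \<in> carrier R" "a' b \<in> carrier R" using a a' b unfolding rep_def by auto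
    have "\<ominus> a b \<oplus> a' b = \<zero>" using z c by (simp add: l_minus)
    then have "a b \<oplus> (\<ominus> a b \<oplus> a' b) = a b \<oplus> \<zero>" by simp
    then show ?thesis using c by (simp add: r_neg2)
  qed
  define A where "A v = (SOME a. rep v a)" for v
  have A: "rep v (A v)" if "v \<in> carrier N" for v unfolding A_def by (rule someI_ex[OF rep_ex[OF that]])
  have Ac: "A v b \<in> carrier R" if "v \<in> carrier N" "b \<in> B" for v b
    using A[OF that(1)] that(2) unfolding rep_def by auto
  have rep_0: "rep \<zero>\<^bsub>N\<^esub> (\<lambda>_. \<zero>)"
  proof -
    have "N.lincomb (\<lambda>_. \<zero>) B = (\<Oplus>\<^bsub>N\<^esub>b\<in>B. \<zero>\<^bsub>N\<^esub>)"
      unfolding N.lincomb_def using Bc by (intro N.M.add.finprod_cong') (auto simp: subset_iff)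
    then show ?thesis
      unfolding rep_def using submodule.zero_closed[OF K] by (intro conjI bexI[of _ "\<zero>\<^bsub>N\<^esub>"]) simp_all
  qed
  have form: "linear_form N (\<lambda>v. A v b)" if b: "b \<in> B" for b
    unfolding linear_form_def
  proof (intro conjI ballI)
    fix v assume v: "v \<in> carrier N"
    show "A v b \<in> carrier R" by (rule Ac[OF v b])
    {
      fix v' assume v': "v' \<in> carrier N"
      have "rep (\<one> \<odot>\<^bsub>N\<^esub> v \<oplus>\<^bsub>N\<^esub> v') (\<lambda>b. \<one> \<otimes> A v b \<oplus> A v' b)" by (rule rep_lin[OF one_closed A[OF v] A[OF v']])
      then have "A (v \<oplus>\<^bsub>N\<^esub> v') b = \<one> \<otimes> A v b \<oplus> A v' b"
        using rep_unique[OF A _ b, of "v \<oplus>\<^bsub>N\<^esub> v'"] v v' by simp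
      then show "A (v \<oplus>\<^bsub>N\<^esub> v') b = A v b \<oplus> A v' b" using Ac[OF v b] by simp
    next
      fix r assume r: "r \<in> carrier R"
      have "rep (r \<odot>\<^bsub>N\<^esub> v \<oplus>\<^bsub>N\<^esub> \<zero>\<^bsub>N\<^esub>) (\<lambda>b. r \<otimes> A v b \<oplus> \<zero>)" by (rule rep_lin[OF r A[OF v] rep_0])
      then have "A (r \<odot>\<^bsub>N\<^esub> v) b = r \<otimes> A v b \<oplus> \<zero>"
        using rep_unique[OF A _ b, of "r \<odot>\<^bsub>N\<^esub> v"] v r by simp
      then show "A (r \<odot>\<^bsub>N\<^esub> v) b = r \<otimes> A v b" using Ac[OF v b] r by simp
    }
  qed
  obtain h where h: "bij_betw h {..<n} B"
    using ex_bij_betw_nat_finite[OF B(1)] B(2) by (auto simp: lessThan_atLeast0)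
  have hB: "h i \<in> B" if "i < n" for i using bij_betwE[OF h] that by simp
  have unit: "A (h j) (h i) = (if i = j then \<one> else \<zero>)" if ij: "i < n" "j < n" for i j
  proof -
    have hc: "h j \<in> carrier N" using hB[OF ij(2)] Bc by auto
    have "N.lincomb (\<lambda>b. if h j = b then \<one> else \<zero>) B = (\<Oplus>\<^bsub>N\<^esub>b\<in>B. if h j = b then b else \<zero>\<^bsub>N\<^esub>)"
      unfolding N.lincomb_def using Bc by (intro N.M.add.finprod_cong') (auto simp: subset_iff)
    also have "\<dots> = h j"
      by (rule N.M.add.finprod_singleton[OF hB[OF ij(2)] B(1)]) (use Bc in auto)
    finally have "rep (h j) (\<lambda>b. if h j = b then \<one> else \<zero>)"
      unfolding rep_def using submodule.zero_closed[OF K] hc by (intro conjI bexI[of _ "\<zero>\<^bsub>N\<^esub>"]) simp_all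
    from rep_unique[OF A[OF hc] this hB[OF ij(1)] hc]
    have "A (h j) (h i) = (if h j = h i then \<one> else \<zero>)" .
    moreover have "h j = h i \<longleftrightarrow> i = j" using h ij unfolding bij_betw_def inj_on_def by auto
    ultimately show ?thesis by simp
  qed
  have "dual_family N n (\<lambda>i v. A v (h i)) h"
    unfolding dual_family_def using form[OF hB] hB Bc unit by (simp add: subset_iff)
  then show ?thesis by (intro exI)
qed

end

lemma (in module) span_induct:
  assumes B: "finite B" "B \<subseteq> carrier M" and v: "v \<in> span B"
    and zero: "T \<zero>\<^bsub>M\<^esub>" and add: "\<And>x y. x \<in> carrier M \<Longrightarrow> y \<in> carrier M \<Longrightarrow> T x \<Longrightarrow> T y \<Longrightarrow> T (x \<oplus>\<^bsub>M\<^esub> y)"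
    and gen: "\<And>r b. r \<in> carrier R \<Longrightarrow> b \<in> B \<Longrightarrow> T (r \<odot>\<^bsub>M\<^esub> b)"
  shows "T v"
proof -
  obtain a where a: "a \<in> B \<rightarrow> carrier R" "lincomb a B = v"
    using finite_in_span[OF B v] by (elim exE conjE)
  have ac: "a b \<in> carrier R" if "b \<in> B" for b by (rule funcset_mem[OF a(1) that])
  have bc: "b \<in> carrier M" if "b \<in> B" for b by (rule subsetD[OF B(2) that])
  have "(\<Oplus>\<^bsub>M\<^esub>b\<in>B. a b \<odot>\<^bsub>M\<^esub> b) \<in> {x \<in> carrier M. T x}"
  proof (rule M.finsum_in_closed_set[OF _ _ _ B(1)])
    show "a b \<odot>\<^bsub>M\<^esub> b \<in> {x \<in> carrier M. T x}" if "b \<in> B" for b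
      using gen[OF ac[OF that] that] ac[OF that] bc[OF that] by simp
  qed (use zero add in simp_all)
  then show ?thesis using a(2) unfolding lincomb_def by simp
qed

subsection \<open>Cartier maps\<close>

locale F_finite_module = F_finite_ring R p for R :: "('a, 'm) ring_scheme" (structure) and p +
  fixes M :: "('a, 'b, 'n) module_scheme"
  assumes module_M: "module R M" and fin_gen_M: "fin_gen R M"

sublocale F_finite_module \<subseteq> M: module R M by (rule module_M)

context F_finite_module
begin

lemma generators:
  obtains B where "finite B" "B \<subseteq> carrier M" "M.span B = carrier M"
  using fin_gen_M unfolding fin_gen_def by blast

abbreviation Fe :: "nat \<Rightarrow> ('a, 'b, 'n) module_scheme" where
  "Fe e \<equiv> frob_push p e R M"

lemma module_Fe: "module R (Fe e)" by (rule frob_push_is_module[OF module_M])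

lemma form_Fe_mult:
  assumes \<phi>: "linear_form (Fe e) \<phi>" and "r \<in> carrier R" "x \<in> carrier M"
  shows "\<phi> ((r [^] (p ^ e)) \<odot>\<^bsub>M\<^esub> x) = r \<otimes> \<phi> x"
  using linear_formD(3)[OF \<phi> assms(2)] assms(3) by simp

lemma form_Fe_add:
  assumes \<phi>: "linear_form (Fe e) \<phi>" and "x \<in> carrier M" "y \<in> carrier M"
  shows "\<phi> (x \<oplus>\<^bsub>M\<^esub> y) = \<phi> x \<oplus> \<phi> y"
  using linear_formD(2)[OF \<phi>] assms(2,3) by simp

lemma form_Fe_closed:
  assumes \<phi>: "linear_form (Fe e) \<phi>" and "x \<in> carrier M"
  shows "\<phi> x \<in> carrier R"
  using linear_formD(1)[OF \<phi>] assms(2) by simp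

text \<open>Near Q, where s is invertible and J vanishes, \<open>F\<^sup>e\<^sub>*M\<close> is
  generated by the products of U and B, so it cannot surject onto a free module of larger rank. The
  proof clears denominators: the multiples s \<delta>_ij of the entries of an identity matrix are
  expressed through \<open>card (U \<times> B)\<close> coefficients, and a dependence modulo Q among
  these gives a contradiction.\<close>

lemma dual_family_card_le:
  assumes Q: "primeideal Q R" and s: "s \<in> carrier R - Q"
    and J: "ideal J R" "\<And>j. j \<in> J \<Longrightarrow> s \<otimes> j = \<zero>"
    and U: "finite U" "U \<subseteq> carrier R" "carrier R \<subseteq> gspan (Fr e) J U"
    and B: "finite B" "B \<subseteq> carrier M" "M.span B = carrier M"
    and d: "dual_family (Fe e) n \<phi> x"
  shows "n \<le> card U * card B"
proof (rule ccontr)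
  assume "\<not> ?thesis"
  then have less: "card (U \<times> B) < card {..<n}" by (simp add: card_cartesian_product)
  interpret Q: primeideal Q R by (rule Q)
  interpret J: ideal J R by (rule J(1))
  note \<phi> = dual_familyD(1)[OF d] and \<phi>x = dual_familyD(3)[OF d]
  have xc: "x i \<in> carrier M" if "i < n" for i using dual_familyD(2)[OF d that] by simp
  have sc: "s \<in> carrier R" using s by simp
  have UBc: "u \<in> carrier R" "b \<in> carrier M" if "(u, b) \<in> U \<times> B" for u b
    using that U(2) B(2) by auto
  text \<open>\<open>s\<^sup>q\<close> kills \<open>J M\<close>, so \<open>s\<^sup>q y\<close> only depends on coefficients with respect to \<open>U \<times> B\<close>.\<close>
  let ?q = "p ^ e"
  have spow: "s [^] ?q \<otimes> j = \<zero>" if "j \<in> J" for j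
  proof -
    obtain m where m: "?q = Suc m" using q_pos[of e] gr0_conv_Suc by blast
    have jc: "j \<in> carrier R" by (rule J.Icarr[OF that])
    have "s [^] ?q \<otimes> j = s [^] m \<otimes> (s \<otimes> j)" unfolding m nat_pow_Suc using sc jc by (simp add: m_assoc)
    then show ?thesis using J(2)[OF that] sc by simp
  qed
  \<comment> \<open>The coefficients c depend on y but not on i: this makes the dependence found
    later hold for all forms simultaneously.\<close>
  define T where "T y \<longleftrightarrow> (\<exists>c. (\<forall>k\<in>U \<times> B. c k \<in> carrier R) \<and>
      (\<forall>i<n. s \<otimes> \<phi> i y = (\<Oplus>k\<in>U \<times> B. c k \<otimes> \<phi> i ((s [^] ?q \<otimes> fst k) \<odot>\<^bsub>M\<^esub> snd k))))" for y
  have kc: "(s [^] ?q \<otimes> fst k) \<odot>\<^bsub>M\<^esub> snd k \<in> carrier M" if "k \<in> U \<times> B" for k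
    using that sc UBc[of "fst k" "snd k"] by simp
  have \<phi>k: "\<phi> i ((s [^] ?q \<otimes> fst k) \<odot>\<^bsub>M\<^esub> snd k) \<in> carrier R" if "k \<in> U \<times> B" "i < n" for i k
    by (rule form_Fe_closed[OF \<phi>[OF that(2)] kc[OF that(1)]])
  have T_add: "T (y \<oplus>\<^bsub>M\<^esub> y')" if y: "y \<in> carrier M" "y' \<in> carrier M" and Ty: "T y" and Ty': "T y'" for y y'
  proof -
    obtain c where c: "\<forall>k\<in>U \<times> B. c k \<in> carrier R"
      "\<forall>i<n. s \<otimes> \<phi> i y = (\<Oplus>k\<in>U \<times> B. c k \<otimes> \<phi> i ((s [^] ?q \<otimes> fst k) \<odot>\<^bsub>M\<^esub> snd k))"
      using Ty unfolding T_def by (elim exE conjE)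
    obtain c' where c': "\<forall>k\<in>U \<times> B. c' k \<in> carrier R"
      "\<forall>i<n. s \<otimes> \<phi> i y' = (\<Oplus>k\<in>U \<times> B. c' k \<otimes> \<phi> i ((s [^] ?q \<otimes> fst k) \<odot>\<^bsub>M\<^esub> snd k))"
      using Ty' unfolding T_def by (elim exE conjE)
    have ck: "c k \<in> carrier R" "c' k \<in> carrier R" if "k \<in> U \<times> B" for k
      by (rule bspec[OF c(1) that], rule bspec[OF c'(1) that])
    have "s \<otimes> \<phi> i (y \<oplus>\<^bsub>M\<^esub> y')
        = (\<Oplus>k\<in>U \<times> B. (c k \<oplus> c' k) \<otimes> \<phi> i ((s [^] ?q \<otimes> fst k) \<odot>\<^bsub>M\<^esub> snd k))" if i: "i < n" for i
    proof -
      have "s \<otimes> \<phi> i (y \<oplus>\<^bsub>M\<^esub> y') = s \<otimes> \<phi> i y \<oplus> s \<otimes> \<phi> i y'"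
        using form_Fe_add[OF \<phi>[OF i] y] form_Fe_closed[OF \<phi>[OF i]] y sc by (simp add: r_distr)
      also have "\<dots> = (\<Oplus>k\<in>U \<times> B. c k \<otimes> \<phi> i ((s [^] ?q \<otimes> fst k) \<odot>\<^bsub>M\<^esub> snd k) \<oplus>
          c' k \<otimes> \<phi> i ((s [^] ?q \<otimes> fst k) \<odot>\<^bsub>M\<^esub> snd k))"
        unfolding c(2)[rule_format, OF i] c'(2)[rule_format, OF i]
        by (rule finsum_addf[symmetric]) (intro Pi_I m_closed ck \<phi>k i, assumption+)+
      also have "\<dots> = (\<Oplus>k\<in>U \<times> B. (c k \<oplus> c' k) \<otimes> \<phi> i ((s [^] ?q \<otimes> fst k) \<odot>\<^bsub>M\<^esub> snd k))"
      proof (rule add.finprod_cong'[OF refl])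
        show "(\<lambda>k. (c k \<oplus> c' k) \<otimes> \<phi> i ((s [^] ?q \<otimes> fst k) \<odot>\<^bsub>M\<^esub> snd k)) \<in> U \<times> B \<rightarrow> carrier R"
          by (intro Pi_I m_closed a_closed ck \<phi>k i)
      qed (intro l_distr[symmetric] ck \<phi>k i)
      finally show ?thesis .
    qed
    then show ?thesis unfolding T_def using c(1) c'(1) by (intro exI[of _ "\<lambda>k. c k \<oplus> c' k"]) simp
  qed
  have T_zeroI: "T y" if "\<And>i. i < n \<Longrightarrow> s \<otimes> \<phi> i y = \<zero>" for y
  proof -
    have "(\<Oplus>k\<in>U \<times> B. \<zero> \<otimes> \<phi> i ((s [^] ?q \<otimes> fst k) \<odot>\<^bsub>M\<^esub> snd k)) = (\<Oplus>k\<in>U \<times> B. \<zero>)" if "i < n" for i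
      by (rule add.finprod_cong') (use \<phi>k that in simp_all)
    then show ?thesis unfolding T_def using that by (intro exI[of _ "\<lambda>k. \<zero>"]) simp
  qed
  have T_gen: "T (r \<odot>\<^bsub>M\<^esub> b)" if r: "r \<in> carrier R" and b: "b \<in> B" for r b
  proof -
    have bc: "b \<in> carrier M" using b B(2) by auto
    have "r \<in> gspan (Fr e) J U" by (rule subsetD[OF U(3) r])
    then show ?thesis
    proof induction
      case (base j)
      have jc: "j \<in> carrier R" by (rule J.Icarr[OF base])
      show ?case
      proof (rule T_zeroI)
        fix i assume i: "i < n"
        have "s \<otimes> \<phi> i (j \<odot>\<^bsub>M\<^esub> b) = \<phi> i ((s [^] ?q) \<odot>\<^bsub>M\<^esub> (j \<odot>\<^bsub>M\<^esub> b))"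
          by (rule form_Fe_mult[OF \<phi>[OF i] sc, symmetric]) (use jc bc in simp)
        also have "(s [^] ?q) \<odot>\<^bsub>M\<^esub> (j \<odot>\<^bsub>M\<^esub> b) = (s [^] ?q \<otimes> j) \<odot>\<^bsub>M\<^esub> b"
          by (rule M.smult_assoc1[symmetric]) (use sc jc bc in simp_all)
        also have "\<dots> = \<zero>\<^bsub>M\<^esub>" unfolding spow[OF base] using bc by simp
        also have "\<phi> i \<zero>\<^bsub>M\<^esub> = \<zero>" using linear_form_zero[OF module_Fe \<phi>[OF i]] by simp
        finally show "s \<otimes> \<phi> i (j \<odot>\<^bsub>M\<^esub> b) = \<zero>" .
      qed
    next
      case (step y d u)
      obtain t where t: "t \<in> carrier R" "d = t [^] ?q" using step.hyps(2) unfolding Fr_def by (elim imageE)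
      have uc: "u \<in> carrier R" by (rule subsetD[OF U(2) step.hyps(3)])
      have yc: "y \<in> carrier R"
        by (rule subsetD[OF gspan_carrier[OF Fr_carrier J.a_subset U(2)] step.hyps(1)])
      have "T ((d \<otimes> u) \<odot>\<^bsub>M\<^esub> b)"
        unfolding T_def
      proof (intro exI[of _ "\<lambda>k. if k = (u, b) then t else \<zero>"] conjI allI impI)
        fix i assume i: "i < n"
        have k: "(u, b) \<in> U \<times> B" using step.hyps(3) b by simp
        have "(\<Oplus>k\<in>U \<times> B. (if k = (u, b) then t else \<zero>) \<otimes> \<phi> i ((s [^] ?q \<otimes> fst k) \<odot>\<^bsub>M\<^esub> snd k))
            = (\<Oplus>k\<in>U \<times> B. if (u, b) = k then t \<otimes> \<phi> i ((s [^] ?q \<otimes> fst k) \<odot>\<^bsub>M\<^esub> snd k) else \<zero>)"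
          by (rule add.finprod_cong') (use \<phi>k i t in auto)
        also have "\<dots> = t \<otimes> \<phi> i ((s [^] ?q \<otimes> fst (u, b)) \<odot>\<^bsub>M\<^esub> snd (u, b))"
          by (rule add.finprod_singleton[OF k]) (use U(1) B(1) \<phi>k[OF _ i] t in auto)
        also have "\<dots> = \<phi> i ((t [^] ?q) \<odot>\<^bsub>M\<^esub> ((s [^] ?q \<otimes> u) \<odot>\<^bsub>M\<^esub> b))"
          using form_Fe_mult[OF \<phi>[OF i] t(1) kc[OF k]] by simp
        also have "(t [^] ?q) \<odot>\<^bsub>M\<^esub> ((s [^] ?q \<otimes> u) \<odot>\<^bsub>M\<^esub> b) = (s [^] ?q) \<odot>\<^bsub>M\<^esub> ((d \<otimes> u) \<odot>\<^bsub>M\<^esub> b)"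
        proof -
          have "t [^] ?q \<otimes> (s [^] ?q \<otimes> u) = s [^] ?q \<otimes> (d \<otimes> u)" unfolding t(2) using t(1) sc uc by (simp add: m_lcomm)
          then show ?thesis using t sc uc bc by (simp add: M.smult_assoc1[symmetric])
        qed
        also have "\<phi> i \<dots> = s \<otimes> \<phi> i ((d \<otimes> u) \<odot>\<^bsub>M\<^esub> b)"
          by (rule form_Fe_mult[OF \<phi>[OF i] sc]) (use t uc bc in simp)
        finally show "s \<otimes> \<phi> i ((d \<otimes> u) \<odot>\<^bsub>M\<^esub> b)
            = (\<Oplus>k\<in>U \<times> B. (if k = (u, b) then t else \<zero>) \<otimes> \<phi> i ((s [^] ?q \<otimes> fst k) \<odot>\<^bsub>M\<^esub> snd k))"
          by (rule sym)
      qed (use t in simp)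
      moreover have "(y \<oplus> d \<otimes> u) \<odot>\<^bsub>M\<^esub> b = y \<odot>\<^bsub>M\<^esub> b \<oplus>\<^bsub>M\<^esub> (d \<otimes> u) \<odot>\<^bsub>M\<^esub> b"
        using t uc yc bc by (simp add: M.smult_l_distr)
      ultimately show ?case using T_add[OF _ _ step.IH] t uc yc bc by simp
    qed
  qed
  have T: "T y" if "y \<in> carrier M" for y
  proof (rule M.span_induct[OF B(1,2)])
    show "y \<in> M.span B" using that B(3) by simp
    show "T \<zero>\<^bsub>M\<^esub>" by (rule T_zeroI) (use linear_form_zero[OF module_Fe \<phi>] sc in simp)
  qed (rule T_add T_gen, assumption+)+
  have "\<forall>j. \<exists>c. j < n \<longrightarrow> (\<forall>k\<in>U \<times> B. c k \<in> carrier R) \<and>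
      (\<forall>i<n. s \<otimes> \<phi> i (x j) = (\<Oplus>k\<in>U \<times> B. c k \<otimes> \<phi> i ((s [^] ?q \<otimes> fst k) \<odot>\<^bsub>M\<^esub> snd k)))"
  proof
    fix j
    show "\<exists>c. j < n \<longrightarrow> (\<forall>k\<in>U \<times> B. c k \<in> carrier R) \<and>
      (\<forall>i<n. s \<otimes> \<phi> i (x j) = (\<Oplus>k\<in>U \<times> B. c k \<otimes> \<phi> i ((s [^] ?q \<otimes> fst k) \<odot>\<^bsub>M\<^esub> snd k)))"
    proof (cases "j < n")
      case True
      show ?thesis using T[OF xc[OF True]] unfolding T_def by (elim exE) (rule exI, rule impI)
    qed simp
  qed
  from choice[OF this] obtain c where c: "\<forall>j. j < n \<longrightarrow> (\<forall>k\<in>U \<times> B. c j k \<in> carrier R) \<and>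
      (\<forall>i<n. s \<otimes> \<phi> i (x j) = (\<Oplus>k\<in>U \<times> B. c j k \<otimes> \<phi> i ((s [^] ?q \<otimes> fst k) \<odot>\<^bsub>M\<^esub> snd k)))"
    by (elim exE)
  have cc: "c j k \<in> carrier R" if "j \<in> {..<n}" "k \<in> U \<times> B" for j k 
    by (rule bspec[OF conjunct1[OF c[rule_format]] that(2)]) (use that(1) in simp)
  have ceq: "s \<otimes> \<phi> i (x j) = (\<Oplus>k\<in>U \<times> B. c j k \<otimes> \<phi> i ((s [^] ?q \<otimes> fst k) \<odot>\<^bsub>M\<^esub> snd k))"
    if "j < n" "i < n" for i j using c that by simp
  have fin: "finite (U \<times> B)" using U(1) B(1) by simp
  have "\<exists>a. a \<in> {..<n} \<rightarrow> carrier R \<and> (\<exists>j\<in>{..<n}. a j \<notin> Q) \<and>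
      (\<forall>k\<in>U \<times> B. (\<Oplus>j\<in>{..<n}. a j \<otimes> c j k) \<in> Q)"
    by (intro dependence_mod_prime[OF Q finite_lessThan fin less] cc)
  then obtain a i where a: "a \<in> {..<n} \<rightarrow> carrier R" "\<forall>k\<in>U \<times> B. (\<Oplus>j\<in>{..<n}. a j \<otimes> c j k) \<in> Q"
    and i: "i \<in> {..<n}" "a i \<notin> Q" by (elim exE conjE bexE) (rule that)
  have ac: "a j \<in> carrier R" if "j \<in> {..<n}" for j by (rule funcset_mem[OF a(1) that])
  have i': "i < n" using i by simp
  let ?f = "\<lambda>k. \<phi> i ((s [^] ?q \<otimes> fst k) \<odot>\<^bsub>M\<^esub> snd k)"
  \<comment> \<open>The form chosen is the one at an index i with a_i outside Q. Evaluating the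
    dependence there yields a_i s on one side and an element of Q on the other.\<close>
  have "(\<Oplus>j\<in>{..<n}. (a j \<otimes> s) \<otimes> (if i = j then \<one> else \<zero>)) = a i \<otimes> s"
    by (rule finsum_unit_vectors[where v = "\<lambda>j. a j \<otimes> s", OF _ i']) (use ac sc in \<open>simp add: vec_def\<close>)
  moreover have "(\<Oplus>j\<in>{..<n}. (a j \<otimes> s) \<otimes> (if i = j then \<one> else \<zero>))
      = (\<Oplus>j\<in>{..<n}. \<Oplus>k\<in>U \<times> B. a j \<otimes> c j k \<otimes> ?f k)"
  proof (rule add.finprod_cong'[OF refl])
    fix j assume j: "j \<in> {..<n}"
    have "(a j \<otimes> s) \<otimes> (if i = j then \<one> else \<zero>) = a j \<otimes> (s \<otimes> \<phi> i (x j))"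
      using \<phi>x[OF i', of j] j ac[OF j] sc by (simp add: m_assoc)
    also have "\<dots> = (\<Oplus>k\<in>U \<times> B. a j \<otimes> (c j k \<otimes> ?f k))"
      unfolding ceq[OF _ i', of j, OF lessThan_iff[THEN iffD1, OF j]]
      by (rule finsum_rdistr[OF fin ac[OF j]]) (use cc[OF j] \<phi>k[OF _ i'] in simp)
    also have "\<dots> = (\<Oplus>k\<in>U \<times> B. a j \<otimes> c j k \<otimes> ?f k)"
      by (rule add.finprod_cong') (use cc[OF j] \<phi>k[OF _ i'] ac[OF j] in \<open>simp_all add: m_assoc\<close>)
    finally show "(a j \<otimes> s) \<otimes> (if i = j then \<one> else \<zero>) = (\<Oplus>k\<in>U \<times> B. a j \<otimes> c j k \<otimes> ?f k)" .
  next
    show "(\<lambda>j. \<Oplus>k\<in>U \<times> B. a j \<otimes> c j k \<otimes> ?f k) \<in> {..<n} \<rightarrow> carrier R"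
      by (intro Pi_I finsum_closed m_closed ac cc \<phi>k i')
  qed
  moreover have "(\<Oplus>j\<in>{..<n}. \<Oplus>k\<in>U \<times> B. a j \<otimes> c j k \<otimes> ?f k)
      = (\<Oplus>k\<in>U \<times> B. \<Oplus>j\<in>{..<n}. a j \<otimes> c j k \<otimes> ?f k)"
    by (rule finsum_swap[OF finite_lessThan fin]) (intro m_closed ac cc \<phi>k i')
  moreover have "(\<Oplus>k\<in>U \<times> B. \<Oplus>j\<in>{..<n}. a j \<otimes> c j k \<otimes> ?f k) \<in> Q"
  proof (rule ideal_finsum[OF Q.ideal_axioms fin])
    fix k assume k: "k \<in> U \<times> B"
    have "(\<Oplus>j\<in>{..<n}. a j \<otimes> c j k) \<otimes> ?f k \<in> Q"
      by (rule Q.I_r_closed[OF bspec[OF a(2) k] \<phi>k[OF k i']])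
    moreover have "(\<Oplus>j\<in>{..<n}. a j \<otimes> c j k) \<otimes> ?f k = (\<Oplus>j\<in>{..<n}. a j \<otimes> c j k \<otimes> ?f k)"
      by (rule finsum_ldistr[OF finite_lessThan \<phi>k[OF k i']]) (intro Pi_I m_closed ac cc k)
    ultimately show "(\<Oplus>j\<in>{..<n}. a j \<otimes> c j k \<otimes> ?f k) \<in> Q" by (simp only:)
  qed
  ultimately have "a i \<otimes> s \<in> Q" by (simp only:)
  then show False using Q.I_prime[OF ac[OF i(1)] sc] i(2) s by blast
qed

text \<open>The map \<open>x \<mapsto> (h k x)\<^sub>k\<close> is linear from \<open>F\<^sub>*M\<close> to \<open>M^\<rho>\<close>; below, \<open>hits_multiples\<close> says that \<open>c\<close>
  kills its cokernel.\<close>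

definition cartier_family :: "nat \<Rightarrow> (nat \<Rightarrow> 'b \<Rightarrow> 'b) \<Rightarrow> bool" where
  "cartier_family \<rho> h \<longleftrightarrow> (\<forall>k<\<rho>. \<forall>x\<in>carrier M. h k x \<in> carrier M \<and>
     (\<forall>y\<in>carrier M. h k (x \<oplus>\<^bsub>M\<^esub> y) = h k x \<oplus>\<^bsub>M\<^esub> h k y) \<and>
     (\<forall>r\<in>carrier R. h k ((r [^] p) \<odot>\<^bsub>M\<^esub> x) = r \<odot>\<^bsub>M\<^esub> h k x))"

lemma cartier_familyD:
  assumes "cartier_family \<rho> h" "k < \<rho>" "x \<in> carrier M"
  shows "h k x \<in> carrier M"
    "y \<in> carrier M \<Longrightarrow> h k (x \<oplus>\<^bsub>M\<^esub> y) = h k x \<oplus>\<^bsub>M\<^esub> h k y"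
    "r \<in> carrier R \<Longrightarrow> h k ((r [^] p) \<odot>\<^bsub>M\<^esub> x) = r \<odot>\<^bsub>M\<^esub> h k x"
  using assms unfolding cartier_family_def by simp_all

definition hits_multiples :: "nat \<Rightarrow> (nat \<Rightarrow> 'b \<Rightarrow> 'b) \<Rightarrow> 'a \<Rightarrow> bool" where
  "hits_multiples \<rho> h c \<longleftrightarrow> (\<forall>v. (\<forall>k<\<rho>. v k \<in> carrier M) \<longrightarrow> (\<exists>x\<in>carrier M. \<forall>k<\<rho>. h k x = c \<odot>\<^bsub>M\<^esub> v k))"

lemma hits_multiplesD:
  assumes "hits_multiples \<rho> h c" "\<forall>k<\<rho>. v k \<in> carrier M"
  shows "\<exists>x\<in>carrier M. \<forall>k<\<rho>. h k x = c \<odot>\<^bsub>M\<^esub> v k"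
  using assms unfolding hits_multiples_def by simp

lemma hits_multiples_ideal:
  assumes h: "cartier_family \<rho> h"
  shows "ideal {c \<in> carrier R. hits_multiples \<rho> h c} R"
proof (rule idealI_cring)
  note hD = cartier_familyD[OF h]
  have h0: "h k \<zero>\<^bsub>M\<^esub> = \<zero>\<^bsub>M\<^esub>" if "k < \<rho>" for k
  proof -
    have "h k ((\<zero> [^] p) \<odot>\<^bsub>M\<^esub> \<zero>\<^bsub>M\<^esub>) = \<zero> \<odot>\<^bsub>M\<^esub> h k \<zero>\<^bsub>M\<^esub>"
      by (rule hD(3)[OF that M.M.zero_closed zero_closed])
    then show ?thesis using hD(1)[OF that M.M.zero_closed] by simp
  qed
  show "\<zero> \<in> {c \<in> carrier R. hits_multiples \<rho> h c}"
    unfolding hits_multiples_def using h0 by (intro CollectI conjI zero_closed allI impI bexI[of _ "\<zero>\<^bsub>M\<^esub>"]) simp_all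
  show "c \<oplus> d \<in> {c \<in> carrier R. hits_multiples \<rho> h c}"
    if cd: "c \<in> {c \<in> carrier R. hits_multiples \<rho> h c}" "d \<in> {c \<in> carrier R. hits_multiples \<rho> h c}" for c d
  proof -
    have c: "c \<in> carrier R" "hits_multiples \<rho> h c" "d \<in> carrier R" "hits_multiples \<rho> h d" using cd by simp_all
    have "hits_multiples \<rho> h (c \<oplus> d)"
      unfolding hits_multiples_def
    proof (intro allI impI)
      fix v assume v: "\<forall>k<\<rho>. v k \<in> carrier M"
      obtain x where x: "x \<in> carrier M" "\<forall>k<\<rho>. h k x = c \<odot>\<^bsub>M\<^esub> v k"
        using hits_multiplesD[OF c(2) v] by (elim bexE)
      obtain y where y: "y \<in> carrier M" "\<forall>k<\<rho>. h k y = d \<odot>\<^bsub>M\<^esub> v k"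
        using hits_multiplesD[OF c(4) v] by (elim bexE)
      show "\<exists>x\<in>carrier M. \<forall>k<\<rho>. h k x = (c \<oplus> d) \<odot>\<^bsub>M\<^esub> v k"
        using x y v c hD(2)[OF _ x(1) y(1)] by (intro bexI[of _ "x \<oplus>\<^bsub>M\<^esub> y"]) (simp_all add: M.smult_l_distr)
    qed
    then show ?thesis using c by simp
  qed
  show "r \<otimes> c \<in> {c \<in> carrier R. hits_multiples \<rho> h c}"
    if r: "r \<in> carrier R" and c0: "c \<in> {c \<in> carrier R. hits_multiples \<rho> h c}" for r c
  proof -
    have c: "c \<in> carrier R" "hits_multiples \<rho> h c" using c0 by simp_all
    have "hits_multiples \<rho> h (r \<otimes> c)"
      unfolding hits_multiples_def
    proof (intro allI impI)
      fix v assume v: "\<forall>k<\<rho>. v k \<in> carrier M"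
      obtain x where x: "x \<in> carrier M" "\<forall>k<\<rho>. h k x = c \<odot>\<^bsub>M\<^esub> v k"
        using hits_multiplesD[OF c(2) v] by (elim bexE)
      show "\<exists>x\<in>carrier M. \<forall>k<\<rho>. h k x = (r \<otimes> c) \<odot>\<^bsub>M\<^esub> v k"
        using x v c r hD(3)[OF _ x(1) r]
        by (intro bexI[of _ "(r [^] p) \<odot>\<^bsub>M\<^esub> x"]) (simp_all add: M.smult_assoc1)
    qed
    then show ?thesis using c r by simp
  qed
qed simp

lemma dual_family_mono: "dual_family N n \<phi> x \<Longrightarrow> m \<le> n \<Longrightarrow> dual_family N m \<phi> x"
  unfolding dual_family_def by simp

text \<open>One step of the recursion. Composing h with the n forms on each of the \<rho> slots maps
  \<open>F\<^sup>e\<^sup>+\<^sup>1\<^sub>*M\<close> to \<open>R^(n \<rho>)\<close>. The ideal I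
  kills the cokernel of h, so the cokernel of the composite is generated by \<rho>
  \<open>card B\<close> t elements; \<open>clear_generators\<close> makes the map surjective at the
  price of as many coordinates, and preimages of unit vectors complete a dual family.\<close>

lemma dual_family_Suc:
  fixes B :: "'b set"
  assumes h: "cartier_family \<rho> h" and \<rho>: "\<rho> > 0"
    and I: "ideal I R" "\<And>c. c \<in> I \<Longrightarrow> hits_multiples \<rho> h c" and mu: "mu_le e I t"
    and B: "finite B" "B \<subseteq> carrier M" "M.span B = carrier M"
    and k: "\<And>P. primeideal P R \<Longrightarrow> rk P < p ^ k"
    and d: "dual_family (Fe e) n \<phi> x" and le: "k + \<rho> * card B * t \<le> n * \<rho>"
  shows "\<exists>\<psi> y. dual_family (Fe (Suc e)) (n * \<rho> - \<rho> * card B * t) \<psi> y"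
proof -
  interpret I: ideal I R by (rule I(1))
  note hD = cartier_familyD[OF h]
  note \<phi> = dual_familyD(1)[OF d] and \<phi>x = dual_familyD(3)[OF d]
  have xc: "x i \<in> carrier M" if "i < n" for i using dual_familyD(2)[OF d that] by simp
  obtain U where U: "finite U" "card U \<le> t" "U \<subseteq> carrier R" "carrier R \<subseteq> gspan (Fr e) I U"
    using mu unfolding mu_le_def by (elim exE conjE)
  let ?q = "p ^ e"
  define m where "m = n * \<rho>"
  have idiv: "i div \<rho> < n" if "i < m" for i using that \<rho> by (simp add: m_def div_less_iff_less_mult)
  have imod: "i mod \<rho> < \<rho>" for i using \<rho> by simp
  have \<phi>0: "\<phi> i \<zero>\<^bsub>M\<^esub> = \<zero>" if "i < n" for i using linear_form_zero[OF module_Fe \<phi>[OF that]] by simp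
  have \<phi>c: "\<phi> i y \<in> carrier R" if "i < n" "y \<in> carrier M" for i y
    by (rule form_Fe_closed[OF \<phi>[OF that(1)] that(2)])
  have \<phi>a: "\<phi> i (y \<oplus>\<^bsub>M\<^esub> z) = \<phi> i y \<oplus> \<phi> i z" if "i < n" "y \<in> carrier M" "z \<in> carrier M" for i y z
    by (rule form_Fe_add[OF \<phi>[OF that(1)] that(2,3)])
  have \<phi>s: "\<phi> i ((r [^] ?q) \<odot>\<^bsub>M\<^esub> y) = r \<otimes> \<phi> i y" if "i < n" "r \<in> carrier R" "y \<in> carrier M" for i r y
    by (rule form_Fe_mult[OF \<phi>[OF that(1)] that(2,3)])
  \<comment> \<open>Coordinate i of \<open>R^(n \<rho>)\<close> encodes the pair of form
    \<open>i div \<rho>\<close> and slot \<open>i mod \<rho>\<close>.\<close>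
  define \<Phi> where "\<Phi> y i = \<phi> (i div \<rho>) (h (i mod \<rho>) y)" for y i
  have \<Phi>v: "\<Phi> y \<in> vec m" if "y \<in> carrier M" for y
    unfolding vec_def \<Phi>_def using \<phi>c[OF idiv hD(1)[OF imod that]] by simp
  have \<Phi>a: "\<Phi> (y \<oplus>\<^bsub>M\<^esub> z) i = \<Phi> y i \<oplus> \<Phi> z i" if "i < m" "y \<in> carrier M" "z \<in> carrier M" for i y z
    unfolding \<Phi>_def hD(2)[OF imod that(2,3)]
    by (rule \<phi>a[OF idiv[OF that(1)] hD(1)[OF imod that(2)] hD(1)[OF imod that(3)]])
  have \<Phi>s: "\<Phi> ((r [^] (p ^ Suc e)) \<odot>\<^bsub>M\<^esub> y) i = r \<otimes> \<Phi> y i" if "i < m" "r \<in> carrier R" "y \<in> carrier M" for i r y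
  proof -
    have "r [^] (p ^ Suc e) = (r [^] ?q) [^] p" using frob_pow_add[OF that(2), of e 1] by simp
    then have "h (i mod \<rho>) ((r [^] (p ^ Suc e)) \<odot>\<^bsub>M\<^esub> y) = (r [^] ?q) \<odot>\<^bsub>M\<^esub> h (i mod \<rho>) y"
      using hD(3)[OF imod that(3), of "r [^] ?q"] that(2) by simp
    then show ?thesis
      unfolding \<Phi>_def using \<phi>s[OF idiv[OF that(1)] that(2) hD(1)[OF imod that(3)]] by simp
  qed
  define W where "W = {v. \<exists>y\<in>carrier M. \<forall>i<m. v i = \<Phi> y i}"
  have WI: "v \<in> W" if "y \<in> carrier M" "\<And>i. i < m \<Longrightarrow> v i = \<Phi> y i" for v y
    unfolding W_def using that by (intro CollectI bexI[of _ y]) simp_all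
  have WE: "\<exists>y\<in>carrier M. \<forall>i<m. v i = \<Phi> y i" if "v \<in> W" for v using that unfolding W_def by (rule CollectD)
  have \<Phi>r: "\<exists>z\<in>carrier M. \<forall>i<m. r \<otimes> \<Phi> y i = \<Phi> z i" if "r \<in> carrier R" "y \<in> carrier M" for r y
    using \<Phi>s[OF _ that] that by (intro bexI[of _ "(r [^] (p ^ Suc e)) \<odot>\<^bsub>M\<^esub> y"]) simp_all
  have W: "vsub m W"
    unfolding vsub_def
  proof (intro conjI ballI allI impI)
    show "W \<subseteq> vec m"
    proof
      fix v assume "v \<in> W"
      from WE[OF this] obtain y where y: "y \<in> carrier M" "\<forall>i<m. v i = \<Phi> y i" by (elim bexE)
      show "v \<in> vec m" using vecD[OF \<Phi>v[OF y(1)]] y(2) by (simp add: vec_def)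
    qed
    have "\<Phi> \<zero>\<^bsub>M\<^esub> i = \<zero>" if "i < m" for i
    proof -
      have "\<Phi> ((\<zero> [^] (p ^ Suc e)) \<odot>\<^bsub>M\<^esub> \<zero>\<^bsub>M\<^esub>) i = \<zero> \<otimes> \<Phi> \<zero>\<^bsub>M\<^esub> i"
        by (rule \<Phi>s[OF that zero_closed M.M.zero_closed])
      then show ?thesis using vecD[OF \<Phi>v[OF M.M.zero_closed] that] by simp
    qed
    then show "(\<lambda>_. \<zero>) \<in> W" by (intro WI[of "\<zero>\<^bsub>M\<^esub>"]) simp_all
    fix v assume "v \<in> W"
    from WE[OF this] obtain y where y: "y \<in> carrier M" "\<forall>i<m. v i = \<Phi> y i" by (elim bexE)
    {
      fix v' assume "v' \<in> W"
      from WE[OF this] obtain y' where y': "y' \<in> carrier M" "\<forall>i<m. v' i = \<Phi> y' i" by (elim bexE)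
      show "(\<lambda>i. v i \<oplus> v' i) \<in> W"
        by (rule WI[of "y \<oplus>\<^bsub>M\<^esub> y'"]) (use y y' \<Phi>a in simp_all)
    next
      fix r assume r: "r \<in> carrier R"
      obtain z where "z \<in> carrier M" "\<forall>i<m. r \<otimes> \<Phi> y i = \<Phi> z i" using \<Phi>r[OF r y(1)] by (elim bexE)
      then show "(\<lambda>i. r \<otimes> v i) \<in> W" using y(2) by (intro WI[of z]) simp_all
    next
      fix v' assume "\<forall>i<m. v i = v' i"
      then show "v' \<in> W" using y by (intro WI[of y]) simp_all
    }
  qed
  \<comment> \<open>The image in \<open>R^(n \<rho>)\<close> of the tuple with z in slot l and zeros
    elsewhere. Such images, for z = u b with u in U and b in B, generate the cokernel.\<close>
  define E where "E l z i = (if i mod \<rho> = l then \<phi> (i div \<rho>) z else \<zero>)" for l z i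
  have Ev: "E l z \<in> vec m" if "z \<in> carrier M" for l z
    unfolding vec_def E_def using \<phi>c[OF idiv that] by simp
  define S where "S = (\<lambda>(l, b, u). E l (u \<odot>\<^bsub>M\<^esub> b)) ` ({..<\<rho>} \<times> B \<times> U)"
  have ubc: "u \<odot>\<^bsub>M\<^esub> b \<in> carrier M" if "u \<in> U" "b \<in> B" for u b
    using subsetD[OF U(3) that(1)] subsetD[OF B(2) that(2)] by simp
  have S: "finite S" "S \<subseteq> vec m"
    unfolding S_def using B(1) U(1) Ev[OF ubc] by (simp, auto)
  have "card S \<le> card ({..<\<rho>} \<times> B \<times> U)" unfolding S_def using B(1) U(1) by (intro card_image_le) simp
  also have "\<dots> \<le> \<rho> * card B * t" using U(2) by (simp add: card_cartesian_product mult_le_mono)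
  finally have cardS: "card S \<le> \<rho> * card B * t" .
  have "vgen m W (card S)"
  proof (rule vgen_finite[OF S W])
    fix W' assume W': "vsub m W'" "W \<subseteq> W'" "S \<subseteq> W'"
    note D = vsubD[OF W'(1)]
    have E_add: "E l (y \<oplus>\<^bsub>M\<^esub> z) \<in> W'" if "E l y \<in> W'" "E l z \<in> W'" "y \<in> carrier M" "z \<in> carrier M" for l y z
      by (rule D(5)[OF D(3)[OF that(1,2)]]) (use \<phi>a[OF idiv that(3,4)] in \<open>simp add: E_def\<close>)
    have E_gen: "E l (r \<odot>\<^bsub>M\<^esub> b) \<in> W'" if l: "l < \<rho>" and r: "r \<in> carrier R" and b: "b \<in> B" for l r b
    proof -
      have bc: "b \<in> carrier M" by (rule subsetD[OF B(2) b])
      have "r \<in> gspan (Fr e) I U" by (rule subsetD[OF U(4) r])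
      then show ?thesis
      proof induction
        case (base c)
        have cc: "c \<in> carrier R" by (rule I.Icarr[OF base])
        have "\<exists>y\<in>carrier M. \<forall>j<\<rho>. h j y = c \<odot>\<^bsub>M\<^esub> (if j = l then b else \<zero>\<^bsub>M\<^esub>)"
          by (rule hits_multiplesD[OF I(2)[OF base]]) (use bc in simp)
        then obtain y where y: "y \<in> carrier M" "\<forall>j<\<rho>. h j y = c \<odot>\<^bsub>M\<^esub> (if j = l then b else \<zero>\<^bsub>M\<^esub>)"
          by (elim bexE)
        \<comment> \<open>For c in I, \<open>hits_multiples\<close> provides a preimage under h of
          the tuple with c b in slot l, so this vector already lies in the image W.\<close>
        have "E l (c \<odot>\<^bsub>M\<^esub> b) \<in> W"
        proof (rule WI[OF y(1)])
          fix i assume i: "i < m"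
          have "h (i mod \<rho>) y = (if i mod \<rho> = l then c \<odot>\<^bsub>M\<^esub> b else \<zero>\<^bsub>M\<^esub>)"
            using y(2) imod[of i] cc by simp
          then show "E l (c \<odot>\<^bsub>M\<^esub> b) i = \<Phi> y i" unfolding E_def \<Phi>_def using \<phi>0[OF idiv[OF i]] by simp
        qed
        then show ?case by (rule subsetD[OF W'(2)])
      next
        case (step y c u)
        obtain r where r: "r \<in> carrier R" "c = r [^] ?q" using step.hyps(2) unfolding Fr_def by (elim imageE)
        have uc: "u \<in> carrier R" by (rule subsetD[OF U(3) step.hyps(3)])
        have yc: "y \<in> carrier R"
          by (rule subsetD[OF gspan_carrier[OF Fr_carrier I.a_subset U(3)] step.hyps(1)])
        have "E l (u \<odot>\<^bsub>M\<^esub> b) \<in> S"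
          unfolding S_def by (rule image_eqI[of _ _ "(l, b, u)"]) (use l b step.hyps(3) in simp_all)
        then have EuW: "E l (u \<odot>\<^bsub>M\<^esub> b) \<in> W'" by (rule subsetD[OF W'(3)])
        have "E l ((c \<otimes> u) \<odot>\<^bsub>M\<^esub> b) \<in> W'"
        proof (rule D(5)[OF D(4)[OF r(1) EuW]])
          fix i assume i: "i < m"
          have "(c \<otimes> u) \<odot>\<^bsub>M\<^esub> b = (r [^] ?q) \<odot>\<^bsub>M\<^esub> (u \<odot>\<^bsub>M\<^esub> b)"
            unfolding r(2) by (rule M.smult_assoc1) (use r(1) uc bc in simp_all)
          then show "E l ((c \<otimes> u) \<odot>\<^bsub>M\<^esub> b) i = r \<otimes> E l (u \<odot>\<^bsub>M\<^esub> b) i"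
            unfolding E_def using \<phi>s[OF idiv[OF i] r(1) ubc[OF step.hyps(3) b]] r(1) by simp
        qed
        moreover have "(y \<oplus> c \<otimes> u) \<odot>\<^bsub>M\<^esub> b = y \<odot>\<^bsub>M\<^esub> b \<oplus>\<^bsub>M\<^esub> (c \<otimes> u) \<odot>\<^bsub>M\<^esub> b"
          by (rule M.smult_l_distr) (use yc r uc bc in simp_all)
        ultimately show ?case using E_add[OF step.IH] yc r uc bc by simp
      qed
    qed
    have E_all: "E l z \<in> W'" if "l < \<rho>" "z \<in> carrier M" for l z
    proof -
      have "z \<in> carrier M \<and> E l z \<in> W'"
      proof (rule M.span_induct[OF B(1,2)])
        show "z \<in> M.span B" using that(2) B(3) by simp
        show "\<zero>\<^bsub>M\<^esub> \<in> carrier M \<and> E l \<zero>\<^bsub>M\<^esub> \<in> W'"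
          by (intro conjI M.M.zero_closed D(5)[OF D(2)]) (use \<phi>0[OF idiv] in \<open>simp add: E_def\<close>)
        show "y \<oplus>\<^bsub>M\<^esub> z \<in> carrier M \<and> E l (y \<oplus>\<^bsub>M\<^esub> z) \<in> W'"
          if "y \<in> carrier M \<and> E l y \<in> W'" "z \<in> carrier M \<and> E l z \<in> W'" for y z
          using E_add[of l y z] that by simp
        show "r \<odot>\<^bsub>M\<^esub> b \<in> carrier M \<and> E l (r \<odot>\<^bsub>M\<^esub> b) \<in> W'" if rb: "r \<in> carrier R" "b \<in> B" for r b
          using E_gen[OF \<open>l < \<rho>\<close> rb] subsetD[OF B(2) rb(2)] rb(1) by simp
      qed
      then show ?thesis by (rule conjunct2)
    qed
    show "vec m \<subseteq> W'"
    proof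
      fix v assume v: "v \<in> vec m"
      \<comment> \<open>Coordinates in slot l are prescribed through the dual elements; the scalars
        are raised to the power p^e because that is how R acts on
        \<open>F\<^sup>e\<^sub>*M\<close>.\<close>
      define y where "y l = (\<Oplus>\<^bsub>M\<^esub>j\<in>{..<n}. (v (j * \<rho> + l) [^] ?q) \<odot>\<^bsub>M\<^esub> x j)" for l
      have jl: "j * \<rho> + l < m" if "j < n" "l < \<rho>" for j l
      proof -
        have "j * \<rho> + l < Suc j * \<rho>" using that(2) by simp
        also have "\<dots> \<le> n * \<rho>" using that(1) by (intro mult_le_mono1) simp
        finally show ?thesis by (simp add: m_def)
      qed
      have vc: "v (j * \<rho> + l) \<in> carrier R" if "j < n" "l < \<rho>" for j l by (rule vecD[OF v jl[OF that]])
      have yc: "y l \<in> carrier M" if "l < \<rho>" for l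
        unfolding y_def by (rule M.M.finsum_closed) (use vc[OF _ that] xc in simp)
      have \<phi>y: "\<phi> i (y l) = v (i * \<rho> + l)" if i: "i < n" and l: "l < \<rho>" for i l
      proof -
        have "\<phi> i (\<Oplus>\<^bsub>Fe e\<^esub>j\<in>{..<n}. (v (j * \<rho> + l) [^] ?q) \<odot>\<^bsub>M\<^esub> x j)
            = (\<Oplus>j\<in>{..<n}. \<phi> i ((v (j * \<rho> + l) [^] ?q) \<odot>\<^bsub>M\<^esub> x j))"
          by (rule linear_form_finsum[OF module_Fe \<phi>[OF i] finite_lessThan]) (use vc[OF _ l] xc in simp)
        also have "\<dots> = (\<Oplus>j\<in>{..<n}. v (j * \<rho> + l) \<otimes> (if i = j then \<one> else \<zero>))"
          by (rule add.finprod_cong') (use \<phi>s[OF i vc[OF _ l] xc] \<phi>x[OF i] vc[OF _ l] in simp_all)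
        also have "\<dots> = v (i * \<rho> + l)"
          by (rule finsum_unit_vectors[where v = "\<lambda>j. v (j * \<rho> + l)", OF _ i]) (use vc[OF _ l] in \<open>simp add: vec_def\<close>)
        finally show ?thesis unfolding y_def by (simp add: finsum_def)
      qed
      \<comment> \<open>The vector v is assembled slot by slot, since only vectors supported in a
        single slot are known to lie in \<open>W'\<close>.\<close>
      have "(\<lambda>i. if i mod \<rho> < j then \<phi> (i div \<rho>) (y (i mod \<rho>)) else \<zero>) \<in> W'" if "j \<le> \<rho>" for j
        using that
      proof (induction j)
        case 0
        show ?case using D(2) by simp
      next
        case (Suc j)
        have IH: "(\<lambda>i. if i mod \<rho> < j then \<phi> (i div \<rho>) (y (i mod \<rho>)) else \<zero>) \<in> W'"
          by (rule Suc.IH) (use Suc.prems in simp)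
        have Ej: "E j (y j) \<in> W'" by (rule E_all[OF _ yc]) (use Suc.prems in simp_all)
        show ?case
        proof (rule D(5)[OF D(3)[OF IH Ej]])
          fix i assume i: "i < m"
          have c: "\<phi> (i div \<rho>) (y (i mod \<rho>)) \<in> carrier R" by (rule \<phi>c[OF idiv[OF i] yc[OF imod]])
          show "(if i mod \<rho> < Suc j then \<phi> (i div \<rho>) (y (i mod \<rho>)) else \<zero>)
            = (if i mod \<rho> < j then \<phi> (i div \<rho>) (y (i mod \<rho>)) else \<zero>) \<oplus> E j (y j) i"
            unfolding E_def using c by (cases "i mod \<rho> < j"; cases "i mod \<rho> = j") simp_all
        qed
      qed
      from this[OF order_refl] show "v \<in> W'"
      proof (rule D(5))
        fix i assume i: "i < m"
        show "v i = (if i mod \<rho> < \<rho> then \<phi> (i div \<rho>) (y (i mod \<rho>)) else \<zero>)"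
          using \<phi>y[OF idiv[OF i] imod] imod[of i] by simp
      qed
    qed
  qed
  moreover have "k + card S \<le> m" using le cardS by (simp add: m_def)
  ultimately obtain \<pi> where \<pi>: "vlin m (m - card S) \<pi>" "vec (m - card S) \<subseteq> vimg (m - card S) \<pi> W"
    using clear_generators[OF W _ _ k] by (metis (no_types))
  let ?m' = "m - card S"
  define \<psi> where "\<psi> j y = \<pi> (\<Phi> y) j" for j y
  have \<psi>: "linear_form (Fe (Suc e)) (\<psi> j)" if j: "j < ?m'" for j
    unfolding linear_form_def
  proof (intro conjI ballI)
    fix y assume "y \<in> carrier (Fe (Suc e))"
    then have y: "y \<in> carrier M" by simp
    show "\<psi> j y \<in> carrier R" unfolding \<psi>_def by (rule vecD[OF vlinD(1)[OF \<pi>(1) \<Phi>v[OF y]] j])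
    {
      fix z assume "z \<in> carrier (Fe (Suc e))"
      then have z: "z \<in> carrier M" by simp
      have "\<pi> (\<Phi> (y \<oplus>\<^bsub>M\<^esub> z)) j = \<pi> (\<lambda>i. \<Phi> y i \<oplus> \<Phi> z i) j"
        by (rule vlinD(4)[OF \<pi>(1) vec_add[OF \<Phi>v[OF y] \<Phi>v[OF z]] \<Phi>a[OF _ y z] j])
      also have "\<dots> = \<pi> (\<Phi> y) j \<oplus> \<pi> (\<Phi> z) j" by (rule vlinD(2)[OF \<pi>(1) \<Phi>v[OF y] \<Phi>v[OF z] j])
      finally show "\<psi> j (y \<oplus>\<^bsub>Fe (Suc e)\<^esub> z) = \<psi> j y \<oplus> \<psi> j z" unfolding \<psi>_def frob_push_simps .
    next
      fix r assume r: "r \<in> carrier R"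
      have "\<pi> (\<Phi> ((r [^] (p ^ Suc e)) \<odot>\<^bsub>M\<^esub> y)) j = \<pi> (\<lambda>i. r \<otimes> \<Phi> y i) j"
        by (rule vlinD(4)[OF \<pi>(1) vec_smult[OF r \<Phi>v[OF y]] \<Phi>s[OF _ r y] j])
      also have "\<dots> = r \<otimes> \<pi> (\<Phi> y) j" by (rule vlinD(3)[OF \<pi>(1) r \<Phi>v[OF y] j])
      finally show "\<psi> j (r \<odot>\<^bsub>Fe (Suc e)\<^esub> y) = r \<otimes> \<psi> j y" unfolding \<psi>_def frob_push_simps .
    }
  qed
  have "\<forall>j. \<exists>y. y \<in> carrier M \<and> (\<forall>i<?m'. \<psi> i y = (if i = j then \<one> else \<zero>))"
  proof
    fix j
    have "(\<lambda>i. if i = j then \<one> else \<zero>) \<in> vec ?m'" by (simp add: vec_def)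
    then have "(\<lambda>i. if i = j then \<one> else \<zero>) \<in> vimg ?m' \<pi> W" by (rule subsetD[OF \<pi>(2)])
    then obtain u where u: "u \<in> W" "\<And>i. i < ?m' \<Longrightarrow> (if i = j then \<one> else \<zero>) = \<pi> u i"
      by (rule vimgE) (rule that, simp_all)
    obtain y where y: "y \<in> carrier M" "\<forall>i<m. u i = \<Phi> y i" using WE[OF u(1)] by (elim bexE)
    have "\<pi> u i = \<psi> i y" if "i < ?m'" for i
      unfolding \<psi>_def by (rule vlinD(4)[OF \<pi>(1) \<Phi>v[OF y(1)] _ that]) (use y(2) in simp)
    then show "\<exists>y. y \<in> carrier M \<and> (\<forall>i<?m'. \<psi> i y = (if i = j then \<one> else \<zero>))"
      using y(1) u(2) by (intro exI[of _ y]) simp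
  qed
  from choice[OF this] obtain y where y: "\<forall>j. y j \<in> carrier M \<and> (\<forall>i<?m'. \<psi> i (y j) = (if i = j then \<one> else \<zero>))"
    by (elim exE)
  have "dual_family (Fe (Suc e)) ?m' \<psi> y" unfolding dual_family_def using \<psi> y by simp
  \<comment> \<open>The generators in S may coincide, so \<open>card S\<close> can be smaller than
    the stated loss; surplus members of the family are dropped.\<close>
  then have "dual_family (Fe (Suc e)) (n * \<rho> - \<rho> * card B * t) \<psi> y"
    by (rule dual_family_mono) (use cardS in \<open>simp add: m_def\<close>)
  then show ?thesis by (intro exI)
qed

end

section \<open>Construction of Cartier maps at a minimal prime\<close>

context F_finite_ring
begin

text \<open>The coefficients are indexed by the position in the family, so a value that occurs
  repeatedly among the \<open>b k\<close> causes no ambiguity.\<close>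

lemma gspan_family_coeffs:
  assumes Q: "ideal Q R" and b: "\<And>k. k < n \<Longrightarrow> b k \<in> carrier R"
    and x: "x \<in> gspan (Fr 1) Q (b ` {..<n})"
  shows "\<exists>c\<in>vec n. x \<ominus> (\<Oplus>k\<in>{..<n}. c k [^] p \<otimes> b k) \<in> Q"
proof -
  interpret Q: ideal Q R by (rule Q)
  define S where "S c = (\<Oplus>k\<in>{..<n}. c k [^] p \<otimes> b k)" for c
  have Sc: "S c \<in> carrier R" if "c \<in> vec n" for c
    unfolding S_def using vecD[OF that] b by (intro finsum_closed) simp
  have S_add: "S (\<lambda>k. c k \<oplus> c' k) = S c \<oplus> S c'" if "c \<in> vec n" "c' \<in> vec n" for c c'
  proof -
    have "S (\<lambda>k. c k \<oplus> c' k) = (\<Oplus>k\<in>{..<n}. c k [^] p \<otimes> b k \<oplus> c' k [^] p \<otimes> b k)"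
      unfolding S_def
    proof (rule add.finprod_cong'[OF refl])
      fix k assume "k \<in> {..<n}"
      then have c: "c k \<in> carrier R" "c' k \<in> carrier R" "b k \<in> carrier R"
        using vecD[OF that(1)] vecD[OF that(2)] b by simp_all
      show "(c k \<oplus> c' k) [^] p \<otimes> b k = c k [^] p \<otimes> b k \<oplus> c' k [^] p \<otimes> b k"
        using frob_add[OF c(1,2), of 1] c by (simp add: l_distr)
    qed (use vecD[OF that(1)] vecD[OF that(2)] b in simp)
    also have "\<dots> = S c \<oplus> S c'"
      unfolding S_def by (rule finsum_addf) (use vecD[OF that(1)] vecD[OF that(2)] b in simp_all)
    finally show ?thesis .
  qed
  let ?T = "{x \<in> carrier R. \<exists>c\<in>vec n. x \<ominus> S c \<in> Q}"
  have "gspan (Fr 1) Q (b ` {..<n}) \<subseteq> ?T"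
  proof (rule gspan_subset)
    have p0: "\<zero> [^] p = \<zero>" using frob_zero[of 1] by simp
    have "S (\<lambda>_. \<zero>) = (\<Oplus>k\<in>{..<n}. \<zero>)"
      unfolding S_def by (rule add.finprod_cong') (use b p0 in simp_all)
    then have S0: "S (\<lambda>_. \<zero>) = \<zero>" by simp
    show "Q \<subseteq> ?T"
    proof
      fix y assume y: "y \<in> Q"
      have yc: "y \<in> carrier R" by (rule Q.Icarr[OF y])
      show "y \<in> ?T"
        using y yc by (intro CollectI conjI bexI[of _ "\<lambda>_. \<zero>"]) (simp_all add: S0 a_minus_def vec_def)
    qed
    fix d u assume d: "d \<in> Fr 1" and "u \<in> b ` {..<n}"
    then obtain j where j: "j < n" "u = b j" by auto
    obtain r where r: "r \<in> carrier R" "d = r [^] p" using d unfolding Fr_def by auto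
    have "S (\<lambda>k. if j = k then r else \<zero>) = (\<Oplus>k\<in>{..<n}. if j = k then r [^] p \<otimes> b k else \<zero>)"
      unfolding S_def by (rule add.finprod_cong') (use b p0 r(1) in simp_all)
    also have "\<dots> = r [^] p \<otimes> b j"
      by (rule add.finprod_singleton) (use j b r(1) in simp_all)
    finally have "S (\<lambda>k. if j = k then r else \<zero>) = d \<otimes> u" using j r by simp
    moreover have "d \<otimes> u \<in> carrier R" using j r b by simp
    moreover have "(\<lambda>k. if j = k then r else \<zero>) \<in> vec n" using r(1) by (simp add: vec_def)
    ultimately show "d \<otimes> u \<in> ?T"
      by (intro CollectI conjI bexI[of _ "\<lambda>k. if j = k then r else \<zero>"]) (simp_all add: a_minus_def r_neg)
  next
    fix x y assume "x \<in> ?T" "y \<in> ?T"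
    then obtain c c' where c: "x \<in> carrier R" "c \<in> vec n" "x \<ominus> S c \<in> Q"
      and c': "y \<in> carrier R" "c' \<in> vec n" "y \<ominus> S c' \<in> Q" by (elim CollectE conjE bexE)
    have "(x \<oplus> y) \<ominus> S (\<lambda>k. c k \<oplus> c' k) = (x \<ominus> S c) \<oplus> (y \<ominus> S c')"
      unfolding S_add[OF c(2) c'(2)] using c(1) c'(1) Sc[OF c(2)] Sc[OF c'(2)]
      by (simp add: a_minus_def minus_add a_ac)
    then have "(x \<oplus> y) \<ominus> S (\<lambda>k. c k \<oplus> c' k) \<in> Q" using Q.a_closed[OF c(3) c'(3)] by (simp only:)
    then show "x \<oplus> y \<in> ?T" using c(1) c'(1) vec_add[OF c(2) c'(2)] by (intro CollectI conjI bexI a_closed)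
  qed
  then have "x \<in> ?T" using x by (rule subsetD)
  then show ?thesis unfolding S_def by (elim CollectE conjE)
qed

end

context F_finite_module
begin

text \<open>Since s outside Q kills Q, the local ring at Q is a field, and L becomes a basis of the
  localized module: it is a largest subset of the generators that is independent there, and d is a
  common denominator for expressing M through L.\<close>

lemma generic_basis:
  assumes Q: "primeideal Q R" and s: "s \<in> carrier R - Q" "\<And>z. z \<in> Q \<Longrightarrow> s \<otimes> z = \<zero>"
  obtains L d where "finite L" "L \<subseteq> carrier M" "d \<in> carrier R - Q"
    "\<And>x. x \<in> carrier M \<Longrightarrow> d \<odot>\<^bsub>M\<^esub> x \<in> M.span L"
    "\<And>a l. a \<in> L \<rightarrow> carrier R \<Longrightarrow> M.lincomb a L = \<zero>\<^bsub>M\<^esub> \<Longrightarrow> l \<in> L \<Longrightarrow> a l \<in> Q"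
proof -
  interpret Q: primeideal Q R by (rule Q)
  obtain B where B: "finite B" "B \<subseteq> carrier M" "M.span B = carrier M" by (rule generators)
  \<comment> \<open>The multiplier t expresses that the combination vanishes after localization at
    Q.\<close>
  define ind where "ind L \<longleftrightarrow> (\<forall>a\<in>L \<rightarrow> carrier R. \<forall>t\<in>carrier R - Q.
      t \<odot>\<^bsub>M\<^esub> M.lincomb a L = \<zero>\<^bsub>M\<^esub> \<longrightarrow> (\<forall>l\<in>L. a l \<in> Q))" for L
  have "\<exists>L. (L \<subseteq> B \<and> ind L) \<and> (\<forall>L'. L' \<subseteq> B \<and> ind L' \<longrightarrow> card L' \<le> card L)"
  proof (rule ex_has_greatest_nat)
    show "{} \<subseteq> B \<and> ind {}" by (simp add: ind_def)
    show "\<forall>L. L \<subseteq> B \<and> ind L \<longrightarrow> card L < Suc (card B)" using card_mono[OF B(1)] by (simp add: le_imp_less_Suc)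
  qed
  then obtain L where L: "L \<subseteq> B" "ind L" "\<forall>L'. L' \<subseteq> B \<and> ind L' \<longrightarrow> card L' \<le> card L" by (elim exE conjE)
  have Lf: "finite L" by (rule finite_subset[OF L(1) B(1)])
  have Lc: "L \<subseteq> carrier M" using L(1) B(2) by (rule subset_trans)
  have indD: "a l \<in> Q" if "a \<in> L \<rightarrow> carrier R" "t \<in> carrier R - Q" "t \<odot>\<^bsub>M\<^esub> M.lincomb a L = \<zero>\<^bsub>M\<^esub>" "l \<in> L" for a t l
    by (rule bspec[OF mp[OF bspec[OF bspec[OF L(2)[unfolded ind_def] that(1)] that(2)] that(3)] that(4)])
  have sub: "submodule R (M.span L) M" by (rule M.span_is_submodule[OF Lc])
  note sub_add = submodule.m_closed[OF sub] and sub_smult = submodule.smult_closed[OF sub]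
  have lin: "M.lincomb a L \<in> M.span L" if "a \<in> L \<rightarrow> carrier R" for a
    unfolding M.finite_span[OF Lf Lc] using that by (intro CollectI exI conjI) simp_all
  have "\<exists>t\<in>carrier R - Q. t \<odot>\<^bsub>M\<^esub> b \<in> M.span L" if b: "b \<in> B" for b
  proof (cases "b \<in> L")
    case True
    have bc: "b \<in> carrier M" using b B(2) by auto
    have "b \<in> M.span L" by (rule subsetD[OF M.in_own_span[OF Lc] True])
    then show ?thesis using one_notin_prime[OF Q] bc by (intro bexI[of _ \<one>]) simp_all
  next
    case False
    have bc: "b \<in> carrier M" using b B(2) by auto
    have "\<not> ind (insert b L)"
    proof
      assume "ind (insert b L)"
      then have "card (insert b L) \<le> card L" using L(1,3) b by simp
      then show False using False Lf by simp
    qed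
    then obtain a t where a: "a \<in> insert b L \<rightarrow> carrier R" and t: "t \<in> carrier R - Q"
      and z: "t \<odot>\<^bsub>M\<^esub> M.lincomb a (insert b L) = \<zero>\<^bsub>M\<^esub>" and nq: "\<not> (\<forall>l\<in>insert b L. a l \<in> Q)"
      unfolding ind_def Ball_def[of "insert b L \<rightarrow> carrier R"] Ball_def[of "carrier R - Q"] not_all not_imp
      by (elim exE conjE) (rule that)
    have tc: "t \<in> carrier R" and sc: "s \<in> carrier R" using t s(1) by simp_all
    have ab: "a b \<in> carrier R" by (rule funcset_mem[OF a]) simp
    have aL: "a \<in> L \<rightarrow> carrier R" using a by auto
    define \<Lambda> where "\<Lambda> = M.lincomb a L"
    have \<Lambda>c: "\<Lambda> \<in> carrier M" unfolding \<Lambda>_def by (rule M.lincomb_closed[OF Lc aL])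
    have "M.lincomb a (insert b L) = a b \<odot>\<^bsub>M\<^esub> b \<oplus>\<^bsub>M\<^esub> \<Lambda>"
      unfolding \<Lambda>_def M.lincomb_def
      by (rule M.M.finsum_insert[OF Lf False]) (use aL Lc ab bc in auto)
    then have e1: "(t \<otimes> a b) \<odot>\<^bsub>M\<^esub> b \<oplus>\<^bsub>M\<^esub> t \<odot>\<^bsub>M\<^esub> \<Lambda> = \<zero>\<^bsub>M\<^esub>"
      using z tc ab bc \<Lambda>c by (simp add: M.smult_r_distr M.smult_assoc1)
    show ?thesis
    proof (cases "a b \<in> Q")
      case True
      \<comment> \<open>If the coefficient of b is in Q, multiplying by s deletes the term of b, and
        a relation on the independent set L alone remains.\<close>
      have "s \<odot>\<^bsub>M\<^esub> ((t \<otimes> a b) \<odot>\<^bsub>M\<^esub> b \<oplus>\<^bsub>M\<^esub> t \<odot>\<^bsub>M\<^esub> \<Lambda>) = (t \<otimes> (s \<otimes> a b)) \<odot>\<^bsub>M\<^esub> b \<oplus>\<^bsub>M\<^esub> (s \<otimes> t) \<odot>\<^bsub>M\<^esub> \<Lambda>"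
        using tc sc ab bc \<Lambda>c by (simp add: M.smult_r_distr M.smult_assoc1[symmetric] m_lcomm)
      then have "(s \<otimes> t) \<odot>\<^bsub>M\<^esub> \<Lambda> = \<zero>\<^bsub>M\<^esub>" unfolding e1 s(2)[OF True] using tc sc bc \<Lambda>c by simp
      then have "a l \<in> Q" if "l \<in> L" for l
        using indD[OF aL prime_notin_mult[OF Q s(1) t] _ that] unfolding \<Lambda>_def by simp
      then show ?thesis using True nq by simp
    next
      case nab: False
      have "(t \<otimes> a b) \<odot>\<^bsub>M\<^esub> b = \<ominus>\<^bsub>M\<^esub> (t \<odot>\<^bsub>M\<^esub> \<Lambda>)"
        by (rule M.M.minus_equality[symmetric, OF e1]) (use tc ab bc \<Lambda>c in simp_all)
      also have "\<dots> = (\<ominus> \<one>) \<odot>\<^bsub>M\<^esub> (t \<odot>\<^bsub>M\<^esub> \<Lambda>)"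
        by (rule M.smult_minus_1[symmetric]) (use tc \<Lambda>c in simp)
      also have "\<dots> \<in> M.span L" unfolding \<Lambda>_def using tc lin[OF aL] by (intro sub_smult) simp_all
      finally show ?thesis using prime_notin_mult[OF Q t, of "a b"] ab nab by (intro bexI[of _ "t \<otimes> a b"]) simp_all
    qed
  qed
  then have "\<exists>d\<in>carrier R - Q. \<forall>b\<in>B. d \<odot>\<^bsub>M\<^esub> b \<in> M.span L"
  proof (rule prime_finite_common_multiple[OF Q B(1)])
    fix s t b assume *: "s \<in> carrier R" "t \<in> carrier R" "b \<in> B" "s \<odot>\<^bsub>M\<^esub> b \<in> M.span L"
    have "(t \<otimes> s) \<odot>\<^bsub>M\<^esub> b = t \<odot>\<^bsub>M\<^esub> (s \<odot>\<^bsub>M\<^esub> b)" by (rule M.smult_assoc1) (use * B(2) in auto)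
    then show "(t \<otimes> s) \<odot>\<^bsub>M\<^esub> b \<in> M.span L" using sub_smult[OF *(2,4)] by simp
  qed
  then obtain d where d: "d \<in> carrier R - Q" "\<forall>b\<in>B. d \<odot>\<^bsub>M\<^esub> b \<in> M.span L" by (elim bexE)
  have dc: "d \<in> carrier R" using d(1) by simp
  have dx: "d \<odot>\<^bsub>M\<^esub> x \<in> M.span L" if x: "x \<in> carrier M" for x
  proof (rule M.span_induct[where T = "\<lambda>x. d \<odot>\<^bsub>M\<^esub> x \<in> M.span L", OF B(1,2)])
    show "x \<in> M.span B" using x B(3) by simp
    show "d \<odot>\<^bsub>M\<^esub> \<zero>\<^bsub>M\<^esub> \<in> M.span L" using submodule.zero_closed[OF sub] dc by simp
    show "d \<odot>\<^bsub>M\<^esub> (x \<oplus>\<^bsub>M\<^esub> y) \<in> M.span L"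
      if "x \<in> carrier M" "y \<in> carrier M" "d \<odot>\<^bsub>M\<^esub> x \<in> M.span L" "d \<odot>\<^bsub>M\<^esub> y \<in> M.span L" for x y
      using M.smult_r_distr[OF dc that(1,2)] sub_add[OF that(3,4)] by simp
    show "d \<odot>\<^bsub>M\<^esub> (r \<odot>\<^bsub>M\<^esub> b) \<in> M.span L" if "r \<in> carrier R" "b \<in> B" for r b
    proof -
      have bc: "b \<in> carrier M" using that B(2) by auto
      have "d \<odot>\<^bsub>M\<^esub> (r \<odot>\<^bsub>M\<^esub> b) = r \<odot>\<^bsub>M\<^esub> (d \<odot>\<^bsub>M\<^esub> b)"
        using that(1) dc bc by (simp add: M.smult_assoc1[symmetric] m_comm)
      then show ?thesis using sub_smult[OF that(1) bspec[OF d(2) that(2)]] by simp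
    qed
  qed
  have one: "\<one> \<in> carrier R - Q" using one_notin_prime[OF Q] by simp
  show ?thesis
  proof (rule that[OF Lf Lc d(1) dx])
    fix a l assume *: "a \<in> L \<rightarrow> carrier R" "M.lincomb a L = \<zero>\<^bsub>M\<^esub>" "l \<in> L"
    show "a l \<in> Q" by (rule indD[OF *(1) one _ *(3)]) (use *(2) in simp)
  qed
qed

text \<open>Over the residue field at Q, with coordinates along L, \<open>F\<^sub>*\<close> of a
  line is \<rho>-dimensional with basis b. So x is sent to the coordinates of d x, these are
  multiplied by \<sigma>^p and expanded in b, and h k collects the k-th coefficients. The last
  clause, vanishing on Q M, allows the families at different minimal primes to be added without
  interfering.\<close>

lemma local_cartier_family:
  assumes Q: "primeideal Q R" and s: "s \<in> carrier R - Q" "\<And>z. z \<in> Q \<Longrightarrow> s \<otimes> z = \<zero>"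
  shows "\<exists>h. cartier_family (rk Q) h \<and> (\<exists>c\<in>carrier R - Q. hits_multiples (rk Q) h c) \<and>
    (\<forall>z\<in>Q. \<forall>x\<in>carrier M. \<forall>k<rk Q. h k (z \<odot>\<^bsub>M\<^esub> x) = \<zero>\<^bsub>M\<^esub>)"
proof -
  interpret Q: primeideal Q R by (rule Q)
  note QI = Q.ideal_axioms
  let ?\<rho> = "rk Q"
  obtain L d where L: "finite L" "L \<subseteq> carrier M" and d: "d \<in> carrier R - Q"
    and dL: "\<And>x. x \<in> carrier M \<Longrightarrow> d \<odot>\<^bsub>M\<^esub> x \<in> M.span L"
    and ind: "\<And>a l. a \<in> L \<rightarrow> carrier R \<Longrightarrow> M.lincomb a L = \<zero>\<^bsub>M\<^esub> \<Longrightarrow> l \<in> L \<Longrightarrow> a l \<in> Q"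
    by (rule generic_basis[OF Q s]) (assumption, rule that)
  obtain b :: "nat \<Rightarrow> 'a" where b: "pindep 1 Q Q {..<?\<rho>} b" using rk_basis[OF Q] by (elim exE)
  have bc: "b k \<in> carrier R" if "k < ?\<rho>" for k using b that unfolding pindep_def by auto
  obtain \<sigma> where \<sigma>: "\<sigma> \<in> carrier R - Q" "\<forall>x\<in>carrier R. \<sigma> [^] p \<otimes> x \<in> gspan (Fr 1) Q (b ` {..<?\<rho>})"
    using rk_span_uniform[OF Q b] by (elim bexE)
  have c: "d \<in> carrier R" "\<sigma> \<in> carrier R" "s \<in> carrier R" using d \<sigma>(1) s(1) by simp_all
  have dcoeff: "\<exists>y. y \<in> L \<rightarrow> carrier R \<and> M.lincomb y L = d \<odot>\<^bsub>M\<^esub> x" if "x \<in> carrier M" for x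
    using M.finite_in_span[OF L dL[OF that]] by simp
  define S where "S A = (\<Oplus>k\<in>{..<?\<rho>}. A k [^] p \<otimes> b k)" for A
  have Sc: "S A \<in> carrier R" if "A \<in> vec ?\<rho>" for A
    unfolding S_def using vecD[OF that] bc by (intro finsum_closed) simp
  have S_lin: "S (\<lambda>k. r \<otimes> A k \<oplus> A' k) = r [^] p \<otimes> S A \<oplus> S A'"
    if r: "r \<in> carrier R" and A: "A \<in> vec ?\<rho>" and A': "A' \<in> vec ?\<rho>" for r A A'
  proof -
    have "r [^] p \<otimes> S A = (\<Oplus>k\<in>{..<?\<rho>}. r [^] p \<otimes> (A k [^] p \<otimes> b k))"
      unfolding S_def by (rule finsum_rdistr) (use vecD[OF A] bc r in simp_all)
    then have "r [^] p \<otimes> S A \<oplus> S A' = (\<Oplus>k\<in>{..<?\<rho>}. r [^] p \<otimes> (A k [^] p \<otimes> b k) \<oplus> A' k [^] p \<otimes> b k)"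
      unfolding S_def using vecD[OF A] vecD[OF A'] bc r by (simp add: finsum_addf Pi_def)
    also have "\<dots> = S (\<lambda>k. r \<otimes> A k \<oplus> A' k)"
      unfolding S_def
    proof (rule add.finprod_cong'[OF refl])
      fix k assume "k \<in> {..<?\<rho>}"
      then have k: "A k \<in> carrier R" "A' k \<in> carrier R" "b k \<in> carrier R"
        using vecD[OF A] vecD[OF A'] bc by simp_all
      show "r [^] p \<otimes> (A k [^] p \<otimes> b k) \<oplus> A' k [^] p \<otimes> b k = (r \<otimes> A k \<oplus> A' k) [^] p \<otimes> b k"
        using frob_add[of "r \<otimes> A k" "A' k" 1] k r by (simp add: nat_pow_distrib l_distr m_assoc)
    qed (use vecD[OF A] vecD[OF A'] bc r in simp)
    finally show ?thesis by (rule sym)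
  qed
  \<comment> \<open>A relation rather than a function: the expansion in b is only determined modulo
    Q.\<close>
  define rep where "rep x A \<longleftrightarrow> (\<forall>l\<in>L. A l \<in> vec ?\<rho>) \<and>
      (\<exists>y. y \<in> L \<rightarrow> carrier R \<and> M.lincomb y L = d \<odot>\<^bsub>M\<^esub> x \<and> (\<forall>l\<in>L. \<sigma> [^] p \<otimes> y l \<ominus> S (A l) \<in> Q))" for x A
  have rep_ex: "\<exists>A. rep x A" if xM: "x \<in> carrier M" for x
  proof -
    obtain y where y: "y \<in> L \<rightarrow> carrier R" "M.lincomb y L = d \<odot>\<^bsub>M\<^esub> x" using dcoeff[OF xM] by (elim exE conjE)
    have "\<forall>l\<in>L. \<exists>A. A \<in> vec ?\<rho> \<and> \<sigma> [^] p \<otimes> y l \<ominus> S A \<in> Q"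
    proof
      fix l assume "l \<in> L"
      then have "y l \<in> carrier R" by (rule funcset_mem[OF y(1)])
      from gspan_family_coeffs[OF QI bc bspec[OF \<sigma>(2) this]]
      show "\<exists>A. A \<in> vec ?\<rho> \<and> \<sigma> [^] p \<otimes> y l \<ominus> S A \<in> Q" unfolding S_def by (simp only: Bex_def)
    qed
    from bchoice[OF this] obtain A where "\<forall>l\<in>L. A l \<in> vec ?\<rho> \<and> \<sigma> [^] p \<otimes> y l \<ominus> S (A l) \<in> Q" by (elim exE)
    then show ?thesis unfolding rep_def using y by (intro exI[of _ A] conjI exI[of _ y]) simp_all
  qed
  have rep_lin: "rep ((r [^] p) \<odot>\<^bsub>M\<^esub> x \<oplus>\<^bsub>M\<^esub> x') (\<lambda>l k. r \<otimes> A l k \<oplus> A' l k)"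
    if r: "r \<in> carrier R" and x: "x \<in> carrier M" "x' \<in> carrier M" and A: "rep x A" and A': "rep x' A'" for r x x' A A'
  proof -
    obtain y where Av: "\<forall>l\<in>L. A l \<in> vec ?\<rho>" and y: "y \<in> L \<rightarrow> carrier R" "M.lincomb y L = d \<odot>\<^bsub>M\<^esub> x"
      and yQ: "\<forall>l\<in>L. \<sigma> [^] p \<otimes> y l \<ominus> S (A l) \<in> Q" using A unfolding rep_def by (elim exE conjE)
    obtain y' where A'v: "\<forall>l\<in>L. A' l \<in> vec ?\<rho>" and y': "y' \<in> L \<rightarrow> carrier R" "M.lincomb y' L = d \<odot>\<^bsub>M\<^esub> x'"
      and y'Q: "\<forall>l\<in>L. \<sigma> [^] p \<otimes> y' l \<ominus> S (A' l) \<in> Q" using A' unfolding rep_def by (elim exE conjE)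
    have rp: "r [^] p \<in> carrier R" using r by simp
    have ry: "(\<lambda>l. r [^] p \<otimes> y l) \<in> L \<rightarrow> carrier R" using y(1) rp by auto
    have ryy: "(\<lambda>l. r [^] p \<otimes> y l \<oplus> y' l) \<in> L \<rightarrow> carrier R" using ry y'(1) by auto
    have "M.lincomb (\<lambda>l. r [^] p \<otimes> y l \<oplus> y' l) L = (r [^] p) \<odot>\<^bsub>M\<^esub> (d \<odot>\<^bsub>M\<^esub> x) \<oplus>\<^bsub>M\<^esub> d \<odot>\<^bsub>M\<^esub> x'"
      using M.lincomb_sum[OF L ry y'(1)] M.lincomb_smult[OF L(2) y(1) rp] y(2) y'(2) by simp
    also have "\<dots> = d \<odot>\<^bsub>M\<^esub> ((r [^] p) \<odot>\<^bsub>M\<^esub> x \<oplus>\<^bsub>M\<^esub> x')"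
      using rp c x by (simp add: M.smult_r_distr M.smult_assoc1[symmetric] m_comm)
    finally have 1: "M.lincomb (\<lambda>l. r [^] p \<otimes> y l \<oplus> y' l) L = d \<odot>\<^bsub>M\<^esub> ((r [^] p) \<odot>\<^bsub>M\<^esub> x \<oplus>\<^bsub>M\<^esub> x')" .
    have 2: "\<sigma> [^] p \<otimes> (r [^] p \<otimes> y l \<oplus> y' l) \<ominus> S (\<lambda>k. r \<otimes> A l k \<oplus> A' l k) \<in> Q" if l: "l \<in> L" for l
    proof -
      have yc: "y l \<in> carrier R" "y' l \<in> carrier R" using y(1) y'(1) l by auto
      have SA: "S (A l) \<in> carrier R" "S (A' l) \<in> carrier R" using Sc Av A'v l by simp_all
      have "r [^] p \<otimes> (\<sigma> [^] p \<otimes> y l \<ominus> S (A l)) \<oplus> (\<sigma> [^] p \<otimes> y' l \<ominus> S (A' l)) \<in> Q"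
        by (rule Q.a_closed[OF Q.I_l_closed[OF bspec[OF yQ l] rp] bspec[OF y'Q l]])
      moreover have "\<sigma> [^] p \<otimes> (r [^] p \<otimes> y l \<oplus> y' l) \<ominus> S (\<lambda>k. r \<otimes> A l k \<oplus> A' l k)
          = r [^] p \<otimes> (\<sigma> [^] p \<otimes> y l \<ominus> S (A l)) \<oplus> (\<sigma> [^] p \<otimes> y' l \<ominus> S (A' l))"
        unfolding S_lin[OF r bspec[OF Av l] bspec[OF A'v l]] using rp c yc SA
        by (simp add: a_minus_def minus_add r_distr r_minus a_ac m_ac)
      ultimately show ?thesis by (simp only:)
    qed
    have 3: "(\<lambda>k. r \<otimes> A l k \<oplus> A' l k) \<in> vec ?\<rho>" if "l \<in> L" for l
      by (rule vec_add[OF vec_smult[OF r bspec[OF Av that]] bspec[OF A'v that]])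
    show ?thesis unfolding rep_def using 1 2 3 ryy by (intro conjI ballI exI[of _ "\<lambda>l. r [^] p \<otimes> y l \<oplus> y' l"]) simp_all
  qed
  \<comment> \<open>Serves two purposes: with z = 0 it shows that the coefficients of x are unique
    modulo Q, and for general z it shows that h vanishes on Q M.\<close>
  have rep_Q: "A l k \<in> Q" if z: "z \<in> Q" and x: "x \<in> carrier M" and A: "rep (z \<odot>\<^bsub>M\<^esub> x) A" and l: "l \<in> L" and k: "k < ?\<rho>" for z x A l k
  proof -
    have zc: "z \<in> carrier R" by (rule Q.Icarr[OF z])
    obtain y where Av: "\<forall>l\<in>L. A l \<in> vec ?\<rho>" and y: "y \<in> L \<rightarrow> carrier R" "M.lincomb y L = d \<odot>\<^bsub>M\<^esub> (z \<odot>\<^bsub>M\<^esub> x)"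
      and yQ: "\<forall>l\<in>L. \<sigma> [^] p \<otimes> y l \<ominus> S (A l) \<in> Q" using A unfolding rep_def by (elim exE conjE)
    obtain y0 where y0: "y0 \<in> L \<rightarrow> carrier R" "M.lincomb y0 L = d \<odot>\<^bsub>M\<^esub> x" using dcoeff[OF x] by (elim exE conjE)
    have mz: "\<ominus> z \<in> carrier R" using zc by simp
    have zy0: "(\<lambda>l. \<ominus> z \<otimes> y0 l) \<in> L \<rightarrow> carrier R" using y0(1) zc by auto
    have "M.lincomb (\<lambda>l. \<ominus> z \<otimes> y0 l \<oplus> y l) L = (\<ominus> z) \<odot>\<^bsub>M\<^esub> (d \<odot>\<^bsub>M\<^esub> x) \<oplus>\<^bsub>M\<^esub> d \<odot>\<^bsub>M\<^esub> (z \<odot>\<^bsub>M\<^esub> x)"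
      using M.lincomb_sum[OF L zy0 y(1)] M.lincomb_smult[OF L(2) y0(1) mz] y(2) y0(2) by simp
    also have "\<dots> = (\<ominus> z \<otimes> d \<oplus> d \<otimes> z) \<odot>\<^bsub>M\<^esub> x"
      using zc c x by (simp add: M.smult_assoc1[symmetric] M.smult_l_distr)
    also have "\<ominus> z \<otimes> d \<oplus> d \<otimes> z = \<zero>" using zc c by (simp add: l_minus m_comm[of d z] l_neg)
    finally have lz: "M.lincomb (\<lambda>l. \<ominus> z \<otimes> y0 l \<oplus> y l) L = \<zero>\<^bsub>M\<^esub>" using x by simp
    have zyy: "(\<lambda>l. \<ominus> z \<otimes> y0 l \<oplus> y l) \<in> L \<rightarrow> carrier R" using zy0 y(1) by auto
    have dif: "\<ominus> z \<otimes> y0 l \<oplus> y l \<in> Q" by (rule ind[OF zyy lz l])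
    have yc: "y l \<in> carrier R" "y0 l \<in> carrier R" using y(1) y0(1) l by auto
    have "\<ominus> z \<in> Q" using z by simp
    then have "\<ominus> z \<otimes> y0 l \<in> Q" using yc(2) by (rule Q.I_r_closed)
    then have yl: "y l \<in> Q" using ideal_add_cancel[OF QI yc(1), of "\<ominus> z \<otimes> y0 l"] dif yc zc by (simp add: a_comm)
    have SA: "S (A l) \<in> carrier R" using Sc Av l by simp
    have "\<ominus> (\<sigma> [^] p \<otimes> y l \<ominus> S (A l)) \<oplus> \<sigma> [^] p \<otimes> y l \<in> Q"
      using bspec[OF yQ l] Q.I_l_closed[OF yl, of "\<sigma> [^] p"] c by simp
    moreover have "\<ominus> (\<sigma> [^] p \<otimes> y l \<ominus> S (A l)) \<oplus> \<sigma> [^] p \<otimes> y l = S (A l)"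
    proof -
      define u where "u = \<sigma> [^] p \<otimes> y l"
      have uc: "u \<in> carrier R" using c yc by (simp add: u_def)
      have "\<ominus> (u \<ominus> S (A l)) \<oplus> u = S (A l)" using uc SA by (simp add: a_minus_def minus_add a_ac r_neg r_neg1 r_neg2)
      then show ?thesis unfolding u_def .
    qed
    ultimately have "(\<Oplus>k\<in>{..<?\<rho>}. A l k [^] (p ^ 1) \<otimes> b k) \<in> Q" unfolding S_def by simp
    moreover have "A l \<in> {..<?\<rho>} \<rightarrow> carrier R" using vecD[OF bspec[OF Av l]] by simp
    ultimately have "\<forall>k\<in>{..<?\<rho>}. A l k \<in> Q"
      using b unfolding pindep_def by (elim conjE) (drule (1) bspec, simp)
    then show ?thesis using k by simp
  qed
  have repc: "A l k \<in> carrier R" if "rep x A" "l \<in> L" "k < ?\<rho>" for x A l k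
    using that vecD unfolding rep_def by (elim conjE) (drule (1) bspec, simp add: vec_def)
  \<comment> \<open>Two representations of x are subtracted by p-linearity with the scalar -1, where
    (-1)^p + 1 = 0 holds for every p. The difference of the coefficients is in Q and is killed by
    s.\<close>
  have s_eq: "s \<otimes> A l k = s \<otimes> A' l k"
    if A: "rep x A" and A': "rep x A'" and x: "x \<in> carrier M" and l: "l \<in> L" and k: "k < ?\<rho>" for x A A' l k
  proof -
    have m1: "(\<ominus> \<one>) [^] p \<oplus> \<one> = \<zero>"
      using frob_add[of "\<ominus> \<one>" \<one> 1] frob_zero[of 1] by (simp add: l_neg)
    have "((\<ominus> \<one>) [^] p) \<odot>\<^bsub>M\<^esub> x \<oplus>\<^bsub>M\<^esub> x = ((\<ominus> \<one>) [^] p \<oplus> \<one>) \<odot>\<^bsub>M\<^esub> x"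
      using x by (simp add: M.smult_l_distr)
    also have "\<dots> = \<zero> \<odot>\<^bsub>M\<^esub> x" by (simp only: m1)
    finally have "rep (\<zero> \<odot>\<^bsub>M\<^esub> x) (\<lambda>l k. \<ominus> \<one> \<otimes> A l k \<oplus> A' l k)"
      using rep_lin[OF _ x x A A', of "\<ominus> \<one>"] by simp
    from rep_Q[OF Q.zero_closed x this l k] have "\<ominus> \<one> \<otimes> A l k \<oplus> A' l k \<in> Q" .
    from s(2)[OF this] have e: "s \<otimes> (\<ominus> \<one> \<otimes> A l k \<oplus> A' l k) = \<zero>" .
    have cc: "A l k \<in> carrier R" "A' l k \<in> carrier R" by (rule repc[OF A l k], rule repc[OF A' l k])
    have "s \<otimes> A' l k \<oplus> \<ominus> (s \<otimes> A l k) = \<zero>" using e cc c by (simp add: l_minus r_minus r_distr a_comm)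
    then have "\<ominus> (\<ominus> (s \<otimes> A l k)) = s \<otimes> A' l k"
      by (rule minus_equality) (use cc c in simp_all)
    then show ?thesis using cc c by simp
  qed
  define A where "A x = (SOME A. rep x A)" for x
  have A: "rep x (A x)" if "x \<in> carrier M" for x unfolding A_def by (rule someI_ex[OF rep_ex[OF that]])
  \<comment> \<open>The factor s removes the ambiguity modulo Q, so h does not depend on the chosen
    coefficients.\<close>
  define h where "h k x = M.lincomb (\<lambda>l. s \<otimes> A x l k) L" for k x
  have sA: "(\<lambda>l. s \<otimes> A x l k) \<in> L \<rightarrow> carrier R" if "x \<in> carrier M" "k < ?\<rho>" for x k
    using repc[OF A[OF that(1)] _ that(2)] c by simp
  have h_rep: "h k x = M.lincomb (\<lambda>l. s \<otimes> A' l k) L" if "rep x A'" "x \<in> carrier M" "k < ?\<rho>" for x A' k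
    unfolding h_def
    by (rule M.lincomb_cong[OF refl L(2)]) (use s_eq[OF A[OF that(2)] that(1,2) _ that(3)] repc[OF that(1) _ that(3)] c in simp_all)
  have h0: "h k (z \<odot>\<^bsub>M\<^esub> x) = \<zero>\<^bsub>M\<^esub>" if "z \<in> Q" "x \<in> carrier M" "k < ?\<rho>" for z x k
  proof -
    have zx: "z \<odot>\<^bsub>M\<^esub> x \<in> carrier M" using that Q.Icarr by simp
    have "s \<otimes> A (z \<odot>\<^bsub>M\<^esub> x) l k = \<zero>" if "l \<in> L" for l
      by (rule s(2)[OF rep_Q[OF \<open>z \<in> Q\<close> \<open>x \<in> carrier M\<close> A[OF zx] that \<open>k < ?\<rho>\<close>]])
    then have "M.lincomb (\<lambda>l. s \<otimes> A (z \<odot>\<^bsub>M\<^esub> x) l k) L = (\<Oplus>\<^bsub>M\<^esub>l\<in>L. \<zero>\<^bsub>M\<^esub>)"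
      unfolding M.lincomb_def using L(2) by (intro M.M.add.finprod_cong') (auto simp: subset_iff)
    then show ?thesis unfolding h_def by simp
  qed
  have lin: "h k ((r [^] p) \<odot>\<^bsub>M\<^esub> x \<oplus>\<^bsub>M\<^esub> y) = r \<odot>\<^bsub>M\<^esub> h k x \<oplus>\<^bsub>M\<^esub> h k y"
    if r: "r \<in> carrier R" and x: "x \<in> carrier M" and y: "y \<in> carrier M" and k: "k < ?\<rho>" for r x y k
  proof -
    have rsA: "(\<lambda>l. r \<otimes> (s \<otimes> A x l k)) \<in> L \<rightarrow> carrier R" using sA[OF x k] r by auto
    have "h k ((r [^] p) \<odot>\<^bsub>M\<^esub> x \<oplus>\<^bsub>M\<^esub> y) = M.lincomb (\<lambda>l. s \<otimes> (r \<otimes> A x l k \<oplus> A y l k)) L"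
      using h_rep[OF rep_lin[OF r x y A[OF x] A[OF y]] _ k] r x y by simp
    also have "\<dots> = M.lincomb (\<lambda>l. r \<otimes> (s \<otimes> A x l k) \<oplus> s \<otimes> A y l k) L"
      by (rule M.lincomb_cong[OF refl L(2)])
        (use repc[OF A[OF x] _ k] repc[OF A[OF y] _ k] r c in \<open>simp_all add: r_distr m_lcomm\<close>)
    also have "\<dots> = r \<odot>\<^bsub>M\<^esub> h k x \<oplus>\<^bsub>M\<^esub> h k y"
      unfolding h_def using M.lincomb_sum[OF L rsA sA[OF y k]] M.lincomb_smult[OF L(2) sA[OF x k] r] by simp
    finally show ?thesis .
  qed
  have hc: "h k x \<in> carrier M" if "x \<in> carrier M" "k < ?\<rho>" for k x
    unfolding h_def by (rule M.lincomb_closed[OF L(2) sA[OF that]])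
  have hz: "h k \<zero>\<^bsub>M\<^esub> = \<zero>\<^bsub>M\<^esub>" if "k < ?\<rho>" for k
    using h0[OF Q.zero_closed M.M.zero_closed that] by simp
  have "cartier_family ?\<rho> h"
    unfolding cartier_family_def
  proof (intro allI impI ballI conjI)
    fix k x assume k: "k < ?\<rho>" and x: "x \<in> carrier M"
    show "h k x \<in> carrier M" by (rule hc[OF x k])
    {
      fix y assume y: "y \<in> carrier M"
      show "h k (x \<oplus>\<^bsub>M\<^esub> y) = h k x \<oplus>\<^bsub>M\<^esub> h k y" using lin[OF one_closed x y k] x hc[OF x k] by simp
    next
      fix r assume r: "r \<in> carrier R"
      show "h k ((r [^] p) \<odot>\<^bsub>M\<^esub> x) = r \<odot>\<^bsub>M\<^esub> h k x"
        using lin[OF r x M.M.zero_closed k] r x hc[OF x k] hz[OF k] by simp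
    }
  qed
  moreover have "hits_multiples ?\<rho> h (s \<otimes> (\<sigma> \<otimes> (d \<otimes> d)))"
    unfolding hits_multiples_def
  proof (intro allI impI)
    fix v assume v: "\<forall>k<?\<rho>. v k \<in> carrier M"
    have "\<forall>k. \<exists>y. k < ?\<rho> \<longrightarrow> y \<in> L \<rightarrow> carrier R \<and> M.lincomb y L = d \<odot>\<^bsub>M\<^esub> v k"
      using dcoeff v by simp
    from choice[OF this] obtain E where
      E: "\<forall>k. k < ?\<rho> \<longrightarrow> E k \<in> L \<rightarrow> carrier R \<and> M.lincomb (E k) L = d \<odot>\<^bsub>M\<^esub> v k" by (elim exE)
    have Ec: "E k l \<in> carrier R" if "k < ?\<rho>" "l \<in> L" for k l using E that by auto
    have El: "(\<lambda>k. E k l) \<in> vec ?\<rho>" if "l \<in> L" for l using Ec[OF _ that] by (simp add: vec_def)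
    \<comment> \<open>The power p - 1 complements the factor d of d x to d^p. Then \<sigma>^p d y_l
      is the expansion with coefficients \<sigma> d E_kl, and as the E_kl are the coordinates of d
      v_k, the tuple v is hit up to the factor s \<sigma> d d.\<close>
    define y where "y l = d [^] (p - 1) \<otimes> S (\<lambda>k. E k l)" for l
    have yc: "y \<in> L \<rightarrow> carrier R" using Sc[OF El] c by (simp add: y_def)
    define x where "x = M.lincomb y L"
    have xc: "x \<in> carrier M" unfolding x_def by (rule M.lincomb_closed[OF L(2) yc])
    have dyc: "(\<lambda>l. d \<otimes> y l) \<in> L \<rightarrow> carrier R" using yc c by auto
    have dp: "d \<otimes> d [^] (p - 1) = d [^] p"
    proof -
      obtain m where m: "p = Suc m" using prime_gt_0_nat[OF p_prime] gr0_conv_Suc by blast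
      show ?thesis unfolding m using c by (simp add: m_comm)
    qed
    have \<sigma>d: "\<sigma> \<otimes> d \<in> carrier R" using c by simp
    have z0: "(\<lambda>_. \<zero>) \<in> vec ?\<rho>" by (simp add: vec_def)
    have "rep x (\<lambda>l k. (\<sigma> \<otimes> d) \<otimes> E k l \<oplus> \<zero>)"
      unfolding rep_def
    proof (intro conjI ballI exI[of _ "\<lambda>l. d \<otimes> y l"])
      show "M.lincomb (\<lambda>l. d \<otimes> y l) L = d \<odot>\<^bsub>M\<^esub> x" unfolding x_def by (rule M.lincomb_smult[OF L(2) yc c(1)])
      fix l assume l: "l \<in> L"
      show "(\<lambda>k. (\<sigma> \<otimes> d) \<otimes> E k l \<oplus> \<zero>) \<in> vec ?\<rho>" using Ec[OF _ l] c by (simp add: vec_def)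
      have SE: "S (\<lambda>k. E k l) \<in> carrier R" by (rule Sc[OF El[OF l]])
      have S0: "S (\<lambda>_. \<zero>) = \<zero>"
      proof -
        have "S (\<lambda>_. \<zero>) = (\<Oplus>k\<in>{..<?\<rho>}. \<zero>)"
          unfolding S_def by (rule add.finprod_cong') (use bc frob_zero[of 1] in simp_all)
        then show ?thesis by simp
      qed
      have "S (\<lambda>k. (\<sigma> \<otimes> d) \<otimes> E k l \<oplus> \<zero>) = (\<sigma> \<otimes> d) [^] p \<otimes> S (\<lambda>k. E k l)"
        unfolding S_lin[OF \<sigma>d El[OF l] z0] S0 using SE c by simp
      also have "\<dots> = \<sigma> [^] p \<otimes> (d [^] p \<otimes> S (\<lambda>k. E k l))" using SE c by (simp add: nat_pow_distrib m_assoc)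
      also have "\<dots> = \<sigma> [^] p \<otimes> (d \<otimes> y l)" unfolding dp[symmetric] y_def using SE c by (simp add: m_assoc)
      finally show "\<sigma> [^] p \<otimes> (d \<otimes> y l) \<ominus> S (\<lambda>k. (\<sigma> \<otimes> d) \<otimes> E k l \<oplus> \<zero>) \<in> Q"
        using dyc l c by (simp add: a_minus_def r_neg Pi_def)
    qed (rule dyc)
    then have hx: "h k x = M.lincomb (\<lambda>l. s \<otimes> ((\<sigma> \<otimes> d) \<otimes> E k l \<oplus> \<zero>)) L" if "k < ?\<rho>" for k
      by (rule h_rep[OF _ xc that])
    have "h k x = (s \<otimes> (\<sigma> \<otimes> (d \<otimes> d))) \<odot>\<^bsub>M\<^esub> v k" if k: "k < ?\<rho>" for k
    proof -
      have Ek: "E k \<in> L \<rightarrow> carrier R" "M.lincomb (E k) L = d \<odot>\<^bsub>M\<^esub> v k" using E k by simp_all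
      have ssd: "s \<otimes> (\<sigma> \<otimes> d) \<in> carrier R" using c by simp
      have sE: "(\<lambda>l. (s \<otimes> (\<sigma> \<otimes> d)) \<otimes> E k l) \<in> L \<rightarrow> carrier R" using Ec[OF k] ssd by simp
      have "h k x = M.lincomb (\<lambda>l. (s \<otimes> (\<sigma> \<otimes> d)) \<otimes> E k l) L"
        unfolding hx[OF k] by (rule M.lincomb_cong[OF refl L(2) _ sE]) (use Ec[OF k] c in \<open>simp add: m_assoc\<close>)
      also have "\<dots> = (s \<otimes> (\<sigma> \<otimes> d)) \<odot>\<^bsub>M\<^esub> (d \<odot>\<^bsub>M\<^esub> v k)"
        using M.lincomb_smult[OF L(2) Ek(1) ssd] Ek(2) by simp
      also have "\<dots> = (s \<otimes> (\<sigma> \<otimes> (d \<otimes> d))) \<odot>\<^bsub>M\<^esub> v k"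
        using c v k by (simp add: M.smult_assoc1[symmetric] m_assoc)
      finally show ?thesis .
    qed
    then show "\<exists>x\<in>carrier M. \<forall>k<?\<rho>. h k x = (s \<otimes> (\<sigma> \<otimes> (d \<otimes> d))) \<odot>\<^bsub>M\<^esub> v k"
      using xc by (intro bexI[of _ x]) simp_all
  qed
  moreover have "s \<otimes> (\<sigma> \<otimes> (d \<otimes> d)) \<in> carrier R - Q"
    by (intro prime_notin_mult[OF Q] s(1) \<sigma>(1) d)
  ultimately show ?thesis using h0 by (intro exI[of _ h] conjI bexI ballI allI impI)
qed

end

subsection \<open>Residue fields\<close>

lemma (in domain) pow_non_zero:
  assumes "x \<in> carrier R" "x \<noteq> \<zero>"
  shows "x [^] (n::nat) \<noteq> \<zero>"
  by (induction n) (use assms in \<open>simp_all add: integral_iff\<close>)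

text \<open>One factor q is cancelled at a time, from a or from its cofactor c. It is applied to the
  polynomial X - u, to find the divisors of (X - u)^p.\<close>

lemma (in domain) prime_power_factor:
  assumes q: "q \<in> carrier R" "q \<noteq> \<zero>" "prime R q"
    and "a \<in> carrier R" "c \<in> carrier R" "a \<otimes> c = q [^] (n::nat)"
  shows "\<exists>k\<le>n. \<exists>u\<in>Units R. a = u \<otimes> q [^] k"
  using assms(4-6)
proof (induction n arbitrary: a c)
  case 0
  then have "a \<otimes> c = \<one>" "c \<otimes> a = \<one>" by (simp_all add: m_comm)
  then have "a \<in> Units R" unfolding Units_def using "0.prems"(1,2) by auto
  then show ?case using "0.prems" by (intro exI[of _ 0] conjI bexI[of _ a]) simp_all
next
  case (Suc n)
  have qn: "q [^] n \<in> carrier R" using q by simp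
  have eq: "a \<otimes> c = q \<otimes> q [^] n" using Suc.prems(3) q by (simp add: m_comm)
  have "q divides a \<otimes> c" unfolding eq by (rule dividesI[OF qn refl])
  then have "q divides a \<or> q divides c" using q(3) Suc.prems(1,2) unfolding prime_def by simp
  then show ?case
  proof
    assume "q divides a"
    then obtain a' where a': "a' \<in> carrier R" "a = q \<otimes> a'" unfolding factor_def by (elim bexE)
    have "q \<otimes> (a' \<otimes> c) = q \<otimes> q [^] n" using eq a' q Suc.prems(2) by (simp add: m_assoc)
    then have "a' \<otimes> c = q [^] n" using m_lcancel[OF q(2,1)] a'(1) Suc.prems(2) qn by simp
    from Suc.IH[OF a'(1) Suc.prems(2) this] obtain k u where
      k: "k \<le> n" and u: "u \<in> Units R" "a' = u \<otimes> q [^] k" by (elim exE conjE bexE)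
    have uc: "u \<in> carrier R" using u(1) by (rule Units_closed)
    have "a = u \<otimes> q [^] Suc k" unfolding a'(2) u(2) using uc q by (simp add: m_ac)
    then show ?thesis using k u(1) by (intro exI[of _ "Suc k"] conjI bexI[of _ u]) simp_all
  next
    assume "q divides c"
    then obtain c' where c': "c' \<in> carrier R" "c = q \<otimes> c'" unfolding factor_def by (elim bexE)
    have "q \<otimes> (a \<otimes> c') = q \<otimes> q [^] n" using eq c' q Suc.prems(1) by (simp add: m_lcomm)
    then have "a \<otimes> c' = q [^] n" using m_lcancel[OF q(2,1)] c'(1) Suc.prems(1) qn by simp
    from Suc.IH[OF Suc.prems(1) c'(1) this] obtain k u where
      k: "k \<le> n" and u: "u \<in> Units R" "a = u \<otimes> q [^] k" by (elim exE conjE bexE)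
    then show ?thesis by (intro exI[of _ k] conjI bexI[of _ u]) simp_all
  qed
qed

lemma (in field) subfield_mem_coprime_powers:
  assumes L: "subfield L R" and u: "u \<in> carrier R"
    and d: "u [^] (d::nat) \<in> L" and q: "u [^] (q::nat) \<in> L" and "coprime d q" "0 < q"
  shows "u \<in> L"
proof (cases "u = \<zero> \<or> q = 1")
  case True
  then show ?thesis using subringE(2)[OF subfieldE(1)[OF L]] q u by auto
next
  case False
  then have u0: "u \<noteq> \<zero>" and q1: "q \<noteq> 1" by simp_all
  note sub = subfieldE(1)[OF L]
  have powL: "x [^] (n::nat) \<in> L" if "x \<in> L" for x n
    by (induction n) (use subringE(3,6)[OF sub] that in simp_all)
  \<comment> \<open>From d x = q y + 1, u is the quotient of u^(d x) by u^(q y), both in L. The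
    exponent q = 1 was set aside because this form of Bezout's identity requires q \<noteq>
    1.\<close>
  obtain x y where xy: "d * x = Suc (q * y)"
    using coprime_bezout_strong[OF assms(5) q1] by (elim exE) (rule that, simp)
  have "u [^] (q * y) \<otimes> u = u [^] (d * x)" unfolding xy by simp
  moreover have "u [^] (d * x) \<in> L" using powL[OF d, of x] u by (simp add: nat_pow_pow)
  moreover have w: "u [^] (q * y) \<in> L" using powL[OF q, of y] u by (simp add: nat_pow_pow)
  moreover have nz: "u [^] (q * y) \<noteq> \<zero>" using pow_non_zero[OF u u0] by simp
  moreover have "inv (u [^] (q * y)) \<in> L" using subfield_m_inv(1)[OF L] w nz by simp
  ultimately have "inv (u [^] (q * y)) \<otimes> (u [^] (q * y) \<otimes> u) \<in> L" using subringE(6)[OF sub] by simp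
  moreover have "u [^] (q * y) \<in> Units R" using u nz by (simp add: field_Units)
  ultimately show ?thesis using u by (simp add: m_assoc[symmetric])
qed

context field
begin

text \<open>The minimal polynomial of u over L divides X^p - u^p = (X - u)^p, so it is (X - u)^k
  with k \<le> p. Its constant term (-u)^k lies in L; for 0 < k < p this and (-u)^p in L would put u
  into L.\<close>

lemma purely_inseparable_degree:
  assumes p: "Factorial_Ring.prime (p::nat)" and ch: "[p] \<cdot> \<one> = \<zero>"
    and L: "subfield L R" and u: "u \<in> carrier R" "u \<notin> L" "u [^] p \<in> L"
  shows "(algebraic over L) u" "dimension p L (simple_extension L u)"
proof -
  note sub = subfieldE(1)[OF L]
  note K = carrier_is_subfield
  note Kr = carrier_is_subring
  interpret UL: domain "L[X]" by (rule univ_poly_is_domain[OF sub])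
  interpret UK: domain "poly_ring R" by (rule univ_poly_is_domain[OF Kr])
  interpret hL: ring_hom_ring "R \<lparr> carrier := L \<rparr>" "L[X]" poly_of_const by (rule canonical_embedding_ring_hom[OF sub])
  have "poly_of_const \<in> ring_hom R (poly_ring R)" using canonical_embedding_is_hom[OF Kr] by simp
  then interpret hK: ring_hom_ring R "poly_ring R" poly_of_const
    by (intro ring_hom_ringI2 ring_axioms UK.ring_axioms)
  have mu: "\<ominus> u \<in> carrier R" using u by simp
  \<comment> \<open>With (-u)^p instead of -(u^p) as constant term, g is the p-th power of X + (-u)
    by additivity of Frobenius, also for p = 2.\<close>
  have mL: "(\<ominus> u) [^] p \<in> L" (is "?v \<in> L")
  proof -
    have "?v \<oplus> u [^] p = \<zero>"
      using prime_char_add_pow[OF p ch mu u(1)] u(1) prime_gt_0_nat[OF p] by (simp add: l_neg nat_pow_zero)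
    then have "?v = \<ominus> (u [^] p)" using u(1) by (intro minus_equality[symmetric]) simp_all
    then show ?thesis using subringE(5)[OF sub u(3)] by simp
  qed
  define q where "q = X \<oplus>\<^bsub>poly_ring R\<^esub> poly_of_const (\<ominus> u)"
  have Xc: "X \<in> carrier (poly_ring R)" by (rule var_closed(1)[OF Kr])
  have XL: "X \<in> carrier (L[X])" by (rule var_closed(1)[OF sub])
  have qc: "q \<in> carrier (poly_ring R)" unfolding q_def using Xc mu by simp
  have q_eq: "q = [\<one>, \<ominus> u]"
    unfolding q_def var_def poly_of_const_def using u by (simp add: univ_poly_def)
  have chU: "[p] \<cdot>\<^bsub>poly_ring R\<^esub> \<one>\<^bsub>poly_ring R\<^esub> = \<zero>\<^bsub>poly_ring R\<^esub>"
    proof -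
    have "[n] \<cdot>\<^bsub>poly_ring R\<^esub> \<one>\<^bsub>poly_ring R\<^esub> = poly_of_const ([n] \<cdot> \<one>)" for n :: nat
    proof (induction n)
      case (Suc n)
      have c: "[n] \<cdot> \<one> \<in> carrier R" by simp
      show ?case using Suc hK.hom_add[OF c one_closed] c by (simp add: add_pow_def)
    qed (simp add: add_pow_def)
    then show ?thesis using ch by simp
  qed
  define g where "g = X [^]\<^bsub>L[X]\<^esub> p \<oplus>\<^bsub>L[X]\<^esub> poly_of_const ((\<ominus> u) [^] p)"
  have pcL: "poly_of_const ((\<ominus> u) [^] p) \<in> carrier (L[X])" using hL.hom_closed mL by simp
  have gL: "g \<in> carrier (L[X])" unfolding g_def using XL pcL by simp
  have gq: "g = q [^]\<^bsub>poly_ring R\<^esub> p"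
    proof -
    have pw: "X [^]\<^bsub>L[X]\<^esub> n = X [^]\<^bsub>poly_ring R\<^esub> n" for n :: nat
      by (induction n) (simp_all add: nat_pow_def univ_poly_def)
    have "q [^]\<^bsub>poly_ring R\<^esub> p = X [^]\<^bsub>poly_ring R\<^esub> p \<oplus>\<^bsub>poly_ring R\<^esub> poly_of_const (\<ominus> u) [^]\<^bsub>poly_ring R\<^esub> p"
      unfolding q_def by (rule UK.prime_char_add_pow[OF p chU Xc]) (use mu in simp)
    also have "poly_of_const (\<ominus> u) [^]\<^bsub>poly_ring R\<^esub> p = poly_of_const ((\<ominus> u) [^] p)"
      by (rule hK.hom_nat_pow[OF mu, symmetric])
    finally show ?thesis unfolding g_def pw by (simp add: univ_poly_def)
  qed
  have evq: "eval q u = \<zero>" unfolding q_eq using u by (simp add: r_neg)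
  have evg: "eval g u = \<zero>"
    proof -
    interpret ev: ring_hom_ring "poly_ring R" R "\<lambda>p. eval p u" by (rule eval_ring_hom[OF Kr u(1)])
    have "eval g u = (eval q u) [^] p" unfolding gq by (rule ev.hom_nat_pow[OF qc])
    then show ?thesis unfolding evq using prime_gt_0_nat[OF p] by (simp add: nat_pow_zero)
  qed
  have q0: "q \<noteq> \<zero>\<^bsub>poly_ring R\<^esub>" unfolding q_eq by (simp add: univ_poly_def)
  have g0: "g \<noteq> []"
    using UK.pow_non_zero[OF qc q0, of p] unfolding gq by (simp add: univ_poly_zero)
  show alg: "(algebraic over L) u" by (rule algebraicI[OF gL g0 evg])
  define f where "f = Irr L u"
  note f = IrrE[OF L u(1) alg, folded f_def]
  have fK: "f \<in> carrier (poly_ring R)" by (rule carrier_polynomial_shell[OF sub f(1)])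
  have "g \<in> PIdl\<^bsub>L[X]\<^esub> f"
    using Irr_generates_ker[OF L u(1) alg] gL evg unfolding a_kernel_def' f_def by auto
  then obtain c where c: "c \<in> carrier (L[X])" "g = c \<otimes>\<^bsub>L[X]\<^esub> f" unfolding cgenideal_def by auto
  have cK: "c \<in> carrier (poly_ring R)" by (rule carrier_polynomial_shell[OF sub c(1)])
  have fc: "f \<otimes>\<^bsub>poly_ring R\<^esub> c = q [^]\<^bsub>poly_ring R\<^esub> p"
    using c(2) gq UK.m_comm[OF cK fK] by (simp add: univ_poly_def)
  have "pirreducible (carrier R) q" unfolding q_eq
    by (rule subring_degree_one_imp_pirreducible[OF Kr]) (use mu in simp_all)
  then have "pprime (carrier R) q" using pprime_iff_pirreducible[OF K qc] by simp
  then have qp: "prime (poly_ring R) q" unfolding ring_prime_def by simp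
  obtain k a where k: "k \<le> p" and a: "a \<in> Units (poly_ring R)" "f = a \<otimes>\<^bsub>poly_ring R\<^esub> q [^]\<^bsub>poly_ring R\<^esub> k"
    using UK.prime_power_factor[OF qc q0 qp fK cK fc] by (elim exE conjE bexE)
  obtain \<alpha> where \<alpha>: "a = [\<alpha>]" "\<alpha> \<in> carrier R" "\<alpha> \<noteq> \<zero>" using a(1) univ_poly_units[OF K] by auto
  have qk: "q [^]\<^bsub>poly_ring R\<^esub> k \<in> carrier (poly_ring R)" using qc by simp
  have pol: "polynomial (carrier R) f" "polynomial (carrier R) (q [^]\<^bsub>poly_ring R\<^esub> k)" "polynomial (carrier R) a"
    using fK qk a(1) UK.Units_closed by (simp_all add: univ_poly_carrier)
  have qk0: "q [^]\<^bsub>poly_ring R\<^esub> k \<noteq> []" using UK.pow_non_zero[OF qc q0] by (simp add: univ_poly_zero)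
  have pq: "polynomial (carrier R) (q [^]\<^bsub>poly_ring R\<^esub> n)" "q [^]\<^bsub>poly_ring R\<^esub> n \<noteq> []" for n :: nat
    using UK.nat_pow_closed[OF qc] UK.pow_non_zero[OF qc q0] by (simp_all add: univ_poly_carrier univ_poly_zero)
  \<comment> \<open>Leading coefficients are tracked because f is only known to be a unit times a
    power of q; both being monic, the unit is 1.\<close>
  have lc_mult: "lead_coeff (poly_mult f1 f2) = lead_coeff f1 \<otimes> lead_coeff f2"
    if "polynomial (carrier R) f1" "polynomial (carrier R) f2" "f1 \<noteq> []" "f2 \<noteq> []" for f1 f2
  proof -
    have "poly_mult f1 f2 \<noteq> []" using poly_mult_integral[OF Kr that(1,2)] that(3,4) by auto
    then show ?thesis using poly_mult_lead_coeff_aux[OF Kr that] poly_mult_degree_eq[OF Kr that(1,2)] that(3,4)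
        lead_coeff_simp[of "poly_mult f1 f2"] by simp
  qed
  have fpm: "f = poly_mult [\<alpha>] (q [^]\<^bsub>poly_ring R\<^esub> k)" using a(2) \<alpha>(1) by (simp add: univ_poly_def)
  have deg: "degree f = k"
    unfolding fpm using poly_mult_degree_eq[OF Kr pol(3) pq(1)[of k]] pq(2)[of k] \<alpha>(1)
      polynomial_pow_degree[OF qc, of k] by (simp add: q_eq)
  have lc: "lead_coeff (q [^]\<^bsub>poly_ring R\<^esub> n) = \<one>" for n :: nat
    proof (induction n)
    case 0
    show ?case by (simp add: univ_poly_def)
  next
    case (Suc n)
    have "q [^]\<^bsub>poly_ring R\<^esub> Suc n = poly_mult (q [^]\<^bsub>poly_ring R\<^esub> n) q" by (simp add: nat_pow_def univ_poly_def)
    moreover have "polynomial (carrier R) q" "q \<noteq> []" using qc q_eq by (simp_all add: univ_poly_carrier)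
    ultimately show ?case using lc_mult[OF pq(1)[of n] _ pq(2)[of n]] Suc by (simp add: q_eq)
  qed
  have "lead_coeff f = \<alpha>"
    unfolding fpm using lc_mult[OF pol(3) pq(1)[of k] _ pq(2)[of k]] lc[of k] \<alpha>(1,2) by simp
  then have \<alpha>1: "\<alpha> = \<one>" using f(3) by simp
  have "k = p"
  proof (rule ccontr)
    assume "k \<noteq> p"
    then have kp: "k < p" using k by simp
    have "0 < k" using pirreducible_degree[OF L f(1,2)] deg by simp
    then have cop: "coprime k p"
      using kp p by (metis coprime_commute nat_dvd_not_less prime_imp_coprime)
    interpret ev: ring_hom_ring "poly_ring R" R "\<lambda>p. eval p \<zero>" by (rule eval_ring_hom[OF Kr zero_closed])
    have "eval f \<zero> = (\<ominus> u) [^] k"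
      proof -
      have "a \<in> carrier (poly_ring R)" using a(1) by (rule UK.Units_closed)
      then have "eval f \<zero> = eval a \<zero> \<otimes> (eval q \<zero>) [^] k"
        unfolding a(2) using ev.hom_mult[OF _ qk] ev.hom_nat_pow[OF qc] by simp
      also have "eval a \<zero> = \<one>" unfolding \<alpha>(1) \<alpha>1 by simp
      also have "eval q \<zero> = \<ominus> u" unfolding q_eq using mu by simp
      finally show ?thesis using mu by simp
    qed
    moreover have "eval f \<zero> \<in> L"
      proof -
      have "set f \<subseteq> L" using f(1) by (simp add: univ_poly_def polynomial_def) (auto simp: polynomial_def)
      then show ?thesis
        using ring.eval_in_carrier[OF subring_is_ring[OF sub], of f \<zero>] eval_consistent[OF sub] subringE(2)[OF sub] by simp
    qed
    ultimately have "(\<ominus> u) [^] k \<in> L" by simp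
    from subfield_mem_coprime_powers[OF L mu this mL cop] have "\<ominus> u \<in> L" using prime_gt_0_nat[OF p] by simp
    then have "\<ominus> (\<ominus> u) \<in> L" by (rule subringE(5)[OF sub])
    then show False using u(1,2) by simp
  qed
  then show "dimension p L (simple_extension L u)"
    using dimension_simple_extension[OF L u(1) alg] deg unfolding f_def by simp
qed

text \<open>Adjoining an element outside L multiplies the base field's degree by exactly p, and all
  p-th powers still lie in the larger field, so the induction on the degree continues over
  it.\<close>

lemma dimension_power_of_char:
  assumes p: "Factorial_Ring.prime (p::nat)" and ch: "[p] \<cdot> \<one> = \<zero>"
    and L: "subfield L R" and pL: "\<And>x. x \<in> carrier R \<Longrightarrow> x [^] p \<in> L"
    and dim: "dimension n L (carrier R)"
  shows "\<exists>m. n = p ^ m"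
  using L pL dim
proof (induction n arbitrary: L rule: less_induct)
  case (less n)
  note L = less.prems(1)
  show ?case
  proof (cases "carrier R \<subseteq> L")
    case True
    then have "carrier R = L" using subfieldE(3)[OF L] by simp
    then have "dimension 1 L (carrier R)" using dimension_one[OF L] by simp
    then have "n = 1" using dimension_is_inj[OF L less.prems(3)] by simp
    then show ?thesis by (intro exI[of _ 0]) simp
  next
    case False
    then obtain u where u: "u \<in> carrier R" "u \<notin> L" by auto
    note deg = purely_inseparable_degree[OF p ch L u less.prems(2)[OF u(1)]]
    let ?F = "simple_extension L u"
    have F: "subfield ?F R" using simple_extension_is_subfield[OF L u(1)] deg(1) by simp
    have LF: "L \<subseteq> ?F" by (rule simple_extension_incl[OF subfieldE(3)[OF L] u(1)])
    obtain Us where Us: "set Us \<subseteq> carrier R" "independent L Us" "length Us = n" "Span L Us = carrier R"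
      using exists_base[OF L less.prems(3)] by auto
    \<comment> \<open>A basis over L still spans over the larger field, which shows that the degree
      over that field is finite before the tower law is applied.\<close>
    have "Span ?F Us = carrier R"
      proof
      show "Span ?F Us \<subseteq> carrier R" by (rule Span_in_carrier[OF subfieldE(3)[OF F] Us(1)])
      show "carrier R \<subseteq> Span ?F Us"
        unfolding Us(4)[symmetric] Span_eq_combine_set[OF L Us(1)] Span_eq_combine_set[OF F Us(1)]
        using LF by blast
    qed
    then have "finite_dimension ?F (carrier R)" using Span_finite_dimension[OF F Us(1)] by simp
    then obtain m where m: "dimension m ?F (carrier R)" unfolding finite_dimension_def by (elim exE)
    have n: "n = p * m"
      by (rule dimension_is_inj[OF L less.prems(3) telescopic_base[OF L F deg(2) m]])
    have "m \<noteq> 0"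
    proof
      assume "m = 0"
      then have "carrier R = {\<zero>}" using dimension_zero[OF F] m by simp
      then show False by (metis one_closed singletonD zero_not_one)
    qed
    then have "m < n" using n prime_gt_1_nat[OF p] by simp
    then obtain j where "m = p ^ j" using less.IH[OF _ F _ m] less.prems(2) LF by auto
    then show ?thesis using n by (intro exI[of _ "Suc j"]) simp
  qed
qed

end

section \<open>Localization and its residue field\<close>

locale fraction_cring = cring R for R (structure) +
  fixes S :: "'a set"
  assumes S_sub: "S \<subseteq> carrier R" and S_one: "\<one> \<in> S" and S_mult: "s \<in> S \<Longrightarrow> t \<in> S \<Longrightarrow> s \<otimes> t \<in> S"
begin

lemma S_closed: "s \<in> S \<Longrightarrow> s \<in> carrier R"
  using S_sub by auto

lemma loc_rel_iff:
  "((a, s), (b, t)) \<in> loc_rel R S \<longleftrightarrow>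
    a \<in> carrier R \<and> s \<in> S \<and> b \<in> carrier R \<and> t \<in> S \<and> (\<exists>u\<in>S. u \<otimes> (a \<otimes> t) = u \<otimes> (b \<otimes> s))"
proof -
  have "u \<otimes> (a \<otimes> t \<ominus> b \<otimes> s) = \<zero> \<longleftrightarrow> u \<otimes> (a \<otimes> t) = u \<otimes> (b \<otimes> s)"
    if "a \<in> carrier R" "s \<in> S" "b \<in> carrier R" "t \<in> S" "u \<in> S" for u
  proof -
    have c: "s \<in> carrier R" "t \<in> carrier R" "u \<in> carrier R" using that S_closed by simp_all
    have "u \<otimes> (a \<otimes> t \<ominus> b \<otimes> s) = u \<otimes> (a \<otimes> t) \<ominus> u \<otimes> (b \<otimes> s)"
      using c that(1,3) by (simp add: a_minus_def r_distr r_minus)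
    then show ?thesis using c that(1,3) by (simp add: r_right_minus_eq)
  qed
  then show ?thesis unfolding loc_rel_def by auto
qed

lemma loc_rel_equiv: "equiv (carrier R \<times> S) (loc_rel R S)"
proof (rule equivI)
  show "loc_rel R S \<subseteq> (carrier R \<times> S) \<times> carrier R \<times> S" unfolding loc_rel_def by auto
  show "refl_on (carrier R \<times> S) (loc_rel R S)"
    by (rule refl_onI) (use S_one loc_rel_iff in auto)
  show "sym (loc_rel R S)"
    by (rule symI) (clarsimp simp: loc_rel_iff, metis)
  show "trans (loc_rel R S)"
  proof (rule transI, clarify)
    fix a s b t c w assume "((a, s), (b, t)) \<in> loc_rel R S" "((b, t), (c, w)) \<in> loc_rel R S"
    then obtain u v where m: "a \<in> carrier R" "s \<in> S" "b \<in> carrier R" "t \<in> S" "c \<in> carrier R" "w \<in> S" "u \<in> S" "v \<in> S"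
      and u: "u \<otimes> (a \<otimes> t) = u \<otimes> (b \<otimes> s)" and v: "v \<otimes> (b \<otimes> w) = v \<otimes> (c \<otimes> t)"
      unfolding loc_rel_iff by (elim conjE bexE)
    have cl: "s \<in> carrier R" "t \<in> carrier R" "w \<in> carrier R" "u \<in> carrier R" "v \<in> carrier R"
      using m S_closed by simp_all
    \<comment> \<open>The middle denominator t joins the two multipliers as an additional factor,
      which is why S has to be closed under products.\<close>
    have "(u \<otimes> v \<otimes> t) \<otimes> (a \<otimes> w) = (v \<otimes> w) \<otimes> (u \<otimes> (a \<otimes> t))" using m cl by (simp add: m_ac)
    also have "\<dots> = (u \<otimes> s) \<otimes> (v \<otimes> (b \<otimes> w))" unfolding u using m cl by (simp add: m_ac)
    also have "\<dots> = (u \<otimes> v \<otimes> t) \<otimes> (c \<otimes> s)" unfolding v using m cl by (simp add: m_ac)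
    finally show "((a, s), (c, w)) \<in> loc_rel R S"
      unfolding loc_rel_iff using m by (intro conjI bexI[of _ "u \<otimes> v \<otimes> t"] S_mult)
  qed
qed

lemma frac_eq:
  assumes "a \<in> carrier R" "s \<in> S" "b \<in> carrier R" "t \<in> S"
  shows "loc_frac R S a s = loc_frac R S b t \<longleftrightarrow> (\<exists>u\<in>S. u \<otimes> (a \<otimes> t) = u \<otimes> (b \<otimes> s))"
  unfolding loc_frac_def using eq_equiv_class_iff[OF loc_rel_equiv, of "(a, s)" "(b, t)"] assms
  by (simp add: loc_rel_iff)

lemma frac_eqI:
  assumes "a \<in> carrier R" "s \<in> S" "b \<in> carrier R" "t \<in> S" "a \<otimes> t = b \<otimes> s"
  shows "loc_frac R S a s = loc_frac R S b t"
  using frac_eq[OF assms(1-4)] assms(5) S_one by auto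

abbreviation RS where "RS \<equiv> localization R S"

lemma frac_closed: "a \<in> carrier R \<Longrightarrow> s \<in> S \<Longrightarrow> loc_frac R S a s \<in> carrier RS"
  unfolding localization_def loc_frac_def by (auto intro: quotientI)

lemma frac_cases:
  assumes "Xa \<in> carrier RS"
  obtains a s where "a \<in> carrier R" "s \<in> S" "Xa = loc_frac R S a s"
  using assms unfolding localization_def loc_frac_def by (auto elim: quotientE)

text \<open>The operations are unions over all representatives; when the result does not depend on
  the representatives, such a union collapses to a single fraction.\<close>

lemma frac_UN:
  assumes "a \<in> carrier R" "s \<in> S" "b \<in> carrier R" "t \<in> S"
    and "\<And>a' s' b' t'. a' \<in> carrier R \<Longrightarrow> s' \<in> S \<Longrightarrow> b' \<in> carrier R \<Longrightarrow> t' \<in> S \<Longrightarrow>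
      \<exists>u\<in>S. u \<otimes> (a \<otimes> s') = u \<otimes> (a' \<otimes> s) \<Longrightarrow> \<exists>u\<in>S. u \<otimes> (b \<otimes> t') = u \<otimes> (b' \<otimes> t) \<Longrightarrow> g a' s' b' t' = g a s b t"
  shows "(\<Union>(a', s')\<in>loc_frac R S a s. \<Union>(b', t')\<in>loc_frac R S b t. g a' s' b' t') = g a s b t"
proof -
  have "(a, s) \<in> loc_frac R S a s" "(b, t) \<in> loc_frac R S b t"
    unfolding loc_frac_def using assms(1-4) S_one by (auto simp: loc_rel_iff)
  moreover have "g a' s' b' t' = g a s b t" if "(a', s') \<in> loc_frac R S a s" "(b', t') \<in> loc_frac R S b t" for a' s' b' t'
    by (rule assms(5)) (use that in \<open>simp_all add: loc_frac_def loc_rel_iff\<close>)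
  ultimately show ?thesis by blast
qed

lemma frac_mult:
  assumes "a \<in> carrier R" "s \<in> S" "b \<in> carrier R" "t \<in> S"
  shows "loc_frac R S a s \<otimes>\<^bsub>RS\<^esub> loc_frac R S b t = loc_frac R S (a \<otimes> b) (s \<otimes> t)"
proof -
  have "loc_frac R S (a' \<otimes> b') (s' \<otimes> t') = loc_frac R S (a \<otimes> b) (s \<otimes> t)"
    if m: "a' \<in> carrier R" "s' \<in> S" "b' \<in> carrier R" "t' \<in> S"
      and ex: "\<exists>u\<in>S. u \<otimes> (a \<otimes> s') = u \<otimes> (a' \<otimes> s)" "\<exists>u\<in>S. u \<otimes> (b \<otimes> t') = u \<otimes> (b' \<otimes> t)" for a' s' b' t'
  proof -
    obtain u v where uv: "u \<in> S" "v \<in> S" and u: "u \<otimes> (a \<otimes> s') = u \<otimes> (a' \<otimes> s)" and v: "v \<otimes> (b \<otimes> t') = v \<otimes> (b' \<otimes> t)"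
      using ex by (elim bexE)
    have cl: "s \<in> carrier R" "t \<in> carrier R" "s' \<in> carrier R" "t' \<in> carrier R" "u \<in> carrier R" "v \<in> carrier R"
      using m uv assms S_closed by simp_all
    have "(u \<otimes> v) \<otimes> ((a' \<otimes> b') \<otimes> (s \<otimes> t)) = (u \<otimes> (a' \<otimes> s)) \<otimes> (v \<otimes> (b' \<otimes> t))" using m assms cl by (simp add: m_ac)
    also have "\<dots> = (u \<otimes> v) \<otimes> ((a \<otimes> b) \<otimes> (s' \<otimes> t'))" unfolding u[symmetric] v[symmetric] using m assms cl by (simp add: m_ac)
    finally show ?thesis using frac_eq m assms uv S_mult by (metis m_closed)
  qed
  then have "(\<Union>(a', s')\<in>loc_frac R S a s. \<Union>(b', t')\<in>loc_frac R S b t. loc_frac R S (a' \<otimes> b') (s' \<otimes> t'))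
      = loc_frac R S (a \<otimes> b) (s \<otimes> t)"
    by (intro frac_UN[where g = "\<lambda>a s b t. loc_frac R S (a \<otimes> b) (s \<otimes> t)"] assms)
  then show ?thesis by (simp add: localization_def)
qed

lemma frac_add:
  assumes "a \<in> carrier R" "s \<in> S" "b \<in> carrier R" "t \<in> S"
  shows "loc_frac R S a s \<oplus>\<^bsub>RS\<^esub> loc_frac R S b t = loc_frac R S (a \<otimes> t \<oplus> b \<otimes> s) (s \<otimes> t)"
proof -
  have "loc_frac R S (a' \<otimes> t' \<oplus> b' \<otimes> s') (s' \<otimes> t') = loc_frac R S (a \<otimes> t \<oplus> b \<otimes> s) (s \<otimes> t)"
    if m: "a' \<in> carrier R" "s' \<in> S" "b' \<in> carrier R" "t' \<in> S"
      and ex: "\<exists>u\<in>S. u \<otimes> (a \<otimes> s') = u \<otimes> (a' \<otimes> s)" "\<exists>u\<in>S. u \<otimes> (b \<otimes> t') = u \<otimes> (b' \<otimes> t)" for a' s' b' t'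
  proof -
    obtain u v where uv: "u \<in> S" "v \<in> S" and u: "u \<otimes> (a \<otimes> s') = u \<otimes> (a' \<otimes> s)" and v: "v \<otimes> (b \<otimes> t') = v \<otimes> (b' \<otimes> t)"
      using ex by (elim bexE)
    have cl: "s \<in> carrier R" "t \<in> carrier R" "s' \<in> carrier R" "t' \<in> carrier R" "u \<in> carrier R" "v \<in> carrier R"
      using m uv assms S_closed by simp_all
    have "(u \<otimes> v) \<otimes> ((a' \<otimes> t' \<oplus> b' \<otimes> s') \<otimes> (s \<otimes> t))
        = (v \<otimes> t \<otimes> t') \<otimes> (u \<otimes> (a' \<otimes> s)) \<oplus> (u \<otimes> s \<otimes> s') \<otimes> (v \<otimes> (b' \<otimes> t))"
      using m assms cl by (simp add: m_ac l_distr r_distr)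
    also have "\<dots> = (u \<otimes> v) \<otimes> ((a \<otimes> t \<oplus> b \<otimes> s) \<otimes> (s' \<otimes> t'))"
      unfolding u[symmetric] v[symmetric] using m assms cl by (simp add: m_ac l_distr r_distr)
    finally have e: "(u \<otimes> v) \<otimes> ((a' \<otimes> t' \<oplus> b' \<otimes> s') \<otimes> (s \<otimes> t)) = (u \<otimes> v) \<otimes> ((a \<otimes> t \<oplus> b \<otimes> s) \<otimes> (s' \<otimes> t'))" .
    have "a' \<otimes> t' \<oplus> b' \<otimes> s' \<in> carrier R" "a \<otimes> t \<oplus> b \<otimes> s \<in> carrier R" using m assms cl by simp_all
    then show ?thesis using frac_eq e m assms uv S_mult by metis
  qed
  then have "(\<Union>(a', s')\<in>loc_frac R S a s. \<Union>(b', t')\<in>loc_frac R S b t. loc_frac R S (a' \<otimes> t' \<oplus> b' \<otimes> s') (s' \<otimes> t'))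
      = loc_frac R S (a \<otimes> t \<oplus> b \<otimes> s) (s \<otimes> t)"
    by (intro frac_UN[where g = "\<lambda>a s b t. loc_frac R S (a \<otimes> t \<oplus> b \<otimes> s) (s \<otimes> t)"] assms)
  then show ?thesis by (simp add: localization_def)
qed

lemma frac_one: "\<one>\<^bsub>RS\<^esub> = loc_frac R S \<one> \<one>" and frac_zero: "\<zero>\<^bsub>RS\<^esub> = loc_frac R S \<zero> \<one>"
  by (simp_all add: localization_def)

lemma localization_is_cring: "cring RS"
proof (rule cringI)
  note simps = frac_mult frac_add frac_one frac_zero frac_closed S_mult S_one S_closed
  show "abelian_group RS"
  proof (rule abelian_groupI)
    fix Xa Y assume "Xa \<in> carrier RS" "Y \<in> carrier RS"
    then obtain a s b t where *: "a \<in> carrier R" "s \<in> S" "Xa = loc_frac R S a s" "b \<in> carrier R" "t \<in> S" "Y = loc_frac R S b t"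
      by (elim frac_cases)
    then show "Xa \<oplus>\<^bsub>RS\<^esub> Y \<in> carrier RS" by (simp add: simps)
    show "Xa \<oplus>\<^bsub>RS\<^esub> Y = Y \<oplus>\<^bsub>RS\<^esub> Xa" using * by (simp add: simps a_comm m_comm)
    fix Z assume "Z \<in> carrier RS"
    then obtain c w where "c \<in> carrier R" "w \<in> S" "Z = loc_frac R S c w" by (elim frac_cases)
    with * show "Xa \<oplus>\<^bsub>RS\<^esub> Y \<oplus>\<^bsub>RS\<^esub> Z = Xa \<oplus>\<^bsub>RS\<^esub> (Y \<oplus>\<^bsub>RS\<^esub> Z)"
      by (simp add: simps l_distr r_distr m_ac a_ac)
  next
    show "\<zero>\<^bsub>RS\<^esub> \<in> carrier RS" by (simp add: simps)
    fix Xa assume "Xa \<in> carrier RS"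
    then obtain a s where *: "a \<in> carrier R" "s \<in> S" "Xa = loc_frac R S a s" by (elim frac_cases)
    then show "\<zero>\<^bsub>RS\<^esub> \<oplus>\<^bsub>RS\<^esub> Xa = Xa" by (simp add: simps)
    have "loc_frac R S (\<ominus> a) s \<oplus>\<^bsub>RS\<^esub> Xa = \<zero>\<^bsub>RS\<^esub>"
      unfolding *(3) using *(1,2) by (simp add: simps l_distr[symmetric] l_neg) (rule frac_eqI, simp_all add: simps)
    then show "\<exists>Y\<in>carrier RS. Y \<oplus>\<^bsub>RS\<^esub> Xa = \<zero>\<^bsub>RS\<^esub>"
      using *(1,2) by (intro bexI[of _ "loc_frac R S (\<ominus> a) s"]) (simp_all add: simps)
  qed
  show "comm_monoid RS"
  proof (rule comm_monoidI)
    fix Xa Y assume "Xa \<in> carrier RS" "Y \<in> carrier RS"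
    then obtain a s b t where *: "a \<in> carrier R" "s \<in> S" "Xa = loc_frac R S a s" "b \<in> carrier R" "t \<in> S" "Y = loc_frac R S b t"
      by (elim frac_cases)
    then show "Xa \<otimes>\<^bsub>RS\<^esub> Y \<in> carrier RS" by (simp add: simps)
    show "Xa \<otimes>\<^bsub>RS\<^esub> Y = Y \<otimes>\<^bsub>RS\<^esub> Xa" using * by (simp add: simps m_comm)
    fix Z assume "Z \<in> carrier RS"
    then obtain c w where "c \<in> carrier R" "w \<in> S" "Z = loc_frac R S c w" by (elim frac_cases)
    with * show "Xa \<otimes>\<^bsub>RS\<^esub> Y \<otimes>\<^bsub>RS\<^esub> Z = Xa \<otimes>\<^bsub>RS\<^esub> (Y \<otimes>\<^bsub>RS\<^esub> Z)" by (simp add: simps m_assoc)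
  next
    show "\<one>\<^bsub>RS\<^esub> \<in> carrier RS" by (simp add: simps)
    fix Xa assume "Xa \<in> carrier RS"
    then obtain a s where *: "a \<in> carrier R" "s \<in> S" "Xa = loc_frac R S a s" by (elim frac_cases)
    then show "\<one>\<^bsub>RS\<^esub> \<otimes>\<^bsub>RS\<^esub> Xa = Xa" by (simp add: simps)
  qed
  fix Xa Y Z assume "Xa \<in> carrier RS" "Y \<in> carrier RS" "Z \<in> carrier RS"
  then obtain a s b t c w where *: "a \<in> carrier R" "s \<in> S" "Xa = loc_frac R S a s" "b \<in> carrier R" "t \<in> S" "Y = loc_frac R S b t"
    "c \<in> carrier R" "w \<in> S" "Z = loc_frac R S c w"
    by (elim frac_cases)
  then show "(Xa \<oplus>\<^bsub>RS\<^esub> Y) \<otimes>\<^bsub>RS\<^esub> Z = Xa \<otimes>\<^bsub>RS\<^esub> Z \<oplus>\<^bsub>RS\<^esub> Y \<otimes>\<^bsub>RS\<^esub> Z"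
    by (simp add: simps) (rule frac_eqI, simp_all add: simps l_distr r_distr m_ac)
qed

lemma frac_hom: "(\<lambda>a. loc_frac R S a \<one>) \<in> ring_hom R RS"
  by (rule ring_hom_memI) (simp_all add: frac_mult frac_add frac_one frac_closed S_one)

end

text \<open>A description of the residue field by its map from R: the kernel is P and every element
  is a fraction of images. All later arguments use only this description, never equivalence
  classes.\<close>

lemma (in cring) residue_field_properties:
  assumes P: "primeideal P R"
  defines "K \<equiv> residue_field R P"
  shows "\<exists>\<pi>. field K \<and> \<pi> \<in> ring_hom R K \<and> (\<forall>a\<in>carrier R. \<pi> a = \<zero>\<^bsub>K\<^esub> \<longleftrightarrow> a \<in> P) \<and>
    (\<forall>x\<in>carrier K. \<exists>s\<in>carrier R - P. \<exists>a\<in>carrier R. x \<otimes>\<^bsub>K\<^esub> \<pi> s = \<pi> a)"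
proof -
  interpret P: primeideal P R by (rule P)
  have one: "\<one> \<notin> P" using P.one_imp_carrier P.I_notcarr by auto
  interpret L: fraction_cring R "carrier R - P"
    by unfold_locales (use one P.I_prime in auto)
  interpret RS: cring L.RS by (rule L.localization_is_cring)
  let ?f = "loc_frac R (carrier R - P)"
  \<comment> \<open>The extension of P written as fractions with numerator in P. It is maximal
    because a fraction with numerator outside P is inverted by exchanging numerator and
    denominator.\<close>
  define J where "J = {?f a s | a s. a \<in> P \<and> s \<in> carrier R - P}"
  have JI: "?f a s \<in> J" if "a \<in> P" "s \<in> carrier R - P" for a s unfolding J_def using that by auto
  have Jf: "?f a s \<in> J \<longleftrightarrow> a \<in> P" if a: "a \<in> carrier R" and s: "s \<in> carrier R - P" for a s
  proof
    assume "?f a s \<in> J"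
    then obtain b t where b: "b \<in> P" "t \<in> carrier R - P" "?f a s = ?f b t" unfolding J_def by auto
    then obtain u where u: "u \<in> carrier R - P" "u \<otimes> (a \<otimes> t) = u \<otimes> (b \<otimes> s)"
      using L.frac_eq[OF a s P.Icarr[OF b(1)] b(2)] by auto
    have "u \<otimes> (b \<otimes> s) \<in> P" using b(1) s u(1) by (intro P.I_l_closed P.I_r_closed) simp_all
    then have "u \<otimes> (a \<otimes> t) \<in> P" using u(2) by simp
    then show "a \<in> P" using P.I_prime u(1) a b(2) by (metis DiffE m_closed)
  qed (rule JI[OF _ s])
  have JE: "\<exists>a s. Xa = ?f a s \<and> a \<in> P \<and> s \<in> carrier R - P" if "Xa \<in> J" for Xa
    using that unfolding J_def by (elim CollectE)
  have J_sub: "J \<subseteq> carrier L.RS" unfolding J_def using L.frac_closed P.Icarr by auto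
  have J: "ideal J L.RS"
  proof (rule RS.idealI_cring[OF J_sub])
    show "\<zero>\<^bsub>L.RS\<^esub> \<in> J" unfolding L.frac_zero by (rule JI) (use one in simp_all)
    fix Xa Y assume Xa: "Xa \<in> J"
    obtain a s where *: "Xa = ?f a s" "a \<in> P" "s \<in> carrier R - P" using JE[OF Xa] by (elim exE conjE)
    have ac: "a \<in> carrier R" "s \<in> carrier R" using * P.Icarr by simp_all
    {
      assume Y: "Y \<in> J"
      obtain b t where Y': "Y = ?f b t" "b \<in> P" "t \<in> carrier R - P" using JE[OF Y] by (elim exE conjE)
      have bc: "b \<in> carrier R" "t \<in> carrier R" using Y' P.Icarr by simp_all
      have "a \<otimes> t \<oplus> b \<otimes> s \<in> P" using * Y' ac bc by (intro P.a_closed P.I_r_closed)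
      then show "Xa \<oplus>\<^bsub>L.RS\<^esub> Y \<in> J"
        unfolding *(1) Y'(1) L.frac_add[OF ac(1) *(3) bc(1) Y'(3)] using JI L.S_mult * Y' by simp
    next
      fix r assume "r \<in> carrier L.RS"
      then obtain b t where r: "b \<in> carrier R" "t \<in> carrier R - P" "r = ?f b t" by (rule L.frac_cases)
      have "b \<otimes> a \<in> P" using P.I_l_closed[OF *(2) r(1)] .
      then show "r \<otimes>\<^bsub>L.RS\<^esub> Xa \<in> J"
        unfolding *(1) r(3) L.frac_mult[OF r(1,2) ac(1) *(3)] using JI L.S_mult * r(2) by simp
    }
  qed
  have gen: "genideal L.RS ((\<lambda>a. ?f a \<one>) ` P) = J"
  proof (rule subset_antisym)
    show "genideal L.RS ((\<lambda>a. ?f a \<one>) ` P) \<subseteq> J"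
      by (rule RS.genideal_minimal[OF J]) (use JI one in auto)
    show "J \<subseteq> genideal L.RS ((\<lambda>a. ?f a \<one>) ` P)"
    proof
      fix Xa assume Xa: "Xa \<in> J"
      obtain a s where *: "Xa = ?f a s" "a \<in> P" "s \<in> carrier R - P" using JE[OF Xa] by (elim exE conjE)
      have ac: "a \<in> carrier R" "s \<in> carrier R" using * P.Icarr by simp_all
      have sub: "(\<lambda>a. ?f a \<one>) ` P \<subseteq> carrier L.RS" using L.frac_closed P.Icarr one by auto
      have "?f a \<one> \<in> genideal L.RS ((\<lambda>a. ?f a \<one>) ` P)" using RS.genideal_self[OF sub] *(2) by auto
      moreover have "?f \<one> s \<in> carrier L.RS" using L.frac_closed * by simp
      moreover have "?f \<one> s \<otimes>\<^bsub>L.RS\<^esub> ?f a \<one> = Xa"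
        unfolding *(1) using L.frac_mult[OF one_closed *(3) ac(1) L.S_one] ac by simp
      ultimately show "Xa \<in> genideal L.RS ((\<lambda>a. ?f a \<one>) ` P)"
        using ideal.I_l_closed[OF RS.genideal_ideal[OF sub]] by metis
    qed
  qed
  have K: "K = L.RS Quot J" unfolding K_def residue_field_def Let_def gen ..
  interpret J: ideal J L.RS by (rule J)
  have max: "maximalideal J L.RS"
  proof (rule maximalidealI[OF J])
    show "carrier L.RS \<noteq> J"
    proof
      assume "carrier L.RS = J"
      then have "?f \<one> \<one> \<in> J" using L.frac_closed L.S_one by auto
      then show False using Jf[OF one_closed L.S_one] one by simp
    qed
    fix I assume I: "ideal I L.RS" "J \<subseteq> I" "I \<subseteq> carrier L.RS"
    interpret I: ideal I L.RS by (rule I(1))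
    show "I = J \<or> I = carrier L.RS"
    proof (cases "I \<subseteq> J")
      case False
      then obtain Xa where Xa: "Xa \<in> I" "Xa \<notin> J" by auto
      obtain a s where as: "a \<in> carrier R" "s \<in> carrier R - P" "Xa = ?f a s"
        by (rule L.frac_cases[OF subsetD[OF I(3) Xa(1)]])
      have aP: "a \<in> carrier R - P" using Xa(2) as JI by auto
      have sa: "?f s a \<in> carrier L.RS" using L.frac_closed aP as by simp
      have "?f s a \<otimes>\<^bsub>L.RS\<^esub> Xa = \<one>\<^bsub>L.RS\<^esub>"
        unfolding as(3) L.frac_one using aP as L.frac_mult[of s a a s] L.S_mult[OF aP as(2)]
        by simp (rule L.frac_eqI, simp_all add: L.S_one L.S_mult one m_comm)
      then have "\<one>\<^bsub>L.RS\<^esub> \<in> I" using I.I_l_closed[OF Xa(1) sa] by simp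
      then show ?thesis using I.one_imp_carrier by simp
    qed (use I(2) in simp)
  qed
  have fld: "field K" unfolding K by (rule maximalideal.quotient_is_field[OF max L.localization_is_cring])
  interpret K: field K by (rule fld)
  define \<pi> where "\<pi> a = J +>\<^bsub>L.RS\<^esub> ?f a \<one>" for a
  have q: "(+>\<^bsub>L.RS\<^esub>) J \<in> ring_hom L.RS K" unfolding K by (rule J.rcos_ring_hom)
  have hom: "\<pi> \<in> ring_hom R K"
    using ring_hom_trans[OF L.frac_hom q] unfolding \<pi>_def comp_def .
  have zero: "J +>\<^bsub>L.RS\<^esub> Xa = \<zero>\<^bsub>K\<^esub> \<longleftrightarrow> Xa \<in> J" if "Xa \<in> carrier L.RS" for Xa
  proof -
    have "\<zero>\<^bsub>K\<^esub> = J" unfolding K FactRing_def by simp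
    then show ?thesis using J.a_rcos_self[OF that] J.a_rcos_const[of Xa] by metis
  qed
  have ker: "\<pi> a = \<zero>\<^bsub>K\<^esub> \<longleftrightarrow> a \<in> P" if "a \<in> carrier R" for a
    unfolding \<pi>_def using zero[OF L.frac_closed[OF that L.S_one]] Jf[OF that L.S_one] by simp
  have "\<exists>s\<in>carrier R - P. \<exists>a\<in>carrier R. x \<otimes>\<^bsub>K\<^esub> \<pi> s = \<pi> a" if "x \<in> carrier K" for x
  proof -
    obtain Xa where Xa: "Xa \<in> carrier L.RS" "x = J +>\<^bsub>L.RS\<^esub> Xa"
      using \<open>x \<in> carrier K\<close> unfolding K FactRing_def A_RCOSETS_def' by auto
    obtain a s where as: "a \<in> carrier R" "s \<in> carrier R - P" "Xa = ?f a s" using Xa(1) by (rule L.frac_cases)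
    have s1: "?f s \<one> \<in> carrier L.RS" using L.frac_closed L.S_one as by simp
    have "x \<otimes>\<^bsub>K\<^esub> \<pi> s = J +>\<^bsub>L.RS\<^esub> (Xa \<otimes>\<^bsub>L.RS\<^esub> ?f s \<one>)"
      unfolding Xa(2) \<pi>_def using ring_hom_mult[OF q Xa(1) s1] by simp
    also have "Xa \<otimes>\<^bsub>L.RS\<^esub> ?f s \<one> = ?f a \<one>"
      unfolding as(3) using as L.S_one L.frac_mult[of a s s \<one>]
      by simp (rule L.frac_eqI, simp_all add: L.S_one one)
    finally show ?thesis using as unfolding \<pi>_def by auto
  qed
  then show ?thesis using fld hom ker by (intro exI[of _ \<pi>]) simp
qed

section \<open>Frobenius bases of fields\<close>

text \<open>Lets a residue field be treated as a \<open>frob_ring\<close> in its own right.\<close>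

lemma (in field) noetherian_ring_field: "noetherian_ring R"
proof (intro noetherian_ring.intro ring_axioms noetherian_ring_axioms.intro)
    fix I assume I: "ideal I R"
    then have "I = {\<zero>} \<or> I = carrier R" using all_ideals by auto
    then show "\<exists>A\<subseteq>carrier R. finite A \<and> I = Idl A"
    proof
      assume "I = {\<zero>}"
      then show ?thesis using genideal_zero by (intro exI[of _ "{\<zero>}"]) simp
    next
      assume "I = carrier R"
      then show ?thesis using genideal_one by (intro exI[of _ "{\<one>}"]) simp
    qed
qed

lemma (in ring) has_characteristic_primeI:
  assumes p: "Factorial_Ring.prime p" and z: "[p] \<cdot> \<one> = \<zero>" and nz: "\<one> \<noteq> \<zero>"
  shows "has_characteristic R p"
  unfolding has_characteristic_def
proof (intro allI iffI)
  fix n :: nat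
  have mult: "[(m * k)] \<cdot> \<one> = \<zero>" if "[m] \<cdot> \<one> = \<zero>" for m k :: nat
    using add.nat_pow_pow[of \<one> k m] add.nat_pow_one[of k] that by (simp add: add_pow_def)
  {
    assume "p dvd n"
    then show "[n] \<cdot> \<one> = \<zero>" using mult[OF z] by (elim dvdE) simp
  next
    assume n: "[n] \<cdot> \<one> = \<zero>"
    show "p dvd n"
    proof (rule ccontr)
      assume "\<not> p dvd n"
      then have "coprime p n" using prime_imp_coprime[OF p] by simp
      then have "coprime n p" by (simp add: coprime_commute)
      from coprime_bezout_strong[OF this] obtain x y where xy: "n * x = Suc (p * y)"
        using prime_gt_1_nat[OF p] by auto
      have "[(Suc (p * y))] \<cdot> \<one> = [(p * y)] \<cdot> \<one> \<oplus> \<one>" by (simp add: add_pow_def)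
      then have "\<one> = \<zero>" using mult[OF n, of x] mult[OF z, of y] unfolding xy by simp
      then show False using nz by simp
    qed
  }
qed

locale frob_field = frob_ring R p + field R for R :: "('a, 'm) ring_scheme" (structure) and p
begin

text \<open>A basis of \<open>F\<^sub>*R\<close> over the field R. It links three notions of degree:
  \<open>rk\<close> of a prime, \<open>dimension\<close> over the subfield of p-th powers, and
  \<open>vectorspace.dim\<close> in the definition of \<alpha>.\<close>

definition frob_basis :: "nat \<Rightarrow> (nat \<Rightarrow> 'a) \<Rightarrow> bool" where
  "frob_basis n \<beta> \<longleftrightarrow> (\<forall>k<n. \<beta> k \<in> carrier R) \<and>
    (\<forall>c\<in>vec n. (\<Oplus>k\<in>{..<n}. c k [^] p \<otimes> \<beta> k) = \<zero> \<longrightarrow> (\<forall>k<n. c k = \<zero>)) \<and>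
    (\<forall>x\<in>carrier R. \<exists>c\<in>vec n. x = (\<Oplus>k\<in>{..<n}. c k [^] p \<otimes> \<beta> k))"

lemma frob_basisD:
  assumes "frob_basis n \<beta>"
  shows "k < n \<Longrightarrow> \<beta> k \<in> carrier R"
    "c \<in> vec n \<Longrightarrow> (\<Oplus>k\<in>{..<n}. c k [^] p \<otimes> \<beta> k) = \<zero> \<Longrightarrow> k < n \<Longrightarrow> c k = \<zero>"
    "x \<in> carrier R \<Longrightarrow> \<exists>c\<in>vec n. x = (\<Oplus>k\<in>{..<n}. c k [^] p \<otimes> \<beta> k)"
proof -
  note d = assms[unfolded frob_basis_def]
  show "k < n \<Longrightarrow> \<beta> k \<in> carrier R" by (rule conjunct1[OF d, rule_format])
  show "c \<in> vec n \<Longrightarrow> (\<Oplus>k\<in>{..<n}. c k [^] p \<otimes> \<beta> k) = \<zero> \<Longrightarrow> k < n \<Longrightarrow> c k = \<zero>"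
    by (rule conjunct1[OF conjunct2[OF d], rule_format])
  show "x \<in> carrier R \<Longrightarrow> \<exists>c\<in>vec n. x = (\<Oplus>k\<in>{..<n}. c k [^] p \<otimes> \<beta> k)"
    by (rule conjunct2[OF conjunct2[OF d], rule_format])
qed

lemma frob_zero_p: "\<zero> [^] p = \<zero>"
  using frob_zero[of 1] by simp

lemma frob_uminus:
  assumes "x \<in> carrier R"
  shows "(\<ominus> x) [^] p = \<ominus> (x [^] p)"
proof -
  have "(\<ominus> x) [^] p \<oplus> x [^] p = \<zero>"
    using frob_add[of "\<ominus> x" x 1] assms by (simp add: l_neg frob_zero_p)
  then show ?thesis by (intro minus_equality[symmetric]) (use assms in simp_all)
qed

lemma frob_image_subfield: "subfield ((\<lambda>x. x [^] p) ` carrier R) R" (is "subfield ?L R")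
proof (rule subfieldI')
  show "subring ?L R"
  proof (rule subringI)
    show "?L \<subseteq> carrier R" by auto
    show "\<one> \<in> ?L" by (rule image_eqI[of _ _ \<one>]) simp_all
    fix x assume "x \<in> ?L"
    then obtain r where r: "r \<in> carrier R" "x = r [^] p" by auto
    show "\<ominus> x \<in> ?L" using r frob_uminus[OF r(1)] by (intro image_eqI[of _ _ "\<ominus> r"]) simp_all
    fix y assume "y \<in> ?L"
    then obtain s where s: "s \<in> carrier R" "y = s [^] p" by auto
    show "x \<otimes> y \<in> ?L" using r s by (intro image_eqI[of _ _ "r \<otimes> s"]) (simp_all add: nat_pow_distrib)
    show "x \<oplus> y \<in> ?L" using r s frob_add[of r s 1] by (intro image_eqI[of _ _ "r \<oplus> s"]) simp_all
  qed
  fix x assume x: "x \<in> ?L - {\<zero>}"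
  then obtain r where r: "r \<in> carrier R" "x = r [^] p" by auto
  have "r \<noteq> \<zero>" using x r frob_zero_p by auto
  then have u: "r \<in> Units R" using r(1) by (simp add: field_Units)
  have "x \<otimes> (inv r) [^] p = \<one>" unfolding r(2) using u r(1) by (simp add: nat_pow_distrib[symmetric])
  then have "inv x = (inv r) [^] p" using u r by (intro comm_inv_char) simp_all
  then show "inv x \<in> ?L" using u by (intro image_eqI[of _ _ "inv r"]) simp_all
qed

text \<open>Through Frobenius, \<open>F\<^sub>*R\<close> as a space over R is R as a space over its
  subfield of p-th powers. The dimension is built up by adjoining one basis element at a time as a
  \<open>line_extension\<close>.\<close>

lemma frob_basis_dimension:
  assumes \<beta>: "frob_basis n \<beta>"
  shows "dimension n ((\<lambda>x. x [^] p) ` carrier R) (carrier R)"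
proof -
  let ?L = "(\<lambda>x. x [^] p) ` carrier R"
  let ?E = "\<lambda>m. (\<lambda>c. \<Oplus>k\<in>{..<m}. c k [^] p \<otimes> \<beta> k) ` vec m"
  have \<beta>c: "\<beta> k \<in> carrier R" if "k < n" for k by (rule frob_basisD(1)[OF \<beta> that])
  have ind: "c k = \<zero>" if "c \<in> vec n" "(\<Oplus>k\<in>{..<n}. c k [^] p \<otimes> \<beta> k) = \<zero>" "k < n" for c k
    by (rule frob_basisD(2)[OF \<beta> that])
  have cl: "c k [^] p \<otimes> \<beta> k \<in> carrier R" if "c \<in> vec m" "m \<le> n" "k < m" for c m k
    using vecD[OF that(1,3)] \<beta>c[of k] that by simp
  have "dimension m ?L (?E m)" if "m \<le> n" for m
    using that
  proof (induction m)
    case 0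
    have "?E 0 = {\<zero>}" by (auto simp: vec_def)
    then show ?case using zero_dim by simp
  next
    case (Suc m)
    have b: "\<beta> m \<in> carrier R" by (rule \<beta>c) (use Suc.prems in simp)
    have split: "(\<Oplus>k\<in>{..<Suc m}. c k [^] p \<otimes> \<beta> k) = c m [^] p \<otimes> \<beta> m \<oplus> (\<Oplus>k\<in>{..<m}. c k [^] p \<otimes> \<beta> k)"
      if c: "c \<in> vec (Suc m)" for c
      unfolding lessThan_Suc by (rule finsum_insert) (use cl[OF c Suc.prems] in auto)
    have Ec: "?E m \<subseteq> carrier R"
    proof (rule image_subsetI)
      fix c assume c: "c \<in> vec m"
      show "(\<Oplus>k\<in>{..<m}. c k [^] p \<otimes> \<beta> k) \<in> carrier R"
        by (rule finsum_closed) (use cl[OF c] Suc.prems in auto)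
    qed
    have notin: "\<beta> m \<notin> ?E m"
    proof
      assume "\<beta> m \<in> ?E m"
      then obtain c where c: "c \<in> vec m" "\<beta> m = (\<Oplus>k\<in>{..<m}. c k [^] p \<otimes> \<beta> k)" by auto
      \<comment> \<open>The supposed relation expressing the new element by its predecessors,
        extended by zeros to all n indices so that independence of the full basis applies.\<close>
      define c' where "c' k = (if k < m then c k else if k = m then \<ominus> \<one> else \<zero>)" for k
      have c'v: "c' \<in> vec n" unfolding vec_def c'_def using vecD[OF c(1)] by simp
      have c'm: "c' \<in> vec (Suc m)" unfolding vec_def c'_def using vecD[OF c(1)] by simp
      have "(\<Oplus>k\<in>{..<n}. c' k [^] p \<otimes> \<beta> k) = (\<Oplus>k\<in>{..<Suc m}. c' k [^] p \<otimes> \<beta> k)"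
        by (rule add.finprod_mono_neutral_cong_right)
          (use Suc.prems \<beta>c vecD[OF c'v] in \<open>auto simp: c'_def frob_zero_p\<close>)
      also have "\<dots> = c' m [^] p \<otimes> \<beta> m \<oplus> (\<Oplus>k\<in>{..<m}. c' k [^] p \<otimes> \<beta> k)" by (rule split[OF c'm])
      also have "(\<Oplus>k\<in>{..<m}. c' k [^] p \<otimes> \<beta> k) = \<beta> m"
        unfolding c(2) by (rule add.finprod_cong') (use cl[OF c(1)] Suc.prems in \<open>auto simp: c'_def\<close>)
      also have "c' m [^] p \<otimes> \<beta> m = \<ominus> \<beta> m" unfolding c'_def using b by (simp add: frob_uminus l_minus)
      finally have "(\<Oplus>k\<in>{..<n}. c' k [^] p \<otimes> \<beta> k) = \<zero>" using b by (simp add: l_neg)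
      from ind[OF c'v this, of m] have "\<ominus> \<one> = \<zero>" using Suc.prems by (simp add: c'_def)
      then have "\<ominus> (\<ominus> \<one>) = \<ominus> \<zero>" by (rule arg_cong)
      then show False using one_not_zero by simp
    qed
    have "line_extension ?L (\<beta> m) (?E m) = ?E (Suc m)"
    proof (rule Set.set_eqI)
      fix x
      show "x \<in> line_extension ?L (\<beta> m) (?E m) \<longleftrightarrow> x \<in> ?E (Suc m)"
      proof
        assume "x \<in> line_extension ?L (\<beta> m) (?E m)"
        then obtain r c where r: "r \<in> carrier R" and c: "c \<in> vec m"
          and x: "x = r [^] p \<otimes> \<beta> m \<oplus> (\<Oplus>k\<in>{..<m}. c k [^] p \<otimes> \<beta> k)"
          unfolding line_extension_mem_iff by auto
        define c' where "c' k = (if k < m then c k else r)" for k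
        have c'm: "c' \<in> vec (Suc m)" unfolding vec_def c'_def using vecD[OF c] r by simp
        have "(\<Oplus>k\<in>{..<m}. c' k [^] p \<otimes> \<beta> k) = (\<Oplus>k\<in>{..<m}. c k [^] p \<otimes> \<beta> k)"
          by (rule add.finprod_cong') (use cl[OF c] Suc.prems in \<open>auto simp: c'_def\<close>)
        then have "x = (\<Oplus>k\<in>{..<Suc m}. c' k [^] p \<otimes> \<beta> k)" unfolding split[OF c'm] x by (simp add: c'_def)
        then show "x \<in> ?E (Suc m)" using c'm by (rule image_eqI)
      next
        assume "x \<in> ?E (Suc m)"
        then obtain c where c: "c \<in> vec (Suc m)" "x = (\<Oplus>k\<in>{..<Suc m}. c k [^] p \<otimes> \<beta> k)" by auto
        have "c \<in> vec m" using vecD[OF c(1)] by (simp add: vec_def)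
        moreover have "c m \<in> carrier R" using vecD[OF c(1)] by simp
        ultimately show "x \<in> line_extension ?L (\<beta> m) (?E m)"
          unfolding line_extension_mem_iff c(2) split[OF c(1)] by (intro bexI[of _ "c m [^] p"] bexI) auto
      qed
    qed
    then show ?case using Suc_dim[OF b notin Suc.IH] Suc.prems by simp
  qed
  from this[of n] have "dimension n ?L (?E n)" by simp
  moreover have "?E n = carrier R"
  proof
    show "?E n \<subseteq> carrier R"
    proof (rule image_subsetI)
      fix c assume c: "c \<in> vec n"
      show "(\<Oplus>k\<in>{..<n}. c k [^] p \<otimes> \<beta> k) \<in> carrier R"
        by (rule finsum_closed) (use cl[OF c] in auto)
    qed
    show "carrier R \<subseteq> ?E n"
    proof
      fix x assume "x \<in> carrier R"
      from frob_basisD(3)[OF \<beta> this] show "x \<in> ?E n" by (elim bexE) (rule image_eqI)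
    qed
  qed
  ultimately show ?thesis by simp
qed

lemma frob_basis_power_of_char:
  assumes "frob_basis n \<beta>"
  shows "\<exists>m. n = p ^ m"
proof (rule dimension_power_of_char[OF p_prime _ frob_image_subfield _ frob_basis_dimension[OF assms]])
  show "[p] \<cdot> \<one> = \<zero>" using has_char unfolding has_characteristic_def by simp
qed simp

lemma frob_basis_dim:
  assumes \<beta>: "frob_basis n \<beta>"
  shows "vectorspace.dim R (frob_push p 1 R (self_module R)) = n"
proof -
  let ?V = "frob_push p 1 R (self_module R)"
  interpret V: vectorspace R ?V
    by (rule vectorspace.intro[OF frob_push_is_module[OF self_module_is_module] field_axioms])
  have \<beta>c: "\<beta> k \<in> carrier R" if "k < n" for k by (rule frob_basisD(1)[OF \<beta> that])
  have ind: "c k = \<zero>" if "c \<in> vec n" "(\<Oplus>k\<in>{..<n}. c k [^] p \<otimes> \<beta> k) = \<zero>" "k < n" for c k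
    by (rule frob_basisD(2)[OF \<beta> that])
  have Vs: "carrier ?V = carrier R" "\<zero>\<^bsub>?V\<^esub> = \<zero>" "finsum ?V = finsum R"
    "\<And>r x. r \<odot>\<^bsub>?V\<^esub> x = r [^] p \<otimes> x"
    by (simp_all add: frob_push_def self_module_def finsum_def finprod_def fun_eq_iff)
  have unit: "(\<Oplus>k\<in>{..<n}. (if j = k then r else \<zero>) [^] p \<otimes> \<beta> k) = r [^] p \<otimes> \<beta> j"
    if "j < n" "r \<in> carrier R" for j r
  proof -
    have "(\<Oplus>k\<in>{..<n}. (if j = k then r else \<zero>) [^] p \<otimes> \<beta> k) = (\<Oplus>k\<in>{..<n}. if j = k then r [^] p \<otimes> \<beta> k else \<zero>)"
      by (rule add.finprod_cong') (use \<beta>c that(2) in \<open>auto simp: frob_zero_p\<close>)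
    also have "\<dots> = r [^] p \<otimes> \<beta> j"
      by (rule add.finprod_singleton) (use that \<beta>c in auto)
    finally show ?thesis .
  qed
  have inj: "inj_on \<beta> {..<n}"
  proof (rule inj_onI, rule ccontr)
    fix i j assume ij: "i \<in> {..<n}" "j \<in> {..<n}" "\<beta> i = \<beta> j" "i \<noteq> j"
    let ?c = "\<lambda>k. if i = k then \<one> else if j = k then \<ominus> \<one> else \<zero>"
    have cv: "?c \<in> vec n" by (simp add: vec_def)
    have "(\<Oplus>k\<in>{..<n}. ?c k [^] p \<otimes> \<beta> k)
        = (\<Oplus>k\<in>{..<n}. (if i = k then \<one> else \<zero>) [^] p \<otimes> \<beta> k \<oplus> (if j = k then \<ominus> \<one> else \<zero>) [^] p \<otimes> \<beta> k)"
      by (rule add.finprod_cong') (use \<beta>c ij(4) in \<open>auto simp: frob_zero_p\<close>)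
    also have "\<dots> = (\<Oplus>k\<in>{..<n}. (if i = k then \<one> else \<zero>) [^] p \<otimes> \<beta> k) \<oplus> (\<Oplus>k\<in>{..<n}. (if j = k then \<ominus> \<one> else \<zero>) [^] p \<otimes> \<beta> k)"
      by (rule finsum_addf) (use \<beta>c in auto)
    also have "\<dots> = \<one> [^] p \<otimes> \<beta> i \<oplus> (\<ominus> \<one>) [^] p \<otimes> \<beta> j" using ij unit by simp
    also have "\<dots> = \<zero>" using ij \<beta>c by (simp add: frob_uminus l_minus r_neg)
    finally have "?c i = \<zero>" using ind[OF cv] ij(1) by blast
    then show False using one_not_zero by simp
  qed
  let ?A = "\<beta> ` {..<n}"
  have lc: "V.lincomb a ?A = (\<Oplus>k\<in>{..<n}. a (\<beta> k) [^] p \<otimes> \<beta> k)" if "a \<in> ?A \<rightarrow> carrier R" for a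
    unfolding V.lincomb_def Vs by (rule finsum_reindex) (use that \<beta>c inj in auto)
  have Ac: "?A \<subseteq> carrier ?V" unfolding Vs using \<beta>c by auto
  have "V.lin_indpt ?A"
  proof (rule V.finite_lin_indpt2)
    fix a assume a: "a \<in> ?A \<rightarrow> carrier R" "V.lincomb a ?A = \<zero>\<^bsub>?V\<^esub>"
    have v: "(\<lambda>k. if k < n then a (\<beta> k) else \<zero>) \<in> vec n" using a(1) by (auto simp: vec_def)
    have "(\<Oplus>k\<in>{..<n}. (if k < n then a (\<beta> k) else \<zero>) [^] p \<otimes> \<beta> k) = (\<Oplus>k\<in>{..<n}. a (\<beta> k) [^] p \<otimes> \<beta> k)"
      by (rule add.finprod_cong') (use a(1) \<beta>c in auto)
    also have "\<dots> = \<zero>" using a(2) lc[OF a(1)] unfolding Vs by simp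
    finally have "\<forall>k<n. (if k < n then a (\<beta> k) else \<zero>) = \<zero>" using ind[OF v] by blast
    then show "\<forall>v\<in>?A. a v = \<zero>" by auto
  qed (use Ac in auto)
  moreover have "V.span ?A = carrier ?V"
  proof
    show "V.span ?A \<subseteq> carrier ?V" by (rule V.span_is_subset2[OF Ac])
    show "carrier ?V \<subseteq> V.span ?A"
    proof
      fix x assume "x \<in> carrier ?V"
      then have "x \<in> carrier R" unfolding Vs .
      from frob_basisD(3)[OF \<beta> this] obtain c where
        c: "c \<in> vec n" "x = (\<Oplus>k\<in>{..<n}. c k [^] p \<otimes> \<beta> k)" by (elim bexE)
      define a where "a v = c (the_inv_into {..<n} \<beta> v)" for v
      have ak: "a (\<beta> k) = c k" if "k < n" for k unfolding a_def using the_inv_into_f_f[OF inj] that by simp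
      have a: "a \<in> ?A \<rightarrow> carrier R" using ak vecD[OF c(1)] by auto
      have "x = V.lincomb a ?A"
        unfolding lc[OF a] c(2) by (rule add.finprod_cong') (use ak vecD[OF c(1)] \<beta>c in auto)
      then show "x \<in> V.span ?A" using a V.finite_span[of ?A] Ac by auto
    qed
  qed
  ultimately have "V.basis ?A" unfolding V.basis_def using Ac by simp
  then have "V.dim = card ?A" by (intro V.dim_basis) simp
  then show ?thesis using card_image[OF inj] by simp
qed

end

context F_finite_ring
begin

text \<open>A maximal independent family modulo P maps to a basis over the residue field:
  independence follows by clearing one common denominator, spanning by making denominators p-th
  powers. This identifies \<open>rk P\<close> with the degree behind \<alpha>(P).\<close>

lemma residue_field_basis:
  assumes P: "primeideal P R"
  shows "\<exists>\<beta>. frob_field (residue_field R P) p \<and> frob_field.frob_basis (residue_field R P) p (rk P) \<beta>"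
proof -
  interpret P: primeideal P R by (rule P)
  define K where "K = residue_field R P"
  obtain \<pi> where K: "field K" and \<pi>: "\<pi> \<in> ring_hom R K" and ker: "\<forall>a\<in>carrier R. \<pi> a = \<zero>\<^bsub>K\<^esub> \<longleftrightarrow> a \<in> P"
    and frac: "\<forall>x\<in>carrier K. \<exists>s\<in>carrier R - P. \<exists>a\<in>carrier R. x \<otimes>\<^bsub>K\<^esub> \<pi> s = \<pi> a"
    using residue_field_properties[OF P] unfolding K_def by (elim exE conjE)
  interpret K: field K by (rule K)
  interpret \<pi>: ring_hom_ring R K \<pi> by (intro ring_hom_ringI2 ring_axioms K.ring_axioms \<pi>)
  interpret \<pi>c: ring_hom_cring R K \<pi>
    by (intro ring_hom_cring.intro ring_hom_cring_axioms.intro is_cring K.is_cring \<pi>)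
  have "[p] \<cdot>\<^bsub>K\<^esub> \<one>\<^bsub>K\<^esub> = \<zero>\<^bsub>K\<^esub>"
  proof -
    have "[n] \<cdot>\<^bsub>K\<^esub> \<one>\<^bsub>K\<^esub> = \<pi> ([n] \<cdot> \<one>)" for n :: nat
    proof (induction n)
      case (Suc n)
      have c: "[n] \<cdot> \<one> \<in> carrier R" by simp
      show ?case using Suc \<pi>.hom_add[OF c one_closed] c by (simp add: add_pow_def)
    qed (simp add: add_pow_def)
    moreover have "[p] \<cdot> \<one> = \<zero>" using has_char unfolding has_characteristic_def by simp
    ultimately show ?thesis by simp
  qed
  then have "has_characteristic K p" by (intro K.has_characteristic_primeI p_prime) simp_all
  then interpret KF: frob_field K p
    by (intro frob_field.intro frob_ring.intro frob_ring_axioms.intro K.is_cring K.noetherian_ring_field p_prime K)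
  let ?n = "rk P"
  obtain b :: "nat \<Rightarrow> 'a" where b: "pindep 1 P P {..<?n} b" using rk_basis[OF P] by (elim exE)
  have bc: "b k \<in> carrier R" if "k < ?n" for k using b that unfolding pindep_def by auto
  obtain \<sigma> where \<sigma>: "\<sigma> \<in> carrier R - P" "\<forall>x\<in>carrier R. \<sigma> [^] p \<otimes> x \<in> gspan (Fr 1) P (b ` {..<?n})"
    using rk_span_uniform[OF P b] by (elim bexE)
  define \<beta> where "\<beta> k = \<pi> (b k)" for k
  have \<beta>c: "\<beta> k \<in> carrier K" if "k < ?n" for k unfolding \<beta>_def using bc[OF that] by simp
  have \<pi>S: "(\<Oplus>\<^bsub>K\<^esub>k\<in>{..<?n}. \<pi> (c k) [^]\<^bsub>K\<^esub> p \<otimes>\<^bsub>K\<^esub> \<beta> k) = \<pi> (\<Oplus>k\<in>{..<?n}. c k [^] p \<otimes> b k)"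
    if c: "c \<in> vec ?n" for c
  proof -
    have "\<pi> (\<Oplus>k\<in>{..<?n}. c k [^] p \<otimes> b k) = (\<Oplus>\<^bsub>K\<^esub>k\<in>{..<?n}. (\<pi> \<circ> (\<lambda>k. c k [^] p \<otimes> b k)) k)"
      using \<pi>c.hom_finsum[of "\<lambda>k. c k [^] p \<otimes> b k" "{..<?n}"] vecD[OF c] bc by (simp add: Pi_def comp_def)
    also have "\<dots> = (\<Oplus>\<^bsub>K\<^esub>k\<in>{..<?n}. \<pi> (c k) [^]\<^bsub>K\<^esub> p \<otimes>\<^bsub>K\<^esub> \<beta> k)"
      by (rule K.add.finprod_cong') (use vecD[OF c] bc in \<open>simp_all add: \<beta>_def \<pi>.hom_nat_pow\<close>)
    finally show ?thesis by (rule sym)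
  qed
  have \<pi>nz: "\<pi> s \<in> Units K" "\<pi> s \<noteq> \<zero>\<^bsub>K\<^esub>" if "s \<in> carrier R - P" for s
    using ker that by (simp_all add: K.field_Units)
  have ind: "x k = \<zero>\<^bsub>K\<^esub>" if x: "x \<in> K.vec ?n" and z: "(\<Oplus>\<^bsub>K\<^esub>k\<in>{..<?n}. x k [^]\<^bsub>K\<^esub> p \<otimes>\<^bsub>K\<^esub> \<beta> k) = \<zero>\<^bsub>K\<^esub>" and k: "k < ?n" for x k
  proof -
    have xc: "x k \<in> carrier K" if "k < ?n" for k using K.vecD[OF x that] .
    have "\<exists>s\<in>carrier R - P. \<forall>k\<in>{..<?n}. \<exists>a\<in>carrier R. x k \<otimes>\<^bsub>K\<^esub> \<pi> s = \<pi> a"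
    proof (rule prime_finite_common_multiple[OF P])
      show "\<exists>s\<in>carrier R - P. \<exists>a\<in>carrier R. x k \<otimes>\<^bsub>K\<^esub> \<pi> s = \<pi> a" if "k \<in> {..<?n}" for k
        by (rule bspec[OF frac]) (use xc that in simp)
      fix s t k assume *: "s \<in> carrier R" "t \<in> carrier R" "k \<in> {..<?n}" "\<exists>a\<in>carrier R. x k \<otimes>\<^bsub>K\<^esub> \<pi> s = \<pi> a"
      then obtain a where a: "a \<in> carrier R" "x k \<otimes>\<^bsub>K\<^esub> \<pi> s = \<pi> a" by (elim bexE)
      have "x k \<otimes>\<^bsub>K\<^esub> \<pi> (t \<otimes> s) = \<pi> t \<otimes>\<^bsub>K\<^esub> (x k \<otimes>\<^bsub>K\<^esub> \<pi> s)" using xc * by (simp add: K.m_lcomm)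
      then have "x k \<otimes>\<^bsub>K\<^esub> \<pi> (t \<otimes> s) = \<pi> (t \<otimes> a)" using a * by simp
      then show "\<exists>a\<in>carrier R. x k \<otimes>\<^bsub>K\<^esub> \<pi> (t \<otimes> s) = \<pi> a" using a(1) * by (intro bexI[of _ "t \<otimes> a"]) simp_all
    qed simp
    then obtain s where s: "s \<in> carrier R - P" "\<forall>k\<in>{..<?n}. \<exists>a. a \<in> carrier R \<and> x k \<otimes>\<^bsub>K\<^esub> \<pi> s = \<pi> a"
      unfolding Bex_def by (elim exE conjE) simp
    from bchoice[OF s(2)] obtain a where a: "\<forall>k\<in>{..<?n}. a k \<in> carrier R \<and> x k \<otimes>\<^bsub>K\<^esub> \<pi> s = \<pi> (a k)" by (elim exE)
    define a' where "a' k = (if k < ?n then a k else \<zero>)" for k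
    have a': "a' \<in> vec ?n" using a by (simp add: vec_def a'_def)
    have sc: "\<pi> s \<in> carrier K" using s(1) by simp
    have "\<pi> (\<Oplus>k\<in>{..<?n}. a' k [^] p \<otimes> b k) = (\<Oplus>\<^bsub>K\<^esub>k\<in>{..<?n}. \<pi> s [^]\<^bsub>K\<^esub> p \<otimes>\<^bsub>K\<^esub> (x k [^]\<^bsub>K\<^esub> p \<otimes>\<^bsub>K\<^esub> \<beta> k))"
      unfolding \<pi>S[OF a', symmetric]
    proof (rule K.add.finprod_cong'[OF refl])
      fix k assume k: "k \<in> {..<?n}"
      have "\<pi> (a' k) = x k \<otimes>\<^bsub>K\<^esub> \<pi> s" using a k by (simp add: a'_def)
      then show "\<pi> (a' k) [^]\<^bsub>K\<^esub> p \<otimes>\<^bsub>K\<^esub> \<beta> k = \<pi> s [^]\<^bsub>K\<^esub> p \<otimes>\<^bsub>K\<^esub> (x k [^]\<^bsub>K\<^esub> p \<otimes>\<^bsub>K\<^esub> \<beta> k)"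
        using xc[of k] \<beta>c[of k] k sc by (simp add: K.nat_pow_distrib K.m_ac)
    qed (use xc \<beta>c sc in simp)
    also have "\<dots> = \<pi> s [^]\<^bsub>K\<^esub> p \<otimes>\<^bsub>K\<^esub> (\<Oplus>\<^bsub>K\<^esub>k\<in>{..<?n}. x k [^]\<^bsub>K\<^esub> p \<otimes>\<^bsub>K\<^esub> \<beta> k)"
      by (rule K.finsum_rdistr[symmetric]) (use xc \<beta>c sc in auto)
    also have "\<dots> = \<zero>\<^bsub>K\<^esub>" unfolding z using sc by simp
    finally have "\<pi> (\<Oplus>k\<in>{..<?n}. a' k [^] p \<otimes> b k) = \<zero>\<^bsub>K\<^esub>" .
    moreover have "(\<Oplus>k\<in>{..<?n}. a' k [^] p \<otimes> b k) \<in> carrier R"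
      by (rule finsum_closed) (use vecD[OF a'] bc in auto)
    ultimately have "(\<Oplus>k\<in>{..<?n}. a' k [^] (p ^ 1) \<otimes> b k) \<in> P" using ker by simp
    moreover have "a' \<in> {..<?n} \<rightarrow> carrier R" using vecD[OF a'] by simp
    ultimately have "\<forall>k\<in>{..<?n}. a' k \<in> P"
      using b unfolding pindep_def by (elim conjE) (drule (1) bspec, simp)
    then have "a k \<in> P" using k by (simp add: a'_def)
    moreover have ak: "a k \<in> carrier R" "x k \<otimes>\<^bsub>K\<^esub> \<pi> s = \<pi> (a k)" using a k by simp_all
    ultimately have "x k \<otimes>\<^bsub>K\<^esub> \<pi> s = \<zero>\<^bsub>K\<^esub>" using ker by simp
    then show ?thesis using K.integral[OF _ xc[OF k] sc] \<pi>nz(2)[OF s(1)] by auto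
  qed
  have span: "\<exists>c\<in>K.vec ?n. x = (\<Oplus>\<^bsub>K\<^esub>k\<in>{..<?n}. c k [^]\<^bsub>K\<^esub> p \<otimes>\<^bsub>K\<^esub> \<beta> k)" if x: "x \<in> carrier K" for x
  proof -
    obtain s a where s: "s \<in> carrier R - P" and a: "a \<in> carrier R" and xs: "x \<otimes>\<^bsub>K\<^esub> \<pi> s = \<pi> a"
      using bspec[OF frac x] by (elim bexE)
    \<comment> \<open>The fraction a / s equals a s^(p-1) / s^p. A p-th power as denominator acts as
      a scalar on \<open>F\<^sub>*\<close> of the residue field and can be moved into the
      coefficients.\<close>
    define y where "y = a \<otimes> s [^] (p - 1)"
    have yc: "y \<in> carrier R" unfolding y_def using a s by simp
    have "\<exists>c\<in>vec ?n. \<sigma> [^] p \<otimes> y \<ominus> (\<Oplus>k\<in>{..<?n}. c k [^] p \<otimes> b k) \<in> P"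
      by (rule gspan_family_coeffs[OF P.ideal_axioms bc bspec[OF \<sigma>(2) yc]])
    then obtain c where c: "c \<in> vec ?n" "\<sigma> [^] p \<otimes> y \<ominus> (\<Oplus>k\<in>{..<?n}. c k [^] p \<otimes> b k) \<in> P" by (elim bexE)
    have Sc: "(\<Oplus>k\<in>{..<?n}. c k [^] p \<otimes> b k) \<in> carrier R"
      by (rule finsum_closed) (use vecD[OF c(1)] bc in auto)
    have \<sigma>y: "\<sigma> [^] p \<otimes> y \<in> carrier R" using \<sigma>(1) yc by simp
    have "\<pi> (\<sigma> [^] p \<otimes> y \<ominus> (\<Oplus>k\<in>{..<?n}. c k [^] p \<otimes> b k)) = \<zero>\<^bsub>K\<^esub>"
      by (rule iffD2[OF bspec[OF ker P.Icarr[OF c(2)]] c(2)])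
    then have "\<pi> (\<sigma> [^] p \<otimes> y) \<ominus>\<^bsub>K\<^esub> \<pi> (\<Oplus>k\<in>{..<?n}. c k [^] p \<otimes> b k) = \<zero>\<^bsub>K\<^esub>"
      using \<sigma>y Sc by (simp add: a_minus_def)
    then have "\<pi> (\<sigma> [^] p \<otimes> y) = \<pi> (\<Oplus>k\<in>{..<?n}. c k [^] p \<otimes> b k)"
      using K.r_right_minus_eq[of "\<pi> (\<sigma> [^] p \<otimes> y)"] \<sigma>y Sc by simp
    then have e: "\<pi> (\<sigma> [^] p \<otimes> y) = (\<Oplus>\<^bsub>K\<^esub>k\<in>{..<?n}. \<pi> (c k) [^]\<^bsub>K\<^esub> p \<otimes>\<^bsub>K\<^esub> \<beta> k)" unfolding \<pi>S[OF c(1)] .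
    define w where "w = \<pi> \<sigma> \<otimes>\<^bsub>K\<^esub> \<pi> s"
    have \<sigma>K: "\<pi> \<sigma> \<in> carrier K" "\<pi> s \<in> carrier K" using \<sigma>(1) s by simp_all
    have wU: "w \<in> Units K" unfolding w_def using \<pi>nz[OF \<sigma>(1)] \<pi>nz[OF s] by simp
    have wc: "w \<in> carrier K" "inv\<^bsub>K\<^esub> w \<in> carrier K" using K.Units_closed[OF wU] K.Units_inv_closed[OF wU] by simp_all
    obtain m where m: "p = Suc m" using prime_gt_0_nat[OF p_prime] gr0_conv_Suc by auto
    have "\<pi> (\<sigma> [^] p \<otimes> y) = \<pi> \<sigma> [^]\<^bsub>K\<^esub> p \<otimes>\<^bsub>K\<^esub> ((x \<otimes>\<^bsub>K\<^esub> \<pi> s) \<otimes>\<^bsub>K\<^esub> \<pi> s [^]\<^bsub>K\<^esub> (p - 1))"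
      unfolding y_def xs using \<sigma>(1) s a by (simp add: \<pi>.hom_nat_pow)
    also have "\<dots> = w [^]\<^bsub>K\<^esub> p \<otimes>\<^bsub>K\<^esub> x"
      unfolding w_def using \<sigma>K x by (simp add: m K.nat_pow_distrib K.m_ac)
    finally have wx: "w [^]\<^bsub>K\<^esub> p \<otimes>\<^bsub>K\<^esub> x = (\<Oplus>\<^bsub>K\<^esub>k\<in>{..<?n}. \<pi> (c k) [^]\<^bsub>K\<^esub> p \<otimes>\<^bsub>K\<^esub> \<beta> k)" using e by simp
    have \<pi>ck: "\<pi> (c k) \<in> carrier K" if "k < ?n" for k using vecD[OF c(1) that] by simp
    have "x = (inv\<^bsub>K\<^esub> w) [^]\<^bsub>K\<^esub> p \<otimes>\<^bsub>K\<^esub> (w [^]\<^bsub>K\<^esub> p \<otimes>\<^bsub>K\<^esub> x)"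
      using wU wc x by (simp add: K.m_assoc[symmetric] K.nat_pow_distrib[symmetric])
    also have "\<dots> = (\<Oplus>\<^bsub>K\<^esub>k\<in>{..<?n}. (inv\<^bsub>K\<^esub> w) [^]\<^bsub>K\<^esub> p \<otimes>\<^bsub>K\<^esub> (\<pi> (c k) [^]\<^bsub>K\<^esub> p \<otimes>\<^bsub>K\<^esub> \<beta> k))"
      unfolding wx by (rule K.finsum_rdistr) (use wc \<pi>ck \<beta>c in auto)
    also have "\<dots> = (\<Oplus>\<^bsub>K\<^esub>k\<in>{..<?n}. (inv\<^bsub>K\<^esub> w \<otimes>\<^bsub>K\<^esub> \<pi> (c k)) [^]\<^bsub>K\<^esub> p \<otimes>\<^bsub>K\<^esub> \<beta> k)"
      by (rule K.add.finprod_cong') (use wc \<pi>ck \<beta>c in \<open>auto simp: K.nat_pow_distrib K.m_assoc\<close>)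
    finally show ?thesis using \<pi>ck wc vecD[OF c(1)]
      by (intro bexI[of _ "\<lambda>k. inv\<^bsub>K\<^esub> w \<otimes>\<^bsub>K\<^esub> \<pi> (c k)"]) (simp_all add: K.vec_def)
  qed
  have "KF.frob_basis ?n \<beta>" unfolding KF.frob_basis_def using \<beta>c ind span by (intro conjI ballI allI impI)
  then show ?thesis unfolding K_def[symmetric] using KF.frob_field_axioms by (intro exI[of _ \<beta>] conjI)
qed

lemma rk_power_of_p:
  assumes "primeideal P R"
  shows "\<exists>m. rk P = p ^ m"
proof -
  obtain \<beta> where \<beta>: "frob_field (residue_field R P) p" "frob_field.frob_basis (residue_field R P) p (rk P) \<beta>"
    using residue_field_basis[OF assms] by (elim exE conjE)
  show ?thesis by (rule frob_field.frob_basis_power_of_char[OF \<beta>])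
qed

lemma frob_alpha_eq:
  assumes "primeideal P R"
  shows "frob_alpha p R P = log (real p) (real (rk P))"
proof -
  obtain \<beta> where \<beta>: "frob_field (residue_field R P) p" "frob_field.frob_basis (residue_field R P) p (rk P) \<beta>"
    using residue_field_basis[OF assms] by (elim exE conjE)
  show ?thesis unfolding frob_alpha_def Let_def frob_field.frob_basis_dim[OF \<beta>] ..
qed

subsection \<open>Minimal primes and the limit\<close>

text \<open>Take the finitely many primes cutting out the nilradical. Every prime contains one of
  them, so the minimal primes are the minimal members of this finite family.\<close>

lemma minimal_prime_cover:
  shows "finite (minimal_primes R)" "minimal_primes R \<noteq> {}"
    and "primeideal Q R \<Longrightarrow> \<exists>P\<in>minimal_primes R. P \<subseteq> Q"
    and "x \<in> carrier R \<Longrightarrow> (\<And>P. P \<in> minimal_primes R \<Longrightarrow> x \<in> P) \<Longrightarrow> \<exists>n::nat. x [^] n = \<zero>"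
proof -
  obtain PP where fin: "finite PP" and PP': "\<forall>P\<in>PP. primeideal P R \<and> {\<zero>} \<subseteq> P"
    and nil': "\<forall>x\<in>carrier R. (\<forall>P\<in>PP. x \<in> P) \<longrightarrow> (\<exists>n::nat. x [^] n \<in> {\<zero>})"
    using exists_finite_primes[OF is_cring zeroideal] by (elim exE conjE) (rule that)
  have PP: "primeideal P R" if "P \<in> PP" for P by (rule conjunct1[OF bspec[OF PP' that]])
  have nil: "\<exists>n::nat. x [^] n \<in> {\<zero>}" if "x \<in> carrier R" "\<forall>P\<in>PP. x \<in> P" for x
    by (rule mp[OF bspec[OF nil' that(1)] that(2)])
  \<comment> \<open>Otherwise prime avoidance gives s outside Q in all members of \<open>PP\<close>;
    such an s is nilpotent and hence in Q.\<close>
  have below: "\<exists>P\<in>PP. P \<subseteq> Q" if Q: "primeideal Q R" for Q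
  proof (rule ccontr)
    assume neg: "\<not> (\<exists>P\<in>PP. P \<subseteq> Q)"
    have "\<exists>s\<in>carrier R - Q. \<forall>P\<in>PP. s \<in> P"
    proof (rule prime_finite_common_multiple[OF Q fin])
      fix P assume P: "P \<in> PP"
      then obtain x where "x \<in> P" "x \<notin> Q" using neg by auto
      then show "\<exists>s\<in>carrier R - Q. s \<in> P"
        using ideal.Icarr[OF primeideal.axioms(1)[OF PP[OF P]]] by (intro bexI[of _ x]) simp_all
    next
      fix s t P assume "t \<in> carrier R" "P \<in> PP" "s \<in> P"
      then show "t \<otimes> s \<in> P" using ideal.I_l_closed[OF primeideal.axioms(1)[OF PP]] by simp
    qed
    then obtain s where s: "s \<in> carrier R - Q" "\<forall>P\<in>PP. s \<in> P" by (elim bexE)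
    then obtain n :: nat where "s [^] n = \<zero>" using nil[of s] by auto
    then have "s [^] n \<in> Q" using additive_subgroup.zero_closed[OF ideal.axioms(1)[OF primeideal.axioms(1)[OF Q]]] by simp
    then show False using prime_pow[OF Q] s(1) by blast
  qed
  have min: "\<exists>P\<in>minimal_primes R. P \<in> PP \<and> P \<subseteq> Q" if Q: "primeideal Q R" for Q
  proof -
    obtain P0 where P0: "P0 \<in> PP" "P0 \<subseteq> Q" using below[OF Q] by auto
    obtain P where P: "P \<in> PP" "P \<subseteq> P0" "\<forall>P'\<in>PP. P' \<subseteq> P \<longrightarrow> P = P'"
      using finite_has_minimal2[OF fin P0(1)] by auto
    have "P \<in> minimal_primes R"
      unfolding minimal_primes_def
    proof (intro CollectI conjI allI impI)
      show "primeideal P R" by (rule PP[OF P(1)])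
      fix Q' assume Q': "primeideal Q' R \<and> Q' \<subseteq> P"
      then obtain P' where "P' \<in> PP" "P' \<subseteq> Q'" using below[OF conjunct1[OF Q']] by auto
      then show "Q' = P" using P(3) Q' by blast
    qed
    then show ?thesis using P P0 by auto
  qed
  have mp: "minimal_primes R \<subseteq> PP"
  proof
    fix Q assume Q: "Q \<in> minimal_primes R"
    then have Qp: "primeideal Q R" unfolding minimal_primes_def by simp
    obtain P where "P \<in> PP" "P \<subseteq> Q" using below[OF Qp] by auto
    then have "P = Q" using Q PP unfolding minimal_primes_def by simp
    then show "Q \<in> PP" using \<open>P \<in> PP\<close> by simp
  qed
  show "finite (minimal_primes R)" by (rule finite_subset[OF mp fin])
  show "\<exists>P\<in>minimal_primes R. P \<subseteq> Q" if "primeideal Q R" using min[OF that] by auto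
  have "PP \<noteq> {}"
  proof
    assume "PP = {}"
    then obtain n :: nat where "\<one> [^] n = \<zero>" using nil[OF one_closed] by auto
    then show False using one_not_zero by simp
  qed
  then obtain P where "P \<in> PP" by auto
  then show "minimal_primes R \<noteq> {}" using min[OF PP] by auto
  show "\<exists>n::nat. x [^] n = \<zero>" if x: "x \<in> carrier R" and all: "\<And>P. P \<in> minimal_primes R \<Longrightarrow> x \<in> P"
  proof -
    have "\<forall>P\<in>PP. x \<in> P"
    proof
      fix P assume "P \<in> PP"
      then obtain P' where "P' \<in> minimal_primes R" "P' \<subseteq> P" using min[OF PP] by auto
      then show "x \<in> P" using all by auto
    qed
    then show ?thesis using nil[OF x] by simp
  qed
qed

definition reduced :: bool where
  "reduced \<longleftrightarrow> (\<forall>x\<in>carrier R. \<forall>n::nat. x [^] n = \<zero> \<longrightarrow> x = \<zero>)"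

lemma minimal_prime_is_prime: "Q \<in> minimal_primes R \<Longrightarrow> primeideal Q R"
  unfolding minimal_primes_def by simp

text \<open>Choose s outside Q in all other minimal primes. For z in Q the product s z lies in every
  minimal prime, so it is nilpotent, and zero in a reduced ring. Thus the local ring at Q is a
  field, as \<open>generic_basis\<close> requires.\<close>

lemma minimal_prime_annihilator:
  assumes red: reduced and Q: "Q \<in> minimal_primes R"
  shows "\<exists>s\<in>carrier R - Q. (\<forall>P\<in>minimal_primes R - {Q}. s \<in> P) \<and> (\<forall>z\<in>Q. s \<otimes> z = \<zero>)"
proof -
  note Qp = minimal_prime_is_prime[OF Q]
  have "\<exists>s\<in>carrier R - Q. \<forall>P\<in>minimal_primes R - {Q}. s \<in> P"
  proof (rule prime_finite_common_multiple[OF Qp])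
    show "finite (minimal_primes R - {Q})" using minimal_prime_cover(1) by simp
    fix P assume P: "P \<in> minimal_primes R - {Q}"
    then have "\<not> P \<subseteq> Q" using Q unfolding minimal_primes_def by auto
    then obtain x where "x \<in> P" "x \<notin> Q" by auto
    moreover have "primeideal P R" using P minimal_prime_is_prime by simp
    ultimately show "\<exists>s\<in>carrier R - Q. s \<in> P"
      using ideal.Icarr[OF primeideal.axioms(1)] by (intro bexI[of _ x]) simp_all
  next
    fix s t P assume "t \<in> carrier R" "P \<in> minimal_primes R - {Q}" "s \<in> P"
    then show "t \<otimes> s \<in> P" using ideal.I_l_closed[OF primeideal.axioms(1)[OF minimal_prime_is_prime]] by simp
  qed
  then obtain s where s: "s \<in> carrier R - Q" "\<forall>P\<in>minimal_primes R - {Q}. s \<in> P" by (elim bexE)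
  have "s \<otimes> z = \<zero>" if z: "z \<in> Q" for z
  proof -
    have zc: "z \<in> carrier R" by (rule ideal.Icarr[OF primeideal.axioms(1)[OF Qp] z])
    have szP: "s \<otimes> z \<in> P" if P: "P \<in> minimal_primes R" for P
    proof (cases "P = Q")
      case True
      then show ?thesis using ideal.I_l_closed[OF primeideal.axioms(1)[OF Qp] z] s(1) by simp
    next
      case False
      then show ?thesis using ideal.I_r_closed[OF primeideal.axioms(1)[OF minimal_prime_is_prime[OF P]] _ zc] s(2) P by simp
    qed
    have szc: "s \<otimes> z \<in> carrier R" using s(1) zc by simp
    have "\<exists>n::nat. (s \<otimes> z) [^] n = \<zero>" by (rule minimal_prime_cover(4)[OF szc]) (rule szP)
    then obtain n :: nat where n: "(s \<otimes> z) [^] n = \<zero>" by (elim exE)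
    show ?thesis by (rule mp[OF spec[OF bspec[OF red[unfolded reduced_def] szc]] n])
  qed
  then show ?thesis using s by (intro bexI[of _ s]) simp_all
qed

lemma rk_mono:
  assumes "primeideal P R" "primeideal Q R" "P \<subseteq> Q"
  shows "rk Q \<le> rk P"
proof (cases "P = Q")
  case False
  then have "p * rk Q \<le> rk P" using rank_drop[OF assms(1,2)] assms(3) by blast
  moreover have "rk Q \<le> p * rk Q" using prime_gt_0_nat[OF p_prime] by simp
  ultimately show ?thesis by (rule le_trans[rotated])
qed simp

text \<open>The integer \<rho> = p^\<gamma>(R), by \<open>frob_gamma_eq\<close>; working with it
  keeps real exponents out of the counting.\<close>

definition max_rk :: nat where
  "max_rk = Max (rk ` minimal_primes R)"

lemma rk_le_max_rk: "primeideal P R \<Longrightarrow> rk P \<le> max_rk"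
proof -
  assume P: "primeideal P R"
  obtain Q where Q: "Q \<in> minimal_primes R" "Q \<subseteq> P" using minimal_prime_cover(3)[OF P] by auto
  have "rk P \<le> rk Q" by (rule rk_mono[OF minimal_prime_is_prime[OF Q(1)] P Q(2)])
  also have "\<dots> \<le> max_rk" unfolding max_rk_def using minimal_prime_cover(1) Q(1) by (intro Max_ge) simp_all
  finally show ?thesis .
qed

lemma max_rk_attained: "\<exists>Q\<in>minimal_primes R. rk Q = max_rk"
proof -
  have "max_rk \<in> rk ` minimal_primes R"
    unfolding max_rk_def using minimal_prime_cover(1,2) by (intro Max_in) simp_all
  then show ?thesis by auto
qed

lemma frob_gamma_eq: "frob_gamma p R = log (real p) (real max_rk)"
proof -
  have p1: "real p > 1" using prime_gt_1_nat[OF p_prime] by simp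
  have eq: "frob_alpha p R Q = log (real p) (real (rk Q))" if "Q \<in> minimal_primes R" for Q
    by (rule frob_alpha_eq[OF minimal_prime_is_prime[OF that]])
  show ?thesis
    unfolding frob_gamma_def
  proof (rule Max_eqI)
    show "finite (frob_alpha p R ` minimal_primes R)" using minimal_prime_cover(1) by simp
    obtain Q where Q: "Q \<in> minimal_primes R" "rk Q = max_rk" using max_rk_attained by (elim bexE)
    show "log (real p) (real max_rk) \<in> frob_alpha p R ` minimal_primes R"
      using Q eq[OF Q(1)] by (intro image_eqI[of _ _ Q]) simp_all
    fix y assume "y \<in> frob_alpha p R ` minimal_primes R"
    then obtain P where P: "P \<in> minimal_primes R" "y = frob_alpha p R P" by auto
    note Pp = minimal_prime_is_prime[OF P(1)]
    have "0 < rk P" using rk_pos[OF Pp] by simp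
    then have "log (real p) (real (rk P)) \<le> log (real p) (real max_rk)"
      using rk_le_max_rk[OF Pp] p1 by (subst log_le_cancel_iff) simp_all
    then show "y \<le> log (real p) (real max_rk)" using eq[OF P(1)] P(2) by simp
  qed
qed

end

section \<open>Bounds and recursion for the ranks a_e\<close>

context F_finite_module
begin

text \<open>The local families have the same length \<rho> and are simply added. To see that I is
  not inside Q, preimages are multiplied by an element that lies in all the other minimal primes:
  this switches off all summands but the one at Q.\<close>

lemma global_cartier_family:
  assumes red: reduced and rk: "\<And>Q. Q \<in> minimal_primes R \<Longrightarrow> rk Q = \<rho>"
  shows "\<exists>h I. cartier_family \<rho> h \<and> ideal I R \<and> (\<forall>c\<in>I. hits_multiples \<rho> h c) \<and>
    (\<forall>Q\<in>minimal_primes R. \<not> I \<subseteq> Q)"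
proof -
  let ?P = "minimal_primes R"
  have fin: "finite ?P" by (rule minimal_prime_cover(1))
  have "\<forall>Q\<in>?P. \<exists>s. s \<in> carrier R - Q \<and> (\<forall>P\<in>?P - {Q}. s \<in> P) \<and> (\<forall>z\<in>Q. s \<otimes> z = \<zero>)"
    using minimal_prime_annihilator[OF red] unfolding Bex_def by (intro ballI)
  from bchoice[OF this] obtain s where
    s: "\<forall>Q\<in>?P. s Q \<in> carrier R - Q \<and> (\<forall>P\<in>?P - {Q}. s Q \<in> P) \<and> (\<forall>z\<in>Q. s Q \<otimes> z = \<zero>)" by (elim exE)
  have sQ: "s Q \<in> carrier R - Q" and sP: "P \<in> ?P \<Longrightarrow> P \<noteq> Q \<Longrightarrow> s Q \<in> P"
    and sz: "z \<in> Q \<Longrightarrow> s Q \<otimes> z = \<zero>" if "Q \<in> ?P" for P Q z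
    using bspec[OF s that] by simp_all
  have "\<forall>Q\<in>?P. \<exists>h. cartier_family \<rho> h \<and> (\<exists>c\<in>carrier R - Q. hits_multiples \<rho> h c) \<and>
    (\<forall>z\<in>Q. \<forall>x\<in>carrier M. \<forall>k<\<rho>. h k (z \<odot>\<^bsub>M\<^esub> x) = \<zero>\<^bsub>M\<^esub>)"
  proof
    fix Q assume Q: "Q \<in> ?P"
    show "\<exists>h. cartier_family \<rho> h \<and> (\<exists>c\<in>carrier R - Q. hits_multiples \<rho> h c) \<and>
      (\<forall>z\<in>Q. \<forall>x\<in>carrier M. \<forall>k<\<rho>. h k (z \<odot>\<^bsub>M\<^esub> x) = \<zero>\<^bsub>M\<^esub>)"
      by (rule local_cartier_family[OF minimal_prime_is_prime[OF Q] sQ[OF Q] sz[OF Q], unfolded rk[OF Q]])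
  qed
  from bchoice[OF this] obtain h where
    h: "\<forall>Q\<in>?P. cartier_family \<rho> (h Q) \<and> (\<exists>c\<in>carrier R - Q. hits_multiples \<rho> (h Q) c) \<and>
      (\<forall>z\<in>Q. \<forall>x\<in>carrier M. \<forall>k<\<rho>. h Q k (z \<odot>\<^bsub>M\<^esub> x) = \<zero>\<^bsub>M\<^esub>)" by (elim exE)
  have hc: "cartier_family \<rho> (h Q)" if "Q \<in> ?P" for Q by (rule conjunct1[OF bspec[OF h that]])
  have hh: "\<exists>c\<in>carrier R - Q. hits_multiples \<rho> (h Q) c" if "Q \<in> ?P" for Q
    by (rule conjunct1[OF conjunct2[OF bspec[OF h that]]])
  have h0: "h Q k (z \<odot>\<^bsub>M\<^esub> x) = \<zero>\<^bsub>M\<^esub>" if "Q \<in> ?P" "z \<in> Q" "x \<in> carrier M" "k < \<rho>" for Q z x k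
    by (rule conjunct2[OF conjunct2[OF bspec[OF h that(1)]], rule_format, OF that(2-4)])
  note hD = cartier_familyD[OF hc]
  define H where "H k x = (\<Oplus>\<^bsub>M\<^esub>Q\<in>?P. h Q k x)" for k x
  have fam: "cartier_family \<rho> H"
    unfolding cartier_family_def
  proof (intro allI impI ballI conjI)
    fix k x assume k: "k < \<rho>" and x: "x \<in> carrier M"
    show "H k x \<in> carrier M" unfolding H_def by (rule M.M.finsum_closed) (use hD(1)[OF _ k x] in auto)
    {
      fix y assume y: "y \<in> carrier M"
      have "H k (x \<oplus>\<^bsub>M\<^esub> y) = (\<Oplus>\<^bsub>M\<^esub>Q\<in>?P. h Q k x \<oplus>\<^bsub>M\<^esub> h Q k y)"
        unfolding H_def by (rule M.M.add.finprod_cong'[OF refl]) (use hD(1)[OF _ k] hD(2)[OF _ k x y] x y in auto)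
      also have "\<dots> = H k x \<oplus>\<^bsub>M\<^esub> H k y"
        unfolding H_def by (rule M.M.finsum_addf) (use hD(1)[OF _ k] x y in auto)
      finally show "H k (x \<oplus>\<^bsub>M\<^esub> y) = H k x \<oplus>\<^bsub>M\<^esub> H k y" .
    next
      fix r assume r: "r \<in> carrier R"
      have "H k ((r [^] p) \<odot>\<^bsub>M\<^esub> x) = (\<Oplus>\<^bsub>M\<^esub>Q\<in>?P. r \<odot>\<^bsub>M\<^esub> h Q k x)"
        unfolding H_def by (rule M.M.add.finprod_cong'[OF refl]) (use hD(1)[OF _ k] hD(3)[OF _ k x r] x r in auto)
      also have "\<dots> = r \<odot>\<^bsub>M\<^esub> H k x"
        unfolding H_def by (rule M.finsum_smult_ldistr[OF fin r, symmetric]) (use hD(1)[OF _ k x] in auto)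
      finally show "H k ((r [^] p) \<odot>\<^bsub>M\<^esub> x) = r \<odot>\<^bsub>M\<^esub> H k x" .
    }
  qed
  define I where "I = {c \<in> carrier R. hits_multiples \<rho> H c}"
  have I: "ideal I R" unfolding I_def by (rule hits_multiples_ideal[OF fam])
  have "\<not> I \<subseteq> Q" if Q: "Q \<in> ?P" for Q
  proof -
    obtain c where c: "c \<in> carrier R - Q" "hits_multiples \<rho> (h Q) c" using hh[OF Q] by (elim bexE)
    have cs: "c \<in> carrier R" "s Q \<in> carrier R" using c(1) sQ[OF Q] by simp_all
    have "hits_multiples \<rho> H (s Q \<otimes> c)"
      unfolding hits_multiples_def
    proof (intro allI impI)
      fix v assume v: "\<forall>k<\<rho>. v k \<in> carrier M"
      obtain x where x: "x \<in> carrier M" "\<forall>k<\<rho>. h Q k x = c \<odot>\<^bsub>M\<^esub> v k"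
        using hits_multiplesD[OF c(2) v] by (elim bexE)
      \<comment> \<open>The p-th power turns into the plain factor s_Q under the p-linear family at
        Q, while it lies in every other minimal prime P, where the local family vanishes on P
        M.\<close>
      define x' where "x' = (s Q [^] p) \<odot>\<^bsub>M\<^esub> x"
      have x': "x' \<in> carrier M" unfolding x'_def using x(1) cs by simp
      have "H k x' = (s Q \<otimes> c) \<odot>\<^bsub>M\<^esub> v k" if k: "k < \<rho>" for k
      proof -
        have vk: "v k \<in> carrier M" using v k by simp
        have hQ: "h Q k x' = (s Q \<otimes> c) \<odot>\<^bsub>M\<^esub> v k"
          unfolding x'_def hD(3)[OF Q k x(1) cs(2)] using x(2) k cs vk by (simp add: M.smult_assoc1)
        have other: "h P k x' = \<zero>\<^bsub>M\<^esub>" if P: "P \<in> ?P" "P \<noteq> Q" for P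
        proof -
          have "s Q [^] p \<in> P"
            by (rule ideal_pow[OF primeideal.axioms(1)[OF minimal_prime_is_prime[OF P(1)]] sP[OF Q P]])
              (rule prime_gt_0_nat[OF p_prime])
          then show ?thesis unfolding x'_def by (rule h0[OF P(1) _ x(1) k])
        qed
        have "H k x' = (\<Oplus>\<^bsub>M\<^esub>P\<in>?P. if Q = P then h Q k x' else \<zero>\<^bsub>M\<^esub>)"
          unfolding H_def
        proof (rule M.M.add.finprod_cong'[OF refl])
          show "(\<lambda>P. if Q = P then h Q k x' else \<zero>\<^bsub>M\<^esub>) \<in> ?P \<rightarrow> carrier M" using hD(1)[OF Q k x'] by auto
          fix P assume "P \<in> ?P"
          then show "h P k x' = (if Q = P then h Q k x' else \<zero>\<^bsub>M\<^esub>)" using other[of P] by (cases "Q = P") auto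
        qed
        also have "\<dots> = h Q k x'"
          by (rule M.M.add.finprod_singleton[OF Q fin]) (use hD(1)[OF Q k x'] in simp)
        finally show ?thesis unfolding hQ .
      qed
      then show "\<exists>x\<in>carrier M. \<forall>k<\<rho>. H k x = (s Q \<otimes> c) \<odot>\<^bsub>M\<^esub> v k" using x' by (intro bexI[of _ x']) simp_all
    qed
    then have "s Q \<otimes> c \<in> I" unfolding I_def using cs by simp
    moreover have "s Q \<otimes> c \<notin> Q" using prime_notin_mult[OF minimal_prime_is_prime[OF Q] sQ[OF Q] c(1)] by simp
    ultimately show ?thesis by auto
  qed
  moreover have "\<forall>c\<in>I. hits_multiples \<rho> H c" unfolding I_def by simp
  ultimately show ?thesis using fam I by (intro exI[of _ H] exI[of _ I] conjI ballI) simp_all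
qed

abbreviation a_rank :: "nat \<Rightarrow> nat" where
  "a_rank e \<equiv> frob_free_rank p R M e"

lemma dual_family_bound:
  assumes Q: "primeideal Q R" and s: "s \<in> carrier R - Q"
    and J: "ideal J R" "\<And>j. j \<in> J \<Longrightarrow> s \<otimes> j = \<zero>"
    and g: "\<And>P. primeideal P R \<Longrightarrow> J \<subseteq> P \<Longrightarrow> rk P \<le> g"
  shows "\<exists>C::real\<ge>0. \<forall>e n \<phi> x. dual_family (Fe e) n \<phi> x \<longrightarrow> real n \<le> C * real g ^ e"
proof -
  obtain B where B: "finite B" "B \<subseteq> carrier M" "M.span B = carrier M" by (rule generators)
  obtain C :: real where C: "C \<ge> 0" "\<forall>e. \<exists>t. mu_le e J t \<and> real t \<le> C * real g ^ e"
    using mu_growth[OF J(1) g] by auto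
  have "real n \<le> (C * real (card B)) * real g ^ e" if d: "dual_family (Fe e) n \<phi> x" for e n \<phi> x
  proof -
    obtain t where t: "mu_le e J t" "real t \<le> C * real g ^ e" using spec[OF C(2), of e] by (elim exE conjE)
    obtain U where U: "finite U" "card U \<le> t" "U \<subseteq> carrier R" "carrier R \<subseteq> gspan (Fr e) J U"
      using t(1) unfolding mu_le_def by (elim exE conjE)
    have "n \<le> card U * card B" by (rule dual_family_card_le[OF Q s J U(1,3,4) B d])
    also have "\<dots> \<le> t * card B" using U(2) by simp
    finally have "real n \<le> real t * real (card B)" by (metis of_nat_le_iff of_nat_mult)
    also have "\<dots> \<le> (C * real g ^ e) * real (card B)" using t(2) by (intro mult_right_mono) simp_all
    finally show ?thesis by (simp add: mult_ac)
  qed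
  moreover have "C * real (card B) \<ge> 0" using C(1) by simp
  ultimately show ?thesis by blast
qed

lemma dual_family_bound_max:
  "\<exists>C::real\<ge>0. \<forall>e n \<phi> x. dual_family (Fe e) n \<phi> x \<longrightarrow> real n \<le> C * real max_rk ^ e"
proof -
  obtain Q where Q: "Q \<in> minimal_primes R" using minimal_prime_cover(2) by auto
  note Qp = minimal_prime_is_prime[OF Q]
  show ?thesis
    by (rule dual_family_bound[OF Qp _ zeroideal, of \<one>]) (use one_notin_prime[OF Qp] rk_le_max_rk in auto)
qed

text \<open>The definition of a_e as a maximum is only informative once the set of ranks is finite,
  and this follows from the generator bound at any minimal prime.\<close>

lemma a_rank_eq_Max:
  shows "finite {n. \<exists>\<phi> x. dual_family (Fe e) n \<phi> x}"
    and "a_rank e = Max {n. \<exists>\<phi> x. dual_family (Fe e) n \<phi> x}"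
proof -
  obtain C :: real where "C \<ge> 0" and C: "\<forall>e n \<phi> x. dual_family (Fe e) n \<phi> x \<longrightarrow> real n \<le> C * real max_rk ^ e"
    using dual_family_bound_max by (elim exE conjE) (rule that)
  have "{n. \<exists>\<phi> x. dual_family (Fe e) n \<phi> x} \<subseteq> {.. nat \<lfloor>C * real max_rk ^ e\<rfloor>}"
  proof (rule subsetI, elim CollectE exE)
    fix n \<phi> x assume "dual_family (Fe e) n \<phi> x"
    then have "real n \<le> C * real max_rk ^ e" by (rule C[rule_format])
    then show "n \<in> {.. nat \<lfloor>C * real max_rk ^ e\<rfloor>}" by (simp add: le_nat_floor)
  qed
  then show "finite {n. \<exists>\<phi> x. dual_family (Fe e) n \<phi> x}" by (rule finite_subset) simp
  have "{n. free_summand_of_rank R (Fe e) n} = {n. \<exists>\<phi> x. dual_family (Fe e) n \<phi> x}"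
  proof (intro Collect_cong iffI)
    fix n
    show "\<exists>\<phi> x. dual_family (Fe e) n \<phi> x" if "free_summand_of_rank R (Fe e) n"
      by (rule free_summand_dual_family[OF module_Fe that])
    show "free_summand_of_rank R (Fe e) n" if "\<exists>\<phi> x. dual_family (Fe e) n \<phi> x"
      using that by (elim exE) (rule dual_family_free_summand[OF module_Fe])
  qed
  then show "a_rank e = Max {n. \<exists>\<phi> x. dual_family (Fe e) n \<phi> x}" unfolding frob_free_rank_def by simp
qed

lemma a_rank_family: "\<exists>\<phi> x. dual_family (Fe e) (a_rank e) \<phi> x"
proof -
  have "0 \<in> {n. \<exists>\<phi> x. dual_family (Fe e) n \<phi> x}" unfolding dual_family_def by simp
  then have "a_rank e \<in> {n. \<exists>\<phi> x. dual_family (Fe e) n \<phi> x}"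
    unfolding a_rank_eq_Max(2) by (intro Max_in a_rank_eq_Max(1)) blast
  then show ?thesis by (elim CollectE)
qed

lemma le_a_rank: "dual_family (Fe e) n \<phi> x \<Longrightarrow> n \<le> a_rank e"
  unfolding a_rank_eq_Max(2) by (intro Max_ge a_rank_eq_Max(1) CollectI exI)

lemma a_rank_bound_max: "\<exists>C::real\<ge>0. \<forall>e. real (a_rank e) \<le> C * real max_rk ^ e"
proof -
  obtain C :: real where C: "C \<ge> 0" "\<forall>e n \<phi> x. dual_family (Fe e) n \<phi> x \<longrightarrow> real n \<le> C * real max_rk ^ e"
    using dual_family_bound_max by (elim exE conjE) (rule that)
  have "real (a_rank e) \<le> C * real max_rk ^ e" for e
  proof -
    obtain \<phi> x where "dual_family (Fe e) (a_rank e) \<phi> x" using a_rank_family[of e] by (elim exE)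
    then show ?thesis by (rule C(2)[rule_format])
  qed
  then show ?thesis using C(1) by auto
qed

lemma max_rk_pos: "0 < max_rk"
  using max_rk_attained rk_pos[OF minimal_prime_is_prime] by fastforce

text \<open>If some form takes the value 1 at x, then z = z \<phi>(x) = \<phi>(z^(p^e) x), which is
  0 as soon as z^(p^e) = 0. So a nonzero nilpotent z leaves no free summand for large e.\<close>

lemma a_rank_not_reduced:
  assumes "\<not> reduced"
  shows "\<exists>C. \<forall>e. real (a_rank e) \<le> C * (real max_rk / real p) ^ e"
proof -
  obtain z n where z: "z \<in> carrier R" "z [^] (n::nat) = \<zero>" "z \<noteq> \<zero>"
    using assms unfolding reduced_def by auto
  have zero: "a_rank e = 0" if e: "n \<le> e" for e
  proof (rule ccontr)
    assume pos: "a_rank e \<noteq> 0"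
    obtain \<phi> x where d: "dual_family (Fe e) (a_rank e) \<phi> x" using a_rank_family[of e] by (elim exE)
    have \<phi>: "linear_form (Fe e) (\<phi> 0)" and x: "x 0 \<in> carrier M" and one: "\<phi> 0 (x 0) = \<one>"
      using dual_familyD[OF d] pos by simp_all
    have "n \<le> p ^ e"
      using e less_exp[of e] power_mono[OF prime_ge_2_nat[OF p_prime], of e] by linarith
    then obtain m where m: "p ^ e = n + m" using le_Suc_ex by auto
    have "z [^] (p ^ e) = z [^] n \<otimes> z [^] m" unfolding m using z(1) by (simp add: nat_pow_mult)
    then have "z [^] (p ^ e) = \<zero>" using z by simp
    then have "\<phi> 0 (\<zero> \<odot>\<^bsub>M\<^esub> x 0) = z" using form_Fe_mult[OF \<phi> z(1) x] one z(1) by simp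
    moreover have "\<phi> 0 (\<zero> \<odot>\<^bsub>M\<^esub> x 0) = \<zero>" using form_Fe_mult[OF \<phi> zero_closed x] frob_zero[of e] one by simp
    ultimately show False using z(3) by simp
  qed
  define y where "y e = (real max_rk / real p) ^ e" for e
  have y: "y e > 0" for e unfolding y_def using max_rk_pos prime_gt_0_nat[OF p_prime] by simp
  \<comment> \<open>A crude constant for the finitely many exponents e < n; beyond them the rank is
    0.\<close>
  define C where "C = (\<Sum>e<n. real (a_rank e) / y e)"
  have C0: "C \<ge> 0" unfolding C_def using y by (intro sum_nonneg divide_nonneg_pos) simp_all
  have "real (a_rank e) \<le> C * y e" for e
  proof (cases "e < n")
    case True
    have "real (a_rank e) / y e \<le> C"
      unfolding C_def using True y by (intro member_le_sum divide_nonneg_pos) simp_all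
    then show ?thesis using y[of e] by (simp add: field_simps)
  next
    case False
    then show ?thesis using zero[of e] C0 y[of e] by simp
  qed
  then show ?thesis unfolding y_def by auto
qed

lemma a_rank_small_component:
  assumes red: reduced and Q: "Q \<in> minimal_primes R" "rk Q \<noteq> max_rk"
  shows "\<exists>C. \<forall>e. real (a_rank e) \<le> C * (real max_rk / real p) ^ e"
proof -
  note Qp = minimal_prime_is_prime[OF Q(1)]
  obtain s where s: "s \<in> carrier R - Q" "\<forall>z\<in>Q. s \<otimes> z = \<zero>"
    using minimal_prime_annihilator[OF red Q(1)] by auto
  have "\<exists>C::real\<ge>0. \<forall>e n \<phi> x. dual_family (Fe e) n \<phi> x \<longrightarrow> real n \<le> C * real (rk Q) ^ e"
    by (rule dual_family_bound[OF Qp s(1) primeideal.axioms(1)[OF Qp] _ rk_mono[OF Qp]]) (use s(2) in auto)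
  then obtain C :: real where
    C: "C \<ge> 0" "\<forall>e n \<phi> x. dual_family (Fe e) n \<phi> x \<longrightarrow> real n \<le> C * real (rk Q) ^ e"
    by (elim exE conjE) (rule that)
  obtain Q' where Q': "Q' \<in> minimal_primes R" "rk Q' = max_rk" using max_rk_attained by (elim bexE)
  obtain m where m: "rk Q = p ^ m" using rk_power_of_p[OF Qp] by (elim exE)
  obtain k where k: "max_rk = p ^ k" using rk_power_of_p[OF minimal_prime_is_prime[OF Q'(1)]] Q'(2) by auto
  have "p ^ m < p ^ k" using rk_le_max_rk[OF Qp] Q(2) m k by simp
  then have "m < k" using prime_gt_1_nat[OF p_prime] by (simp add: power_strict_increasing_iff)
  then have "p * p ^ m \<le> p ^ k" using prime_gt_0_nat[OF p_prime] power_increasing[of "Suc m" k p] by simp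
  then have "real p * real (rk Q) \<le> real max_rk" using m k by (metis of_nat_le_iff of_nat_mult)
  then have le: "real (rk Q) \<le> real max_rk / real p" using prime_gt_0_nat[OF p_prime] by (simp add: field_simps)
  have "real (a_rank e) \<le> C * (real max_rk / real p) ^ e" for e
  proof -
    obtain \<phi> x where "dual_family (Fe e) (a_rank e) \<phi> x" using a_rank_family[of e] by (elim exE)
    then have "real (a_rank e) \<le> C * real (rk Q) ^ e" by (rule C(2)[rule_format])
    also have "\<dots> \<le> C * (real max_rk / real p) ^ e" by (intro mult_left_mono power_mono le C(1)) simp
    finally show ?thesis .
  qed
  then show ?thesis by auto
qed

lemma a_rank_recursion:
  assumes red: reduced and rk: "\<And>Q. Q \<in> minimal_primes R \<Longrightarrow> rk Q = max_rk"
  shows "\<exists>C::real\<ge>0. \<forall>e. real max_rk * real (a_rank e) - C * (real max_rk / real p) ^ e \<le> real (a_rank (Suc e))"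
proof -
  let ?\<rho> = max_rk
  obtain B where B: "finite B" "B \<subseteq> carrier M" "M.span B = carrier M" by (rule generators)
  have "\<exists>h I. cartier_family ?\<rho> h \<and> ideal I R \<and> (\<forall>c\<in>I. hits_multiples ?\<rho> h c) \<and>
    (\<forall>Q\<in>minimal_primes R. \<not> I \<subseteq> Q)"
    by (rule global_cartier_family[OF red rk])
  then obtain h I where h: "cartier_family ?\<rho> h" and I: "ideal I R" and Ih: "\<forall>c\<in>I. hits_multiples ?\<rho> h c"
    and nI: "\<forall>Q\<in>minimal_primes R. \<not> I \<subseteq> Q"
    by (elim exE conjE) (rule that)
  have p0: "0 < p" by (rule prime_gt_0_nat[OF p_prime])
  \<comment> \<open>A prime over I strictly contains a minimal prime, because I is contained in none
    of the minimal primes; so the growth over I has rate at most \<rho>/p.\<close>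
  have g: "rk P \<le> ?\<rho> div p" if P: "primeideal P R" "I \<subseteq> P" for P
  proof -
    obtain Q where Q: "Q \<in> minimal_primes R" "Q \<subseteq> P" using minimal_prime_cover(3)[OF P(1)] by auto
    have "Q \<noteq> P" using bspec[OF nI Q(1)] P(2) by auto
    then have "p * rk P \<le> rk Q" using rank_drop[OF minimal_prime_is_prime[OF Q(1)] P(1)] Q(2) by blast
    then show ?thesis using rk[OF Q(1)] p0 by (simp add: less_eq_div_iff_mult_less_eq mult.commute)
  qed
  obtain C :: real where C: "C \<ge> 0" "\<forall>e. \<exists>t. mu_le e I t \<and> real t \<le> C * real (?\<rho> div p) ^ e"
    using mu_growth[OF I g] by auto
  obtain Q where Q: "Q \<in> minimal_primes R" using minimal_prime_cover(2) by auto
  obtain m where m: "?\<rho> = p ^ m" using rk_power_of_p[OF minimal_prime_is_prime[OF Q]] rk[OF Q] by auto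
  have k: "rk P < p ^ Suc m" if "primeideal P R" for P
  proof -
    have "p ^ m < p ^ Suc m" using prime_gt_1_nat[OF p_prime] by (intro power_strict_increasing) simp_all
    then show ?thesis using rk_le_max_rk[OF that] unfolding m by (rule le_less_trans[rotated])
  qed
  \<comment> \<open>Ranks are below \<open>p ^ Suc m\<close>, so \<open>dual_family_Suc\<close>
    keeps a reserve of m + 1 coordinates. This inequality lets one multiple of \<rho> pay for the
    reserve.\<close>
  have m\<rho>: "Suc m \<le> ?\<rho>"
    using less_exp[of m] power_mono[OF prime_ge_2_nat[OF p_prime], of m] unfolding m by linarith
  \<comment> \<open>The summand 1 added to \<open>card B\<close> pays for the reserve in the case
    where \<open>dual_family_Suc\<close> does not apply.\<close>
  define D where "D = real ?\<rho> * real (card B + 1) * C"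
  have "real ?\<rho> * real (a_rank e) - D * (real ?\<rho> / real p) ^ e \<le> real (a_rank (Suc e))" for e
  proof -
    let ?n = "a_rank e"
    obtain t where t: "mu_le e I t" "real t \<le> C * real (?\<rho> div p) ^ e" using spec[OF C(2), of e] by (elim exE conjE)
    have "real (?\<rho> div p) \<le> real ?\<rho> / real p" by (rule of_nat_div_le_of_nat)
    then have "C * real (?\<rho> div p) ^ e \<le> C * (real ?\<rho> / real p) ^ e" using C(1) by (intro mult_left_mono power_mono) simp_all
    then have tb: "real t \<le> C * (real ?\<rho> / real p) ^ e" using t(2) by simp
    have "?\<rho> * ?n \<le> a_rank (Suc e) + ?\<rho> * (card B + 1) * t"
    proof (cases "Suc m + ?\<rho> * card B * t \<le> ?n * ?\<rho>")
      case True
      obtain \<phi> x where d: "dual_family (Fe e) ?n \<phi> x" using a_rank_family[of e] by (elim exE)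
      have "\<exists>\<psi> y. dual_family (Fe (Suc e)) (?n * ?\<rho> - ?\<rho> * card B * t) \<psi> y"
        by (rule dual_family_Suc[OF h max_rk_pos I bspec[OF Ih] t(1) B k d True])
      then obtain \<psi> y where "dual_family (Fe (Suc e)) (?n * ?\<rho> - ?\<rho> * card B * t) \<psi> y" by (elim exE)
      then have "?n * ?\<rho> - ?\<rho> * card B * t \<le> a_rank (Suc e)" by (rule le_a_rank)
      then show ?thesis by (simp add: algebra_simps)
    next
      \<comment> \<open>There are too few coordinates to clear the cokernel, but then \<rho> a_e is
        itself below the error term. For t = 0 this case only arises with a_e = 0.\<close>
      case False
      show ?thesis
      proof (cases "?n = 0 \<or> t = 0")
        case True
        have "?n = 0"
        proof (rule ccontr)
          assume "?n \<noteq> 0"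
          then have "Suc m \<le> ?n * ?\<rho>" using m\<rho> mult_le_mono1[of 1 ?n ?\<rho>] by linarith
          moreover have "t = 0" using True \<open>?n \<noteq> 0\<close> by simp
          ultimately have "Suc m + ?\<rho> * card B * t \<le> ?n * ?\<rho>" using m\<rho> le_trans by simp
          then show False using False by simp
        qed
        then show ?thesis by simp
      next
        case nt: False
        have "?n * ?\<rho> < Suc m + ?\<rho> * card B * t" using False by simp
        also have "\<dots> \<le> ?\<rho> * t + ?\<rho> * card B * t"
        proof -
          have "?\<rho> \<le> ?\<rho> * t" using nt by simp
          then show ?thesis using m\<rho> by linarith
        qed
        finally show ?thesis by (simp add: algebra_simps)
      qed
    qed
    then have "real (?\<rho> * ?n) \<le> real (a_rank (Suc e) + ?\<rho> * (card B + 1) * t)" by (simp only: of_nat_le_iff)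
    then have "real ?\<rho> * real ?n \<le> real (a_rank (Suc e)) + (real ?\<rho> * real (card B + 1)) * real t" by (simp only: of_nat_add of_nat_mult)
    moreover have "(real ?\<rho> * real (card B + 1)) * real t \<le> (real ?\<rho> * real (card B + 1)) * (C * (real ?\<rho> / real p) ^ e)"
      by (intro mult_left_mono tb) simp
    moreover have "\<dots> = D * (real ?\<rho> / real p) ^ e" unfolding D_def by simp
    ultimately show ?thesis by linarith
  qed
  moreover have "D \<ge> 0" unfolding D_def using C(1) by simp
  ultimately show ?thesis by auto
qed

end

section \<open>Limits of real sequences\<close>

lemma limit_of_small:
  fixes a :: "nat \<Rightarrow> real"
  assumes a0: "\<And>e. 0 \<le> a e" and \<rho>: "0 < \<rho>" and p: "1 < p" and le: "\<And>e. a e \<le> C * (\<rho> / p) ^ e"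
  shows "(\<lambda>e. a e / \<rho> ^ e) \<longlonglongrightarrow> 0"
proof (rule tendsto_sandwich[of "\<lambda>_. 0" _ _ "\<lambda>e. C * (1 / p) ^ e"])
  have "(\<lambda>e. C * (1 / p) ^ e) \<longlonglongrightarrow> C * 0"
    by (intro tendsto_mult tendsto_const LIMSEQ_power_zero) (use p in simp)
  then show "(\<lambda>e. C * (1 / p) ^ e) \<longlonglongrightarrow> 0" by simp
  show "\<forall>\<^sub>F e in sequentially. a e / \<rho> ^ e \<le> C * (1 / p) ^ e"
    using le \<rho> p by (intro always_eventually allI) (simp add: field_simps power_divide)
  show "\<forall>\<^sub>F e in sequentially. 0 \<le> a e / \<rho> ^ e" using a0 \<rho> by simp
qed simp

lemma limit_of_almost_monotone:
  fixes a :: "nat \<Rightarrow> real"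
  assumes \<rho>: "0 < \<rho>" and p: "1 < p" and step: "\<And>e. \<rho> * a e - C * (\<rho> / p) ^ e \<le> a (Suc e)"
    and bd: "\<And>e. a e \<le> D * \<rho> ^ e" and C: "0 \<le> C"
  shows "\<exists>s C'. (\<lambda>e. a e / \<rho> ^ e) \<longlonglongrightarrow> s \<and> (\<forall>e. a e \<le> s * \<rho> ^ e + C' * (\<rho> / p) ^ e)"
proof -
  \<comment> \<open>The total of the relative losses (C/\<rho>) p^-e over all e. It satisfies K -
    K/p = C/\<rho>, so passing from K p^-e to K p^-(e+1) releases precisely the loss of step
    e.\<close>
  define K where "K = (C / \<rho>) * (p / (p - 1))"
  have K0: "0 \<le> K" unfolding K_def using C \<rho> p by simp
  have Kp: "K - K / p = C / \<rho>" unfolding K_def using p \<rho> by (simp add: divide_simps) (simp add: algebra_simps)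
  define u where "u e = a e / \<rho> ^ e - K * (1 / p) ^ e" for e
  have "u e \<le> u (Suc e)" for e
  proof -
    have "(\<rho> * a e - C * (\<rho> / p) ^ e) / \<rho> ^ Suc e \<le> a (Suc e) / \<rho> ^ Suc e"
      using step[of e] \<rho> by (intro divide_right_mono) simp_all
    moreover have "(\<rho> * a e - C * (\<rho> / p) ^ e) / \<rho> ^ Suc e = a e / \<rho> ^ e - (C / \<rho>) * (1 / p) ^ e"
      using \<rho> p by (simp add: diff_divide_distrib power_divide)
    moreover have "K * (1 / p) ^ Suc e = K * (1 / p) ^ e - (C / \<rho>) * (1 / p) ^ e"
      unfolding Kp[symmetric] by (simp add: algebra_simps)
    ultimately show ?thesis unfolding u_def by linarith
  qed
  then have inc: "incseq u" by (rule incseq_SucI)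
  have ub: "u e \<le> D" for e
  proof -
    have "a e / \<rho> ^ e \<le> D" using bd[of e] \<rho> by (simp add: field_simps)
    moreover have "0 \<le> K * (1 / p) ^ e" using K0 p by simp
    ultimately show ?thesis unfolding u_def by linarith
  qed
  obtain s where s: "u \<longlonglongrightarrow> s" "\<forall>e. u e \<le> s" using incseq_convergent[OF inc, of D] ub by auto
  have "(\<lambda>e. u e + K * (1 / p) ^ e) \<longlonglongrightarrow> s + K * 0"
    by (intro tendsto_add tendsto_mult tendsto_const LIMSEQ_power_zero s(1)) (use p in simp)
  then have "(\<lambda>e. a e / \<rho> ^ e) \<longlonglongrightarrow> s" unfolding u_def by simp
  moreover have "a e \<le> s * \<rho> ^ e + K * (\<rho> / p) ^ e" for e
  proof -
    have "a e / \<rho> ^ e \<le> s + K * (1 / p) ^ e" using s(2) unfolding u_def by (simp add: algebra_simps)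
    then have "a e \<le> (s + K * (1 / p) ^ e) * \<rho> ^ e" using \<rho> by (simp add: pos_divide_le_eq)
    also have "\<dots> = s * \<rho> ^ e + K * (\<rho> / p) ^ e" by (simp add: algebra_simps power_divide)
    finally show ?thesis .
  qed
  ultimately show ?thesis by auto
qed

theorem theorem4p7:
  fixes R :: "('a, 'm) ring_scheme" and M :: "('a, 'b, 'n) module_scheme" and p :: nat
  assumes "cring R" and "noetherian_ring R"
    and "Factorial_Ring.prime p" and "has_characteristic R p" and "F_finite p R"
    and "module R M" and "fin_gen R M"
  shows "\<exists>s::real.
      (\<lambda>e. real (frob_free_rank p R M e) / real p powr (real e * frob_gamma p R))
        \<longlonglongrightarrow> s \<and>
      (\<exists>C::real. \<forall>e::nat.
        real (frob_free_rank p R M e)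
          \<le> s * real p powr (real e * frob_gamma p R)
             + C * real p powr (real e * (frob_gamma p R - 1)))"
proof -
  interpret F_finite_module R p M
    by (intro F_finite_module.intro F_finite_ring.intro frob_ring.intro frob_ring_axioms.intro
        F_finite_ring_axioms.intro F_finite_module_axioms.intro assms)
  have p1: "1 < real p" using prime_gt_1_nat[OF assms(3)] by simp
  have \<rho>: "0 < real max_rk" using max_rk_pos by simp
  have p\<gamma>: "real p powr frob_gamma p R = real max_rk" unfolding frob_gamma_eq using p1 \<rho> by simp
  have pow1: "real p powr (real e * frob_gamma p R) = real max_rk ^ e" for e
    using powr_powr[of "real p" "frob_gamma p R" "real e"] \<rho> unfolding p\<gamma> by (simp add: mult.commute powr_realpow)
  have "real p powr (frob_gamma p R - 1) = real max_rk / real p" using p1 p\<gamma> by (simp add: powr_diff)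
  then have pow2: "real p powr (real e * (frob_gamma p R - 1)) = (real max_rk / real p) ^ e" for e
    using powr_powr[of "real p" "frob_gamma p R - 1" "real e"] \<rho> p1 by (simp add: mult.commute powr_realpow)
  show ?thesis
    unfolding pow1 pow2
  \<comment> \<open>In the first case the recursion yields s together with the error term. In the
    second the ranks are of order (\<rho>/p)^e, so s = 0 and the whole sequence is absorbed by the
    error term.\<close>
  proof (cases "reduced \<and> (\<forall>Q\<in>minimal_primes R. rk Q = max_rk)")
    case True
    then have red: reduced and rk: "\<And>Q. Q \<in> minimal_primes R \<Longrightarrow> rk Q = max_rk" by simp_all
    obtain C :: real where C: "C \<ge> 0" "\<And>e. real max_rk * real (a_rank e) - C * (real max_rk / real p) ^ e \<le> real (a_rank (Suc e))"
      using a_rank_recursion[OF red rk] by auto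
    obtain D :: real where D: "\<And>e. real (a_rank e) \<le> D * real max_rk ^ e" using a_rank_bound_max by auto
    show "\<exists>s. (\<lambda>e. real (a_rank e) / real max_rk ^ e) \<longlonglongrightarrow> s \<and>
      (\<exists>C. \<forall>e. real (a_rank e) \<le> s * real max_rk ^ e + C * (real max_rk / real p) ^ e)"
      using limit_of_almost_monotone[of "real max_rk" "real p" "\<lambda>e. real (a_rank e)" C D, OF \<rho> p1 C(2) D C(1)] by auto
  next
    case False
    have "\<exists>C. \<forall>e. real (a_rank e) \<le> C * (real max_rk / real p) ^ e"
    proof (cases reduced)
      case red: True
      then obtain Q where "Q \<in> minimal_primes R" "rk Q \<noteq> max_rk" using False by auto
      then show ?thesis by (rule a_rank_small_component[OF red])
    qed (rule a_rank_not_reduced)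
    then obtain C where "\<forall>e. real (a_rank e) \<le> C * (real max_rk / real p) ^ e" by (elim exE)
    then have C: "real (a_rank e) \<le> C * (real max_rk / real p) ^ e" for e by simp
    show "\<exists>s. (\<lambda>e. real (a_rank e) / real max_rk ^ e) \<longlonglongrightarrow> s \<and>
      (\<exists>C. \<forall>e. real (a_rank e) \<le> s * real max_rk ^ e + C * (real max_rk / real p) ^ e)"
    proof (rule exI[of _ 0], intro conjI exI[of _ C] allI)
      show "(\<lambda>e. real (a_rank e) / real max_rk ^ e) \<longlonglongrightarrow> 0"
        by (rule limit_of_small[OF _ \<rho> p1 C]) simp
      show "real (a_rank e) \<le> 0 * real max_rk ^ e + C * (real max_rk / real p) ^ e" for e using C[of e] by simp
    qed
  qed
qed

end
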